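(* Let $(X,\bar h)=(Z\times\mathbb R,h+dt^2)$ be a canonical cylindrical manifold of dimension $n\ge3$, with $Z$ connected and $\lambda(\mathcal L_h)=0$. Then there does not exist a Yamabe minimizer $u\in C^\infty_+(X)\cap L^{1,2}_{\bar h}(X)$ with respect to the metric $\bar h$.
   Context: A canonical cylindrical manifold is $Z\times\mathbb R$ with the metric $\bar h=h+dt^2$, where $(Z,h)$ is a closed Riemannian manifold of dimension $n-1$. With $\alpha_n=\frac{4(n-1)}{n-2}$, $L^{1,2}_{\bar h}(X)$ the Sobolev space of functions square-integrable with their first weak derivatives, and $C^\infty_+(X)$ the positive smooth functions, set for $u\in L^{1,2}_{\bar h}(X)$, $u\not\equiv0$, $$Q_{(X,\bar h)}(u)=\frac{\int_X(\alpha_n|du|^2+R_{\bar h}u^2)\,d\sigma_{\bar h}}{\left(\int_X|u|^{\frac{2n}{n-2}}d\sigma_{\bar h}\right)^{\frac{n-2}{n}}},\qquad Y^{cyl}_{[\bar h]}(X)=\inf_{u\in L^{1,2}_{\bar h}(X),\,u\not\equiv0}Q_{(X,\bar h)}(u).$$ A Yamabe minimizer with respect to $\bar h$ is a function $u\in C^\infty_+(X)\cap L^{1,2}_{\bar h}(X)$ with $Q_{(X,\bar h)}(u)=Y^{cyl}_{[\bar h]}(X)$. $\lambda(\mathcal L_h)$ is the first eigenvalue of $\mathcal L_h=-\alpha_n\Delta_h+R_h$ on $(Z,h)$. *)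

theory Defs
  imports "HOL-Analysis.Analysis"
begin

section \<open>Smooth maps between Euclidean spaces\<close>

primrec Ck_on :: "nat \<Rightarrow> ('e::euclidean_space \<Rightarrow> 'f::real_normed_vector) \<Rightarrow> 'e set \<Rightarrow> bool" where
  "Ck_on 0 f V \<longleftrightarrow> continuous_on V f"
| "Ck_on (Suc k) f V \<longleftrightarrow> (\<forall>x\<in>V. f differentiable (at x)) \<and>
     (\<forall>v. Ck_on k (\<lambda>x. frechet_derivative f (at x) v) V)"

text \<open>Used only for open sets.\<close>

definition smooth_on :: "'e::euclidean_space set \<Rightarrow> ('e \<Rightarrow> 'f::real_normed_vector) \<Rightarrow> bool" where
  "smooth_on V f \<longleftrightarrow> (\<forall>k. Ck_on k f V)"

abbreviation pd :: "'e::euclidean_space \<Rightarrow> ('e \<Rightarrow> 'f::real_normed_vector) \<Rightarrow> 'e \<Rightarrow> 'f" where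
  "pd b f x \<equiv> frechet_derivative f (at x) b"


section \<open>Riemannian manifolds\<close>

text \<open>The points are all elements of the type \<open>'a\<close>, the charts take values in \<open>'e\<close>
  (so the dimension is \<open>DIM('e)\<close>) and are indexed by the set \<open>idx\<close>; the index set lets a product
  manifold reuse the indices of its factor.  The metric is given by its expression in each chart:
  \<open>metric M i x v w\<close> is the inner product, at the point with coordinates \<open>x\<close> in chart \<open>i\<close>, of the
  tangent vectors with coordinate vectors \<open>v\<close> and \<open>w\<close>.\<close>

record ('i, 'a, 'e) riem =
  idx :: "'i set"
  chart_dom :: "'i \<Rightarrow> 'a set"
  chart :: "'i \<Rightarrow> 'a \<Rightarrow> 'e"
  metric :: "'i \<Rightarrow> 'e \<Rightarrow> 'e \<Rightarrow> 'e \<Rightarrow> real"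

definition chart_img :: "('i, 'a, 'e) riem \<Rightarrow> 'i \<Rightarrow> 'e set" where
  "chart_img M i = chart M i ` chart_dom M i"

definition param :: "('i, 'a, 'e) riem \<Rightarrow> 'i \<Rightarrow> 'e \<Rightarrow> 'a" where
  "param M i = inv_into (chart_dom M i) (chart M i)"

definition overlap :: "('i, 'a, 'e) riem \<Rightarrow> 'i \<Rightarrow> 'i \<Rightarrow> 'e set" where
  "overlap M i j = chart M i ` (chart_dom M i \<inter> chart_dom M j)"

definition transition :: "('i, 'a, 'e) riem \<Rightarrow> 'i \<Rightarrow> 'i \<Rightarrow> 'e \<Rightarrow> 'e" where
  "transition M i j = chart M j \<circ> param M i"

definition riemannian_manifold ::
  "('i, 'a::{t2_space,second_countable_topology}, 'e::euclidean_space) riem \<Rightarrow> bool" where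
  "riemannian_manifold M \<longleftrightarrow>
     (\<Union>i\<in>idx M. chart_dom M i) = UNIV \<and>
     (\<forall>i\<in>idx M. open (chart_dom M i) \<and> open (chart_img M i) \<and>
        homeomorphism (chart_dom M i) (chart_img M i) (chart M i) (param M i)) \<and>
     (\<forall>i\<in>idx M. \<forall>j\<in>idx M. smooth_on (overlap M i j) (transition M i j)) \<and>
     (\<forall>i\<in>idx M. \<forall>v w. smooth_on (chart_img M i) (\<lambda>x. metric M i x v w)) \<and>
     (\<forall>i\<in>idx M. \<forall>x\<in>chart_img M i. bilinear (metric M i x) \<and>
        (\<forall>v w. metric M i x v w = metric M i x w v) \<and>
        (\<forall>v. v \<noteq> 0 \<longrightarrow> metric M i x v v > 0)) \<and>
     (\<forall>i\<in>idx M. \<forall>j\<in>idx M. \<forall>x\<in>overlap M i j. \<forall>v w.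
        metric M i x v w =
        metric M j (transition M i j x) (pd v (transition M i j) x) (pd w (transition M i j) x))"

definition closed_riemannian_manifold ::
  "('i, 'a::{t2_space,second_countable_topology}, 'e::euclidean_space) riem \<Rightarrow> bool" where
  "closed_riemannian_manifold M \<longleftrightarrow> riemannian_manifold M \<and> compact (UNIV :: 'a set)"

definition cylinder :: "('i, 'a, 'e) riem \<Rightarrow> ('i, 'a \<times> real, 'e \<times> real) riem" where
  "cylinder M =
     \<lparr> idx = idx M,
       chart_dom = (\<lambda>i. chart_dom M i \<times> UNIV),
       chart = (\<lambda>i (z, t). (chart M i z, t)),
       metric = (\<lambda>i (x, t) (v, a) (w, b). metric M i x v w + a * b) \<rparr>"

definition smooth_function :: "('i, 'a, 'e::euclidean_space) riem \<Rightarrow> ('a \<Rightarrow> real) \<Rightarrow> bool" where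
  "smooth_function M f \<longleftrightarrow> (\<forall>i\<in>idx M. smooth_on (chart_img M i) (f \<circ> param M i))"


section \<open>Local expressions of the metric quantities\<close>

text \<open>For \<open>b, c \<in> Basis\<close>, \<open>cometric M i x b c\<close> is the entry \<open>g\<^sup>b\<^sup>c\<close> of the inverse of the matrix
  \<open>g\<^sub>b\<^sub>c = metric M i x b c\<close>: the linear map inverted here has this matrix.\<close>

definition cometric :: "('i, 'a, 'e::euclidean_space) riem \<Rightarrow> 'i \<Rightarrow> 'e \<Rightarrow> 'e \<Rightarrow> 'e \<Rightarrow> real" where
  "cometric M i x b c = inv (\<lambda>v. \<Sum>d\<in>Basis. metric M i x v d *\<^sub>R d) b \<bullet> c"

text \<open>Leibniz formula for the determinant of the matrix \<open>g\<^sub>b\<^sub>c\<close> indexed by \<open>Basis\<close>.\<close>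

definition gram_det :: "('i, 'a, 'e::euclidean_space) riem \<Rightarrow> 'i \<Rightarrow> 'e \<Rightarrow> real" where
  "gram_det M i x =
     (\<Sum>p | p permutes (Basis :: 'e set). of_int (sign p) * (\<Prod>b\<in>Basis. metric M i x b (p b)))"

text \<open>\<open>christoffel M i k a b x\<close> is \<open>\<Gamma>\<^sup>k\<^sub>a\<^sub>b\<close>.\<close>

definition christoffel ::
  "('i, 'a, 'e::euclidean_space) riem \<Rightarrow> 'i \<Rightarrow> 'e \<Rightarrow> 'e \<Rightarrow> 'e \<Rightarrow> 'e \<Rightarrow> real" where
  "christoffel M i k a b x =
     (1/2) * (\<Sum>l\<in>Basis. cometric M i x k l *
       (pd a (\<lambda>y. metric M i y b l) x + pd b (\<lambda>y. metric M i y a l) x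
        - pd l (\<lambda>y. metric M i y a b) x))"

definition ricci :: "('i, 'a, 'e::euclidean_space) riem \<Rightarrow> 'i \<Rightarrow> 'e \<Rightarrow> 'e \<Rightarrow> 'e \<Rightarrow> real" where
  "ricci M i a b x =
     (\<Sum>k\<in>Basis. pd k (christoffel M i k a b) x - pd b (christoffel M i k a k) x) +
     (\<Sum>k\<in>Basis. \<Sum>l\<in>Basis.
        christoffel M i k k l x * christoffel M i l a b x
        - christoffel M i k b l x * christoffel M i l a k x)"

definition scalar_curvature_loc :: "('i, 'a, 'e::euclidean_space) riem \<Rightarrow> 'i \<Rightarrow> 'e \<Rightarrow> real" where
  "scalar_curvature_loc M i x = (\<Sum>a\<in>Basis. \<Sum>b\<in>Basis. cometric M i x a b * ricci M i a b x)"

text \<open>The Laplacian is \<open>div \<circ> grad\<close>, a nonpositive operator.\<close>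

definition laplacian_loc ::
  "('i, 'a, 'e::euclidean_space) riem \<Rightarrow> 'i \<Rightarrow> ('e \<Rightarrow> real) \<Rightarrow> 'e \<Rightarrow> real" where
  "laplacian_loc M i f x =
     (\<Sum>b\<in>Basis. pd b (\<lambda>y. sqrt (gram_det M i y) * (\<Sum>c\<in>Basis. cometric M i y b c * pd c f y)) x)
     / sqrt (gram_det M i x)"


section \<open>Global quantities\<close>

text \<open>The local expressions do not depend on the chart, so an arbitrary chart around each point
  is used.\<close>

definition chart_at :: "('i, 'a, 'e) riem \<Rightarrow> 'a \<Rightarrow> 'i" where
  "chart_at M p = (SOME i. i \<in> idx M \<and> p \<in> chart_dom M i)"

definition scalar_curvature :: "('i, 'a, 'e::euclidean_space) riem \<Rightarrow> 'a \<Rightarrow> real" where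
  "scalar_curvature M p = (let i = chart_at M p in scalar_curvature_loc M i (chart M i p))"

definition laplacian :: "('i, 'a, 'e::euclidean_space) riem \<Rightarrow> ('a \<Rightarrow> real) \<Rightarrow> 'a \<Rightarrow> real" where
  "laplacian M f p = (let i = chart_at M p in laplacian_loc M i (f \<circ> param M i) (chart M i p))"

definition is_volume ::
  "('i, 'a::topological_space, 'e::euclidean_space) riem \<Rightarrow> 'a measure \<Rightarrow> bool" where
  "is_volume M \<sigma> \<longleftrightarrow> sets \<sigma> = sets borel \<and>
     (\<forall>i\<in>idx M. \<forall>A\<in>sets borel. A \<subseteq> chart_dom M i \<longrightarrow>
        emeasure \<sigma> A = (\<integral>\<^sup>+x\<in>chart M i ` A. ennreal (sqrt (gram_det M i x)) \<partial>lborel))"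

definition volume :: "('i, 'a::topological_space, 'e::euclidean_space) riem \<Rightarrow> 'a measure" where
  "volume M = (THE \<sigma>. is_volume M \<sigma>)"


section \<open>First eigenvalue of the conformal Laplacian\<close>

definition alpha :: "nat \<Rightarrow> real" where
  "alpha n = 4 * (real n - 1) / (real n - 2)"

text \<open>\<open>-\<alpha>\<^sub>n \<Delta> + R\<close>.  The number \<open>n\<close> is a parameter because on the slice of a
  cylinder it is the dimension of the cylinder.\<close>

definition conf_laplacian ::
  "nat \<Rightarrow> ('i, 'a, 'e::euclidean_space) riem \<Rightarrow> ('a \<Rightarrow> real) \<Rightarrow> 'a \<Rightarrow> real" where
  "conf_laplacian n M f p = - alpha n * laplacian M f p + scalar_curvature M p * f p"

definition is_eigenvalue :: "nat \<Rightarrow> ('i, 'a, 'e::euclidean_space) riem \<Rightarrow> real \<Rightarrow> bool" where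
  "is_eigenvalue n M \<mu> \<longleftrightarrow>
     (\<exists>f. smooth_function M f \<and> (\<exists>p. f p \<noteq> 0) \<and> (\<forall>p. conf_laplacian n M f p = \<mu> * f p))"

definition is_first_eigenvalue :: "nat \<Rightarrow> ('i, 'a, 'e::euclidean_space) riem \<Rightarrow> real \<Rightarrow> bool" where
  "is_first_eigenvalue n M \<mu> \<longleftrightarrow>
     is_eigenvalue n M \<mu> \<and> (\<forall>\<nu>. is_eigenvalue n M \<nu> \<longrightarrow> \<mu> \<le> \<nu>)"


section \<open>The Sobolev space and the Yamabe functional\<close>

text \<open>A 1-form is given by its expression in each chart: \<open>\<omega> i x v\<close> is its value, at the point with
  coordinates \<open>x\<close> in chart \<open>i\<close>, on the tangent vector with coordinate vector \<open>v\<close>.\<close>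

definition one_form ::
  "('i, 'a, 'e::euclidean_space) riem \<Rightarrow> ('i \<Rightarrow> 'e \<Rightarrow> 'e \<Rightarrow> real) \<Rightarrow> bool" where
  "one_form M \<omega> \<longleftrightarrow>
     (\<forall>i\<in>idx M. \<forall>x\<in>chart_img M i. linear (\<omega> i x)) \<and>
     (\<forall>i\<in>idx M. \<forall>j\<in>idx M. \<forall>x\<in>overlap M i j. \<forall>v.
        \<omega> i x v = \<omega> j (transition M i j x) (pd v (transition M i j) x))"

definition test_function :: "'e::euclidean_space set \<Rightarrow> ('e \<Rightarrow> real) \<Rightarrow> bool" where
  "test_function V \<eta> \<longleftrightarrow> smooth_on UNIV \<eta> \<and>
     compact (closure {x. \<eta> x \<noteq> 0}) \<and> closure {x. \<eta> x \<noteq> 0} \<subseteq> V"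

definition locally_integrable_on :: "'e::euclidean_space set \<Rightarrow> ('e \<Rightarrow> real) \<Rightarrow> bool" where
  "locally_integrable_on V f \<longleftrightarrow> (\<forall>K. compact K \<and> K \<subseteq> V \<longrightarrow> set_integrable lborel K f)"

definition is_weak_differential ::
  "('i, 'a, 'e::euclidean_space) riem \<Rightarrow> ('a \<Rightarrow> real) \<Rightarrow> ('i \<Rightarrow> 'e \<Rightarrow> 'e \<Rightarrow> real) \<Rightarrow> bool" where
  "is_weak_differential M u \<omega> \<longleftrightarrow> one_form M \<omega> \<and>
     (\<forall>i\<in>idx M. locally_integrable_on (chart_img M i) (u \<circ> param M i) \<and>
        (\<forall>b\<in>Basis. locally_integrable_on (chart_img M i) (\<lambda>x. \<omega> i x b) \<and>
          (\<forall>\<eta>. test_function (chart_img M i) \<eta> \<longrightarrow>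
             (LINT x:chart_img M i|lborel. u (param M i x) * pd b \<eta> x) =
             - (LINT x:chart_img M i|lborel. \<omega> i x b * \<eta> x))))"

text \<open>Unique up to null sets, so the integrals below do not depend on the choice.\<close>

definition weak_differential ::
  "('i, 'a, 'e::euclidean_space) riem \<Rightarrow> ('a \<Rightarrow> real) \<Rightarrow> 'i \<Rightarrow> 'e \<Rightarrow> 'e \<Rightarrow> real" where
  "weak_differential M u = (SOME \<omega>. is_weak_differential M u \<omega>)"

definition form_norm_sq ::
  "('i, 'a, 'e::euclidean_space) riem \<Rightarrow> ('i \<Rightarrow> 'e \<Rightarrow> 'e \<Rightarrow> real) \<Rightarrow> 'a \<Rightarrow> real" where
  "form_norm_sq M \<omega> p =
     (let i = chart_at M p; x = chart M i p in
      \<Sum>b\<in>Basis. \<Sum>c\<in>Basis. cometric M i x b c * \<omega> i x b * \<omega> i x c)"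

definition sobolev12 ::
  "('i, 'a::topological_space, 'e::euclidean_space) riem \<Rightarrow> ('a \<Rightarrow> real) set" where
  "sobolev12 M = {u. u \<in> borel_measurable borel \<and> integrable (volume M) (\<lambda>p. (u p)\<^sup>2) \<and>
     (\<exists>\<omega>. is_weak_differential M u \<omega> \<and> integrable (volume M) (form_norm_sq M \<omega>))}"

definition yamabe_quotient ::
  "('i, 'a::topological_space, 'e::euclidean_space) riem \<Rightarrow> ('a \<Rightarrow> real) \<Rightarrow> real" where
  "yamabe_quotient M u =
     (let n = DIM('e) in
      (LINT p|volume M. alpha n * form_norm_sq M (weak_differential M u) p
                        + scalar_curvature M p * (u p)\<^sup>2)
      / (LINT p|volume M. \<bar>u p\<bar> powr (2 * real n / (real n - 2))) powr ((real n - 2) / real n))"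

text \<open>The infimum is taken in the extended reals since it may be \<open>-\<infinity>\<close>.\<close>

definition yamabe_cyl ::
  "('i, 'a::topological_space, 'e::euclidean_space) riem \<Rightarrow> ereal" where
  "yamabe_cyl M =
     (INF u\<in>{u \<in> sobolev12 M. \<not> (AE p in volume M. u p = 0)}. ereal (yamabe_quotient M u))"

definition yamabe_minimizer ::
  "('i, 'a::topological_space, 'e::euclidean_space) riem \<Rightarrow> ('a \<Rightarrow> real) \<Rightarrow> bool" where
  "yamabe_minimizer M u \<longleftrightarrow>
     smooth_function M u \<and> (\<forall>p. u p > 0) \<and> u \<in> sobolev12 M \<and>
     ereal (yamabe_quotient M u) = yamabe_cyl M"

end

theory Submission
  imports Defs "HOL-Analysis.Analysis"
begin

text \<open>Split the energy of \<open>u\<close> on the cylinder as \<open>A + B\<close>, where \<open>B = \<alpha>\<^sub>n \<integral> u\<^sub>t\<^sup>2\<close> is the axial part, let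
  \<open>D = \<integral> \<bar>u\<bar> powr (2 n / (n - 2))\<close> and \<open>\<kappa> = (n - 2) / n\<close>.  The stretched functions \<open>u\<^sub>s (z, t) = u (z, s t)\<close>
  have quotient \<open>((A + s\<^sup>2 B) / s) / (D / s) powr \<kappa>\<close>.

  If \<open>f\<close> is an eigenfunction on the slice for the eigenvalue 0 and \<open>\<phi>\<close> a cutoff on the line, then \<open>f z * \<phi> t\<close>
  has \<open>A = 0\<close> (Green's formula), so the quotients of its stretchings tend to 0 as \<open>s\<close> tends to 0, and the
  infimum is at most 0.  A minimizer \<open>u\<close> therefore has \<open>A + B \<le> 0\<close>, and comparison with its own stretching
  for \<open>s = 1/2\<close> gives \<open>A + B \<le> 2 powr (1 - \<kappa>) * (A + B / 4)\<close>, hence \<open>B \<le> 0\<close>.  So \<open>u\<close> does not depend on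
  \<open>t\<close>, which is impossible for a positive square-integrable function.

  The quotient takes the junk value 0 when \<open>\<bar>u\<bar> powr (2 n / (n - 2))\<close> is not integrable.  To exclude this for the
  minimizer one needs the Sobolev embedding, which is proved from the Loomis-Whitney inequality and
  transported to the cylinder by a finite partition of unity on the slice.\<close>

section \<open>Calculus of iterated differentiability\<close>

text \<open>The scaling argument handles three integrals only. The bulk of the work comes from the
  objects under the integral signs, which are defined by charts and by choices.
  \<open>scalar_curvature\<close>, \<open>laplacian\<close> and \<open>form_norm_sq\<close> are read
  off in the arbitrary chart \<open>chart_at M p\<close>, which may jump from point to point, so
  their continuity and any integration by parts rest on invariance under transition maps.
  \<open>volume\<close> is a definite description, so a measure with the defining property has to be
  constructed and shown to be the only one. \<open>weak_differential\<close> is a choice, identified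
  with the classical differential by the fundamental lemma of the calculus of variations. Since the
  minimizer, the products of an eigenfunction and a cutoff, and all their stretchings are smooth,
  that identification is made for smooth functions, and only such functions are ever
  compared.\<close>

lemma frechet_derivative_eq: "(f has_derivative f') (at x) \<Longrightarrow> frechet_derivative f (at x) = f'"
  by (metis frechet_derivative_at)

text \<open>Valid also where neither function is differentiable: \<open>frechet_derivative\<close>
  chooses from the set of derivatives, and the two functions have the same set.\<close>

lemma frechet_derivative_cong_open:
  assumes "open V" "x \<in> V" "\<And>y. y \<in> V \<Longrightarrow> f y = g y"
  shows "frechet_derivative f (at x) = frechet_derivative g (at x)"
proof -
  have "(f has_derivative D) (at x) \<longleftrightarrow> (g has_derivative D) (at x)" for D
    using assms has_derivative_transform_within_open[OF _ assms(1,2)] by metis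
  then show ?thesis by (simp add: frechet_derivative_def)
qed

lemma differentiable_cong_open:
  assumes "open V" "x \<in> V" "\<And>y. y \<in> V \<Longrightarrow> f y = g y"
  shows "f differentiable (at x) \<longleftrightarrow> g differentiable (at x)"
  unfolding differentiable_def using assms has_derivative_transform_within_open[OF _ assms(1,2)] by metis

lemma Ck_on_cong:
  assumes "open V" "\<And>y. y \<in> V \<Longrightarrow> f y = g y"
  shows "Ck_on k f V \<longleftrightarrow> Ck_on k g V"
  using assms
proof (induction k arbitrary: f g)
  case 0 then show ?case by (simp cong: continuous_on_cong)
next
  case (Suc k)
  have "Ck_on k (\<lambda>x. frechet_derivative f (at x) v) V \<longleftrightarrow> Ck_on k (\<lambda>x. frechet_derivative g (at x) v) V" for v
    by (rule Suc.IH[OF Suc.prems(1)]) (simp add: frechet_derivative_cong_open[OF Suc.prems(1) _ Suc.prems(2)])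
  moreover have "f differentiable (at x) \<longleftrightarrow> g differentiable (at x)" if "x \<in> V" for x
    by (rule differentiable_cong_open[OF Suc.prems(1) that Suc.prems(2)])
  ultimately show ?case by auto
qed

lemma Ck_on_subset: "Ck_on k f V \<Longrightarrow> W \<subseteq> V \<Longrightarrow> Ck_on k f W"
  by (induction k arbitrary: f) (auto intro: continuous_on_subset)

text \<open>Serves for functions given by different formulas on the pieces of an open cover, such as
  an extension by zero or a bump function seen from another chart.\<close>

lemma Ck_on_local:
  assumes "\<And>x. x \<in> V \<Longrightarrow> \<exists>W. open W \<and> x \<in> W \<and> Ck_on k f W"
  shows "Ck_on k f V"
  using assms
proof (induction k arbitrary: f)
  case 0
  show ?case
  proof (simp add: continuous_on_eq_continuous_within, intro ballI)
    fix x assume "x \<in> V"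
    with 0[of x] obtain W where "open W" "x \<in> W" "Ck_on 0 f W" by blast
    then have "open W" "x \<in> W" "continuous_on W f" by simp_all
    then have "isCont f x" by (simp add: continuous_on_eq_continuous_at)
    then show "continuous (at x within V) f" by (rule continuous_at_imp_continuous_at_within)
  qed
next
  case (Suc k)
  have "f differentiable (at x)" if "x \<in> V" for x
  proof -
    from Suc.prems[OF that] obtain W where "x \<in> W" "Ck_on (Suc k) f W" by blast
    then show ?thesis by simp
  qed
  moreover have "Ck_on k (pd v f) V" for v
  proof (rule Suc.IH)
    fix x assume "x \<in> V"
    then obtain W where "open W" "x \<in> W" "Ck_on (Suc k) f W" using Suc.prems by blast
    then have "open W \<and> x \<in> W \<and> Ck_on k (pd v f) W" by simp
    then show "\<exists>W. open W \<and> x \<in> W \<and> Ck_on k (pd v f) W" by blast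
  qed
  ultimately show ?case by simp
qed

lemma Ck_on_SucD: "Ck_on (Suc k) f V \<Longrightarrow> Ck_on k f V"
proof (induction k arbitrary: f)
  case 0
  then have "f differentiable_on V" 
    unfolding differentiable_on_def by (auto intro: differentiable_at_withinI)
  then show ?case by (simp add: differentiable_imp_continuous_on)
next
  case (Suc k)
  then show ?case by (metis Ck_on.simps(2))
qed

lemma Ck_on_mono: "Ck_on k f V \<Longrightarrow> j \<le> k \<Longrightarrow> Ck_on j f V"
  by (induction k) (use Ck_on_SucD le_Suc_eq in blast)+

lemma Ck_on_imp_continuous: "Ck_on k f V \<Longrightarrow> continuous_on V f"
  using Ck_on_mono[of k f V 0] by simp

lemma Ck_on_differentiable: "Ck_on (Suc k) f V \<Longrightarrow> x \<in> V \<Longrightarrow> f differentiable (at x)"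
  by simp

lemma Ck_on_has_derivative:
  "Ck_on (Suc k) f V \<Longrightarrow> x \<in> V \<Longrightarrow> (f has_derivative frechet_derivative f (at x)) (at x)"
  using frechet_derivative_works by auto

lemma Ck_on_pd: "Ck_on (Suc k) f V \<Longrightarrow> Ck_on k (pd v f) V"
  by simp

text \<open>The form in which the closure properties below are proved: the choice operator in
  \<open>pd\<close> gives way to an explicit derivative \<open>D x\<close>, whose regularity in
  \<open>x\<close> then comes from the induction hypothesis.\<close>

lemma Ck_on_SucI:
  assumes "open V" "\<And>x. x \<in> V \<Longrightarrow> (f has_derivative D x) (at x)" "\<And>v. Ck_on k (\<lambda>x. D x v) V"
  shows "Ck_on (Suc k) f V"
proof -
  have "f differentiable (at x)" if "x \<in> V" for x using assms(2)[OF that] by (auto simp: differentiable_def)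
  moreover have "Ck_on k (pd v f) V" for v
    using assms(3)[of v] by (rule Ck_on_cong[OF assms(1), THEN iffD1, rotated]) (simp add: frechet_derivative_eq[OF assms(2)])
  ultimately show ?thesis by simp
qed

lemma Ck_on_const [simp]: "Ck_on k (\<lambda>x. c) V"
  by (induction k arbitrary: c) (auto simp: frechet_derivative_const)

lemma Ck_on_linear: assumes "bounded_linear L" "open V" shows "Ck_on k L V"
proof (cases k)
  case 0 then show ?thesis using assms by (simp add: linear_continuous_on)
next
  case (Suc j)
  then show ?thesis
    using Ck_on_SucI[OF assms(2), of L "\<lambda>x. L" j] bounded_linear_imp_has_derivative[OF assms(1)] by simp
qed

lemma Ck_on_bounded_linear:
  assumes "bounded_linear L" "open V" "Ck_on k f V" shows "Ck_on k (\<lambda>x. L (f x)) V"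
  using assms(3)
proof (induction k arbitrary: f)
  case 0 then show ?case by (simp add: bounded_linear.continuous_on[OF assms(1)])
next
  case (Suc k)
  show ?case
  proof (rule Ck_on_SucI[OF assms(2) bounded_linear.has_derivative[OF assms(1) Ck_on_has_derivative[OF Suc.prems]]])
    show "Ck_on k (\<lambda>x. L (pd v f x)) V" for v by (rule Suc.IH[OF Ck_on_pd[OF Suc.prems]])
  qed
qed

text \<open>Applied to projections of a product, to dilations and to stretchings of the
  axis.\<close>

lemma Ck_on_inner_linear:
  assumes "bounded_linear L" "open V" "Ck_on k f W" "L ` V \<subseteq> W" shows "Ck_on k (\<lambda>x. f (L x)) V"
  using assms(3)
proof (induction k arbitrary: f)
  case 0 then show ?case
    using continuous_on_compose2[OF _ linear_continuous_on[OF assms(1)] assms(4)] by simp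
next
  case (Suc k)
  show ?case
  proof (rule Ck_on_SucI[OF assms(2)])
    fix x assume "x \<in> V"
    then have "(f has_derivative frechet_derivative f (at (L x))) (at (L x))"
      using Ck_on_has_derivative[OF Suc.prems] assms(4) by auto
    then show "((\<lambda>x. f (L x)) has_derivative (\<lambda>v. frechet_derivative f (at (L x)) (L v))) (at x)"
      by (rule has_derivative_compose[OF bounded_linear_imp_has_derivative[OF assms(1)]])
  qed (use Suc in auto)
qed

lemma Ck_on_add:
  assumes "open V" "Ck_on k f V" "Ck_on k g V" shows "Ck_on k (\<lambda>x. f x + g x) V"
  using assms(2,3)
proof (induction k arbitrary: f g)
  case 0 then show ?case by (simp add: continuous_on_add)
next
  case (Suc k)
  show ?case
    by (rule Ck_on_SucI[OF assms(1) has_derivative_add[OF Ck_on_has_derivative[OF Suc.prems(1)] Ck_on_has_derivative[OF Suc.prems(2)]]])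
       (use Suc in auto)
qed

lemma Ck_on_bilinear:
  assumes "bounded_bilinear h" "open V" "Ck_on k f V" "Ck_on k g V" shows "Ck_on k (\<lambda>x. h (f x) (g x)) V"
  using assms(3,4)
proof (induction k arbitrary: f g)
  case 0 then show ?case by (simp add: bounded_bilinear.continuous_on[OF assms(1)])
next
  case (Suc k)
  have "Ck_on k (\<lambda>x. h (f x) (pd v g x) + h (pd v f x) (g x)) V" for v
    by (intro Ck_on_add[OF assms(2)] Suc.IH Ck_on_pd Ck_on_SucD[OF Suc.prems(1)] Ck_on_SucD[OF Suc.prems(2)] Suc.prems)
  then show ?case
    using Ck_on_SucI[OF assms(2) bounded_bilinear.FDERIV[OF assms(1) Ck_on_has_derivative[OF Suc.prems(1)] Ck_on_has_derivative[OF Suc.prems(2)]]]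
    by blast
qed

lemmas Ck_on_mult = Ck_on_bilinear[OF bounded_bilinear_mult]
lemmas Ck_on_scaleR = Ck_on_bilinear[OF bounded_bilinear_scaleR]
lemmas Ck_on_inner = Ck_on_bounded_linear[OF bounded_linear_inner_left]

lemma Ck_on_minus: "open V \<Longrightarrow> Ck_on k f V \<Longrightarrow> Ck_on k (\<lambda>x. - f x) V"
  by (rule Ck_on_bounded_linear[OF bounded_linear_minus[OF bounded_linear_ident]])

lemma Ck_on_diff:
  "open V \<Longrightarrow> Ck_on k f V \<Longrightarrow> Ck_on k g V \<Longrightarrow> Ck_on k (\<lambda>x. f x - g x) V"
  using Ck_on_add[of V k f "\<lambda>x. - g x"] Ck_on_minus[of V k g] by simp

lemma Ck_on_sum:
  "open V \<Longrightarrow> (\<And>i. i \<in> I \<Longrightarrow> Ck_on k (f i) V) \<Longrightarrow> Ck_on k (\<lambda>x. \<Sum>i\<in>I. f i x) V"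
  by (induction I rule: infinite_finite_induct) (auto intro: Ck_on_add)

lemma Ck_on_prod:
  fixes f :: "'i \<Rightarrow> 'e::euclidean_space \<Rightarrow> real"
  shows "open V \<Longrightarrow> (\<And>i. i \<in> I \<Longrightarrow> Ck_on k (f i) V) \<Longrightarrow> Ck_on k (\<lambda>x. \<Prod>i\<in>I. f i x) V"
  by (induction I rule: infinite_finite_induct) (auto intro: Ck_on_mult)

text \<open>The derivative of 1/f is built from \<open>pd v f\<close> and 1/f itself, so the
  induction hypothesis is used for the same function, one order lower.\<close>

lemma Ck_on_inverse:
  fixes f :: "'e::euclidean_space \<Rightarrow> real"
  assumes "open V" "Ck_on k f V" "\<And>x. x \<in> V \<Longrightarrow> f x \<noteq> 0"
  shows "Ck_on k (\<lambda>x. inverse (f x)) V"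
  using assms(2)
proof (induction k)
  case 0 then show ?case using assms(3) by (auto intro!: continuous_on_inverse)
next
  case (Suc k)
  have "Ck_on k (\<lambda>x. inverse (f x)) V" using Suc Ck_on_SucD by blast
  then show ?case
    using Suc.prems
    by (intro Ck_on_SucI[OF assms(1) Deriv.has_derivative_inverse[OF assms(3) Ck_on_has_derivative[OF Suc.prems]]])
      (auto intro!: Ck_on_minus Ck_on_mult assms(1))
qed

lemma Ck_on_divide:
  fixes f g :: "'e::euclidean_space \<Rightarrow> real"
  assumes "open V" "Ck_on k f V" "Ck_on k g V" "\<And>x. x \<in> V \<Longrightarrow> g x \<noteq> 0"
  shows "Ck_on k (\<lambda>x. f x / g x) V"
  unfolding divide_inverse by (intro Ck_on_mult Ck_on_inverse assms)

text \<open>As for the inverse: the derivative of the root is \<open>pd v f\<close> divided by twice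
  the root.\<close>

lemma Ck_on_sqrt:
  fixes f :: "'e::euclidean_space \<Rightarrow> real"
  assumes "open V" "Ck_on k f V" "\<And>x. x \<in> V \<Longrightarrow> f x > 0"
  shows "Ck_on k (\<lambda>x. sqrt (f x)) V"
  using assms(2)
proof (induction k)
  case 0 then show ?case by (auto intro!: continuous_on_real_sqrt)
next
  case (Suc k)
  have "Ck_on k (\<lambda>x. sqrt (f x)) V" using Suc Ck_on_SucD by blast
  moreover have "sqrt (f x) \<noteq> 0" if "x \<in> V" for x using assms(3)[OF that] by simp
  ultimately have "Ck_on k (\<lambda>x. pd v f x * (inverse (sqrt (f x)) * (1 / 2))) V" for v
    by (intro Ck_on_mult Ck_on_inverse Ck_on_const Ck_on_pd[OF Suc.prems] assms(1))
  moreover have "((\<lambda>x. sqrt (f x)) has_derivative (\<lambda>v. pd v f x * (inverse (sqrt (f x)) * (1 / 2)))) (at x)" if "x \<in> V" for x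
    using has_derivative_real_sqrt[OF assms(3)[OF that] Ck_on_has_derivative[OF Suc.prems that]]
    by (simp add: algebra_simps field_simps)
  ultimately show ?case by (intro Ck_on_SucI[OF assms(1)])
qed

lemma has_derivative_frechet_compose:
  assumes "(f has_derivative f') (at x)" "g differentiable (at (f x))"
  shows "((\<lambda>x. g (f x)) has_derivative (\<lambda>v. pd (f' v) g (f x))) (at x)"
  using has_derivative_compose[OF assms(1)] assms(2) frechet_derivative_works by blast

lemma linear_pd: "f differentiable (at x) \<Longrightarrow> linear (\<lambda>v. pd v f x)"
  using linear_frechet_derivative by fastforce

lemma linear_basis_expand:
  fixes f :: "'e::euclidean_space \<Rightarrow> 'f::real_normed_vector"
  assumes "linear f" shows "f v = (\<Sum>b\<in>Basis. (v \<bullet> b) *\<^sub>R f b)"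
proof -
  have "f v = f (\<Sum>b\<in>Basis. (v \<bullet> b) *\<^sub>R b)" by (simp add: euclidean_representation)
  also have "\<dots> = (\<Sum>b\<in>Basis. (v \<bullet> b) *\<^sub>R f b)" by (simp add: linear_sum[OF assms] linear_cmul[OF assms])
  finally show ?thesis .
qed

text \<open>In the chain rule the direction \<open>pd v f x\<close> moves with \<open>x\<close>,
  whereas \<open>Ck_on\<close> speaks of derivatives in fixed directions. Expanding the moving
  direction in \<open>Basis\<close> reduces the former to the latter.\<close>

lemma Ck_on_compose:
  fixes f :: "'e::euclidean_space \<Rightarrow> 'f::euclidean_space"
  assumes "open V" "Ck_on k f V" "Ck_on k g W" "f ` V \<subseteq> W"
  shows "Ck_on k (\<lambda>x. g (f x)) V"
  using assms(2,3)
proof (induction k arbitrary: g)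
  case 0 then show ?case using assms(4) by (auto intro: continuous_on_compose2)
next
  case (Suc k)
  show ?case
  proof (rule Ck_on_SucI[OF assms(1)])
    fix x assume "x \<in> V"
    then have "f x \<in> W" using assms(4) by auto
    then have g: "g differentiable (at (f x))" using Suc.prems by auto
    have f: "(f has_derivative (\<lambda>v. pd v f x)) (at x)" using Ck_on_has_derivative[OF Suc.prems(1) \<open>x \<in> V\<close>] .
    have "pd (pd v f x) g (f x) = (\<Sum>b\<in>Basis. (pd v f x \<bullet> b) *\<^sub>R pd b g (f x))" for v
      by (rule linear_basis_expand[OF linear_pd[OF g]])
    then show "((\<lambda>x. g (f x)) has_derivative (\<lambda>v. \<Sum>b\<in>Basis. (pd v f x \<bullet> b) *\<^sub>R pd b g (f x))) (at x)"
      using has_derivative_frechet_compose[OF f g] by simp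
  next
    fix v
    have "Ck_on k (\<lambda>x. pd b g (f x)) V" for b
      using Suc.IH[of "pd b g"] Suc.prems Ck_on_SucD[OF Suc.prems(1)] by auto
    then show "Ck_on k (\<lambda>x. \<Sum>b\<in>Basis. (pd v f x \<bullet> b) *\<^sub>R pd b g (f x)) V"
      using Suc.prems by (intro Ck_on_sum Ck_on_scaleR Ck_on_inner assms(1)) auto
  qed
qed

lemma Ck_on_Pair:
  assumes "open V" "Ck_on k f V" "Ck_on k g V" shows "Ck_on k (\<lambda>x. (f x, g x)) V"
  using assms(2,3)
proof (induction k arbitrary: f g)
  case 0 then show ?case by (simp add: continuous_on_Pair)
next
  case (Suc k)
  show ?case
    by (rule Ck_on_SucI[OF assms(1) has_derivative_Pair[OF Ck_on_has_derivative[OF Suc.prems(1)] Ck_on_has_derivative[OF Suc.prems(2)]]])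
       (use Suc in auto)
qed

lemma smooth_onD: "smooth_on V f \<Longrightarrow> Ck_on k f V"
  by (simp add: smooth_on_def)

lemma smooth_on_differentiable: "smooth_on V f \<Longrightarrow> x \<in> V \<Longrightarrow> f differentiable (at x)"
  using smooth_onD[of V f 1] by simp

lemma smooth_on_pd: "smooth_on V f \<Longrightarrow> smooth_on V (pd v f)"
  unfolding smooth_on_def using Ck_on_pd by blast

lemma smooth_on_continuous: "smooth_on V f \<Longrightarrow> continuous_on V f"
  using smooth_onD[of V f 0] by simp

lemma smooth_on_cong: "open V \<Longrightarrow> (\<And>y. y \<in> V \<Longrightarrow> f y = g y) \<Longrightarrow> smooth_on V f \<longleftrightarrow> smooth_on V g"
  unfolding smooth_on_def using Ck_on_cong by blast

section \<open>Symmetry of second derivatives\<close>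

lemma dist_add3: fixes x u v :: "'a::real_normed_vector" shows "dist x (x + u + v) = norm (u + v)"
  using dist_add_cancel[of x 0 "u + v"] by (simp add: add.assoc)

text \<open>The mean value theorem along \<open>u\<close> and then along \<open>v\<close>. The
  second difference itself is symmetric in \<open>u\<close> and \<open>v\<close>, which is what
  makes the two derivatives commute.\<close>

lemma second_difference_mean_value:
  fixes f :: "'e::euclidean_space \<Rightarrow> real"
  assumes "Ck_on 2 f V" "cball x (s * (norm u + norm v)) \<subseteq> V" "s > 0"
  shows "\<exists>y. dist x y \<le> s * (norm u + norm v) \<and>
    f (x + s *\<^sub>R u + s *\<^sub>R v) - f (x + s *\<^sub>R u) - f (x + s *\<^sub>R v) + f x = s * (s * pd v (pd u f) y)"
proof -
  have inV: "x + a *\<^sub>R u + b *\<^sub>R v \<in> V" if "0 \<le> a" "a \<le> s" "0 \<le> b" "b \<le> s" for a b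
  proof -
    have "norm (a *\<^sub>R u + b *\<^sub>R v) \<le> a * norm u + b * norm v"
      using that norm_triangle_ineq[of "a *\<^sub>R u" "b *\<^sub>R v"] by simp
    also have "\<dots> \<le> s * norm u + s * norm v" using that by (intro add_mono mult_right_mono) auto
    also have "\<dots> = s * (norm u + norm v)" by (simp add: algebra_simps)
    finally have "dist x (x + a *\<^sub>R u + b *\<^sub>R v) \<le> s * (norm u + norm v)" by (simp only: dist_add3)
    then show ?thesis using assms(2) by auto
  qed
  have f1: "Ck_on (Suc (Suc 0)) f V" using assms(1) by (simp add: numeral_2_eq_2)
  have d1: "((\<lambda>a. f (x + a *\<^sub>R u + b *\<^sub>R v)) has_real_derivative pd u f (x + a *\<^sub>R u + b *\<^sub>R v)) (at a)"
    if "0 \<le> a" "a \<le> s" "0 \<le> b" "b \<le> s" for a b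
  proof -
    have "((\<lambda>a. x + a *\<^sub>R u + b *\<^sub>R v) has_derivative (\<lambda>h. h *\<^sub>R u)) (at a)"
      by (auto intro!: derivative_eq_intros)
    from has_derivative_compose[OF this Ck_on_has_derivative[OF f1 inV[OF that]]]
    have "((\<lambda>a. f (x + a *\<^sub>R u + b *\<^sub>R v)) has_derivative (\<lambda>h. pd (h *\<^sub>R u) f (x + a *\<^sub>R u + b *\<^sub>R v))) (at a)" .
    moreover have "pd (h *\<^sub>R u) f (x + a *\<^sub>R u + b *\<^sub>R v) = pd u f (x + a *\<^sub>R u + b *\<^sub>R v) * h" for h
      using linear_cmul[OF linear_pd[OF Ck_on_differentiable[OF f1 inV[OF that]]]] by simp
    ultimately show ?thesis by (simp add: has_field_derivative_def)
  qed
  have f2: "Ck_on (Suc 0) (pd u f) V" using f1 by (rule Ck_on_pd)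
  have d2: "((\<lambda>b. pd u f (x + a *\<^sub>R u + b *\<^sub>R v)) has_real_derivative pd v (pd u f) (x + a *\<^sub>R u + b *\<^sub>R v)) (at b)"
    if "0 \<le> a" "a \<le> s" "0 \<le> b" "b \<le> s" for a b
  proof -
    have "((\<lambda>b. x + a *\<^sub>R u + b *\<^sub>R v) has_derivative (\<lambda>h. h *\<^sub>R v)) (at b)"
      by (auto intro!: derivative_eq_intros)
    from has_derivative_compose[OF this Ck_on_has_derivative[OF f2 inV[OF that]]]
    have "((\<lambda>b. pd u f (x + a *\<^sub>R u + b *\<^sub>R v)) has_derivative (\<lambda>h. pd (h *\<^sub>R v) (pd u f) (x + a *\<^sub>R u + b *\<^sub>R v))) (at b)" .
    moreover have "pd (h *\<^sub>R v) (pd u f) (x + a *\<^sub>R u + b *\<^sub>R v) = pd v (pd u f) (x + a *\<^sub>R u + b *\<^sub>R v) * h" for h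
      using linear_cmul[OF linear_pd[OF Ck_on_differentiable[OF f2 inV[OF that]]]] by simp
    ultimately show ?thesis by (simp add: has_field_derivative_def)
  qed
  \<comment> \<open>The increment in direction \<open>v\<close>, as a function of the coefficient of
    \<open>u\<close>.\<close>
  define F where "F a = f (x + a *\<^sub>R u + s *\<^sub>R v) - f (x + a *\<^sub>R u + 0 *\<^sub>R v)" for a
  have dF: "DERIV F a :> pd u f (x + a *\<^sub>R u + s *\<^sub>R v) - pd u f (x + a *\<^sub>R u + 0 *\<^sub>R v)" if "0 \<le> a" "a \<le> s" for a
    unfolding F_def using that assms(3) by (intro DERIV_diff d1) auto
  obtain a where a: "0 < a" "a < s" and Fa: "F s - F 0 = (s - 0) * (pd u f (x + a *\<^sub>R u + s *\<^sub>R v) - pd u f (x + a *\<^sub>R u + 0 *\<^sub>R v))"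
    using MVT2[OF assms(3) dF] by blast
  have d2': "((\<lambda>b. pd u f (x + a *\<^sub>R u + b *\<^sub>R v)) has_real_derivative pd v (pd u f) (x + a *\<^sub>R u + b *\<^sub>R v)) (at b)"
    if "0 \<le> b" "b \<le> s" for b
    using d2[of a b] a that by simp
  obtain b where b: "0 < b" "b < s"
    and Gb: "pd u f (x + a *\<^sub>R u + s *\<^sub>R v) - pd u f (x + a *\<^sub>R u + 0 *\<^sub>R v) = (s - 0) * pd v (pd u f) (x + a *\<^sub>R u + b *\<^sub>R v)"
    using MVT2[OF assms(3) d2'] by blast
  have "norm (a *\<^sub>R u + b *\<^sub>R v) \<le> a * norm u + b * norm v"
    using a b norm_triangle_ineq[of "a *\<^sub>R u" "b *\<^sub>R v"] by simp
  also have "\<dots> \<le> s * norm u + s * norm v" using a b by (intro add_mono mult_right_mono) auto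
  also have "\<dots> = s * (norm u + norm v)" by (simp add: algebra_simps)
  finally have "dist x (x + a *\<^sub>R u + b *\<^sub>R v) \<le> s * (norm u + norm v)" by (simp only: dist_add3)
  moreover have "F s - F 0 = f (x + s *\<^sub>R u + s *\<^sub>R v) - f (x + s *\<^sub>R u) - f (x + s *\<^sub>R v) + f x"
    by (simp add: F_def)
  ultimately show ?thesis using Fa Gb by auto
qed

text \<open>Both orders of differentiation give the same second difference divided by the square of
  \<open>s\<close>, each at some point near \<open>x\<close>. By continuity each is then within half
  of the supposed gap of its value at \<open>x\<close>, which is absurd.\<close>

lemma pd_commute_real:
  fixes f :: "'e::euclidean_space \<Rightarrow> real"
  assumes "open V" "Ck_on 2 f V" "x \<in> V"
  shows "pd v (pd u f) x = pd u (pd v f) x"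
proof (rule ccontr)
  assume ne: "pd v (pd u f) x \<noteq> pd u (pd v f) x"
  define e where "e = \<bar>pd v (pd u f) x - pd u (pd v f) x\<bar> / 2"
  have e: "e > 0" using ne by (simp add: e_def)
  have c: "isCont (pd b (pd a f)) x" for a b
    using assms by (simp add: numeral_2_eq_2 continuous_on_eq_continuous_at)
  obtain d1 where d1: "d1 > 0" "\<And>y. dist y x < d1 \<Longrightarrow> dist (pd v (pd u f) y) (pd v (pd u f) x) < e"
    using c e unfolding continuous_at_eps_delta by metis
  obtain d2 where d2: "d2 > 0" "\<And>y. dist y x < d2 \<Longrightarrow> dist (pd u (pd v f) y) (pd u (pd v f) x) < e"
    using c e unfolding continuous_at_eps_delta by metis
  obtain r where r: "r > 0" "ball x r \<subseteq> V" using assms(1,3) openE by blast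
  \<comment> \<open>\<open>m\<close> is the least of the radius inside \<open>V\<close> and the two
    continuity radii. \<open>s\<close> is so small that the parallelogram stays within
    \<open>m\<close>; the added 1 keeps the denominator positive.\<close>
  define m where "m = min r (min d1 d2)"
  define s where "s = m / (2 * (norm u + norm v + 1))"
  have m: "m > 0" using r d1 d2 by (simp add: m_def)
  have nn: "norm u + norm v + 1 > 0" by (simp add: add_nonneg_pos)
  have s: "s > 0" using m nn by (simp add: s_def)
  have "s * (norm u + norm v) < s * (2 * (norm u + norm v + 1))"
    by (rule mult_strict_left_mono[OF _ s]) (smt (verit) norm_ge_zero)
  also have "\<dots> = m" using nn by (simp add: s_def)
  finally have sm: "s * (norm u + norm v) < m" .
  then have sub: "cball x (s * (norm u + norm v)) \<subseteq> V" using r m_def by auto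
  obtain y where y: "dist x y \<le> s * (norm u + norm v)"
    "f (x + s *\<^sub>R u + s *\<^sub>R v) - f (x + s *\<^sub>R u) - f (x + s *\<^sub>R v) + f x = s * (s * pd v (pd u f) y)"
    using second_difference_mean_value[OF assms(2) sub s] by blast
  have sub': "cball x (s * (norm v + norm u)) \<subseteq> V" using sub by (simp add: add.commute)
  obtain z where z: "dist x z \<le> s * (norm v + norm u)"
    "f (x + s *\<^sub>R v + s *\<^sub>R u) - f (x + s *\<^sub>R v) - f (x + s *\<^sub>R u) + f x = s * (s * pd u (pd v f) z)"
    using second_difference_mean_value[OF assms(2) sub' s] by blast
  have "s * (s * pd v (pd u f) y) = s * (s * pd u (pd v f) z)" using y(2) z(2) by (simp add: algebra_simps)
  then have eq: "pd v (pd u f) y = pd u (pd v f) z" using s by simp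
  have "dist (pd v (pd u f) y) (pd v (pd u f) x) < e" using d1(2)[of y] y(1) sm by (simp add: dist_commute m_def)
  moreover have "dist (pd u (pd v f) z) (pd u (pd v f) x) < e"
    using d2(2)[of z] z(1) sm by (simp add: dist_commute m_def add.commute)
  ultimately show False using eq unfolding e_def dist_real_def by (smt (verit) field_sum_of_halves)
qed

text \<open>Componentwise from the real case; it will be applied to transition maps and their
  derivatives.\<close>

lemma pd_commute:
  fixes f :: "'e::euclidean_space \<Rightarrow> 'f::euclidean_space"
  assumes "open V" "Ck_on 2 f V" "x \<in> V"
  shows "pd v (pd u f) x = pd u (pd v f) x"
proof (rule euclidean_eqI)
  fix b :: 'f assume "b \<in> Basis"
  have pdi: "pd a (\<lambda>y. g y \<bullet> b) y = pd a g y \<bullet> b" if "Ck_on (Suc k) g V" "y \<in> V" for g k y a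
    by (rule fun_cong[OF frechet_derivative_eq[OF bounded_linear.has_derivative[OF bounded_linear_inner_left Ck_on_has_derivative[OF that]]]])
  have pdi2: "pd a (pd c (\<lambda>y. f y \<bullet> b)) x = pd a (pd c f) x \<bullet> b" for a c
  proof -
    have "pd a (pd c (\<lambda>y. f y \<bullet> b)) x = pd a (\<lambda>y. pd c f y \<bullet> b) x"
      by (intro fun_cong[OF frechet_derivative_cong_open[OF assms(1,3)]] pdi[of 1]) (use assms(2) in \<open>auto simp: numeral_2_eq_2\<close>)
    also have "\<dots> = pd a (pd c f) x \<bullet> b"
      by (rule pdi[of 0]) (use assms in \<open>auto simp: numeral_2_eq_2\<close>)
    finally show ?thesis .
  qed
  have "pd v (pd u (\<lambda>y. f y \<bullet> b)) x = pd u (pd v (\<lambda>y. f y \<bullet> b)) x"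
    by (rule pd_commute_real[OF assms(1) Ck_on_inner[OF assms(1,2)] assms(3)])
  then show "pd v (pd u f) x \<bullet> b = pd u (pd v f) x \<bullet> b" by (simp add: pdi2)
qed

section \<open>Smooth bump functions\<close>

text \<open>The functions t^(-j) exp(-1/t), continued by 0. For j = 0 this is the classical flat
  function; the other exponents are included because the family is closed under differentiation up
  to linear combinations.\<close>

definition exp_inv :: "nat \<Rightarrow> real \<Rightarrow> real" where
  "exp_inv j t = (if t > 0 then inverse t ^ j * exp (- inverse t) else 0)"

lemma exp_inv_tendsto_0: "(exp_inv j \<longlongrightarrow> 0) (at_right 0)"
proof -
  have "((\<lambda>t. inverse t ^ j / exp (inverse t)) \<longlongrightarrow> 0) (at_right (0::real))"
    by (rule filterlim_compose[OF tendsto_power_div_exp_0 filterlim_inverse_at_top_right])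
  then show ?thesis
    by (rule Lim_transform_eventually)
       (auto simp: exp_inv_def eventually_at_filter exp_minus divide_inverse)
qed

lemma exp_inv_has_derivative:
  "(exp_inv j has_real_derivative exp_inv (j + 2) t - j * exp_inv (j + 1) t) (at t)"
proof -
  consider "t > 0" | "t < 0" | "t = 0" by linarith
  then show ?thesis
  proof cases
    case 1
    have A: "((\<lambda>t. inverse t ^ j) has_real_derivative - real j * inverse t ^ (j + 1)) (at t)"
    proof (induction j)
      case (Suc j)
      show ?case using DERIV_mult[OF DERIV_inverse[of t] Suc] 1 by (simp add: algebra_simps power2_eq_square)
    qed simp
    have B: "((\<lambda>t. exp (- inverse t)) has_real_derivative exp (- inverse t) * inverse t ^ 2) (at t)"
      using 1 by (auto intro!: derivative_eq_intros simp: power2_eq_square)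
    have "((\<lambda>t. inverse t ^ j * exp (- inverse t)) has_real_derivative
        exp_inv (j + 2) t - j * exp_inv (j + 1) t) (at t)"
      using DERIV_mult[OF A B] 1 by (simp add: exp_inv_def algebra_simps power2_eq_square)
    then show ?thesis
      by (rule has_field_derivative_transform_within_open[of _ _ _ "{0<..}"]) (use 1 in \<open>auto simp: exp_inv_def\<close>)
  next
    case 2
    have "((\<lambda>t. 0) has_real_derivative exp_inv (j + 2) t - j * exp_inv (j + 1) t) (at t)"
      using 2 by (simp add: exp_inv_def)
    then show ?thesis
      by (rule has_field_derivative_transform_within_open[of _ _ _ "{..<0}"]) (use 2 in \<open>auto simp: exp_inv_def\<close>)
  next
    \<comment> \<open>At the origin the difference quotient is 0 from the left and
      \<open>exp_inv (j + 1)\<close> from the right, hence tends to 0, which is the value of the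
      claimed derivative there.\<close>
    case 3
    have "((\<lambda>h. (exp_inv j (0 + h) - exp_inv j 0) / h) \<longlongrightarrow> 0) (at 0)"
      unfolding filterlim_at_split
    proof
      show "((\<lambda>h. (exp_inv j (0 + h) - exp_inv j 0) / h) \<longlongrightarrow> 0) (at_left 0)"
        by (rule Lim_transform_eventually[of "\<lambda>_. 0"]) (auto simp: exp_inv_def eventually_at_filter)
      show "((\<lambda>h. (exp_inv j (0 + h) - exp_inv j 0) / h) \<longlongrightarrow> 0) (at_right 0)"
        by (rule Lim_transform_eventually[OF exp_inv_tendsto_0[of "j + 1"]])
           (auto simp: exp_inv_def eventually_at_filter field_simps)
    qed
    then show ?thesis using 3 by (simp add: DERIV_def exp_inv_def)
  qed
qed

lemma Ck_on_exp_inv: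
  fixes f :: "'e::euclidean_space \<Rightarrow> real"
  assumes "open V" "Ck_on k f V"
  shows "Ck_on k (\<lambda>x. exp_inv j (f x)) V"
  using assms(2)
proof (induction k arbitrary: j)
  case 0
  have "continuous_on UNIV (exp_inv j)" by (rule DERIV_continuous_on[OF exp_inv_has_derivative])
  then show ?case using 0 continuous_on_compose2[of UNIV "exp_inv j" V f] by simp
next
  case (Suc k)
  show ?case
  proof (rule Ck_on_SucI[OF assms(1)])
    fix x assume "x \<in> V"
    show "((\<lambda>x. exp_inv j (f x)) has_derivative
        (\<lambda>v. (exp_inv (j + 2) (f x) - j * exp_inv (j + 1) (f x)) * pd v f x)) (at x)"
      using has_derivative_compose[OF Ck_on_has_derivative[OF Suc.prems \<open>x \<in> V\<close>]
        exp_inv_has_derivative[of j "f x", unfolded has_field_derivative_def]] .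
  next
    fix v
    note IH = Suc.IH[OF Ck_on_SucD[OF Suc.prems]]
    show "Ck_on k (\<lambda>x. (exp_inv (j + 2) (f x) - j * exp_inv (j + 1) (f x)) * pd v f x) V"
      by (intro Ck_on_mult Ck_on_diff Ck_on_const assms(1) IH Ck_on_pd[OF Suc.prems])
  qed
qed

text \<open>Besides the two corners there is a steepness \<open>k\<close>. For fixed
  \<open>k > 0\<close> this is a bump, positive exactly on the open box; for \<open>k\<close>
  tending to infinity it approximates the indicator of that box.\<close>

definition box_bump :: "real \<Rightarrow> 'e::euclidean_space \<Rightarrow> 'e \<Rightarrow> 'e \<Rightarrow> real" where
  "box_bump k l r x =
     (\<Prod>b\<in>Basis. exp_inv 0 (k * (x \<bullet> b - l \<bullet> b)) * exp_inv 0 (k * (r \<bullet> b - x \<bullet> b)))"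

lemma smooth_on_box_bump: "open V \<Longrightarrow> smooth_on V (box_bump k l r)"
  unfolding smooth_on_def box_bump_def[abs_def]
  by (intro allI Ck_on_prod Ck_on_mult Ck_on_exp_inv Ck_on_const Ck_on_diff Ck_on_linear bounded_linear_inner_left)

lemma exp_inv_0: "0 \<le> exp_inv 0 t" "exp_inv 0 t \<le> 1" "0 < exp_inv 0 t \<longleftrightarrow> 0 < t"
  by (auto simp: exp_inv_def)

lemma box_bump_nonneg: "0 \<le> box_bump k l r x"
  unfolding box_bump_def by (intro prod_nonneg ballI mult_nonneg_nonneg exp_inv_0)

lemma box_bump_le_1: "box_bump k l r x \<le> 1"
  unfolding box_bump_def by (intro prod_le_1 conjI mult_nonneg_nonneg mult_le_one exp_inv_0)

lemma box_bump_pos_iff: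
  assumes "k > 0" shows "0 < box_bump k l r x \<longleftrightarrow> x \<in> box l r"
proof
  assume "x \<in> box l r"
  then show "0 < box_bump k l r x"
    unfolding box_bump_def using assms by (intro prod_pos) (auto simp: exp_inv_def mem_box)
next
  assume "0 < box_bump k l r x"
  then have "exp_inv 0 (k * (x \<bullet> b - l \<bullet> b)) * exp_inv 0 (k * (r \<bullet> b - x \<bullet> b)) \<noteq> 0" if "b \<in> Basis" for b
    using that unfolding box_bump_def by (metis (mono_tags, lifting) finite_Basis less_irrefl prod_zero_iff)
  then have "0 < k * (x \<bullet> b - l \<bullet> b) \<and> 0 < k * (r \<bullet> b - x \<bullet> b)" if "b \<in> Basis" for b
    using that by (metis exp_inv_0(1,3) less_eq_real_def mult_eq_0_iff)
  then show "x \<in> box l r" using assms by (auto simp: mem_box zero_less_mult_iff)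
qed

lemma box_bump_eq_0: "k > 0 \<Longrightarrow> x \<notin> box l r \<Longrightarrow> box_bump k l r x = 0"
  using box_bump_pos_iff box_bump_nonneg by (metis less_eq_real_def)

lemma closure_box_bump: "k > 0 \<Longrightarrow> closure {x. box_bump k l r x \<noteq> 0} \<subseteq> cbox l r"
  by (rule closure_minimal) (use box_bump_eq_0[of k _ l r] box_subset_cbox in blast)+

lemma box_bump_tendsto: "(\<lambda>k. box_bump (real (Suc k)) l r x) \<longlonglongrightarrow> indicator (box l r) x"
proof (cases "x \<in> box l r")
  case True
  have lim: "(\<lambda>k. exp_inv 0 (real (Suc k) * t)) \<longlonglongrightarrow> 1" if "t > 0" for t
  proof -
    have "(\<lambda>k. exp (- (inverse (real (Suc k)) * inverse t))) \<longlonglongrightarrow> exp (- (0 * inverse t))"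
      by (intro tendsto_intros LIMSEQ_inverse_real_of_nat)
    then show ?thesis using that by (simp add: exp_inv_def zero_less_mult_iff)
  qed
  have "(\<lambda>k. box_bump (real (Suc k)) l r x) \<longlonglongrightarrow> (\<Prod>b\<in>(Basis::'a set). 1 * 1)"
    unfolding box_bump_def using True by (intro tendsto_prod tendsto_mult lim) (auto simp: mem_box)
  then show ?thesis using True by simp
next
  case False
  then show ?thesis by (simp add: box_bump_eq_0)
qed

lemma test_function_box_bump:
  assumes "k > 0" "cbox l r \<subseteq> V" shows "test_function V (box_bump k l r)"
  unfolding test_function_def
proof (intro conjI)
  show "compact (closure {x. box_bump k l r x \<noteq> 0})"
    using closure_box_bump[OF assms(1), of l r] by (meson closed_closure compact_cbox compact_closure bounded_cbox bounded_subset compact_eq_bounded_closed)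
qed (use closure_box_bump[OF assms(1), of l r] assms(2) smooth_on_box_bump[OF open_UNIV] in auto)

section \<open>Integration by parts and weak derivatives\<close>

lemma set_integrable_compact_support:
  fixes h :: "'e::euclidean_space \<Rightarrow> real"
  assumes "continuous_on V h" "compact K" "K \<subseteq> V" "\<And>x. x \<in> V - K \<Longrightarrow> h x = 0"
  shows "set_integrable lborel V h"
proof -
  have "integrable lborel (\<lambda>x. indicator K x *\<^sub>R h x)"
    using borel_integrable_compact[OF assms(2)] continuous_on_subset[OF assms(1,3)] by blast
  moreover have "(\<lambda>x. indicator V x *\<^sub>R h x) = (\<lambda>x. indicator K x *\<^sub>R h x)"
    using assms(3,4) by (intro ext) (auto simp: indicator_def)
  ultimately show ?thesis by (simp only: set_integrable_def)
qed

text \<open>The open sets \<open>V\<close> and \<open>- K\<close> cover the space, and on their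
  intersection both formulas give 0.\<close>

lemma Ck_on_extend_0:
  fixes h :: "'e::euclidean_space \<Rightarrow> real"
  assumes "open V" "Ck_on k h V" "closed K" "K \<subseteq> V" "\<And>x. x \<in> V - K \<Longrightarrow> h x = 0"
  shows "Ck_on k (\<lambda>x. if x \<in> V then h x else 0) UNIV"
proof (rule Ck_on_local)
  fix x :: 'e
  show "\<exists>W. open W \<and> x \<in> W \<and> Ck_on k (\<lambda>x. if x \<in> V then h x else 0) W"
  proof (cases "x \<in> V")
    case True
    have "Ck_on k (\<lambda>x. if x \<in> V then h x else 0) V"
      using assms(2) by (rule Ck_on_cong[OF assms(1), THEN iffD1, rotated]) auto
    then show ?thesis using True assms(1) by blast
  next
    case False
    have o: "open (- K)" using assms(3) by (simp add: open_Compl)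
    have "Ck_on k (\<lambda>x. if x \<in> V then h x else 0) (- K)"
      by (rule Ck_on_cong[OF o, THEN iffD1, OF _ Ck_on_const[of k 0]]) (use assms(5) in auto)
    then show ?thesis using False o assms(4) by blast
  qed
qed

lemma bounded_compact_support:
  fixes h :: "'e::euclidean_space \<Rightarrow> real"
  assumes "continuous_on UNIV h" "compact K" "\<And>x. x \<notin> K \<Longrightarrow> h x = 0"
  obtains C where "\<And>x. \<bar>h x\<bar> \<le> C" "C \<ge> 0"
proof -
  have "compact (h ` K)" using assms compact_continuous_image continuous_on_subset by blast
  then obtain C where C: "\<And>y. y \<in> h ` K \<Longrightarrow> norm y \<le> C" "C > 0" using compact_imp_bounded bounded_pos by metis
  have "\<bar>h x\<bar> \<le> C" for x using C assms(3)[of x] by (cases "x \<in> K") auto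
  then show ?thesis using that[of C] C by auto
qed

lemma pd_outside_support:
  fixes F :: "'e::euclidean_space \<Rightarrow> real"
  assumes "closed K" "\<And>x. x \<notin> K \<Longrightarrow> F x = 0" "x \<notin> K"
  shows "pd b F x = 0"
proof -
  have "frechet_derivative F (at x) = frechet_derivative (\<lambda>x. 0) (at x)"
    by (rule frechet_derivative_cong_open[of "- K"]) (use assms in auto)
  then show ?thesis by (simp add: frechet_derivative_const)
qed

text \<open>Difference quotients have integral 0 by translation invariance, and converge dominatedly.\<close>

lemma integral_pd_eq_0:
  fixes F :: "'e::euclidean_space \<Rightarrow> real"
  assumes F: "Ck_on 1 F UNIV" and K: "compact K" and F0: "\<And>x. x \<notin> K \<Longrightarrow> F x = 0"
  shows "integrable lborel (pd b F)" "(LINT x|lborel. pd b F x) = 0"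
proof -
  have cF: "continuous_on UNIV F" using Ck_on_imp_continuous[OF F] .
  have cd: "continuous_on UNIV (pd b F)" using F by simp
  have d0: "pd b F x = 0" if "x \<notin> K" for x by (rule pd_outside_support[OF compact_imp_closed[OF K] F0 that])
  have int: "integrable lborel h" if "continuous_on UNIV h" "\<And>x. x \<notin> K \<Longrightarrow> h x = 0" for h :: "'e \<Rightarrow> real"
    using set_integrable_compact_support[of UNIV h K] that K by (simp add: set_integrable_def)
  show "integrable lborel (pd b F)" by (rule int[OF cd d0])
  obtain C where C: "\<And>x. \<bar>pd b F x\<bar> \<le> C" "C \<ge> 0" using bounded_compact_support[OF cd K d0] by blast
  have dF: "((\<lambda>t. F (x + t *\<^sub>R b)) has_real_derivative pd b F (x + t *\<^sub>R b)) (at t)" for x t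
  proof -
    have "((\<lambda>t. x + t *\<^sub>R b) has_derivative (\<lambda>h. h *\<^sub>R b)) (at t)"
      by (auto intro!: derivative_eq_intros)
    from has_derivative_compose[OF this Ck_on_has_derivative[of 0 F UNIV]] F
    have "((\<lambda>t. F (x + t *\<^sub>R b)) has_derivative (\<lambda>h. pd (h *\<^sub>R b) F (x + t *\<^sub>R b))) (at t)" by simp
    moreover have "pd (h *\<^sub>R b) F y = pd b F y * h" for h y
      using linear_cmul[OF linear_pd[of F y]] F by simp
    ultimately show ?thesis by (simp add: has_field_derivative_def)
  qed
  \<comment> \<open>\<open>K\<close> swept backwards along \<open>b\<close> for times in [0, 1]. The
    steps of the difference quotients \<open>q n\<close> are at most 1, so all of them vanish
    outside \<open>K' \<union> K\<close>, on which one integrable constant dominates.\<close>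
  define K' where "K' = (\<lambda>(x, t). x - t *\<^sub>R b) ` (K \<times> {0..1::real})"
  have K': "compact K'" unfolding K'_def split_def
    by (intro compact_continuous_image compact_Times K compact_Icc continuous_intros)
  define q where "q n x = (F (x + inverse (real (Suc n)) *\<^sub>R b) - F x) * real (Suc n)" for n x
  have q_mv: "\<exists>t\<in>{0..inverse (real (Suc n))}. q n x = pd b F (x + t *\<^sub>R b)" for n x
  proof -
    have "0 < inverse (real (Suc n))" by simp
    from MVT2[OF this dF] obtain t where t: "0 < t" "t < inverse (real (Suc n))"
      "F (x + inverse (real (Suc n)) *\<^sub>R b) - F (x + 0 *\<^sub>R b) = (inverse (real (Suc n)) - 0) * pd b F (x + t *\<^sub>R b)" by blast
    then have "q n x = pd b F (x + t *\<^sub>R b)" by (simp add: q_def)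
    then show ?thesis using t by force
  qed
  have qb: "norm (q n x) \<le> C * indicator (K' \<union> K) x" for n x
  proof (cases "x \<in> K' \<union> K")
    case True
    then show ?thesis using q_mv[of n x] C by auto
  next
    case False
    have "x + inverse (real (Suc n)) *\<^sub>R b \<notin> K"
    proof
      assume "x + inverse (real (Suc n)) *\<^sub>R b \<in> K"
      then have "(\<lambda>(x, t). x - t *\<^sub>R b) (x + inverse (real (Suc n)) *\<^sub>R b, inverse (real (Suc n))) \<in> K'"
        unfolding K'_def by (intro imageI) (auto simp: field_simps)
      then show False using False by simp
    qed
    then show ?thesis using False F0 by (simp add: q_def)
  qed
  have lim: "(\<lambda>n. q n x) \<longlonglongrightarrow> pd b F x" for x
  proof -
    have "((\<lambda>h. (F (x + h *\<^sub>R b) - F x) / h) \<longlongrightarrow> pd b F x) (at 0)"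
      using dF[of x 0] by (simp add: DERIV_def)
    moreover have "filterlim (\<lambda>n. inverse (real (Suc n))) (at 0) sequentially"
      using LIMSEQ_inverse_real_of_nat by (auto simp: filterlim_at)
    ultimately have "(\<lambda>n. (F (x + inverse (real (Suc n)) *\<^sub>R b) - F x) / inverse (real (Suc n))) \<longlonglongrightarrow> pd b F x"
      by (rule filterlim_compose)
    then show ?thesis by (simp add: q_def[abs_def] divide_inverse)
  qed
  have intF: "integrable lborel F" by (rule int[OF cF F0])
  have bF [measurable]: "F \<in> borel_measurable borel" using cF by (rule borel_measurable_continuous_onI)
  have tr: "(LINT x|lborel. F (x + v)) = (LINT x|lborel. F x)" "integrable lborel (\<lambda>x. F (x + v))" for v
  proof -
    have e: "lborel = distr lborel borel (\<lambda>x. x + v)" using lborel_affine[of 1 v] by (simp add: density_1 add.commute)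
    show "(LINT x|lborel. F (x + v)) = (LINT x|lborel. F x)"
      by (subst (2) e) (simp add: integral_distr)
    show "integrable lborel (\<lambda>x. F (x + v))"
      using intF by (subst (asm) e) (simp add: integrable_distr_eq)
  qed
  have q0: "(LINT x|lborel. q n x) = 0" for n
    using tr intF by (simp add: q_def)
  have "(\<lambda>n. LINT x|lborel. q n x) \<longlonglongrightarrow> (LINT x|lborel. pd b F x)"
  proof (rule integral_dominated_convergence[where w = "\<lambda>x. C * indicator (K' \<union> K) x"])
    have "emeasure lborel (K' \<union> K) < \<infinity>"
      using K K' compact_Un emeasure_compact_finite by blast
    then show "integrable lborel (\<lambda>x. C * indicator (K' \<union> K) x)"
      using K K' by (intro integrable_mult_right integrable_real_indicator) (auto simp: borel_compact)
    show "pd b F \<in> borel_measurable lborel" using borel_measurable_continuous_onI[OF cd] by simp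
    show "q n \<in> borel_measurable lborel" for n unfolding q_def[abs_def] by measurable
  qed (use lim qb in auto)
  then show "(LINT x|lborel. pd b F x) = 0" using q0 by (simp add: LIMSEQ_const_iff)
qed

text \<open>Extension by 0 reduces this to a function on the whole space.\<close>

lemma set_integral_pd_eq_0:
  fixes G :: "'e::euclidean_space \<Rightarrow> real"
  assumes "open V" "Ck_on 1 G V" "compact K" "K \<subseteq> V" "\<And>x. x \<in> V - K \<Longrightarrow> G x = 0"
  shows "set_integrable lborel V (pd b G)" "(LINT x:V|lborel. pd b G x) = 0"
proof -
  define F where "F x = (if x \<in> V then G x else 0)" for x
  have F: "Ck_on 1 F UNIV" unfolding F_def by (rule Ck_on_extend_0[OF assms(1,2) compact_imp_closed[OF assms(3)] assms(4,5)])
  have F0: "F x = 0" if "x \<notin> K" for x using assms(4,5) that by (auto simp: F_def)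
  have "pd b F x = indicator V x *\<^sub>R pd b G x" for x
  proof (cases "x \<in> V")
    case True
    then show ?thesis using frechet_derivative_cong_open[OF assms(1) True, where f=F and g=G] by (simp add: F_def)
  next
    case False
    then show ?thesis using pd_outside_support[of K F x b, OF compact_imp_closed[OF assms(3)] F0] assms(4) by auto
  qed
  then have e: "pd b F = (\<lambda>x. indicator V x *\<^sub>R pd b G x)" by auto
  show "set_integrable lborel V (pd b G)" "(LINT x:V|lborel. pd b G x) = 0"
    using integral_pd_eq_0[OF F assms(3) F0, of b]
    by (simp_all add: set_integrable_def set_lebesgue_integral_def e)
qed

lemma pd_mult:
  fixes f g :: "'e::euclidean_space \<Rightarrow> real"
  assumes "f differentiable (at x)" "g differentiable (at x)"
  shows "pd b (\<lambda>x. f x * g x) x = f x * pd b g x + pd b f x * g x"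
  by (rule fun_cong[OF frechet_derivative_eq[OF has_derivative_mult[OF assms[THEN frechet_derivative_works[THEN iffD1]]]]])

text \<open>Compact support of the factor \<open>g\<close> is inherited by the product, whose
  derivative has integral 0.\<close>

lemma set_integral_by_parts:
  fixes f g :: "'e::euclidean_space \<Rightarrow> real"
  assumes "open V" "Ck_on 1 f V" "Ck_on 1 g V" "compact K" "K \<subseteq> V" "\<And>x. x \<in> V - K \<Longrightarrow> g x = 0"
  shows "(LINT x:V|lborel. f x * pd b g x) = - (LINT x:V|lborel. pd b f x * g x)"
proof -
  have fg: "Ck_on 1 (\<lambda>x. f x * g x) V" by (intro Ck_on_mult assms)
  have "V - K = V \<inter> - K" by auto
  then have oVK: "open (V - K)" using assms(1,4) by (simp add: compact_imp_closed open_Compl open_Int)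
  have dg0: "pd b g x = 0" if "x \<in> V - K" for x
    using frechet_derivative_cong_open[OF oVK that, of g "\<lambda>x. 0"] assms(6) by (simp add: frechet_derivative_const)
  have i1: "set_integrable lborel V (\<lambda>x. f x * pd b g x)"
    by (rule set_integrable_compact_support[OF _ assms(4,5)])
       (use Ck_on_imp_continuous[OF assms(2)] assms(3) dg0 in \<open>auto intro!: continuous_intros\<close>)
  have i2: "set_integrable lborel V (\<lambda>x. pd b f x * g x)"
    by (rule set_integrable_compact_support[OF _ assms(4,5)])
       (use Ck_on_imp_continuous[OF assms(3)] assms(2,6) in \<open>auto intro!: continuous_intros\<close>)
  have "0 = (LINT x:V|lborel. pd b (\<lambda>x. f x * g x) x)"
    using set_integral_pd_eq_0(2)[OF assms(1) fg assms(4,5)] assms(6) by simp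
  also have "\<dots> = (LINT x:V|lborel. f x * pd b g x + pd b f x * g x)"
    by (rule set_lebesgue_integral_cong) (use assms(1,2,3) in \<open>auto intro!: pd_mult\<close>)
  also have "\<dots> = (LINT x:V|lborel. f x * pd b g x) + (LINT x:V|lborel. pd b f x * g x)"
    by (rule set_integral_add(2)[OF i1 i2])
  finally show ?thesis by simp
qed

section \<open>The fundamental lemma of the calculus of variations\<close>

lemma AE_cbox_imp_box: "AE x in lborel. x \<in> cbox a b \<longrightarrow> x \<in> box a (b::'e::euclidean_space)"
proof -
  have "emeasure lborel (cbox a b - box a b) = emeasure lborel (cbox a b) - emeasure lborel (box a b)"
    using emeasure_lborel_box_finite[of a b] by (intro emeasure_Diff box_subset_cbox) auto
  also have "\<dots> = 0" by (simp add: emeasure_lborel_cbox_eq emeasure_lborel_box_eq)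
  finally have "cbox a b - box a b \<in> null_sets lborel" by auto
  then show ?thesis by (rule AE_I'[where N="cbox a b - box a b"]) auto
qed

text \<open>Dominated convergence along steeper and steeper bumps: integrals against test functions
  determine the integrals over boxes.\<close>

lemma test_function_integral_tendsto:
  fixes g :: "'e::euclidean_space \<Rightarrow> real"
  assumes V: "open V" "locally_integrable_on V g" and lr: "cbox l r \<subseteq> V"
  shows "(\<lambda>k. LINT x:V|lborel. g x * box_bump (real (Suc k)) l r x) \<longlonglongrightarrow> (LINT x:box l r|lborel. g x)"
proof -
  have gi: "integrable lborel (\<lambda>x. indicator (cbox l r) x *\<^sub>R g x)"
    using assms compact_cbox unfolding locally_integrable_on_def set_integrable_def by blast
  then have gm: "(\<lambda>x. indicator (cbox l r) x *\<^sub>R g x) \<in> borel_measurable borel" by simp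
  have bm: "box_bump k l r \<in> borel_measurable borel" for k
    by (intro borel_measurable_continuous_onI smooth_on_continuous smooth_on_box_bump open_UNIV)
  have e: "indicator V x *\<^sub>R (g x * box_bump (real (Suc k)) l r x)
      = (indicator (cbox l r) x *\<^sub>R g x) * box_bump (real (Suc k)) l r x" for k x
    using box_bump_eq_0[of "real (Suc k)" x l r] box_subset_cbox[of l r] lr by (auto simp: indicator_def)
  have "(\<lambda>k. LINT x|lborel. (indicator (cbox l r) x *\<^sub>R g x) * box_bump (real (Suc k)) l r x)
      \<longlonglongrightarrow> (LINT x|lborel. indicator (box l r) x *\<^sub>R g x)"
  proof (rule integral_dominated_convergence[where w = "\<lambda>x. \<bar>indicator (cbox l r) x *\<^sub>R g x\<bar>"])
    show "integrable lborel (\<lambda>x. \<bar>indicator (cbox l r) x *\<^sub>R g x\<bar>)" using gi by (rule integrable_abs)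
    show "AE x in lborel. (\<lambda>k. (indicator (cbox l r) x *\<^sub>R g x) * box_bump (real (Suc k)) l r x)
        \<longlonglongrightarrow> indicator (box l r) x *\<^sub>R g x"
    proof (rule AE_I2)
      fix x
      have "(\<lambda>k. (indicator (cbox l r) x *\<^sub>R g x) * box_bump (real (Suc k)) l r x)
        \<longlonglongrightarrow> (indicator (cbox l r) x *\<^sub>R g x) * indicator (box l r) x"
        by (intro tendsto_mult tendsto_const box_bump_tendsto)
      moreover have "(indicator (cbox l r) x *\<^sub>R g x) * indicator (box l r) x = indicator (box l r) x *\<^sub>R g x"
        using box_subset_cbox[of l r] by (auto simp: indicator_def)
      ultimately show "(\<lambda>k. (indicator (cbox l r) x *\<^sub>R g x) * box_bump (real (Suc k)) l r x)
        \<longlonglongrightarrow> indicator (box l r) x *\<^sub>R g x" by (simp only:)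
    qed
    have "(\<lambda>x. indicator (box l r) x *\<^sub>R (indicator (cbox l r) x *\<^sub>R g x)) \<in> borel_measurable lborel"
      using gm by measurable
    moreover have "(\<lambda>x. indicator (box l r) x *\<^sub>R (indicator (cbox l r) x *\<^sub>R g x)) = (\<lambda>x. indicator (box l r) x *\<^sub>R g x)"
      using box_subset_cbox[of l r] by (intro ext) (auto simp: indicator_def)
    ultimately show "(\<lambda>x. indicator (box l r) x *\<^sub>R g x) \<in> borel_measurable lborel" by (simp only:)
    show "AE x in lborel. norm (indicat_real (cbox l r) x *\<^sub>R g x * box_bump (real (Suc k)) l r x)
        \<le> \<bar>indicat_real (cbox l r) x *\<^sub>R g x\<bar>" for k
      by (intro AE_I2) (simp add: abs_mult mult_left_le box_bump_le_1 box_bump_nonneg mult.assoc indicator_def)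
    show "(\<lambda>x. indicat_real (cbox l r) x *\<^sub>R g x * box_bump (real (Suc k)) l r x) \<in> borel_measurable lborel" for k
      using gm bm by simp
  qed
  then show ?thesis unfolding set_lebesgue_integral_def e .
qed

lemma subset_Pow_UNIV: "A \<subseteq> Pow UNIV" by simp

text \<open>From boxes, vanishing of the integral passes to all Borel sets by Dynkin's argument,
  since boxes are stable under intersection and generate the Borel sets. An integrable function with
  all these integrals zero vanishes almost everywhere.\<close>

lemma fundamental_lemma_calculus_of_variations:
  fixes g :: "'e::euclidean_space \<Rightarrow> real"
  assumes V: "open V" "locally_integrable_on V g"
    and z: "\<And>\<eta>. test_function V \<eta> \<Longrightarrow> (LINT x:V|lborel. g x * \<eta> x) = 0"
  shows "AE x in lborel. x \<in> V \<longrightarrow> g x = 0"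
proof -
  have box0: "(LINT x:box l r|lborel. g x) = 0" if "cbox l r \<subseteq> V" for l r
    using test_function_integral_tendsto[OF V that] z[OF test_function_box_bump[OF _ that]]
    by (simp add: LIMSEQ_const_iff)
  have cb: "AE x in lborel. x \<in> cbox a b \<longrightarrow> g x = 0" if ab: "cbox a b \<subseteq> V" for a b
  proof -
    \<comment> \<open>Cutting off to one box makes the function integrable on the whole space, so
      that complements and countable unions can be handled.\<close>
    define h where "h x = indicator (box a b) x *\<^sub>R g x" for x
    have "integrable lborel (\<lambda>x. indicator (cbox a b) x *\<^sub>R g x)"
      using V ab compact_cbox unfolding locally_integrable_on_def set_integrable_def by blast
    from integrable_mult_indicator[OF _ this, of "box a b"] have "integrable lborel (\<lambda>x. indicator (box a b) x *\<^sub>R (indicator (cbox a b) x *\<^sub>R g x))"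
      by simp
    moreover have "(\<lambda>x. indicator (box a b) x *\<^sub>R (indicator (cbox a b) x *\<^sub>R g x)) = h"
      using box_subset_cbox[of a b] by (intro ext) (auto simp: indicator_def h_def)
    ultimately have hi: "integrable lborel h" by (simp only:)
    have hA: "set_integrable lborel A h" if "A \<in> sets borel" for A
      unfolding set_integrable_def by (rule integrable_mult_indicator) (use that hi in auto)
    have hbox: "(LINT x:box l r|lborel. h x) = 0" for l r
    proof -
      obtain l' r' where lr: "box l r \<inter> box a b = box l' r'" using box_Int_box[of l r a b] by blast
      have e: "(LINT x:box l r|lborel. h x) = (LINT x:box l' r'|lborel. g x)"
        unfolding set_lebesgue_integral_def
        by (rule Bochner_Integration.integral_cong) (auto simp: lr[symmetric] h_def indicator_def)
      show ?thesis
      \<comment> \<open>An empty intersection may be presented with arbitrary corners. Only for a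
        nonempty box is the closed box its closure, and hence contained in
        \<open>cbox a b\<close>.\<close>
      proof (cases "box l' r' = {}")
        case False
        then have "cbox l' r' = closure (box l' r')" by (simp add: closure_box)
        also have "\<dots> \<subseteq> cbox a b" using lr box_subset_cbox[of a b] by (intro closure_minimal) auto
        finally show ?thesis using e box0 ab by simp
      qed (use e in \<open>simp add: set_lebesgue_integral_def\<close>)
    qed
    have Int: "Int_stable (range (\<lambda>(l, r). box l (r::'e)))"
      unfolding Int_stable_def by (auto simp: box_Int_box intro!: image_eqI[OF _ UNIV_I] split: prod.splits)
    have gen: "sigma_sets UNIV (range (\<lambda>(l, r). box l (r::'e))) = sets borel"
      by (simp add: borel_eq_box)
    have all0: "(LINT x:A|lborel. h x) = 0" if "A \<in> sets borel" for A
    proof -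
      have "A \<in> sigma_sets UNIV (range (\<lambda>(l, r). box l (r::'e)))" using that gen by simp
      then show ?thesis
      proof (induction rule: sigma_sets_induct_disjoint[OF Int subset_Pow_UNIV, consumes 1, case_names basic empty compl union])
        case (compl A)
        then have A: "A \<in> sets borel" using gen by simp
        have "(LINT x:UNIV|lborel. h x) = (LINT x:A|lborel. h x) + (LINT x:- A|lborel. h x)"
          using set_integral_Un[of A "- A" lborel h] hA A by (simp add: Compl_partition)
        moreover have "(LINT x:UNIV|lborel. h x) = (LINT x:box a b|lborel. h x)"
          unfolding set_lebesgue_integral_def
          by (rule Bochner_Integration.integral_cong) (auto simp: h_def indicator_def)
        ultimately show ?case using compl hbox by (simp add: Compl_eq_Diff_UNIV)
      next
        case (union A)
        then have A: "\<And>i. A i \<in> sets lborel" using gen by auto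
        have "(LINT x:(\<Union>i. A i)|lborel. h x) = (\<Sum>i. LINT x:A i|lborel. h x)"
          using union A by (intro lebesgue_integral_countable_add hA) (auto simp: disjoint_family_on_def)
        then show ?case using union by simp
      qed (use hbox in \<open>auto simp: set_lebesgue_integral_def\<close>)
    qed
    have "AE x in lborel. h x = 0"
      by (rule sigma_finite_measure.density_zero[OF sigma_finite_lborel hi]) (use all0 in simp)
    then show ?thesis using AE_cbox_imp_box[of a b] by eventually_elim (auto simp: h_def)
  qed
  \<comment> \<open>\<open>V\<close> is a union of countably many closed boxes, so their exceptional
    null sets combine to a null set.\<close>
  obtain D where D: "countable D" "D \<subseteq> Pow V" "\<And>X. X \<in> D \<Longrightarrow> \<exists>a b. X = cbox a b" "\<Union>D = V"
    using open_countable_Union_open_cbox[OF V(1)] by metis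
  have "AE x in lborel. \<forall>X\<in>D. x \<in> X \<longrightarrow> g x = 0"
    unfolding AE_ball_countable[OF D(1)] using cb D(2,3) by (metis Pow_iff subsetD)
  then show ?thesis using D(4) by (elim eventually_mono) auto
qed

section \<open>Contraction with an inner product\<close>

definition inner_form :: "('e::euclidean_space \<Rightarrow> 'e \<Rightarrow> real) \<Rightarrow> bool" where
  "inner_form g \<longleftrightarrow> bilinear g \<and> (\<forall>v w. g v w = g w v) \<and> (\<forall>v. v \<noteq> 0 \<longrightarrow> g v v > 0)"

text \<open>\<open>cometric M i x\<close> is \<open>inverse_form (metric M i x)\<close>; detached
  from charts, the linear algebra is done for a single bilinear form.\<close>

definition inverse_form :: "('e::euclidean_space \<Rightarrow> 'e \<Rightarrow> real) \<Rightarrow> 'e \<Rightarrow> 'e \<Rightarrow> real" where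
  "inverse_form g b c = inv (\<lambda>v. \<Sum>d\<in>Basis. g v d *\<^sub>R d) b \<bullet> c"

text \<open>The trace of \<open>B\<close> with respect to \<open>g\<close>. For the Ricci form it is
  the scalar curvature, for \<open>\<lambda>v w. \<omega> v * \<theta> w\<close> the inner product
  of two covectors.\<close>

definition contract :: "('e::euclidean_space \<Rightarrow> 'e \<Rightarrow> real) \<Rightarrow> ('e \<Rightarrow> 'e \<Rightarrow> real) \<Rightarrow> real" where
  "contract g B = (\<Sum>b\<in>Basis. \<Sum>c\<in>Basis. inverse_form g b c * B b c)"

lemma inner_formD:
  assumes "inner_form g"
  shows "bilinear g" "g v w = g w v" "v \<noteq> 0 \<Longrightarrow> g v v > 0" "g v v \<ge> 0"
    "linear (g v)" "linear (\<lambda>v. g v w)"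
  using assms bilinear_lzero[of g 0] unfolding inner_form_def bilinear_def
  by (auto, metis less_eq_real_def linear_0)

text \<open>\<open>K\<close> raises indices. Positivity makes the lowering map \<open>G\<close>
  injective, hence bijective in finite dimension, so that the \<open>inv\<close> in
  \<open>inverse_form\<close> is a genuine inverse.\<close>

lemma inner_form_sharp:
  fixes g :: "'e::euclidean_space \<Rightarrow> 'e \<Rightarrow> real"
  assumes "inner_form g"
  obtains K where "linear K" "\<And>\<xi> w. g (K \<xi>) w = \<xi> \<bullet> w" "\<And>b c. inverse_form g b c = K b \<bullet> c"
proof -
  define G where "G v = (\<Sum>d\<in>Basis. g v d *\<^sub>R d)" for v
  have Gi: "G v \<bullet> w = g v w" for v w
  proof -
    have "G v \<bullet> w = (\<Sum>d\<in>Basis. (w \<bullet> d) * g v d)"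
      by (simp add: G_def inner_sum_left inner_sum_right inner_commute mult.commute)
    also have "\<dots> = g v w" using linear_basis_expand[OF inner_formD(5)[OF assms], of v w] by simp
    finally show ?thesis .
  qed
  have lG: "linear G"
    by (rule linearI) (simp_all add: G_def linear_add[OF inner_formD(6)[OF assms]]
      linear_cmul[OF inner_formD(6)[OF assms]] scaleR_left_distrib sum.distrib scaleR_sum_right)
  have "inj G"
  proof (rule linear_injective_0[OF lG, THEN iffD2], intro allI impI)
    fix v assume "G v = 0"
    then have "g v v = 0" using Gi[of v v] by simp
    then show "v = 0" using inner_formD(3)[OF assms, of v] by fastforce
  qed
  then have bG: "bij G" using lG linear_injective_imp_surjective by (auto simp: bij_def)
  have lK: "linear (inv G)"
    using \<open>inj G\<close> lG bG by (metis bij_betw_def inj_linear_imp_inv_linear)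
  have GK: "G (inv G \<xi>) = \<xi>" for \<xi> using bG by (simp add: bij_is_surj surj_f_inv_f)
  show thesis
  proof (rule that[OF lK])
    show "g (inv G \<xi>) w = \<xi> \<bullet> w" for \<xi> w using Gi[of "inv G \<xi>" w] GK by simp
    show "inverse_form g b c = inv G b \<bullet> c" for b c by (simp add: inverse_form_def G_def[abs_def])
  qed
qed

lemma contract_sharp:
  assumes "\<And>b c. inverse_form g b c = K b \<bullet> c" "\<And>b. linear (B b)"
  shows "contract g B = (\<Sum>b\<in>Basis. B b (K b))"
  unfolding contract_def
proof (rule sum.cong[OF refl])
  fix b
  show "(\<Sum>c\<in>Basis. inverse_form g b c * B b c) = B b (K b)"
    using linear_basis_expand[OF assms(2), of b "K b"] by (simp add: assms(1))
qed

lemma inner_form_eqI: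
  assumes "inner_form g" "\<And>w. g v w = g v' w" shows "v = v'"
proof -
  have "g (v - v') (v - v') = 0"
    using assms(2) linear_diff[OF inner_formD(6)[OF assms(1)]] by simp
  then show ?thesis using inner_formD(3)[OF assms(1), of "v - v'"] by auto
qed

text \<open>The index raising maps satisfy \<open>K' \<xi> = P (K (adjoint P \<xi>))\<close>; moving
  the adjoint across the sum over \<open>Basis\<close> turns the trace for \<open>g'\<close> into
  the one for \<open>g\<close>. Chart independence of scalar curvature and of norms of forms comes
  from here.\<close>

lemma contract_pullback:
  fixes g g' :: "'e::euclidean_space \<Rightarrow> 'e \<Rightarrow> real"
  assumes g: "inner_form g" "inner_form g'" and P: "linear P" "surj P"
    and gP: "\<And>v w. g v w = g' (P v) (P w)" and BP: "\<And>v w. B v w = B' (P v) (P w)" and B': "bilinear B'"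
  shows "contract g B = contract g' B'"
proof -
  obtain K where K: "linear K" "\<And>\<xi> w. g (K \<xi>) w = \<xi> \<bullet> w" "\<And>b c. inverse_form g b c = K b \<bullet> c"
    by (rule inner_form_sharp[OF g(1)]) (rule that; assumption)
  obtain K' where K': "linear K'" "\<And>\<xi> w. g' (K' \<xi>) w = \<xi> \<bullet> w" "\<And>b c. inverse_form g' b c = K' b \<bullet> c"
    by (rule inner_form_sharp[OF g(2)]) (rule that; assumption)
  have lB1: "linear (B' v)" for v using B' by (simp add: bilinear_def)
  have lB2: "linear (\<lambda>v. B' v w)" for w using B' by (simp add: bilinear_def)
  have lB: "linear (B v)" for v using linear_compose[OF P(1) lB1, of "P v"] by (simp add: BP[abs_def] o_def)
  have K'e: "K' \<xi> = P (K (adjoint P \<xi>))" for \<xi>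
  proof (rule inner_form_eqI[OF g(2)])
    fix w
    obtain w' where w: "w = P w'" using P(2) by (metis surjD)
    have "g' (P (K (adjoint P \<xi>))) w = adjoint P \<xi> \<bullet> w'" using gP K(2) w by metis
    then show "g' (K' \<xi>) w = g' (P (K (adjoint P \<xi>))) w"
      by (simp add: K'(2) w adjoint_works[OF P(1)] inner_commute)
  qed
  have "contract g' B' = (\<Sum>a\<in>Basis. B' a (P (K (adjoint P a))))"
    using contract_sharp[OF K'(3) lB1] K'e by simp
  also have "\<dots> = (\<Sum>a\<in>Basis. \<Sum>c\<in>Basis. (a \<bullet> P c) * B' a (P (K c)))"
  proof (rule sum.cong[OF refl])
    fix a :: 'e
    have "linear (\<lambda>v. B' a (P (K v)))"
      using linear_compose[OF linear_compose[OF K(1) P(1)] lB1[of a]] by (simp add: o_def)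
    from linear_basis_expand[OF this, of "adjoint P a"]
    show "B' a (P (K (adjoint P a))) = (\<Sum>c\<in>Basis. (a \<bullet> P c) * B' a (P (K c)))"
      by (simp add: adjoint_works[OF P(1)] inner_commute)
  qed
  also have "\<dots> = (\<Sum>c\<in>Basis. \<Sum>a\<in>Basis. (P c \<bullet> a) * B' a (P (K c)))"
    by (subst sum.swap) (simp add: inner_commute)
  also have "\<dots> = (\<Sum>c\<in>Basis. B' (P c) (P (K c)))"
    using linear_basis_expand[OF lB2, symmetric] by simp
  also have "\<dots> = contract g B" using contract_sharp[OF K(3) lB] BP by simp
  finally show ?thesis by simp
qed

text \<open>Invariance of the trace under conjugation, written without matrices; the Ricci form is
  such a trace of the curvature operator.\<close>

lemma trace_conjugate:
  fixes T T' P :: "'e::euclidean_space \<Rightarrow> 'e"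
  assumes "linear P" "bij P" "linear T" "\<And>x. T' (P x) = P (T x)"
  shows "(\<Sum>k\<in>Basis. k \<bullet> T' k) = (\<Sum>k\<in>Basis. k \<bullet> T k)"
proof -
  define Q where "Q = inv P"
  have lQ: "linear Q" unfolding Q_def using assms(1,2) by (metis bij_betw_def inj_linear_imp_inv_linear)
  have QP: "Q (P x) = x" "P (Q x) = x" for x
    using assms(2) by (simp_all add: Q_def bij_is_inj bij_is_surj surj_f_inv_f)
  have l: "linear (\<lambda>x. P (T x))" using linear_compose[OF assms(3,1)] by (simp add: o_def)
  have "(\<Sum>k\<in>Basis. k \<bullet> T' k) = (\<Sum>k\<in>Basis. k \<bullet> P (T (Q k)))"
    using assms(4)[of "Q _"] by (simp add: QP)
  also have "\<dots> = (\<Sum>k\<in>Basis. \<Sum>c\<in>Basis. (Q k \<bullet> c) * (k \<bullet> P (T c)))"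
    by (intro sum.cong refl, subst linear_basis_expand[OF l]) (simp add: inner_sum_right)
  also have "\<dots> = (\<Sum>c\<in>Basis. (\<Sum>k\<in>Basis. (P (T c) \<bullet> k) *\<^sub>R Q k) \<bullet> c)"
    by (subst sum.swap) (simp add: inner_sum_left inner_sum_right inner_commute mult.commute)
  also have "\<dots> = (\<Sum>c\<in>Basis. Q (P (T c)) \<bullet> c)"
    using linear_basis_expand[OF lQ, symmetric] by simp
  also have "\<dots> = (\<Sum>k\<in>Basis. k \<bullet> T k)" by (simp add: QP inner_commute)
  finally show ?thesis .
qed

text \<open>With \<open>y\<close> the vector dual to \<omega>, the contraction equals
  \<open>g y y\<close>; the second claim is then the Cauchy-Schwarz inequality for
  \<open>g\<close>.\<close>

lemma contract_nonneg:
  assumes "inner_form g" "linear \<omega>"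
  shows "0 \<le> contract g (\<lambda>v w. \<omega> v * \<omega> w)"
    and "(\<omega> v)\<^sup>2 \<le> g v v * contract g (\<lambda>v w. \<omega> v * \<omega> w)"
proof -
  obtain K where K: "linear K" "\<And>\<xi> w. g (K \<xi>) w = \<xi> \<bullet> w" "\<And>b c. inverse_form g b c = K b \<bullet> c"
    by (rule inner_form_sharp[OF assms(1)]) (rule that; assumption)
  define \<xi> where "\<xi> = (\<Sum>b\<in>Basis. \<omega> b *\<^sub>R b)"
  define y where "y = K \<xi>"
  have w: "\<omega> v = g y v" for v
    using linear_basis_expand[OF assms(2), of v]
    by (simp add: y_def K(2) \<xi>_def inner_sum_left inner_sum_right inner_commute mult.commute)
  have "contract g (\<lambda>v w. \<omega> v * \<omega> w) = (\<Sum>b\<in>Basis. \<omega> b * \<omega> (K b))"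
    by (rule contract_sharp[OF K(3)]) (use assms(2) linear_compose_scale_right[of \<omega>] in simp)
  also have "\<dots> = \<omega> y"
    unfolding y_def \<xi>_def by (simp add: linear_sum[OF K(1)] linear_cmul[OF K(1)] linear_sum[OF assms(2)] linear_cmul[OF assms(2)])
  finally have c: "contract g (\<lambda>v w. \<omega> v * \<omega> w) = g y y" using w by simp
  show "0 \<le> contract g (\<lambda>v w. \<omega> v * \<omega> w)" using c inner_formD(4)[OF assms(1)] by simp
  show "(\<omega> v)\<^sup>2 \<le> g v v * contract g (\<lambda>v w. \<omega> v * \<omega> w)"
  proof (cases "y = 0")
    case True
    then show ?thesis using w linear_0[OF inner_formD(6)[OF assms(1)]] inner_formD(4)[OF assms(1), of v] c by simp
  next
    case False
    then have yy: "g y y > 0" using inner_formD(3)[OF assms(1)] by simp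
    \<comment> \<open>The coefficient for which \<open>t *\<^sub>R y\<close> is closest to
      \<open>v\<close> in the norm of \<open>g\<close>.\<close>
    define t where "t = g y v / g y y"
    have "0 \<le> g (v - t *\<^sub>R y) (v - t *\<^sub>R y)" using inner_formD(4)[OF assms(1)] .
    also have "\<dots> = g v v - 2 * t * g y v + t * t * g y y"
      using inner_formD(2)[OF assms(1), of v y]
      by (simp add: linear_diff[OF inner_formD(5)[OF assms(1)]] linear_diff[OF inner_formD(6)[OF assms(1)]]
        linear_cmul[OF inner_formD(5)[OF assms(1)]] linear_cmul[OF inner_formD(6)[OF assms(1)]] algebra_simps)
    also have "\<dots> = g v v - (g y v)\<^sup>2 / g y y"
      using yy by (simp add: t_def power2_eq_square field_simps)
    finally show ?thesis using yy c w by (simp add: field_simps)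
  qed
qed

section \<open>Charts\<close>

lemma overlap_subset: "overlap M i j \<subseteq> chart_img M i"
  by (auto simp: overlap_def chart_img_def)

context
  fixes M :: "('i, 'a::{t2_space,second_countable_topology}, 'e::euclidean_space) riem"
  assumes M: "riemannian_manifold M"
begin

lemma chart_homeomorphism: "i \<in> idx M \<Longrightarrow> homeomorphism (chart_dom M i) (chart_img M i) (chart M i) (param M i)"
  and open_chart_dom: "i \<in> idx M \<Longrightarrow> open (chart_dom M i)"
  and open_chart_img: "i \<in> idx M \<Longrightarrow> open (chart_img M i)"
  and smooth_transition: "i \<in> idx M \<Longrightarrow> j \<in> idx M \<Longrightarrow> smooth_on (overlap M i j) (transition M i j)"
  and smooth_metric: "i \<in> idx M \<Longrightarrow> smooth_on (chart_img M i) (\<lambda>x. metric M i x v w)"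
  and metric_transition: "i \<in> idx M \<Longrightarrow> j \<in> idx M \<Longrightarrow> x \<in> overlap M i j \<Longrightarrow>
    metric M i x v w = metric M j (transition M i j x) (pd v (transition M i j) x) (pd w (transition M i j) x)"
  using M unfolding riemannian_manifold_def by metis+

lemma inner_form_metric: "i \<in> idx M \<Longrightarrow> x \<in> chart_img M i \<Longrightarrow> inner_form (metric M i x)"
  using M unfolding riemannian_manifold_def inner_form_def by metis

lemma chart_at: "chart_at M p \<in> idx M" "p \<in> chart_dom M (chart_at M p)"
proof -
  have "\<exists>i. i \<in> idx M \<and> p \<in> chart_dom M i"
    using M unfolding riemannian_manifold_def by blast
  from someI_ex[OF this] show "chart_at M p \<in> idx M" "p \<in> chart_dom M (chart_at M p)"
    unfolding chart_at_def by auto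
qed

lemma chart_in_img: "p \<in> chart_dom M i \<Longrightarrow> chart M i p \<in> chart_img M i"
  by (simp add: chart_img_def)

lemma param_chart: "i \<in> idx M \<Longrightarrow> p \<in> chart_dom M i \<Longrightarrow> param M i (chart M i p) = p"
  using chart_homeomorphism by (simp add: homeomorphism_def)

lemma chart_param: "i \<in> idx M \<Longrightarrow> x \<in> chart_img M i \<Longrightarrow> chart M i (param M i x) = x"
  using chart_homeomorphism by (simp add: homeomorphism_def)

lemma param_in_dom: "i \<in> idx M \<Longrightarrow> x \<in> chart_img M i \<Longrightarrow> param M i x \<in> chart_dom M i"
  using chart_homeomorphism by (auto simp: homeomorphism_def)

lemma continuous_on_chart: "i \<in> idx M \<Longrightarrow> continuous_on (chart_dom M i) (chart M i)"
  and continuous_on_param: "i \<in> idx M \<Longrightarrow> continuous_on (chart_img M i) (param M i)"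
  using chart_homeomorphism by (simp_all add: homeomorphism_def)

lemma open_chart_image: "i \<in> idx M \<Longrightarrow> open U \<Longrightarrow> U \<subseteq> chart_dom M i \<Longrightarrow> open (chart M i ` U)"
  using homeomorphism_imp_open_map[OF chart_homeomorphism, of i U] open_chart_dom[of i] open_chart_img[of i]
  by (simp add: openin_open_eq)

lemma open_overlap: "i \<in> idx M \<Longrightarrow> j \<in> idx M \<Longrightarrow> open (overlap M i j)"
  unfolding overlap_def by (intro open_chart_image open_Int open_chart_dom) auto

lemma overlap_iff: "i \<in> idx M \<Longrightarrow> x \<in> overlap M i j \<longleftrightarrow> x \<in> chart_img M i \<and> param M i x \<in> chart_dom M j"
  using param_chart[of i] chart_param[of i x] by (auto simp: overlap_def chart_img_def intro: rev_image_eqI)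

lemma transition_overlap: "i \<in> idx M \<Longrightarrow> j \<in> idx M \<Longrightarrow> x \<in> overlap M i j \<Longrightarrow> transition M i j x \<in> overlap M j i"
  using param_in_dom by (auto simp: overlap_iff transition_def param_chart chart_in_img)

lemma transition_img: "i \<in> idx M \<Longrightarrow> j \<in> idx M \<Longrightarrow> x \<in> overlap M i j \<Longrightarrow> transition M i j x \<in> chart_img M j"
  by (rule subsetD[OF overlap_subset transition_overlap])

lemma param_transition: "i \<in> idx M \<Longrightarrow> j \<in> idx M \<Longrightarrow> x \<in> overlap M i j \<Longrightarrow> param M j (transition M i j x) = param M i x"
  by (auto simp: overlap_iff transition_def param_chart)

lemma transition_inverse: "i \<in> idx M \<Longrightarrow> j \<in> idx M \<Longrightarrow> x \<in> overlap M i j \<Longrightarrow> transition M j i (transition M i j x) = x"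
  using param_transition[of i j x] by (auto simp: overlap_iff transition_def chart_param)

lemma transition_chart: "i \<in> idx M \<Longrightarrow> p \<in> chart_dom M i \<Longrightarrow> transition M i j (chart M i p) = chart M j p"
  by (simp add: transition_def param_chart)

lemma transition_has_derivative:
  "i \<in> idx M \<Longrightarrow> j \<in> idx M \<Longrightarrow> x \<in> overlap M i j \<Longrightarrow>
    (transition M i j has_derivative frechet_derivative (transition M i j) (at x)) (at x)"
  using smooth_on_differentiable[OF smooth_transition] frechet_derivative_works by blast

lemma linear_pd_transition:
  "i \<in> idx M \<Longrightarrow> j \<in> idx M \<Longrightarrow> x \<in> overlap M i j \<Longrightarrow> linear (\<lambda>v. pd v (transition M i j) x)"
  by (rule linear_pd[OF smooth_on_differentiable[OF smooth_transition]])

text \<open>Chain rule for two mutually inverse transition maps; it makes the derivative of a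
  transition map a linear isomorphism.\<close>

lemma pd_transition_inverse:
  assumes "i \<in> idx M" "j \<in> idx M" "x \<in> overlap M i j"
  shows "pd (pd v (transition M i j) x) (transition M j i) (transition M i j x) = v"
proof -
  have "((\<lambda>y. transition M j i (transition M i j y)) has_derivative
      (\<lambda>v. pd (pd v (transition M i j) x) (transition M j i) (transition M i j x))) (at x)"
    using has_derivative_compose[OF transition_has_derivative[OF assms]
      transition_has_derivative[OF assms(2,1) transition_overlap[OF assms]]] .
  moreover have "((\<lambda>y. transition M j i (transition M i j y)) has_derivative (\<lambda>v. v)) (at x)"
    using has_derivative_transform_within_open[OF has_derivative_ident open_overlap[OF assms(1,2)] assms(3)]
      transition_inverse[OF assms(1,2)] by metis
  ultimately show ?thesis using has_derivative_unique by metis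
qed

lemma bij_pd_transition:
  assumes "i \<in> idx M" "j \<in> idx M" "x \<in> overlap M i j"
  shows "bij (\<lambda>v. pd v (transition M i j) x)"
  using pd_transition_inverse[OF assms]
    pd_transition_inverse[OF assms(2,1) transition_overlap[OF assms], unfolded transition_inverse[OF assms]]
  by (intro o_bij[where g="\<lambda>v. pd v (transition M j i) (transition M i j x)"]) auto

lemma smooth_function_transition:
  assumes "smooth_function M f" "i \<in> idx M" "j \<in> idx M" "x \<in> overlap M i j"
  shows "pd v (f \<circ> param M i) x = pd (pd v (transition M i j) x) (f \<circ> param M j) (transition M i j x)"
proof -
  have d: "(f \<circ> param M j) differentiable (at (transition M i j x))"
    using assms transition_img by (metis smooth_function_def smooth_on_differentiable)
  have *: "((\<lambda>y. (f \<circ> param M j) (transition M i j y)) has_derivative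
      (\<lambda>v. pd (pd v (transition M i j) x) (f \<circ> param M j) (transition M i j x))) (at x)"
    by (rule has_derivative_frechet_compose[OF transition_has_derivative[OF assms(2-4)] d])
  have "frechet_derivative (f \<circ> param M i) (at x)
      = frechet_derivative (\<lambda>y. (f \<circ> param M j) (transition M i j y)) (at x)"
    by (rule frechet_derivative_cong_open[OF open_overlap[OF assms(2,3)] assms(4)])
       (simp add: param_transition[OF assms(2,3)])
  then show ?thesis using frechet_derivative_eq[OF *] by simp
qed

end

section \<open>Invariance of the scalar curvature\<close>

text \<open>A product rule in which the linear map varies with the point. Only derivatives of
  \<open>\<lambda>y. F y v\<close> for fixed \<open>v\<close> are given, so the moving argument
  \<open>p x\<close> is expanded in \<open>Basis\<close>.\<close>

lemma has_derivative_linear_family: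
  fixes F :: "'e::euclidean_space \<Rightarrow> 'g::euclidean_space \<Rightarrow> 'f::euclidean_space"
    and \<phi> :: "'h::euclidean_space \<Rightarrow> 'e"
  assumes U: "open U" "x \<in> U" and W: "open W" "\<phi> ` U \<subseteq> W"
    and lin: "\<And>y. y \<in> W \<Longrightarrow> linear (F y)" and diff: "\<And>v. (\<lambda>y. F y v) differentiable (at (\<phi> x))"
    and \<phi>': "(\<phi> has_derivative \<phi>') (at x)" and p': "(p has_derivative p') (at x)"
  shows "((\<lambda>x. F (\<phi> x) (p x)) has_derivative
    (\<lambda>h. pd (\<phi>' h) (\<lambda>y. F y (p x)) (\<phi> x) + F (\<phi> x) (p' h))) (at x)"
proof -
  have xW: "\<phi> x \<in> W" using U W by auto
  have "((\<lambda>y. \<Sum>b\<in>Basis. (p y \<bullet> b) *\<^sub>R F (\<phi> y) b) has_derivative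
      (\<lambda>h. \<Sum>b\<in>Basis. (p x \<bullet> b) *\<^sub>R pd (\<phi>' h) (\<lambda>y. F y b) (\<phi> x) + (p' h \<bullet> b) *\<^sub>R F (\<phi> x) b)) (at x)"
    by (intro has_derivative_sum has_derivative_scaleR has_derivative_frechet_compose[OF \<phi>' diff]
        bounded_linear.has_derivative[OF bounded_linear_inner_left p'])
  moreover have "pd h (\<lambda>y. F y (p x)) (\<phi> x) = (\<Sum>b\<in>Basis. (p x \<bullet> b) *\<^sub>R pd h (\<lambda>y. F y b) (\<phi> x))" for h
  proof -
    have *: "((\<lambda>y. \<Sum>b\<in>Basis. (p x \<bullet> b) *\<^sub>R F y b) has_derivative
      (\<lambda>h. \<Sum>b\<in>Basis. (p x \<bullet> b) *\<^sub>R pd h (\<lambda>y. F y b) (\<phi> x))) (at (\<phi> x))"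
      by (intro has_derivative_sum has_derivative_scaleR_right frechet_derivative_works[THEN iffD1] diff)
    have "frechet_derivative (\<lambda>y. F y (p x)) (at (\<phi> x))
        = frechet_derivative (\<lambda>y. \<Sum>b\<in>Basis. (p x \<bullet> b) *\<^sub>R F y b) (at (\<phi> x))"
      by (rule frechet_derivative_cong_open[OF W(1) xW]) (rule linear_basis_expand[OF lin])
    then show ?thesis using frechet_derivative_eq[OF *] by simp
  qed
  ultimately have "((\<lambda>y. \<Sum>b\<in>Basis. (p y \<bullet> b) *\<^sub>R F (\<phi> y) b) has_derivative
      (\<lambda>h. pd (\<phi>' h) (\<lambda>y. F y (p x)) (\<phi> x) + F (\<phi> x) (p' h))) (at x)"
    using linear_basis_expand[OF lin[OF xW], of "p' _", symmetric] by (simp add: sum.distrib)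
  moreover have "(\<Sum>b\<in>Basis. (p y \<bullet> b) *\<^sub>R F (\<phi> y) b) = F (\<phi> y) (p y)" if "y \<in> U" for y
    using linear_basis_expand[OF lin, of "\<phi> y" "p y"] that W(2) by auto
  ultimately show ?thesis by (rule has_derivative_transform_within_open[OF _ U])
qed

lemma has_derivative_bilinear_family:
  fixes F :: "'e::euclidean_space \<Rightarrow> 'g::euclidean_space \<Rightarrow> 'k::euclidean_space \<Rightarrow> 'f::euclidean_space"
    and \<phi> :: "'h::euclidean_space \<Rightarrow> 'e"
  assumes U: "open U" "x \<in> U" and W: "open W" "\<phi> ` U \<subseteq> W"
    and bil: "\<And>y. y \<in> W \<Longrightarrow> bilinear (F y)" and diff: "\<And>v w. (\<lambda>y. F y v w) differentiable (at (\<phi> x))"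
    and \<phi>': "(\<phi> has_derivative \<phi>') (at x)" and p': "(p has_derivative p') (at x)" and q': "(q has_derivative q') (at x)"
  shows "((\<lambda>x. F (\<phi> x) (p x) (q x)) has_derivative
    (\<lambda>h. pd (\<phi>' h) (\<lambda>y. F y (p x) (q x)) (\<phi> x) + F (\<phi> x) (p' h) (q x) + F (\<phi> x) (p x) (q' h))) (at x)"
proof -
  have lin1: "linear (\<lambda>v. F y v w)" "linear (F y v)" if "y \<in> W" for y v w
    using bil[OF that] by (auto simp: bilinear_def)
  have *: "((\<lambda>x. F (\<phi> x) (p x) w) has_derivative
      (\<lambda>h. pd (\<phi>' h) (\<lambda>y. F y (p x) w) (\<phi> x) + F (\<phi> x) (p' h) w)) (at x)" for w
    by (rule has_derivative_linear_family[OF U W lin1(1) diff \<phi>' p'])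
  have diff': "(\<lambda>y. F (\<phi> y) (p y) w) differentiable (at (id x))" for w
    using * by (auto simp: differentiable_def)
  \<comment> \<open>The second argument is varied by the linear case again, now with the family
    \<open>\<lambda>y. F (\<phi> y) (p y)\<close> and the identity as base map.\<close>
  have "((\<lambda>y. F (\<phi> (id y)) (p (id y)) (q y)) has_derivative
      (\<lambda>h. pd h (\<lambda>y. F (\<phi> y) (p y) (q x)) (id x) + F (\<phi> (id x)) (p (id x)) (q' h))) (at x)"
  proof (rule has_derivative_linear_family[where F="\<lambda>y. F (\<phi> y) (p y)" and \<phi>'="\<lambda>h. h", OF U U(1)])
    show "linear (F (\<phi> y) (p y))" if "y \<in> U" for y using lin1(2) W(2) that by auto
    show "(id has_derivative (\<lambda>h. h)) (at x)" unfolding id_def by (rule has_derivative_ident)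
  qed (use diff' q' in auto)
  then show ?thesis using frechet_derivative_eq[OF *] by simp
qed

text \<open>Cramer's rule: the entries of the inverse are quotients of determinants.\<close>

lemma smooth_cometric:
  fixes M :: "('i, 'a::{t2_space,second_countable_topology}, real ^ 'm::finite) riem"
  assumes M: "riemannian_manifold M" and i: "i \<in> idx M"
  shows "smooth_on (chart_img M i) (\<lambda>x. cometric M i x b c)"
proof -
  let ?V = "chart_img M i"
  have V: "open ?V" by (rule open_chart_img[OF M i])
  \<comment> \<open>The entries are placed so that \<open>A x *v y\<close> is the covector of
    \<open>y\<close> under the metric; \<open>B k\<close> is \<open>A\<close> with column
    \<open>k\<close> replaced by \<open>b\<close>, as in Cramer's rule.\<close>
  define A :: "real^'m \<Rightarrow> real^'m^'m" where "A x = (\<chi> r j. metric M i x (axis j 1) (axis r 1))" for x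
  define B :: "'m \<Rightarrow> real^'m \<Rightarrow> real^'m^'m" where "B k x = (\<chi> r j. if j = k then b $ r else A x $ r $ j)" for k x
  have Am: "A x *v y = (\<Sum>d\<in>Basis. metric M i x y d *\<^sub>R d)" if "x \<in> ?V" for x y
  proof -
    have lin: "linear (\<lambda>v. metric M i x v w)" for w
      using inner_formD(6)[OF inner_form_metric[OF M i that]] .
    have "(A x *v y) $ r = metric M i x y (axis r 1)" for r
    proof -
      have "metric M i x y (axis r 1) = (\<Sum>d\<in>(Basis::(real^'m) set). (y \<bullet> d) * metric M i x d (axis r 1))"
        using linear_basis_expand[OF lin, of y "axis r 1"] by simp
      also have "\<dots> = (\<Sum>j\<in>UNIV. y $ j * metric M i x (axis j 1) (axis r 1))"
        by (simp add: Basis_vec_def sum.UNION_disjoint axis_eq_axis inner_axis sum.reindex image_image inj_on_def)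
      finally show ?thesis by (simp add: A_def matrix_vector_mult_def mult.commute)
    qed
    moreover have "(\<Sum>d\<in>Basis. metric M i x y d *\<^sub>R d) $ r = metric M i x y (axis r 1)" for r
    proof -
      have "(\<Sum>d\<in>Basis. metric M i x y d *\<^sub>R d) $ r = (\<Sum>d\<in>Basis. metric M i x y d *\<^sub>R d) \<bullet> axis r 1"
        by (simp add: inner_axis)
      also have "\<dots> = metric M i x y (axis r 1)"
        by (rule inner_sum_left_Basis) auto
      finally show ?thesis .
    qed
    ultimately show ?thesis by (simp add: vec_eq_iff)
  qed
  have det: "det (A x) \<noteq> 0" if "x \<in> ?V" for x
  proof -
    note g = inner_form_metric[OF M i that]
    have "A x *v y = 0 \<Longrightarrow> y = 0" for y
    proof -
      assume "A x *v y = 0"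
      then have "(\<Sum>d\<in>Basis. metric M i x y d *\<^sub>R d) \<bullet> y = 0" using Am[OF that] by simp
      moreover have "(\<Sum>d\<in>Basis. metric M i x y d *\<^sub>R d) \<bullet> y = metric M i x y y"
        using linear_basis_expand[OF inner_formD(5)[OF g], of y y]
        by (simp add: inner_sum_left inner_sum_right inner_commute mult.commute)
      ultimately show "y = 0" using inner_formD(3)[OF g] by fastforce
    qed
    then show ?thesis
      using matrix_left_invertible_ker[of "A x"] invertible_det_nz[of "A x"] invertible_left_inverse by blast
  qed
  have eq: "cometric M i x b c = (\<chi> k. det (B k x) / det (A x)) \<bullet> c" if x: "x \<in> ?V" for x
  proof -
    note g = inner_form_metric[OF M i x]
    obtain K where K: "linear K" "\<And>\<xi> w. metric M i x (K \<xi>) w = \<xi> \<bullet> w" "\<And>b c. inverse_form (metric M i x) b c = K b \<bullet> c"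
      by (rule inner_form_sharp[OF g]) (rule that; assumption)
    have "A x *v K b = b" using Am[OF x] K(2) by (simp add: euclidean_representation)
    then have "K b = (\<chi> k. det (B k x) / det (A x))"
      using cramer[OF det[OF x], of "K b" b] by (simp add: B_def)
    then show ?thesis using K(3) by (simp add: cometric_def inverse_form_def)
  qed
  have entry: "Ck_on k (\<lambda>x. A x $ r $ j) ?V" for k r j
    using smooth_onD[OF smooth_metric[OF M i]] by (simp add: A_def)
  have Bentry: "Ck_on k (\<lambda>x. B l x $ r $ j) ?V" for k l r j
    using entry by (cases "j = l") (simp_all add: B_def)
  have detC: "Ck_on k (\<lambda>x. det (D x)) ?V" if "\<And>r j. Ck_on k (\<lambda>x. D x $ r $ j) ?V" for k and D :: "real^'m \<Rightarrow> real^'m^'m"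
    unfolding det_def by (intro Ck_on_sum Ck_on_mult Ck_on_const Ck_on_prod V that)
  have "Ck_on k (\<lambda>x. (\<chi> k. det (B k x) / det (A x)) \<bullet> c) ?V" for k
    unfolding inner_vec_def inner_real_def vec_lambda_beta
    by (intro Ck_on_sum Ck_on_mult Ck_on_divide Ck_on_const V detC entry Bentry det)
  then show ?thesis
    unfolding smooth_on_def using eq
    by (subst Ck_on_cong[OF V, where g="\<lambda>x. (\<chi> k. det (B k x) / det (A x)) \<bullet> c"]) auto
qed

section \<open>Christoffel symbols and the curvature tensor\<close>

lemma smooth_christoffel:
  fixes M :: "('i, 'a::{t2_space,second_countable_topology}, real ^ 'm::finite) riem"
  assumes M: "riemannian_manifold M" and i: "i \<in> idx M"
  shows "smooth_on (chart_img M i) (christoffel M i k a b)"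
  unfolding smooth_on_def christoffel_def[abs_def]
  by (intro allI Ck_on_mult Ck_on_const Ck_on_sum Ck_on_diff Ck_on_add open_chart_img[OF M i]
      smooth_onD[OF smooth_cometric[OF M i]] smooth_onD[OF smooth_on_pd[OF smooth_metric[OF M i]]])

text \<open>The symbols with the upper index assembled into a vector: at each point a symmetric
  bilinear map, whose transformation laws can be stated without indices.\<close>

definition christoffel_vec ::
  "('i, 'a, 'e::euclidean_space) riem \<Rightarrow> 'i \<Rightarrow> 'e \<Rightarrow> 'e \<Rightarrow> 'e \<Rightarrow> 'e" where
  "christoffel_vec M i x a b = (\<Sum>k\<in>Basis. christoffel M i k a b x *\<^sub>R k)"

text \<open>The curvature operator R(c, a) applied to b, for coordinate vector fields with constant
  coefficients.\<close>

definition riemann ::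
  "('i, 'a, 'e::euclidean_space) riem \<Rightarrow> 'i \<Rightarrow> 'e \<Rightarrow> 'e \<Rightarrow> 'e \<Rightarrow> 'e \<Rightarrow> 'e" where
  "riemann M i c a b x =
     pd c (\<lambda>y. christoffel_vec M i y a b) x - pd a (\<lambda>y. christoffel_vec M i y c b) x
     + christoffel_vec M i x c (christoffel_vec M i x a b) - christoffel_vec M i x a (christoffel_vec M i x c b)"

context
  fixes M :: "('i, 'a::{t2_space,second_countable_topology}, 'e::euclidean_space) riem"
  assumes M: "riemannian_manifold M"
begin

lemma pd_metric_linear:
  assumes "i \<in> idx M" "x \<in> chart_img M i"
  shows "linear (\<lambda>v. pd c (\<lambda>y. metric M i y v w) x)" "linear (\<lambda>w. pd c (\<lambda>y. metric M i y v w) x)"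
    "linear (\<lambda>c. pd c (\<lambda>y. metric M i y v w) x)"
proof -
  note d = frechet_derivative_works[THEN iffD1, OF smooth_on_differentiable[OF smooth_metric[OF M assms(1)] assms(2)]]
  note g = inner_form_metric[OF M assms(1)]
  note cong = frechet_derivative_cong_open[OF open_chart_img[OF M assms(1)] assms(2)]
  show "linear (\<lambda>v. pd c (\<lambda>y. metric M i y v w) x)" for w
  proof (rule linearI)
    fix v v'
    have "frechet_derivative (\<lambda>y. metric M i y (v + v') w) (at x)
        = frechet_derivative (\<lambda>y. metric M i y v w + metric M i y v' w) (at x)"
      by (rule cong) (rule linear_add[OF inner_formD(6)[OF g]])
    then show "pd c (\<lambda>y. metric M i y (v + v') w) x = pd c (\<lambda>y. metric M i y v w) x + pd c (\<lambda>y. metric M i y v' w) x"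
      using frechet_derivative_eq[OF has_derivative_add[OF d d]] by simp
  next
    fix r v
    have "frechet_derivative (\<lambda>y. metric M i y (r *\<^sub>R v) w) (at x)
        = frechet_derivative (\<lambda>y. r *\<^sub>R metric M i y v w) (at x)"
      by (rule cong) (rule linear_cmul[OF inner_formD(6)[OF g]])
    then show "pd c (\<lambda>y. metric M i y (r *\<^sub>R v) w) x = r *\<^sub>R pd c (\<lambda>y. metric M i y v w) x"
      using frechet_derivative_eq[OF has_derivative_scaleR_right[OF d]] by simp
  qed
  note lin = this
  have "pd c (\<lambda>y. metric M i y v w) x = pd c (\<lambda>y. metric M i y w v) x" for v w
    using fun_cong[OF cong[OF inner_formD(2)[OF g]]] .
  then have "(\<lambda>w. pd c (\<lambda>y. metric M i y v w) x) = (\<lambda>w. pd c (\<lambda>y. metric M i y w v) x)" by blast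
  then show "linear (\<lambda>w. pd c (\<lambda>y. metric M i y v w) x)" using lin by (simp only:)
  show "linear (\<lambda>c. pd c (\<lambda>y. metric M i y v w) x)"
    by (rule linear_pd[OF smooth_on_differentiable[OF smooth_metric[OF M assms(1)] assms(2)]])
qed

lemma pd_metric_commute:
  assumes "i \<in> idx M" "x \<in> chart_img M i"
  shows "pd c (\<lambda>y. metric M i y v w) x = pd c (\<lambda>y. metric M i y w v) x"
  by (rule fun_cong[OF frechet_derivative_cong_open[OF open_chart_img[OF M assms(1)] assms(2)]])
     (rule inner_formD(2)[OF inner_form_metric[OF M assms(1)]])

text \<open>Since the metric is nondegenerate, this determines \<open>christoffel_vec\<close>.
  Symmetry, bilinearity, the transformation law and the case of the cylinder are all derived from it
  instead of from the inverse matrix.\<close>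

lemma koszul:
  assumes i: "i \<in> idx M" and x: "x \<in> chart_img M i"
  shows "metric M i x (christoffel_vec M i x a b) w =
    (pd a (\<lambda>y. metric M i y b w) x + pd b (\<lambda>y. metric M i y a w) x - pd w (\<lambda>y. metric M i y a b) x) / 2"
proof -
  note g = inner_form_metric[OF M i x]
  obtain K where K: "linear K" "\<And>\<xi> w. metric M i x (K \<xi>) w = \<xi> \<bullet> w" "\<And>b c. inverse_form (metric M i x) b c = K b \<bullet> c"
    by (rule inner_form_sharp[OF g]) (rule that; assumption)
  define \<kappa> where "\<kappa> l = pd a (\<lambda>y. metric M i y b l) x + pd b (\<lambda>y. metric M i y a l) x - pd l (\<lambda>y. metric M i y a b) x" for l
  have l\<kappa>: "linear \<kappa>"
    unfolding \<kappa>_def by (intro linear_compose_sub linear_compose_add pd_metric_linear i x)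
  define z where "z = (\<Sum>l\<in>Basis. \<kappa> l *\<^sub>R l)"
  have zw: "z \<bullet> w = \<kappa> w" for w
    using linear_basis_expand[OF l\<kappa>, of w] by (simp add: z_def inner_sum_left inner_sum_right inner_commute mult.commute)
  \<comment> \<open>The inverse of a symmetric form is symmetric; this moves \<open>K\<close> from
    the basis vector to \<open>z\<close>.\<close>
  have Ksym: "K u \<bullet> v = u \<bullet> K v" for u v
    using K(2)[of v "K u"] K(2)[of u "K v"] inner_formD(2)[OF g] by (simp add: inner_commute)
  have "christoffel M i k a b x = (1/2) * (K z \<bullet> k)" for k
  proof -
    have "christoffel M i k a b x = (1/2) * (\<Sum>l\<in>Basis. (K k \<bullet> l) * \<kappa> l)"
      unfolding christoffel_def \<kappa>_def using K(3)[of k] by (simp add: cometric_def inverse_form_def)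
    also have "(\<Sum>l\<in>Basis. (K k \<bullet> l) * \<kappa> l) = \<kappa> (K k)"
      using linear_basis_expand[OF l\<kappa>, of "K k"] by simp
    finally show ?thesis using zw[of "K k"] Ksym[of k z] by (simp add: inner_commute)
  qed
  then have "christoffel M i k a b x = (1/2) *\<^sub>R K z \<bullet> k" for k by simp
  then have "christoffel_vec M i x a b = (\<Sum>k\<in>Basis. ((1/2) *\<^sub>R K z \<bullet> k) *\<^sub>R k)"
    unfolding christoffel_vec_def by (simp only:)
  also have "\<dots> = (1/2) *\<^sub>R K z" by (rule euclidean_representation)
  finally show ?thesis
    by (simp only: linear_cmul[OF inner_formD(6)[OF g]] K(2) zw) (simp add: \<kappa>_def)
qed

lemma christoffel_vec_sym:
  assumes "i \<in> idx M" "x \<in> chart_img M i"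
  shows "christoffel_vec M i x a b = christoffel_vec M i x b a"
  by (rule inner_form_eqI[OF inner_form_metric[OF M assms]])
     (simp add: koszul[OF assms] pd_metric_commute[OF assms, of a b])

lemma bilinear_christoffel_vec:
  assumes "i \<in> idx M" "x \<in> chart_img M i"
  shows "bilinear (christoffel_vec M i x)"
proof -
  note g = inner_form_metric[OF M assms]
  note lin = pd_metric_linear[OF assms]
  have "linear (christoffel_vec M i x a)" for a
  proof (rule linearI)
    fix v w
    show "christoffel_vec M i x a (v + w) = christoffel_vec M i x a v + christoffel_vec M i x a w"
      by (rule inner_form_eqI[OF g])
         (simp add: koszul[OF assms] linear_add[OF inner_formD(6)[OF g]]
          linear_add[OF lin(1)] linear_add[OF lin(2)] linear_add[OF lin(3)] field_simps)
  next
    fix r v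
    show "christoffel_vec M i x a (r *\<^sub>R v) = r *\<^sub>R christoffel_vec M i x a v"
      by (rule inner_form_eqI[OF g])
         (simp add: koszul[OF assms] linear_cmul[OF inner_formD(6)[OF g]]
          linear_cmul[OF lin(1)] linear_cmul[OF lin(2)] linear_cmul[OF lin(3)] field_simps)
  qed
  then show ?thesis unfolding bilinear_def using christoffel_vec_sym[OF assms] by simp
qed

context
  assumes smooth_christoffel_vec: "\<And>i a b. i \<in> idx M \<Longrightarrow> smooth_on (chart_img M i) (\<lambda>x. christoffel_vec M i x a b)"
begin

text \<open>The Ricci form at (a, b) is the trace of the map taking c to R(c, b) a. Smoothness of
  \<open>christoffel_vec\<close> is a hypothesis of this context because Cramer's rule is applied to
  charts in \<open>real ^ 'm\<close>, while the cylinder has charts in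
  \<open>(real ^ 'm) \<times> real\<close> and inherits smoothness from the slice.\<close>

lemma ricci_eq:
  assumes i: "i \<in> idx M" and x: "x \<in> chart_img M i"
  shows "ricci M i a b x = (\<Sum>k\<in>Basis. k \<bullet> riemann M i k b a x)"
proof -
  let ?\<Gamma> = "christoffel_vec M i"
  note bil = bilinear_christoffel_vec[OF i x]
  have k\<Gamma>: "?\<Gamma> y a b \<bullet> k = christoffel M i k a b y" if "k \<in> Basis" for k y a b
    unfolding christoffel_vec_def by (rule inner_sum_left_Basis[OF that])
  have pdk: "pd c (christoffel M i k a b) x = k \<bullet> pd c (\<lambda>y. ?\<Gamma> y a b) x" if "k \<in> Basis" for c k a b
  proof -
    have "(\<lambda>y. ?\<Gamma> y a b) differentiable (at x)"
      by (rule smooth_on_differentiable[OF smooth_christoffel_vec[OF i] x])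
    then have "((\<lambda>y. ?\<Gamma> y a b \<bullet> k) has_derivative (\<lambda>c. pd c (\<lambda>y. ?\<Gamma> y a b) x \<bullet> k)) (at x)"
      by (intro bounded_linear.has_derivative[OF bounded_linear_inner_left] frechet_derivative_works[THEN iffD1])
    from frechet_derivative_eq[OF this] show ?thesis by (simp add: k\<Gamma>[OF that] inner_commute[of k])
  qed
  have quad: "k \<bullet> ?\<Gamma> x c (?\<Gamma> x a b) = (\<Sum>l\<in>Basis. christoffel M i k c l x * christoffel M i l a b x)"
    if "k \<in> Basis" for k a b c
  proof -
    have "?\<Gamma> x c (?\<Gamma> x a b) = (\<Sum>l\<in>Basis. (?\<Gamma> x a b \<bullet> l) *\<^sub>R ?\<Gamma> x c l)"
      using bil by (intro linear_basis_expand) (auto simp: bilinear_def)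
    then show ?thesis
      by (simp add: inner_sum_right k\<Gamma> k\<Gamma>[OF that] inner_commute[of k] mult.commute)
  qed
  have "k \<bullet> riemann M i k b a x = pd k (christoffel M i k a b) x - pd b (christoffel M i k a k) x +
      (\<Sum>l\<in>Basis. christoffel M i k k l x * christoffel M i l a b x - christoffel M i k b l x * christoffel M i l a k x)"
    if k: "k \<in> Basis" for k
  proof -
    have sym: "pd c (\<lambda>y. ?\<Gamma> y a b) x = pd c (\<lambda>y. ?\<Gamma> y b a) x" for a b c
      by (rule fun_cong[OF frechet_derivative_cong_open[OF open_chart_img[OF M i] x]]) (rule christoffel_vec_sym[OF i])
    show ?thesis
      by (simp add: riemann_def inner_add_right inner_diff_right sum_subtractf pdk[OF k] quad[OF k, symmetric]
          sym[where a=b and b=a] sym[where a=k and b=a] christoffel_vec_sym[OF i x, of b a] christoffel_vec_sym[OF i x, of k a])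
  qed
  then show ?thesis by (simp add: ricci_def sum.distrib)
qed

lemma linear_riemann:
  assumes i: "i \<in> idx M" and x: "x \<in> chart_img M i"
  shows "linear (\<lambda>c. riemann M i c a b x)" "linear (\<lambda>a. riemann M i c a b x)" "linear (\<lambda>b. riemann M i c a b x)"
proof -
  note bil = bilinear_christoffel_vec[OF i]
  note d = smooth_on_differentiable[OF smooth_christoffel_vec[OF i] x]
  note d' = frechet_derivative_works[THEN iffD1, OF d]
  note cong = frechet_derivative_cong_open[OF open_chart_img[OF M i] x]
  have l0: "linear (\<lambda>c. pd c (\<lambda>y. christoffel_vec M i y a b) x)" for a b by (rule linear_pd[OF d])
  have l2: "linear (\<lambda>b. pd c (\<lambda>y. christoffel_vec M i y a b) x)" for a c
  proof (rule linearI)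
    fix v w
    have "frechet_derivative (\<lambda>y. christoffel_vec M i y a (v + w)) (at x)
        = frechet_derivative (\<lambda>y. christoffel_vec M i y a v + christoffel_vec M i y a w) (at x)"
      by (rule cong) (simp add: bilinear_radd[OF bil])
    then show "pd c (\<lambda>y. christoffel_vec M i y a (v + w)) x = pd c (\<lambda>y. christoffel_vec M i y a v) x + pd c (\<lambda>y. christoffel_vec M i y a w) x"
      using frechet_derivative_eq[OF has_derivative_add[OF d' d']] by simp
  next
    fix r v
    have "frechet_derivative (\<lambda>y. christoffel_vec M i y a (r *\<^sub>R v)) (at x)
        = frechet_derivative (\<lambda>y. r *\<^sub>R christoffel_vec M i y a v) (at x)"
      by (rule cong) (simp add: bilinear_rmul[OF bil])
    then show "pd c (\<lambda>y. christoffel_vec M i y a (r *\<^sub>R v)) x = r *\<^sub>R pd c (\<lambda>y. christoffel_vec M i y a v) x"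
      using frechet_derivative_eq[OF has_derivative_scaleR_right[OF d']] by simp
  qed
  have sym: "pd c (\<lambda>y. christoffel_vec M i y a b) x = pd c (\<lambda>y. christoffel_vec M i y b a) x" for a b c
    by (rule fun_cong[OF cong]) (rule christoffel_vec_sym[OF i])
  have l1: "linear (\<lambda>a. pd c (\<lambda>y. christoffel_vec M i y a b) x)" for b c
    using l2[where c=c and a=b] by (subst sym)
  have b1: "linear (\<lambda>a. christoffel_vec M i x a b)" for b using bil[OF x] by (simp add: bilinear_def)
  have b2: "linear (christoffel_vec M i x a)" for a using bil[OF x] by (simp add: bilinear_def)
  have b12: "linear (\<lambda>a. christoffel_vec M i x c (christoffel_vec M i x a b))" for b c
    using linear_compose[OF b1 b2] by (simp add: o_def)
  have b22: "linear (\<lambda>b. christoffel_vec M i x c (christoffel_vec M i x a b))" for a c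
    using linear_compose[OF b2 b2] by (simp add: o_def)
  show "linear (\<lambda>c. riemann M i c a b x)" "linear (\<lambda>a. riemann M i c a b x)" "linear (\<lambda>b. riemann M i c a b x)"
    unfolding riemann_def
    by (intro linear_compose_add linear_compose_sub l0 l1 l2 b1 b2 b12 b22)+
qed

lemma bilinear_ricci:
  assumes "i \<in> idx M" "x \<in> chart_img M i"
  shows "bilinear (\<lambda>a b. ricci M i a b x)"
proof -
  note l = linear_riemann[OF assms]
  have "linear (\<lambda>a. \<Sum>k\<in>Basis. k \<bullet> riemann M i k b a x)" "linear (\<lambda>a. \<Sum>k\<in>Basis. k \<bullet> riemann M i k a b x)" for b
    using linear_compose[OF l(3), of "(\<bullet>) _"] linear_compose[OF l(2), of "(\<bullet>) _"]
    by (auto intro!: linear_compose_sum simp: o_def bounded_linear.linear[OF bounded_linear_inner_right])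
  then show ?thesis by (simp add: bilinear_def ricci_eq[OF assms])
qed

lemma scalar_curvature_loc_eq: "scalar_curvature_loc M i x = contract (metric M i x) (\<lambda>a b. ricci M i a b x)"
  by (simp add: scalar_curvature_loc_def contract_def cometric_def inverse_form_def)

section \<open>Curvature under a change of chart\<close>

context
  fixes i j assumes i: "i \<in> idx M" and j: "j \<in> idx M"
begin

private abbreviation "\<phi> \<equiv> transition M i j"
private abbreviation "Dt x v \<equiv> pd v \<phi> x"
private abbreviation "D2t x u v \<equiv> pd u (pd v \<phi>) x"

lemma D2t_sym: "x \<in> overlap M i j \<Longrightarrow> D2t x u v = D2t x v u"
  by (rule pd_commute[OF open_overlap[OF M i j] smooth_onD[OF smooth_transition[OF M i j]]])

lemma Dt_has_derivative:
  "x \<in> overlap M i j \<Longrightarrow> ((\<lambda>y. Dt y v) has_derivative (\<lambda>u. D2t x u v)) (at x)"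
  using smooth_on_differentiable[OF smooth_on_pd[OF smooth_transition[OF M i j]]] frechet_derivative_works by blast

lemma pd_metric_transition:
  assumes x: "x \<in> overlap M i j"
  shows "pd c (\<lambda>y. metric M i y v w) x =
    pd (Dt x c) (\<lambda>y. metric M j y (Dt x v) (Dt x w)) (\<phi> x)
    + metric M j (\<phi> x) (D2t x c v) (Dt x w) + metric M j (\<phi> x) (Dt x v) (D2t x c w)"
proof -
  have "((\<lambda>y. metric M j (\<phi> y) (Dt y v) (Dt y w)) has_derivative
    (\<lambda>c. pd (Dt x c) (\<lambda>y. metric M j y (Dt x v) (Dt x w)) (\<phi> x)
    + metric M j (\<phi> x) (D2t x c v) (Dt x w) + metric M j (\<phi> x) (Dt x v) (D2t x c w))) (at x)"
    by (rule has_derivative_bilinear_family[OF open_overlap[OF M i j] x open_chart_img[OF M j]])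
      (use transition_img[OF M i j] inner_formD(1)[OF inner_form_metric[OF M j]] x
        smooth_on_differentiable[OF smooth_metric[OF M j]]
        Dt_has_derivative transition_has_derivative[OF M i j] in auto)
  moreover have "frechet_derivative (\<lambda>y. metric M i y v w) (at x)
    = frechet_derivative (\<lambda>y. metric M j (\<phi> y) (Dt y v) (Dt y w)) (at x)"
    by (rule frechet_derivative_cong_open[OF open_overlap[OF M i j] x]) (rule metric_transition[OF M i j])
  ultimately show ?thesis using frechet_derivative_eq by (metis (no_types, lifting))
qed

lemma christoffel_transition:
  assumes x: "x \<in> overlap M i j"
  shows "Dt x (christoffel_vec M i x a b) = christoffel_vec M j (\<phi> x) (Dt x a) (Dt x b) + D2t x a b"
proof (rule inner_form_eqI[OF inner_form_metric[OF M j transition_img[OF M i j x]]])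
  fix w'
  obtain w where w: "w' = Dt x w" using bij_pd_transition[OF M i j x] by (metis bij_pointE)
  have xi: "x \<in> chart_img M i" by (rule subsetD[OF overlap_subset x])
  note xj = transition_img[OF M i j x]
  note gj = inner_form_metric[OF M j xj]
  have "metric M j (\<phi> x) (Dt x (christoffel_vec M i x a b)) (Dt x w) = metric M i x (christoffel_vec M i x a b) w"
    by (rule metric_transition[OF M i j x, symmetric])
  \<comment> \<open>\<open>pd_metric_transition\<close> contributes six terms with second
    derivatives of the transition map. Four cancel by symmetry, and two equal ones remain, halved by
    the Koszul formula.\<close>
  also have "\<dots> = metric M j (\<phi> x) (christoffel_vec M j (\<phi> x) (Dt x a) (Dt x b)) (Dt x w) + metric M j (\<phi> x) (D2t x a b) (Dt x w)"
    unfolding koszul[OF i xi] koszul[OF j xj] pd_metric_transition[OF x]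
      D2t_sym[OF x, where u=b and v=a] D2t_sym[OF x, where u=w and v=a] D2t_sym[OF x, where u=w and v=b]
    using inner_formD(2)[OF gj, of "D2t x a w" "Dt x b"] inner_formD(2)[OF gj, of "Dt x a" "D2t x b w"]
    by (simp add: field_simps)
  also have "\<dots> = metric M j (\<phi> x) (christoffel_vec M j (\<phi> x) (Dt x a) (Dt x b) + D2t x a b) (Dt x w)"
    by (simp add: linear_add[OF inner_formD(6)[OF gj]])
  finally show "metric M j (\<phi> x) (Dt x (christoffel_vec M i x a b)) w'
      = metric M j (\<phi> x) (christoffel_vec M j (\<phi> x) (Dt x a) (Dt x b) + D2t x a b) w'" by (simp only: w)
qed

text \<open>The inhomogeneous law of the Christoffel symbols is differentiated once more. Third
  derivatives of the transition map are symmetric in \<open>c\<close> and \<open>a\<close> and drop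
  out of the antisymmetric expression; the second derivatives are eliminated by the law itself, in
  the form \<open>D2\<close>.\<close>

lemma riemann_transition:
  assumes x: "x \<in> overlap M i j"
  shows "Dt x (riemann M i c a b x) = riemann M j (Dt x c) (Dt x a) (Dt x b) (\<phi> x)"
proof -
  let ?G = "christoffel_vec M i x" and ?H = "christoffel_vec M j (\<phi> x)" and ?P = "Dt x"
  let ?dG = "\<lambda>c a b. pd c (\<lambda>y. christoffel_vec M i y a b) x"
  let ?dH = "\<lambda>c a b. pd c (\<lambda>y. christoffel_vec M j y a b) (\<phi> x)"
  have xi: "x \<in> chart_img M i" by (rule subsetD[OF overlap_subset x])
  note xj = transition_img[OF M i j x]
  have lP: "linear ?P" by (rule linear_pd_transition[OF M i j x])
  have lH1: "linear (\<lambda>a. ?H a b)" and lH2: "linear (?H a)" for a b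
    using bilinear_christoffel_vec[OF j xj] by (auto simp: bilinear_def)
  have D2: "D2t y a b = Dt y (christoffel_vec M i y a b) - christoffel_vec M j (\<phi> y) (Dt y a) (Dt y b)"
    if "y \<in> overlap M i j" for y a b
    using christoffel_transition[OF that, of a b] by simp
  have third: "pd c (\<lambda>y. D2t y a b) x = D2t x c (?G a b) + ?P (?dG c a b)
      - (?dH (?P c) (?P a) (?P b) + ?H (D2t x c a) (?P b) + ?H (?P a) (D2t x c b))" for a b c
  proof -
    have 1: "((\<lambda>y. Dt (id y) (christoffel_vec M i y a b)) has_derivative
        (\<lambda>c. pd c (\<lambda>y. Dt y (?G a b)) (id x) + Dt (id x) (?dG c a b))) (at x)"
    proof (rule has_derivative_linear_family[where F=Dt and \<phi>'="\<lambda>h. h", OF open_overlap[OF M i j] x open_overlap[OF M i j]])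
      show "(id has_derivative (\<lambda>h. h)) (at x)" unfolding id_def by (rule has_derivative_ident)
      show "((\<lambda>y. christoffel_vec M i y a b) has_derivative (\<lambda>c. ?dG c a b)) (at x)"
        using smooth_on_differentiable[OF smooth_christoffel_vec[OF i] xi] frechet_derivative_works by blast
      show "(\<lambda>y. Dt y v) differentiable at (id x)" for v
        using Dt_has_derivative[OF x] by (auto simp: differentiable_def)
      show "linear (Dt y)" if "y \<in> overlap M i j" for y by (rule linear_pd_transition[OF M i j that])
    qed simp
    have 2: "((\<lambda>y. christoffel_vec M j (\<phi> y) (Dt y a) (Dt y b)) has_derivative
        (\<lambda>c. ?dH (?P c) (?P a) (?P b) + ?H (D2t x c a) (?P b) + ?H (?P a) (D2t x c b))) (at x)"
      by (rule has_derivative_bilinear_family[OF open_overlap[OF M i j] x open_chart_img[OF M j]])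
        (use transition_img[OF M i j] bilinear_christoffel_vec[OF j] x
          smooth_on_differentiable[OF smooth_christoffel_vec[OF j]]
          Dt_has_derivative transition_has_derivative[OF M i j] in auto)
    have "frechet_derivative (\<lambda>y. D2t y a b) (at x) =
      frechet_derivative (\<lambda>y. Dt (id y) (christoffel_vec M i y a b) - christoffel_vec M j (\<phi> y) (Dt y a) (Dt y b)) (at x)"
      by (rule frechet_derivative_cong_open[OF open_overlap[OF M i j] x]) (simp add: D2)
    then show ?thesis using frechet_derivative_eq[OF has_derivative_diff[OF 1 2]] by simp
  qed
  have "pd c (\<lambda>y. D2t y a b) x = pd a (\<lambda>y. D2t y c b) x"
    by (rule pd_commute[OF open_overlap[OF M i j] smooth_onD[OF smooth_on_pd[OF smooth_transition[OF M i j]]] x])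
  then show ?thesis
    unfolding third riemann_def D2[OF x]
    by (simp add: linear_add[OF lP] linear_diff[OF lP] linear_diff[OF lH1] linear_diff[OF lH2] algebra_simps
        christoffel_vec_sym[OF i xi, of c a] christoffel_vec_sym[OF j xj, of "?P c" "?P a"])
qed

text \<open>Ricci is a trace and so invariant under conjugation; its contraction with the metric is
  invariant under pullback.\<close>

lemma scalar_curvature_loc_transition:
  assumes x: "x \<in> overlap M i j"
  shows "scalar_curvature_loc M i x = scalar_curvature_loc M j (\<phi> x)"
proof -
  have xi: "x \<in> chart_img M i" by (rule subsetD[OF overlap_subset x])
  note xj = transition_img[OF M i j x]
  have bP: "bij (Dt x)" by (rule bij_pd_transition[OF M i j x])
  have "ricci M i a b x = ricci M j (Dt x a) (Dt x b) (\<phi> x)" for a b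
    unfolding ricci_eq[OF i xi] ricci_eq[OF j xj]
    by (rule trace_conjugate[OF linear_pd_transition[OF M i j x] bP, symmetric])
       (simp_all add: linear_riemann[OF i xi] riemann_transition[OF x])
  then show ?thesis
    unfolding scalar_curvature_loc_eq
    by (intro contract_pullback[OF inner_form_metric[OF M i xi] inner_form_metric[OF M j xj] linear_pd_transition[OF M i j x]
      bij_is_surj[OF bP] metric_transition[OF M i j x] _ bilinear_ricci[OF j xj]])
qed

end

end

end

text \<open>Discharges the hypothesis of the curvature context for charts in
  \<open>real ^ 'm\<close>.\<close>

lemma smooth_christoffel_vec:
  fixes M :: "('i, 'a::{t2_space,second_countable_topology}, real ^ 'm::finite) riem"
  assumes "riemannian_manifold M" "i \<in> idx M"
  shows "smooth_on (chart_img M i) (\<lambda>x. christoffel_vec M i x a b)"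
  unfolding christoffel_vec_def smooth_on_def
  by (intro allI Ck_on_sum Ck_on_scaleR Ck_on_const open_chart_img[OF assms] smooth_onD[OF smooth_christoffel[OF assms]])

section \<open>Change of variables and the Gram determinant\<close>

text \<open>The library's change of variables theorem needs a well-ordered index type; a finite type is
  well-ordered through an injection into the natural numbers.\<close>

typedef 'a ranked = "UNIV :: 'a set" by simp

definition rank_of :: "'a::finite \<Rightarrow> nat" where
  "rank_of = (SOME f. inj f)"

lemma inj_rank_of: "inj (rank_of :: 'a::finite \<Rightarrow> nat)"
proof -
  have "\<exists>f :: 'a \<Rightarrow> nat. inj f" using finite_imp_inj_to_nat_seg[of "UNIV :: 'a set"] by auto
  then show ?thesis unfolding rank_of_def by (rule someI_ex)
qed

lemma bij_Rep_ranked: "bij Rep_ranked"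
  by (metis Abs_ranked_inverse Rep_ranked_inverse UNIV_I bijI')

instantiation ranked :: (finite) "{finite, wellorder}"
begin

definition less_eq_ranked :: "'a ranked \<Rightarrow> 'a ranked \<Rightarrow> bool" where
  "x \<le> y \<longleftrightarrow> rank_of (Rep_ranked x) \<le> rank_of (Rep_ranked y)"

definition less_ranked :: "'a ranked \<Rightarrow> 'a ranked \<Rightarrow> bool" where
  "x < y \<longleftrightarrow> rank_of (Rep_ranked x) < rank_of (Rep_ranked y)"

instance
proof
  show "finite (UNIV :: 'a ranked set)"
    using finite_imageD[OF finite[of "range Rep_ranked"]] bij_is_inj[OF bij_Rep_ranked] by blast
  fix x y :: "'a ranked" assume "x \<le> y" "y \<le> x"
  then show "x = y"
    by (simp add: less_eq_ranked_def inj_eq[OF inj_rank_of] Rep_ranked_inject)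
next
  fix P :: "'a ranked \<Rightarrow> bool" and a
  assume P: "\<And>x. (\<And>y. y < x \<Longrightarrow> P y) \<Longrightarrow> P x"
  show "P a"
  proof (induction a rule: measure_induct_rule[where f="\<lambda>x. rank_of (Rep_ranked x)"])
    case (less x)
    show ?case by (rule P) (rule less, simp add: less_ranked_def)
  qed
qed (auto simp: less_eq_ranked_def less_ranked_def)

end

definition rank_basis :: "'m::finite ranked \<Rightarrow> real ^ 'm" where
  "rank_basis r = axis (Rep_ranked r) 1"

text \<open>A relabelling of coordinates: a linear isomorphism preserving Lebesgue measure, along
  which integrals and determinants are moved to the well-ordered index type.\<close>

definition to_ranked :: "real ^ 'm::finite \<Rightarrow> real ^ 'm ranked" where
  "to_ranked x = (\<chi> r. x $ Rep_ranked r)"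

definition of_ranked :: "real ^ 'm ranked \<Rightarrow> real ^ 'm::finite" where
  "of_ranked y = (\<chi> i. y $ Abs_ranked i)"

lemma ranked_inverse [simp]: "of_ranked (to_ranked x) = x" "to_ranked (of_ranked y) = y"
  by (simp_all add: to_ranked_def of_ranked_def vec_eq_iff Abs_ranked_inverse Rep_ranked_inverse)

lemma bounded_linear_ranked: "bounded_linear (to_ranked :: real ^ 'm::finite \<Rightarrow> _)" "bounded_linear (of_ranked :: _ \<Rightarrow> real ^ 'm::finite)"
  by (auto simp: linear_conv_bounded_linear[symmetric] to_ranked_def of_ranked_def vec_eq_iff intro!: linearI)

lemma linear_ranked: "linear (to_ranked :: real ^ 'm::finite \<Rightarrow> _)" "linear (of_ranked :: _ \<Rightarrow> real ^ 'm::finite)"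
  using bounded_linear_ranked[THEN bounded_linear.linear] .

lemma of_ranked_axis: "of_ranked (axis r 1) = rank_basis r"
  by (auto simp: of_ranked_def rank_basis_def vec_eq_iff axis_def Abs_ranked_inverse Rep_ranked_inverse)

lemma bij_rank_basis: "bij_betw rank_basis UNIV (Basis :: (real ^ 'm::finite) set)"
proof -
  have "inj (rank_basis :: 'm ranked \<Rightarrow> real ^ 'm)"
    by (rule injI) (simp add: rank_basis_def axis_eq_axis Rep_ranked_inject)
  moreover have "range (rank_basis :: 'm ranked \<Rightarrow> real ^ 'm) = Basis"
  proof -
    have "axis i 1 \<in> range (rank_basis :: 'm ranked \<Rightarrow> real ^ 'm)" for i :: 'm
      by (rule image_eqI[of _ _ "Abs_ranked i"]) (simp_all add: rank_basis_def Abs_ranked_inverse)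
    then show ?thesis by (auto simp: Basis_vec_def rank_basis_def)
  qed
  ultimately show ?thesis by (simp add: bij_betw_def)
qed

lemma ranked_box: "to_ranked -` box l r = box (of_ranked l) (of_ranked r)"
proof -
  have e: "(\<forall>r. P r) \<longleftrightarrow> (\<forall>i. P (Abs_ranked i))" for P by (metis Rep_ranked_inverse)
  show ?thesis
    unfolding set_eq_iff vimage_eq mem_box_cart to_ranked_def of_ranked_def vec_lambda_beta
    by (subst e) (simp add: Abs_ranked_inverse)
qed

text \<open>\<open>lborel\<close> is determined by the volumes of boxes, and relabelling merely
  permutes the factors of such a volume.\<close>

lemma lborel_to_ranked: "distr lborel borel (to_ranked :: real ^ 'm::finite \<Rightarrow> _) = lborel"
proof (rule lborel_eqI[symmetric])
  have m [measurable]: "(to_ranked :: real ^ 'm \<Rightarrow> _) \<in> borel \<rightarrow>\<^sub>M borel"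
    by (intro borel_measurable_continuous_onI linear_continuous_on bounded_linear_ranked)
  fix l u :: "real ^ 'm ranked"
  assume lu: "\<And>b. b \<in> Basis \<Longrightarrow> l \<bullet> b \<le> u \<bullet> b"
  have P: "prod f (Basis :: (real ^ 'k::finite) set) = (\<Prod>i\<in>UNIV. f (axis i 1))" for f :: "_ \<Rightarrow> real"
    by (simp add: Basis_vec_def UNION_singleton_eq_range prod.reindex inj_on_def axis_eq_axis)
  have "l $ r \<le> u $ r" for r using lu[of "axis r 1"] by (simp add: inner_axis)
  then have "of_ranked l \<bullet> b \<le> of_ranked u \<bullet> b" if "b \<in> Basis" for b
    using that by (auto simp: Basis_vec_def inner_axis of_ranked_def)
  then have "emeasure (distr lborel borel to_ranked) (box l u) = (\<Prod>b\<in>Basis. (of_ranked u - of_ranked l) \<bullet> b)"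
    by (simp add: emeasure_distr ranked_box)
  also have "(\<Prod>b\<in>(Basis :: (real ^ 'm) set). (of_ranked u - of_ranked l) \<bullet> b) = (\<Prod>i\<in>UNIV. u $ Abs_ranked i - l $ Abs_ranked i)"
    by (simp add: P inner_axis of_ranked_def)
  also have "\<dots> = (\<Prod>r\<in>UNIV. u $ r - l $ r)"
  proof (rule prod.reindex_bij_betw[of Abs_ranked])
    show "bij (Abs_ranked :: 'm \<Rightarrow> 'm ranked)"
      by (metis Abs_ranked_inverse Rep_ranked_inverse UNIV_I bijI')
  qed
  also have "\<dots> = (\<Prod>b\<in>Basis. (u - l) \<bullet> b)" by (simp add: P inner_axis)
  finally show "emeasure (distr lborel borel to_ranked) (box l u) = ennreal (\<Prod>b\<in>Basis. (u - l) \<bullet> b)" .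
qed simp

lemma nn_integral_to_ranked:
  fixes h :: "real ^ 'm::finite \<Rightarrow> ennreal"
  assumes "h \<in> borel_measurable borel"
  shows "(\<integral>\<^sup>+y. h (of_ranked y) \<partial>lborel) = (\<integral>\<^sup>+x. h x \<partial>lborel)"
proof -
  have m [measurable]: "(to_ranked :: real ^ 'm \<Rightarrow> _) \<in> borel \<rightarrow>\<^sub>M borel"
    "(of_ranked :: _ \<Rightarrow> real ^ 'm) \<in> borel \<rightarrow>\<^sub>M borel"
    by (intro borel_measurable_continuous_onI linear_continuous_on bounded_linear_ranked)+
  show ?thesis
    using assms by (subst lborel_to_ranked[symmetric]) (simp add: nn_integral_distr)
qed

text \<open>Deduced from the change of variables for absolutely integrable vector-valued functions:
  the scalar \<open>f\<close> enters as \<open>f\<close> times a fixed unit vector \<open>e\<close>,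
  and the inner product with \<open>e\<close> recovers it. If one side is not integrable, neither is
  the other, and both integrals are infinite.\<close>

lemma nn_integral_change_of_variables_wellorder:
  fixes g :: "real ^ 'k::{finite,wellorder} \<Rightarrow> real ^ 'k::_" and f :: "real ^ 'k::_ \<Rightarrow> real"
  assumes S: "S \<in> sets borel" and gS: "g ` S \<in> sets borel"
    and der: "\<And>x. x \<in> S \<Longrightarrow> (g has_derivative g' x) (at x)" and inj: "inj_on g S"
    and f0: "\<And>y. f y \<ge> 0"
    and m1: "(\<lambda>x. indicator S x * (\<bar>det (matrix (g' x))\<bar> * f (g x))) \<in> borel_measurable borel"
    and m2: "(\<lambda>y. indicator (g ` S) y * f y) \<in> borel_measurable borel"
  shows "(\<integral>\<^sup>+x. ennreal (indicator S x * (\<bar>det (matrix (g' x))\<bar> * f (g x))) \<partial>lborel)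
    = (\<integral>\<^sup>+y. ennreal (indicator (g ` S) y * f y) \<partial>lborel)"
proof -
  define e :: "real ^ 'k::_" where "e = axis undefined 1"
  have ee: "e \<bullet> e = 1" by (simp add: e_def inner_axis_axis)
  define u where "u x = indicator S x * (\<bar>det (matrix (g' x))\<bar> * f (g x))" for x
  define v where "v y = indicator (g ` S) y * f y" for y
  have u0: "u x \<ge> 0" and v0: "v x \<ge> 0" for x using f0 by (simp_all add: u_def v_def)
  have ai: "(\<lambda>x. w x *\<^sub>R e) absolutely_integrable_on T \<longleftrightarrow> integrable lborel (\<lambda>x. indicator T x * w x)"
    if "(\<lambda>x. indicator T x * w x) \<in> borel_measurable borel" for T and w :: "real ^ 'k::_ \<Rightarrow> real"
  proof -
    have "(\<lambda>x. w x *\<^sub>R e) absolutely_integrable_on T \<longleftrightarrow> integrable lebesgue (\<lambda>x. indicator T x * w x)"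
    proof
      assume "(\<lambda>x. w x *\<^sub>R e) absolutely_integrable_on T"
      then have "integrable lebesgue (\<lambda>x. (indicator T x *\<^sub>R w x *\<^sub>R e) \<bullet> e)"
        unfolding set_integrable_def by (rule integrable_inner_left)
      then show "integrable lebesgue (\<lambda>x. indicator T x * w x)" by (simp add: ee)
    next
      assume "integrable lebesgue (\<lambda>x. indicator T x * w x)"
      then have "integrable lebesgue (\<lambda>x. (indicator T x * w x) *\<^sub>R e)" by (rule integrable_scaleR_left)
      then show "(\<lambda>x. w x *\<^sub>R e) absolutely_integrable_on T" by (simp add: set_integrable_def)
    qed
    also have "\<dots> \<longleftrightarrow> integrable lborel (\<lambda>x. indicator T x * w x)"
      by (rule integrable_completion) (use that in simp)
    finally show ?thesis .
  qed
  have ii: "integral T (\<lambda>x. w x *\<^sub>R e) = (LINT x|lborel. indicator T x * w x) *\<^sub>R e"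
    if m: "(\<lambda>x. indicator T x * w x) \<in> borel_measurable borel" and i: "integrable lborel (\<lambda>x. indicator T x * w x)"
    for T and w :: "real ^ 'k::_ \<Rightarrow> real"
  proof -
    have "integral T (\<lambda>x. w x *\<^sub>R e) = (LINT x:T|lebesgue. w x *\<^sub>R e)"
      using set_lebesgue_integral_eq_integral(2)[of T "\<lambda>x. w x *\<^sub>R e"] ai[OF m] i by simp
    also have "\<dots> = (LINT x|lebesgue. (indicator T x * w x) *\<^sub>R e)" by (simp add: set_lebesgue_integral_def)
    also have "\<dots> = (LINT x|lebesgue. indicator T x * w x) *\<^sub>R e"
      using i m by (intro integral_scaleR_left) (simp add: integrable_completion)
    also have "(LINT x|lebesgue. indicator T x * w x) = (LINT x|lborel. indicator T x * w x)"
      by (rule integral_completion) (use m in simp)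
    finally show ?thesis .
  qed
  have der': "(g has_derivative g' x) (at x within S)" if "x \<in> S" for x
    using der[OF that] by (rule has_derivative_at_withinI)
  have Sl: "S \<in> sets lebesgue" using S by auto
  note cov = has_absolute_integral_change_of_variables[OF Sl der' inj, of "\<lambda>y. f y *\<^sub>R e"]
  have iff: "integrable lborel u \<longleftrightarrow> integrable lborel v"
    using cov ai[OF m1] ai[OF m2] unfolding u_def v_def scaleR_scaleR by blast
  show ?thesis
  proof (cases "integrable lborel v")
    case True
    then have iu: "integrable lborel u" using iff by simp
    have "integral S (\<lambda>x. (\<bar>det (matrix (g' x))\<bar> * f (g x)) *\<^sub>R e) = integral (g ` S) (\<lambda>y. f y *\<^sub>R e)"
      using cov[of "integral (g ` S) (\<lambda>y. f y *\<^sub>R e)"] ai[OF m2] True unfolding v_def scaleR_scaleR by blast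
    then have "(LINT x|lborel. u x) *\<^sub>R e = (LINT x|lborel. v x) *\<^sub>R e"
      using ii[OF m1] ii[OF m2] iu True unfolding u_def v_def by simp
    then have "(LINT x|lborel. u x) = (LINT x|lborel. v x)" using ee by (metis inner_scaleR_left mult.right_neutral)
    then show ?thesis
      unfolding u_def[symmetric] v_def[symmetric]
      using nn_integral_eq_integral[OF iu] nn_integral_eq_integral[OF True] u0 v0 by simp
  next
    case False
    have inf: "(\<integral>\<^sup>+x. ennreal (w x) \<partial>lborel) = \<infinity>"
      if "\<not> integrable lborel w" "w \<in> borel_measurable borel" "\<And>x. 0 \<le> w x" for w :: "real ^ 'k::_ \<Rightarrow> real"
      using that by (auto simp: integrable_iff_bounded less_top[symmetric])
    show ?thesis
      using inf[of u] inf[of v] False iff u0 v0 m1 m2 by (simp add: u_def[symmetric] v_def[symmetric])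
  qed
qed

definition rank_matrix :: "(real ^ 'm::finite \<Rightarrow> real ^ 'm) \<Rightarrow> real ^ 'm ranked ^ 'm ranked" where
  "rank_matrix P = matrix (\<lambda>y. to_ranked (P (of_ranked y)))"

text \<open>Conjugation with the relabelling moves the problem to the well-ordered index type, where
  the Jacobian is \<open>det (rank_matrix (g' x))\<close>.\<close>

lemma nn_integral_change_of_variables:
  fixes g :: "real ^ 'm::finite \<Rightarrow> real ^ 'm" and f :: "real ^ 'm \<Rightarrow> real"
  assumes S: "S \<in> sets borel" and gS: "g ` S \<in> sets borel"
    and der: "\<And>x. x \<in> S \<Longrightarrow> (g has_derivative g' x) (at x)" and inj: "inj_on g S"
    and f0: "\<And>y. f y \<ge> 0"
    and m1: "(\<lambda>x. indicator S x * (\<bar>det (rank_matrix (g' x))\<bar> * f (g x))) \<in> borel_measurable borel"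
    and m2: "(\<lambda>y. indicator (g ` S) y * f y) \<in> borel_measurable borel"
  shows "(\<integral>\<^sup>+x. ennreal (indicator S x * (\<bar>det (rank_matrix (g' x))\<bar> * f (g x))) \<partial>lborel)
    = (\<integral>\<^sup>+y. ennreal (indicator (g ` S) y * f y) \<partial>lborel)"
proof -
  have m [measurable]: "(of_ranked :: _ \<Rightarrow> real ^ 'm) \<in> borel \<rightarrow>\<^sub>M borel"
    by (intro borel_measurable_continuous_onI linear_continuous_on bounded_linear_ranked)
  define T where "T = of_ranked -` S"
  define G where "G y = to_ranked (g (of_ranked y))" for y
  define G' where "G' y = (\<lambda>h. to_ranked (g' (of_ranked y) (of_ranked h)))" for y
  have vim: "of_ranked -` A \<in> sets borel" if "A \<in> sets borel" for A :: "(real ^ 'm) set"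
    using measurable_sets[OF m that] by simp
  have GT: "G ` T = of_ranked -` (g ` S)"
  proof (intro set_eqI iffI)
    fix y assume "y \<in> of_ranked -` (g ` S)"
    then obtain x where x: "x \<in> S" "of_ranked y = g x" by auto
    then have "y = G (to_ranked x)" "to_ranked x \<in> T" by (simp_all add: G_def T_def x(2)[symmetric])
    then show "y \<in> G ` T" by blast
  qed (auto simp: G_def T_def)
  have i1: "indicator T y = (indicator S (of_ranked y) :: real)" for y by (simp add: T_def indicator_def)
  have i2: "indicator (G ` T) y = (indicator (g ` S) (of_ranked y) :: real)" for y
    unfolding GT by (simp add: indicator_def)
  have oG: "of_ranked (G y) = g (of_ranked y)" for y by (simp add: G_def)
  have dG: "det (matrix (G' y)) = det (rank_matrix (g' (of_ranked y)))" for y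
    by (simp add: rank_matrix_def G'_def)
  have "(\<integral>\<^sup>+y. ennreal (indicator T y * (\<bar>det (matrix (G' y))\<bar> * f (of_ranked (G y)))) \<partial>lborel)
    = (\<integral>\<^sup>+y. ennreal (indicator (G ` T) y * f (of_ranked y)) \<partial>lborel)"
  proof (rule nn_integral_change_of_variables_wellorder)
    show "T \<in> sets borel" unfolding T_def by (rule vim[OF S])
    show "G ` T \<in> sets borel" unfolding GT by (rule vim[OF gS])
    show "(G has_derivative G' y) (at y)" if "y \<in> T" for y
    proof -
      have "(of_ranked has_derivative of_ranked) (at y)"
        by (rule bounded_linear_imp_has_derivative[OF bounded_linear_ranked(2)])
      from has_derivative_compose[OF this der] that
      have "((\<lambda>y. g (of_ranked y)) has_derivative (\<lambda>h. g' (of_ranked y) (of_ranked h))) (at y)"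
        by (simp add: T_def)
      then show ?thesis unfolding G_def[abs_def] G'_def
        by (rule bounded_linear.has_derivative[OF bounded_linear_ranked(1)])
    qed
    show "inj_on G T"
    proof (rule inj_onI)
      fix x y assume "x \<in> T" "y \<in> T" "G x = G y"
      then show "x = y" using inj unfolding T_def G_def inj_on_def by (metis ranked_inverse vimageD)
    qed
    show "(\<lambda>y. indicator T y * (\<bar>det (matrix (G' y))\<bar> * f (of_ranked (G y)))) \<in> borel_measurable borel"
      using measurable_compose[OF m m1] by (simp add: i1 dG G_def)
    show "(\<lambda>y. indicator (G ` T) y * f (of_ranked y)) \<in> borel_measurable borel"
      using measurable_compose[OF m m2] by (simp add: i2)
  qed (use f0 in auto)
  then have "(\<integral>\<^sup>+y. ennreal (indicator S (of_ranked y) * (\<bar>det (rank_matrix (g' (of_ranked y)))\<bar> * f (g (of_ranked y)))) \<partial>lborel)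
    = (\<integral>\<^sup>+y. ennreal (indicator (g ` S) (of_ranked y) * f (of_ranked y)) \<partial>lborel)"
    by (simp only: i1 i2 dG oG)
  then show ?thesis
    using nn_integral_to_ranked[of "\<lambda>x. ennreal (indicator S x * (\<bar>det (rank_matrix (g' x))\<bar> * f (g x)))"]
      nn_integral_to_ranked[of "\<lambda>y. ennreal (indicator (g ` S) y * f y)"] m1 m2
    by simp
qed

section \<open>Gram determinants\<close>

definition rank_gram :: "(real ^ 'm::finite \<Rightarrow> real ^ 'm \<Rightarrow> real) \<Rightarrow> real ^ 'm ranked ^ 'm ranked" where
  "rank_gram g = (\<chi> r s. g (rank_basis r) (rank_basis s))"

text \<open>\<open>gram_det\<close> sums over permutations of \<open>Basis\<close>,
  \<open>det\<close> over permutations of the index type; \<open>map_permutation\<close> along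
  \<open>rank_basis\<close> is a sign-preserving bijection between them.\<close>

lemma gram_det_eq:
  fixes M :: "('i, 'a, real ^ 'm::finite) riem"
  shows "gram_det M i x = det (rank_gram (metric M i x))"
proof -
  let ?b = "rank_basis :: 'm ranked \<Rightarrow> real ^ 'm"
  let ?mp = "map_permutation UNIV ?b"
  have inj: "inj ?b" by (rule bij_betw_imp_inj_on[OF bij_rank_basis])
  have bij: "bij_betw ?mp {p. p permutes UNIV} {p. p permutes (Basis :: (real ^ 'm) set)}"
  proof (rule bij_betwI[where g="map_permutation Basis (inv_into UNIV ?b)"])
    have b': "bij_betw (inv_into UNIV ?b) Basis UNIV" by (rule bij_betw_inv_into[OF bij_rank_basis])
    show "?mp \<in> {p. p permutes UNIV} \<rightarrow> {p. p permutes Basis}"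
      using map_permutation_permutes[OF bij_rank_basis] by auto
    show "map_permutation Basis (inv_into UNIV ?b) \<in> {p. p permutes Basis} \<rightarrow> {p. p permutes UNIV}"
      using map_permutation_permutes[OF b'] by auto
    show "map_permutation Basis (inv_into UNIV ?b) (?mp p) = p" if "p \<in> {p. p permutes UNIV}" for p
      using that inj by (intro map_permutation_compose_inv[OF bij_rank_basis]) auto
    show "?mp (map_permutation Basis (inv_into UNIV ?b) p) = p" if "p \<in> {p. p permutes Basis}" for p
      using that bij_betw_inv_into_right[OF bij_rank_basis] by (intro map_permutation_compose_inv[OF b']) auto
  qed
  have "det (rank_gram (metric M i x)) = (\<Sum>p | p permutes (UNIV :: 'm ranked set).
      of_int (sign (?mp p)) * (\<Prod>b\<in>Basis. metric M i x b (?mp p b)))"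
    unfolding det_def
  proof (rule sum.cong[OF refl])
    fix p :: "'m ranked \<Rightarrow> 'm ranked" assume "p \<in> {p. p permutes UNIV}"
    then have p: "p permutes UNIV" by simp
    have "(\<Prod>b\<in>Basis. metric M i x b (?mp p b)) = (\<Prod>r\<in>UNIV. metric M i x (?b r) (?mp p (?b r)))"
      by (rule prod.reindex_bij_betw[OF bij_rank_basis, symmetric])
    also have "\<dots> = (\<Prod>r\<in>UNIV. rank_gram (metric M i x) $ r $ p r)"
      by (simp add: map_permutation_apply[OF inj] rank_gram_def)
    finally show "of_int (sign p) * (\<Prod>r\<in>UNIV. rank_gram (metric M i x) $ r $ p r)
        = of_int (sign (?mp p)) * (\<Prod>b\<in>Basis. metric M i x b (?mp p b))"
      using sign_map_permutation[where A=UNIV and p=p and f="?b"] p inj by simp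
  qed
  also have "\<dots> = gram_det M i x"
    unfolding gram_det_def by (rule sum.reindex_bij_betw[OF bij])
  finally show ?thesis by simp
qed

lemma rank_gram_mult:
  fixes g :: "real ^ 'm::finite \<Rightarrow> real ^ 'm \<Rightarrow> real"
  assumes "inner_form g"
  shows "v \<bullet> (rank_gram g *v w) = g (of_ranked v) (of_ranked w)"
proof -
  have ex: "of_ranked v = (\<Sum>r\<in>UNIV. v $ r *\<^sub>R rank_basis r)" for v :: "real ^ 'm ranked"
  proof -
    have "of_ranked v = of_ranked (\<Sum>r\<in>UNIV. v $ r *\<^sub>R axis r 1)"
      using basis_expansion[of v] by (simp add: scalar_mult_eq_scaleR)
    then show ?thesis by (simp add: linear_sum[OF linear_ranked(2)] linear_cmul[OF linear_ranked(2)] of_ranked_axis)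
  qed
  show ?thesis
    unfolding ex[of v] ex[of w]
    by (simp add: linear_sum[OF inner_formD(5)[OF assms]] linear_sum[OF inner_formD(6)[OF assms]]
      linear_cmul[OF inner_formD(5)[OF assms]] linear_cmul[OF inner_formD(6)[OF assms]]
      inner_vec_def matrix_vector_mult_def rank_gram_def sum_distrib_left mult.commute mult.left_commute)
      (rule sum.swap)
qed

text \<open>The determinant does not vanish along the segment from the identity to the Gram matrix.\<close>

lemma det_rank_gram_pos:
  fixes g :: "real ^ 'm::finite \<Rightarrow> real ^ 'm \<Rightarrow> real"
  assumes "inner_form g" shows "det (rank_gram g) > 0"
proof (rule ccontr)
  assume neg: "\<not> det (rank_gram g) > 0"
  define A :: "real \<Rightarrow> real ^ 'm ranked ^ 'm ranked" where "A t = (1 - t) *\<^sub>R mat 1 + t *\<^sub>R rank_gram g" for t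
  have c: "continuous_on {0..1} (\<lambda>t. det (A t))"
    unfolding det_def A_def by (intro continuous_intros)
  have "\<exists>t\<ge>0. t \<le> 1 \<and> det (A t) = 0"
    by (rule IVT2'[where f="\<lambda>t. det (A t)"]) (use neg c in \<open>auto simp: A_def det_I\<close>)
  then obtain t where t: "0 \<le> t" "t \<le> 1" "det (A t) = 0" by blast
  then obtain y where y: "A t *v y = 0" "y \<noteq> 0"
    using matrix_left_invertible_ker[of "A t"] invertible_det_nz[of "A t"] invertible_left_inverse by blast
  have "0 = y \<bullet> (A t *v y)" using y by simp
  also have "\<dots> = (1 - t) * (y \<bullet> y) + t * g (of_ranked y) (of_ranked y)"
    by (simp add: A_def matrix_vector_mult_add_rdistrib scaleR_matrix_vector_assoc[symmetric] inner_add_right rank_gram_mult[OF assms])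
  also have "\<dots> > 0"
  proof -
    have "of_ranked y \<noteq> 0" using y(2) ranked_inverse(2)[of y] linear_0[OF linear_ranked(1)] by metis
    then have "g (of_ranked y) (of_ranked y) > 0" "y \<bullet> y > 0" using inner_formD(3)[OF assms] y(2) by auto
    then show ?thesis using t by (cases "t = 0") (auto intro: add_nonneg_pos)
  qed
  finally show False by simp
qed

text \<open>The Gram matrix of \<open>g\<close> is that of \<open>g'\<close> multiplied by
  \<open>rank_matrix P\<close> on the right and by its transpose on the left.\<close>

lemma det_rank_gram_pullback:
  fixes g g' :: "real ^ 'm::finite \<Rightarrow> real ^ 'm \<Rightarrow> real"
  assumes "inner_form g" "inner_form g'" "linear P" "\<And>v w. g v w = g' (P v) (P w)"
  shows "det (rank_gram g) = (det (rank_matrix P))\<^sup>2 * det (rank_gram g')"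
proof -
  let ?P = "rank_matrix P"
  have "linear (\<lambda>y. to_ranked (P (of_ranked y)))"
    using linear_compose[OF linear_compose[OF linear_ranked(2) assms(3)] linear_ranked(1)] by (simp add: o_def)
  then have P: "?P *v y = to_ranked (P (of_ranked y))" for y
    unfolding rank_matrix_def by (simp add: matrix_works)
  have "rank_gram g *v y = (transpose ?P ** rank_gram g' ** ?P) *v y" for y
  proof (rule vector_eq_ldot[THEN iffD1, rule_format])
    fix z
    have "z \<bullet> (transpose ?P *v w) = (?P *v z) \<bullet> w" for w
      using dot_lmul_matrix[of w ?P z] by (simp add: inner_commute)
    then have "z \<bullet> ((transpose ?P ** rank_gram g' ** ?P) *v y) = (?P *v z) \<bullet> (rank_gram g' *v (?P *v y))"
      by (simp only: matrix_vector_mul_assoc[symmetric])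
    then show "z \<bullet> (rank_gram g *v y) = z \<bullet> ((transpose ?P ** rank_gram g' ** ?P) *v y)"
      by (simp add: rank_gram_mult assms(1,2) assms(4) P)
  qed
  then have "rank_gram g = transpose ?P ** rank_gram g' ** ?P" by (simp add: matrix_eq)
  then show ?thesis by (simp add: det_mul power2_eq_square)
qed

section \<open>The Riemannian volume\<close>

text \<open>The volume of one chart, pushed forward to the manifold. The density vanishes off
  \<open>chart_img M i\<close>, and the value \<open>undefined\<close> there turns
  \<open>param M i\<close> into a total Borel function.\<close>

definition chart_measure :: "('i, 'a::topological_space, 'e::euclidean_space) riem \<Rightarrow> 'i \<Rightarrow> 'a measure" where
  "chart_measure M i = distr (density lborel (\<lambda>x. ennreal (sqrt (gram_det M i x)) * indicator (chart_img M i) x)) borel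
     (\<lambda>x. if x \<in> chart_img M i then param M i x else undefined)"

context
  fixes M :: "('i, 'a::{t2_space,second_countable_topology}, 'e::euclidean_space) riem"
  assumes M: "riemannian_manifold M"
begin

lemma smooth_gram_det: "i \<in> idx M \<Longrightarrow> smooth_on (chart_img M i) (gram_det M i)"
  unfolding smooth_on_def gram_det_def[abs_def]
  by (intro allI Ck_on_sum Ck_on_mult Ck_on_const Ck_on_prod open_chart_img[OF M] smooth_onD[OF smooth_metric[OF M]])

lemma measurable_extend:
  fixes h :: "'e \<Rightarrow> 'b::topological_space"
  assumes "i \<in> idx M" "continuous_on (chart_img M i) h"
  shows "(\<lambda>x. if x \<in> chart_img M i then h x else c) \<in> borel_measurable borel"
proof -
  have "{x \<in> space borel. x \<in> chart_img M i} \<in> sets borel" using open_chart_img[OF M assms(1)] by simp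
  then show ?thesis
    by (rule measurable_If_restrict_space_iff[THEN iffD2])
       (auto intro!: borel_measurable_continuous_on_restrict simp: assms(2) )
qed

lemma measurable_param:
  "i \<in> idx M \<Longrightarrow> (\<lambda>x. if x \<in> chart_img M i then param M i x else undefined) \<in> borel \<rightarrow>\<^sub>M borel"
  by (rule measurable_extend[OF _ continuous_on_param[OF M]])

lemma measurable_density:
  assumes "i \<in> idx M"
  shows "(\<lambda>x. ennreal (sqrt (gram_det M i x)) * indicator (chart_img M i) x) \<in> borel_measurable borel"
proof -
  have "(\<lambda>x. if x \<in> chart_img M i then ennreal (sqrt (gram_det M i x)) else 0) \<in> borel_measurable borel"
    by (intro measurable_extend[OF assms] continuous_on_ennreal continuous_on_real_sqrt smooth_on_continuous[OF smooth_gram_det[OF assms]])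
  moreover have "(\<lambda>x. if x \<in> chart_img M i then ennreal (sqrt (gram_det M i x)) else 0)
      = (\<lambda>x. ennreal (sqrt (gram_det M i x)) * indicator (chart_img M i) x)"
    by (auto simp: indicator_def)
  ultimately show ?thesis by simp
qed

lemma chart_image_vimage:
  "i \<in> idx M \<Longrightarrow> A \<subseteq> chart_dom M i \<Longrightarrow> x \<in> chart M i ` A \<longleftrightarrow> x \<in> chart_img M i \<and> param M i x \<in> A"
  using param_chart[OF M] chart_param[OF M] by (auto simp: chart_img_def subset_iff intro: rev_image_eqI)

lemma chart_image_borel:
  assumes "i \<in> idx M" "A \<in> sets borel" "A \<subseteq> chart_dom M i"
  shows "chart M i ` A \<in> sets borel"
proof -
  have "chart M i ` A = ((\<lambda>x. if x \<in> chart_img M i then param M i x else undefined) -` A \<inter> space borel) \<inter> chart_img M i"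
    by (intro set_eqI, unfold chart_image_vimage[OF assms(1,3)]) auto
  then show ?thesis
    using measurable_sets[OF measurable_param[OF assms(1)] assms(2)] open_chart_img[OF M assms(1)] by auto
qed

lemma sets_chart_measure [simp]: "sets (chart_measure M i) = sets borel"
  by (simp add: chart_measure_def)

lemma nn_integral_chart_measure:
  assumes "i \<in> idx M" and F: "F \<in> borel_measurable borel"
  shows "(\<integral>\<^sup>+p. F p \<partial>chart_measure M i)
    = (\<integral>\<^sup>+x. ennreal (sqrt (gram_det M i x)) * F (param M i x) * indicator (chart_img M i) x \<partial>lborel)"
proof -
  have "(\<integral>\<^sup>+p. F p \<partial>chart_measure M i) = (\<integral>\<^sup>+x. ennreal (sqrt (gram_det M i x)) * indicator (chart_img M i) x *
      F (if x \<in> chart_img M i then param M i x else undefined) \<partial>lborel)"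
    unfolding chart_measure_def
    using measurable_param[OF assms(1)] measurable_density[OF assms(1)] F
    by (subst nn_integral_distr) (auto simp: nn_integral_density measurable_compose[OF _ F])
  also have "\<dots> = (\<integral>\<^sup>+x. ennreal (sqrt (gram_det M i x)) * F (param M i x) * indicator (chart_img M i) x \<partial>lborel)"
    by (rule nn_integral_cong) (auto simp: indicator_def)
  finally show ?thesis .
qed

lemma emeasure_chart_measure:
  assumes "i \<in> idx M" "A \<in> sets borel" "A \<subseteq> chart_dom M i"
  shows "emeasure (chart_measure M i) A = (\<integral>\<^sup>+x\<in>chart M i ` A. ennreal (sqrt (gram_det M i x)) \<partial>lborel)"
proof -
  have "emeasure (chart_measure M i) A = (\<integral>\<^sup>+p. indicator A p \<partial>chart_measure M i)"
    using assms(2) by simp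
  also have "\<dots> = (\<integral>\<^sup>+x. ennreal (sqrt (gram_det M i x)) * indicator A (param M i x) * indicator (chart_img M i) x \<partial>lborel)"
    by (rule nn_integral_chart_measure[OF assms(1)]) (use assms(2) in measurable)
  also have "\<dots> = (\<integral>\<^sup>+x\<in>chart M i ` A. ennreal (sqrt (gram_det M i x)) \<partial>lborel)"
    by (rule nn_integral_cong) (use chart_image_vimage[OF assms(1,3)] in \<open>auto simp: indicator_def\<close>)
  finally show ?thesis .
qed

lemma is_volume_iff:
  "is_volume M \<sigma> \<longleftrightarrow> sets \<sigma> = sets borel \<and>
    (\<forall>i\<in>idx M. \<forall>A\<in>sets borel. A \<subseteq> chart_dom M i \<longrightarrow> emeasure \<sigma> A = emeasure (chart_measure M i) A)"
  unfolding is_volume_def using emeasure_chart_measure by auto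

lemma emeasure_chart_measure_Int:
  assumes "i \<in> idx M" "A \<in> sets borel"
  shows "emeasure (chart_measure M i) A = emeasure (chart_measure M i) (A \<inter> chart_dom M i)"
proof -
  have [measurable]: "chart_dom M i \<in> sets borel" using open_chart_dom[OF M assms(1)] by simp
  have "(\<integral>\<^sup>+p. indicator A p \<partial>chart_measure M i) = (\<integral>\<^sup>+p. indicator (A \<inter> chart_dom M i) p \<partial>chart_measure M i)"
    using assms(2) param_in_dom[OF M assms(1)]
    by (subst (1 2) nn_integral_chart_measure[OF assms(1)]) (auto intro!: nn_integral_cong simp: indicator_def)
  then show ?thesis using assms by (simp add: nn_integral_indicator)
qed

text \<open>Turns integrals over a chart domain into integrals against a push-forward measure with
  density, for which substitution rules are at hand.\<close>

lemma volume_restrict_chart: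
  assumes \<sigma>: "is_volume M \<sigma>" and i: "i \<in> idx M"
  shows "density \<sigma> (indicator (chart_dom M i)) = chart_measure M i"
proof (rule measure_eqI)
  have s: "sets \<sigma> = sets borel" using \<sigma> by (simp add: is_volume_def)
  have d: "chart_dom M i \<in> sets borel" using open_chart_dom[OF M i] by simp
  then have d': "chart_dom M i \<in> sets \<sigma>" using s by simp
  fix A assume "A \<in> sets (density \<sigma> (indicator (chart_dom M i)))"
  then have A: "A \<in> sets borel" "A \<in> sets \<sigma>" using s by simp_all
  have "emeasure (density \<sigma> (indicator (chart_dom M i))) A = (\<integral>\<^sup>+p. indicator (chart_dom M i) p * indicator A p \<partial>\<sigma>)"
    by (rule emeasure_density) (use A d' in auto)
  also have "\<dots> = (\<integral>\<^sup>+p. indicator (A \<inter> chart_dom M i) p \<partial>\<sigma>)"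
    by (rule nn_integral_cong) (auto split: split_indicator)
  also have "\<dots> = emeasure \<sigma> (A \<inter> chart_dom M i)" by (rule nn_integral_indicator) (use A d' in auto)
  also have "\<dots> = emeasure (chart_measure M i) (A \<inter> chart_dom M i)"
    using \<sigma> i A d unfolding is_volume_iff by auto
  also have "\<dots> = emeasure (chart_measure M i) A"
    by (rule emeasure_chart_measure_Int[OF i A(1), symmetric])
  finally show "emeasure (density \<sigma> (indicator (chart_dom M i))) A = emeasure (chart_measure M i) A" .
qed (use \<sigma> in \<open>simp add: is_volume_def\<close>)

lemma nn_integral_volume_chart:
  assumes \<sigma>: "is_volume M \<sigma>" and i: "i \<in> idx M" and F: "F \<in> borel_measurable borel"
  shows "(\<integral>\<^sup>+p\<in>chart_dom M i. F p \<partial>\<sigma>)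
    = (\<integral>\<^sup>+x\<in>chart_img M i. ennreal (sqrt (gram_det M i x)) * F (param M i x) \<partial>lborel)"
proof -
  have s: "sets \<sigma> = sets borel" using \<sigma> by (simp add: is_volume_def)
  have d: "chart_dom M i \<in> sets \<sigma>" using open_chart_dom[OF M i] s by simp
  have F': "F \<in> borel_measurable \<sigma>" using F s by (simp cong: measurable_cong_sets)
  have "(\<integral>\<^sup>+p\<in>chart_dom M i. F p \<partial>\<sigma>) = (\<integral>\<^sup>+p. F p \<partial>density \<sigma> (indicator (chart_dom M i)))"
    using d F' by (subst nn_integral_density) (auto simp: mult.commute)
  then show ?thesis
    unfolding volume_restrict_chart[OF \<sigma> i] nn_integral_chart_measure[OF i F] .
qed

lemma integral_volume_chart:
  assumes \<sigma>: "is_volume M \<sigma>" and i: "i \<in> idx M" and F: "F \<in> borel_measurable borel"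
    and g: "\<And>x. x \<in> chart_img M i \<Longrightarrow> gram_det M i x \<ge> 0"
  shows "(LINT p:chart_dom M i|\<sigma>. F p) = (LINT x:chart_img M i|lborel. sqrt (gram_det M i x) * F (param M i x))"
proof -
  have s: "sets \<sigma> = sets borel" using \<sigma> by (simp add: is_volume_def)
  have d: "chart_dom M i \<in> sets \<sigma>" using open_chart_dom[OF M i] s by simp
  have F': "F \<in> borel_measurable \<sigma>" using F s by (simp cong: measurable_cong_sets)
  let ?w = "\<lambda>x. sqrt (gram_det M i x) * indicator (chart_img M i) x"
  let ?h = "\<lambda>x. if x \<in> chart_img M i then param M i x else undefined"
  have w: "(\<lambda>x. ennreal (?w x)) = (\<lambda>x. ennreal (sqrt (gram_det M i x)) * indicator (chart_img M i) x)"
    by (auto simp: indicator_def)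
  have wm: "?w \<in> borel_measurable borel"
  proof -
    have "(\<lambda>x. if x \<in> chart_img M i then sqrt (gram_det M i x) else 0) \<in> borel_measurable borel"
      by (intro measurable_extend[OF i] continuous_on_real_sqrt smooth_on_continuous[OF smooth_gram_det[OF i]])
    moreover have "(\<lambda>x. if x \<in> chart_img M i then sqrt (gram_det M i x) else 0) = ?w" by (auto simp: indicator_def)
    ultimately show ?thesis by simp
  qed
  have hm: "?h \<in> borel \<rightarrow>\<^sub>M borel" by (rule measurable_param[OF i])
  have Fh: "(\<lambda>x. F (?h x)) \<in> borel_measurable borel" by (rule measurable_compose[OF hm F])
  have "(LINT p:chart_dom M i|\<sigma>. F p) = (LINT p|density \<sigma> (indicator (chart_dom M i)). F p)"
    unfolding set_lebesgue_integral_def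
    using d F' by (subst integral_density[where g="indicator (chart_dom M i)", symmetric]) (auto simp: ennreal_indicator)
  also have "\<dots> = (LINT x|density lborel (\<lambda>x. ennreal (?w x)). F (?h x))"
    unfolding volume_restrict_chart[OF \<sigma> i] chart_measure_def w
    by (rule integral_distr) (use hm F in auto)
  also have "\<dots> = (LINT x|lborel. ?w x *\<^sub>R F (?h x))"
    by (rule integral_density) (use wm Fh g in \<open>auto simp: indicator_def\<close>)
  also have "\<dots> = (LINT x:chart_img M i|lborel. sqrt (gram_det M i x) * F (param M i x))"
    unfolding set_lebesgue_integral_def
    by (rule Bochner_Integration.integral_cong) (auto simp: indicator_def)
  finally show ?thesis .
qed

text \<open>In a chart a nonempty open set stays open and nonempty, hence is not negligible, and the
  density is positive on it.\<close>

lemma emeasure_volume_open_pos: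
  assumes \<sigma>: "is_volume M \<sigma>" and g: "\<And>i x. i \<in> idx M \<Longrightarrow> x \<in> chart_img M i \<Longrightarrow> gram_det M i x > 0"
    and U: "open U" "p \<in> U"
  shows "emeasure \<sigma> U \<noteq> 0"
proof
  assume z: "emeasure \<sigma> U = 0"
  define i where "i = chart_at M p"
  have i: "i \<in> idx M" and p: "p \<in> chart_dom M i" using chart_at[OF M] by (auto simp: i_def)
  define V where "V = U \<inter> chart_dom M i"
  have V: "open V" "V \<subseteq> chart_dom M i" "p \<in> V" using U p open_chart_dom[OF M i] by (auto simp: V_def)
  have s: "sets \<sigma> = sets borel" using \<sigma> by (simp add: is_volume_def)
  have "emeasure \<sigma> V \<le> emeasure \<sigma> U" using U s by (intro emeasure_mono) (auto simp: V_def)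
  then have "(\<integral>\<^sup>+x\<in>chart M i ` V. ennreal (sqrt (gram_det M i x)) \<partial>lborel) = 0"
    using z \<sigma> i V unfolding is_volume_def by auto
  moreover have o: "open (chart M i ` V)" by (rule open_chart_image[OF M i V(1,2)])
  have sub: "chart M i ` V \<subseteq> chart_img M i" using V(2) by (auto simp: chart_img_def)
  have "(\<lambda>x. ennreal (sqrt (gram_det M i x)) * indicator (chart M i ` V) x)
      = (\<lambda>x. (ennreal (sqrt (gram_det M i x)) * indicator (chart_img M i) x) * indicator (chart M i ` V) x)"
    by (intro ext) (use sub in \<open>auto split: split_indicator\<close>)
  then have "(\<lambda>x. ennreal (sqrt (gram_det M i x)) * indicator (chart M i ` V) x) \<in> borel_measurable lborel"
    using measurable_density[OF i] o by auto
  ultimately have "AE x in lborel. ennreal (sqrt (gram_det M i x)) * indicator (chart M i ` V) x = 0"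
    by (simp add: nn_integral_0_iff_AE)
  then have "AE x in lborel. x \<notin> chart M i ` V"
    by eventually_elim (use g[OF i] sub in \<open>auto simp: indicator_def ennreal_eq_0_iff not_le[symmetric] split: if_splits\<close>)
  then have "emeasure lborel (chart M i ` V) = 0"
    using o by (subst (asm) AE_iff_measurable[OF _ refl]) auto
  then have "negligible (chart M i ` V)" using o by (simp add: negligible_iff_null_sets null_sets_completionI null_setsI)
  then show False using open_not_negligible[OF o] V(3) by auto
qed

text \<open>The set where \<open>F\<close> differs from 0 is open, and nonempty open sets have
  positive volume.\<close>

lemma continuous_AE_eq_0:
  fixes F :: "'a \<Rightarrow> real"
  assumes \<sigma>: "is_volume M \<sigma>" and g: "\<And>i x. i \<in> idx M \<Longrightarrow> x \<in> chart_img M i \<Longrightarrow> gram_det M i x > 0"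
    and F: "continuous_on UNIV F" "AE p in \<sigma>. F p = 0"
  shows "F p = 0"
proof (rule ccontr)
  assume "F p \<noteq> 0"
  define U where "U = {q. F q \<noteq> 0}"
  have o: "open U" unfolding U_def using F(1) by (intro open_Collect_neq continuous_on_const)
  have s: "sets \<sigma> = sets borel" using \<sigma> by (simp add: is_volume_def)
  have "space \<sigma> = UNIV" using sets_eq_imp_space_eq[OF s] by simp
  then have "emeasure \<sigma> U = 0"
    using F(2) o s AE_iff_measurable[of U \<sigma> "\<lambda>p. F p = 0"] by (auto simp: U_def)
  then show False using emeasure_volume_open_pos[OF \<sigma> g o] \<open>F p \<noteq> 0\<close> by (simp add: U_def)
qed

section \<open>Uniqueness and existence of the volume measure\<close>

lemma volume_unique:
  assumes I: "finite I" "I \<subseteq> idx M" "(\<Union>i\<in>I. chart_dom M i) = UNIV"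
    and \<sigma>: "is_volume M \<sigma>" and \<tau>: "is_volume M \<tau>"
  shows "\<sigma> = \<tau>"
proof (rule measure_eqI)
  have s: "sets \<sigma> = sets borel" "sets \<tau> = sets borel" using \<sigma> \<tau> by (auto simp: is_volume_def)
  then show "sets \<sigma> = sets \<tau>" by simp
  have "emeasure \<sigma> (A \<inter> (\<Union>i\<in>J. chart_dom M i)) = emeasure \<tau> (A \<inter> (\<Union>i\<in>J. chart_dom M i))"
    if "A \<in> sets borel" "finite J" "J \<subseteq> I" for A J
    using that(2,1,3)
  proof (induction J arbitrary: A rule: finite_induct)
    case (insert j J)
    define U where "U = (\<Union>i\<in>J. chart_dom M i)"
    have j: "j \<in> idx M" using insert I by auto
    have U: "U \<in> sets borel" unfolding U_def
      using insert I open_chart_dom[OF M] by (intro borel_open open_UN) auto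
    have dj: "chart_dom M j \<in> sets borel" using open_chart_dom[OF M j] by simp
    \<comment> \<open>What lies outside the charts already treated is contained in chart
      \<open>j\<close>, where the measure is prescribed.\<close>
    have e: "A \<inter> (\<Union>i\<in>insert j J. chart_dom M i) = (A \<inter> U) \<union> (A \<inter> chart_dom M j - U)" by (auto simp: U_def)
    have sub: "A \<inter> chart_dom M j - U \<subseteq> chart_dom M j" by auto
    have "emeasure \<rho> (A \<inter> (\<Union>i\<in>insert j J. chart_dom M i)) = emeasure \<rho> (A \<inter> U) + emeasure (chart_measure M j) (A \<inter> chart_dom M j - U)"
      if "is_volume M \<rho>" for \<rho>
    proof -
      have "emeasure \<rho> (A \<inter> (\<Union>i\<in>insert j J. chart_dom M i)) = emeasure \<rho> (A \<inter> U) + emeasure \<rho> (A \<inter> chart_dom M j - U)"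
        unfolding e using that U dj insert.prems
        by (intro plus_emeasure[symmetric]) (auto simp: is_volume_def)
      then show ?thesis using that j U dj insert.prems sub unfolding is_volume_iff by auto
    qed
    then show ?case using \<sigma> \<tau> insert by (auto simp: U_def)
  qed simp
  from this[OF _ I(1)] show "emeasure \<sigma> A = emeasure \<tau> A" if "A \<in> sets \<sigma>" for A
    using that I(3) s by auto
qed

text \<open>\<open>volume\<close> is a definite description, so exhibiting one measure with the
  defining property evaluates it.\<close>

lemma volume_eqI:
  assumes I: "finite I" "I \<subseteq> idx M" "(\<Union>i\<in>I. chart_dom M i) = UNIV" and \<sigma>: "is_volume M \<sigma>"
  shows "volume M = \<sigma>"
  unfolding volume_def using volume_unique[OF I _ \<sigma>] \<sigma> by blast

text \<open>A compatible family of chart measures is glued along the disjointed cover by finitely many charts.\<close>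

lemma volume_exists:
  assumes I: "finite I" "I \<subseteq> idx M" "(\<Union>i\<in>I. chart_dom M i) = UNIV"
    and compat: "\<And>i j A. i \<in> idx M \<Longrightarrow> j \<in> idx M \<Longrightarrow> A \<in> sets borel \<Longrightarrow> A \<subseteq> chart_dom M i \<inter> chart_dom M j \<Longrightarrow>
      emeasure (chart_measure M i) A = emeasure (chart_measure M j) A"
  shows "\<exists>\<sigma>. is_volume M \<sigma>"
proof -
  have "\<exists>D. (\<forall>i\<in>J. D i \<in> sets borel \<and> D i \<subseteq> chart_dom M i) \<and> disjoint_family_on D J \<and> (\<Union>i\<in>J. D i) = (\<Union>i\<in>J. chart_dom M i)"
    if "finite J" "J \<subseteq> I" for J
    using that
  proof (induction J rule: finite_induct)
    case (insert j J)
    then obtain D where D: "\<forall>i\<in>J. D i \<in> sets borel \<and> D i \<subseteq> chart_dom M i" "disjoint_family_on D J" "(\<Union>i\<in>J. D i) = (\<Union>i\<in>J. chart_dom M i)"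
      by auto
    define E where "E = D(j := chart_dom M j - (\<Union>i\<in>J. D i))"
    have "j \<in> idx M" using insert I by auto
    moreover have "(\<Union>i\<in>J. D i) \<in> sets borel" using D(1) insert(1) by (intro sets.finite_UN) auto
    ultimately have "E j \<in> sets borel" using open_chart_dom[OF M] by (simp add: E_def sets.Diff)
    moreover have "disjoint_family_on E (insert j J)"
      using D(2) insert(2) by (auto simp: E_def disjoint_family_on_def)
    moreover have "(\<Union>i\<in>insert j J. E i) = (\<Union>i\<in>insert j J. chart_dom M i)"
    proof -
      have "(\<Union>i\<in>J. E i) = (\<Union>i\<in>J. D i)" using insert(2) by (auto simp: E_def)
      then show ?thesis using D(3) by (auto simp: E_def)
    qed
    moreover have "\<forall>i\<in>J. E i \<in> sets borel \<and> E i \<subseteq> chart_dom M i" "E j \<subseteq> chart_dom M j"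
      using D(1) insert(2) by (auto simp: E_def)
    ultimately show ?case by blast
  qed (auto simp: disjoint_family_on_def)
  then obtain D where D: "\<And>i. i \<in> I \<Longrightarrow> D i \<in> sets borel" "\<And>i. i \<in> I \<Longrightarrow> D i \<subseteq> chart_dom M i"
    "disjoint_family_on D I" "(\<Union>i\<in>I. D i) = UNIV" using I by (metis order_refl)
  define \<mu> where "\<mu> A = (\<Sum>i\<in>I. emeasure (chart_measure M i) (A \<inter> D i))" for A
  define \<sigma> where "\<sigma> = measure_of UNIV (sets borel) \<mu>"
  have ca: "countably_additive (sets borel) \<mu>"
  proof (rule countably_additiveI)
    fix A :: "nat \<Rightarrow> 'a set" assume A: "range A \<subseteq> sets borel" "disjoint_family A" "(\<Union>n. A n) \<in> sets borel"
    have "(\<lambda>n. \<mu> (A n)) sums \<mu> (\<Union>n. A n)"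
      unfolding \<mu>_def
    proof (rule sums_sum)
      fix i assume i: "i \<in> I"
      have "(\<lambda>n. emeasure (chart_measure M i) (A n \<inter> D i)) sums emeasure (chart_measure M i) (\<Union>n. A n \<inter> D i)"
        using A D(1)[OF i] by (intro sums_emeasure) (auto simp: disjoint_family_on_def)
      then show "(\<lambda>n. emeasure (chart_measure M i) (A n \<inter> D i)) sums emeasure (chart_measure M i) ((\<Union>n. A n) \<inter> D i)"
        by (simp only: UN_simps)
    qed
    then show "(\<Sum>n. \<mu> (A n)) = \<mu> (\<Union>n. A n)" by (rule sums_unique[symmetric])
  qed
  have e\<sigma>: "emeasure \<sigma> A = \<mu> A" if "A \<in> sets borel" for A
    unfolding \<sigma>_def
    by (rule emeasure_measure_of_sigma[OF _ _ ca that])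
       (auto simp: positive_def \<mu>_def sets.sigma_algebra_axioms[of borel, simplified])
  have s\<sigma>: "sets \<sigma> = sets borel"
    unfolding \<sigma>_def using sets.sigma_sets_eq[of "borel :: 'a measure"] by simp
  have "emeasure \<sigma> A = emeasure (chart_measure M j) A" if j: "j \<in> idx M" and A: "A \<in> sets borel" "A \<subseteq> chart_dom M j" for j A
  proof -
    \<comment> \<open>\<open>A \<inter> D i\<close> lies in both charts, so by compatibility the
      measure of chart \<open>i\<close> may be replaced by that of chart \<open>j\<close>.\<close>
    have "emeasure \<sigma> A = (\<Sum>i\<in>I. emeasure (chart_measure M j) (A \<inter> D i))"
      unfolding e\<sigma>[OF A(1)] \<mu>_def
      using I(2) D(1,2) A j by (intro sum.cong refl compat) blast+
    also have "\<dots> = emeasure (chart_measure M j) (\<Union>i\<in>I. A \<inter> D i)"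
    proof (rule sum_emeasure)
      show "disjoint_family_on (\<lambda>i. A \<inter> D i) I" using D(3) unfolding disjoint_family_on_def by blast
    qed (use D A I(1) in auto)
    also have "(\<Union>i\<in>I. A \<inter> D i) = A" using D(4) by auto
    finally show ?thesis .
  qed
  then show ?thesis using s\<sigma> unfolding is_volume_iff by blast
qed

lemma continuous_on_chartwise:
  fixes F :: "'a \<Rightarrow> 'b::topological_space"
  assumes "\<And>i. i \<in> idx M \<Longrightarrow> continuous_on (chart_dom M i) F"
  shows "continuous_on UNIV F"
proof -
  have "(\<Union>i\<in>idx M. chart_dom M i) = UNIV" using M by (simp add: riemannian_manifold_def)
  moreover have "continuous_on (\<Union>i\<in>idx M. chart_dom M i) F"
    by (rule continuous_on_open_UN) (use assms open_chart_dom[OF M] in auto)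
  ultimately show ?thesis by simp
qed

lemma smooth_function_continuous:
  assumes "smooth_function M f" shows "continuous_on UNIV f"
proof (rule continuous_on_chartwise)
  fix i assume i: "i \<in> idx M"
  then have sm: "smooth_on (chart_img M i) (f \<circ> param M i)" using assms by (simp add: smooth_function_def)
  have "continuous_on (chart_dom M i) (\<lambda>p. (f \<circ> param M i) (chart M i p))"
    by (rule continuous_on_compose2[OF smooth_on_continuous[OF sm] continuous_on_chart[OF M i]])
       (use chart_in_img[OF M] in auto)
  then show "continuous_on (chart_dom M i) f" using param_chart[OF M i] by (simp cong: continuous_on_cong)
qed

lemma smooth_function_mult:
  assumes "smooth_function M f" "smooth_function M g" shows "smooth_function M (\<lambda>p. f p * g p)"
  unfolding smooth_function_def smooth_on_def o_def
proof (intro ballI allI)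
  fix i k assume i: "i \<in> idx M"
  then have "Ck_on k (f \<circ> param M i) (chart_img M i)" "Ck_on k (g \<circ> param M i) (chart_img M i)"
    using assms by (auto simp: smooth_function_def smooth_on_def)
  from Ck_on_mult[OF open_chart_img[OF M i] this]
  show "Ck_on k (\<lambda>x. f (param M i x) * g (param M i x)) (chart_img M i)" by simp
qed

end

section \<open>The volume of a closed manifold\<close>

context
  fixes Z :: "('i, 'a::{t2_space,second_countable_topology}, real ^ 'm::finite) riem"
  assumes Z: "closed_riemannian_manifold Z"
begin

lemma closed_riemannian: "riemannian_manifold Z" and compact_UNIV: "compact (UNIV :: 'a set)"
  using Z by (auto simp: closed_riemannian_manifold_def)

lemma finite_chart_cover: "\<exists>I. finite I \<and> I \<subseteq> idx Z \<and> (\<Union>i\<in>I. chart_dom Z i) = UNIV"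
proof -
  have "UNIV \<subseteq> (\<Union>i\<in>idx Z. chart_dom Z i)" using closed_riemannian by (simp add: riemannian_manifold_def)
  from compactE_image[OF compact_UNIV open_chart_dom[OF closed_riemannian] this]
  obtain I where "I \<subseteq> idx Z" "finite I" "UNIV \<subseteq> (\<Union>i\<in>I. chart_dom Z i)" by metis
  then show ?thesis by blast
qed

lemma gram_det_pos: "i \<in> idx Z \<Longrightarrow> x \<in> chart_img Z i \<Longrightarrow> gram_det Z i x > 0"
  unfolding gram_det_eq by (intro det_rank_gram_pos inner_form_metric[OF closed_riemannian])

lemma sqrt_gram_det_transition:
  assumes ij: "i \<in> idx Z" "j \<in> idx Z" and x: "x \<in> overlap Z i j"
  shows "sqrt (gram_det Z i x)
    = \<bar>det (rank_matrix (\<lambda>v. pd v (transition Z i j) x))\<bar> * sqrt (gram_det Z j (transition Z i j x))"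
proof -
  have xi: "x \<in> chart_img Z i" by (rule subsetD[OF overlap_subset x])
  have "gram_det Z i x = (det (rank_matrix (\<lambda>v. pd v (transition Z i j) x)))\<^sup>2 * gram_det Z j (transition Z i j x)"
    unfolding gram_det_eq
    by (rule det_rank_gram_pullback[OF inner_form_metric[OF closed_riemannian ij(1) xi]
      inner_form_metric[OF closed_riemannian ij(2) transition_img[OF closed_riemannian ij x]]
      linear_pd_transition[OF closed_riemannian ij x] metric_transition[OF closed_riemannian ij x]])
  then show ?thesis by (simp add: real_sqrt_mult)
qed

text \<open>Change of variables along the transition map, whose Jacobian is exactly the ratio of the
  two densities.\<close>

lemma chart_measure_compatible:
  assumes ij: "i \<in> idx Z" "j \<in> idx Z" and A: "A \<in> sets borel" "A \<subseteq> chart_dom Z i \<inter> chart_dom Z j"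
  shows "emeasure (chart_measure Z i) A = emeasure (chart_measure Z j) A"
proof -
  note R = closed_riemannian
  define S where "S = chart Z i ` A"
  define g where "g = transition Z i j"
  \<comment> \<open>Cut off to the chart image: elsewhere \<open>gram_det\<close> may be negative,
    and \<open>sqrt\<close> with it, whereas the change of variables is for nonnegative
    functions.\<close>
  define f where "f y = (if y \<in> chart_img Z j then sqrt (gram_det Z j y) else 0)" for y
  have S: "S \<in> sets borel" unfolding S_def by (rule chart_image_borel[OF R ij(1) A(1)]) (use A in auto)
  have Sov: "S \<subseteq> overlap Z i j" using A by (auto simp: S_def overlap_def)
  then have Si: "S \<subseteq> chart_img Z i" using overlap_subset by (rule subset_trans)
  have gS: "g ` S = chart Z j ` A"
    using A transition_chart[OF R ij(1)] by (force simp: g_def S_def image_image subset_iff)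
  have gSb: "g ` S \<in> sets borel" unfolding gS by (rule chart_image_borel[OF R ij(2) A(1)]) (use A in auto)
  have gSj: "g ` S \<subseteq> chart_img Z j" unfolding gS using A by (auto simp: chart_img_def)
  have eq: "\<bar>det (rank_matrix (frechet_derivative g (at x)))\<bar> * f (g x) = sqrt (gram_det Z i x)" if "x \<in> S" for x
    using sqrt_gram_det_transition[OF ij, of x] that Sov gSj by (auto simp: g_def f_def)
  have ext: "(\<lambda>x. indicator T x * sqrt (gram_det Z k x)) \<in> borel_measurable borel"
    if "k \<in> idx Z" "T \<in> sets borel" "T \<subseteq> chart_img Z k" for T k
  proof -
    have "(\<lambda>x. if x \<in> chart_img Z k then sqrt (gram_det Z k x) else 0) \<in> borel_measurable borel"
      by (intro measurable_extend[OF R that(1)] continuous_on_real_sqrt smooth_on_continuous[OF smooth_gram_det[OF R that(1)]])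
    then have "(\<lambda>x. indicator T x * (if x \<in> chart_img Z k then sqrt (gram_det Z k x) else 0)) \<in> borel_measurable borel"
      using that(2) by measurable
    moreover have "(\<lambda>x. indicator T x * (if x \<in> chart_img Z k then sqrt (gram_det Z k x) else 0)) = (\<lambda>x. indicator T x * sqrt (gram_det Z k x))"
      using that(3) by (intro ext) (auto simp: indicator_def)
    ultimately show ?thesis by simp
  qed
  have inj: "inj_on g S"
  proof (rule inj_on_inverseI)
    show "transition Z j i (g x) = x" if "x \<in> S" for x
      unfolding g_def by (rule transition_inverse[OF R ij subsetD[OF Sov that]])
  qed
  have der: "(g has_derivative frechet_derivative g (at x)) (at x)" if "x \<in> S" for x
    unfolding g_def by (rule transition_has_derivative[OF R ij]) (use that Sov in auto)
  have e1: "indicator S x * (\<bar>det (rank_matrix (frechet_derivative g (at x)))\<bar> * f (g x)) = indicator S x * sqrt (gram_det Z i x)" for x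
    using eq[of x] by (auto simp: indicator_def)
  have e2: "indicator (g ` S) y * f y = indicator (g ` S) y * sqrt (gram_det Z j y)" for y
    using gSj by (auto simp: f_def indicator_def)
  have "(\<integral>\<^sup>+x. ennreal (indicator S x * (\<bar>det (rank_matrix (frechet_derivative g (at x)))\<bar> * f (g x))) \<partial>lborel)
    = (\<integral>\<^sup>+y. ennreal (indicator (g ` S) y * f y) \<partial>lborel)"
  proof (rule nn_integral_change_of_variables[OF S gSb der inj])
    show "f y \<ge> 0" for y using gram_det_pos[OF ij(2)] by (auto simp: f_def less_imp_le)
    show "(\<lambda>x. indicator S x * (\<bar>det (rank_matrix (frechet_derivative g (at x)))\<bar> * f (g x))) \<in> borel_measurable borel"
      unfolding e1 by (rule ext[OF ij(1) S Si])
    show "(\<lambda>y. indicator (g ` S) y * f y) \<in> borel_measurable borel"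
      unfolding e2 by (rule ext[OF ij(2) gSb gSj])
  qed
  then have main: "(\<integral>\<^sup>+x. ennreal (indicator S x * sqrt (gram_det Z i x)) \<partial>lborel)
    = (\<integral>\<^sup>+y. ennreal (indicator (g ` S) y * sqrt (gram_det Z j y)) \<partial>lborel)"
    unfolding e1 e2 .
  have "emeasure (chart_measure Z k) A = (\<integral>\<^sup>+x. ennreal (indicator (chart Z k ` A) x * sqrt (gram_det Z k x)) \<partial>lborel)"
    if "k \<in> idx Z" "A \<subseteq> chart_dom Z k" for k
    unfolding emeasure_chart_measure[OF R that(1) A(1) that(2)]
    by (rule nn_integral_cong) (auto simp: indicator_def)
  then show ?thesis using main ij A unfolding S_def[symmetric] gS by (auto simp: S_def)
qed

lemma is_volume_volume: "is_volume Z (volume Z)"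
proof -
  obtain I where I: "finite I" "I \<subseteq> idx Z" "(\<Union>i\<in>I. chart_dom Z i) = UNIV" using finite_chart_cover by blast
  obtain \<sigma> where "is_volume Z \<sigma>"
    using volume_exists[OF closed_riemannian I chart_measure_compatible] by blast
  then show ?thesis using volume_eqI[OF closed_riemannian I] by simp
qed

lemma sets_volume [simp, measurable_cong]: "sets (volume Z) = sets borel"
  using is_volume_volume by (simp add: is_volume_def)

lemma space_volume [simp]: "space (volume Z) = UNIV"
  using sets_eq_imp_space_eq[OF sets_volume] by simp

lemma chart_box:
  assumes "i \<in> idx Z" "p \<in> chart_dom Z i"
  obtains l r where "chart Z i p \<in> box l r" "cbox l r \<subseteq> chart_img Z i"
proof -
  have "open (chart_img Z i)" "chart Z i p \<in> chart_img Z i"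
    using open_chart_img[OF closed_riemannian assms(1)] chart_in_img[OF closed_riemannian assms(2)] by auto
  then show ?thesis using that open_contains_cbox by metis
qed

lemma open_chart_vimage_box:
  assumes "i \<in> idx Z" "open V" "V \<subseteq> chart_img Z i"
  shows "open {p \<in> chart_dom Z i. chart Z i p \<in> V}"
  using continuous_open_preimage[OF continuous_on_chart[OF closed_riemannian assms(1)] open_chart_dom[OF closed_riemannian assms(1)] assms(2)]
  by (simp add: vimage_def Int_def)

text \<open>Every point has a neighbourhood of finite volume, the density being bounded on a closed
  box, and finitely many of these cover the manifold.\<close>

lemma finite_measure_volume: "finite_measure (volume Z)"
proof
  note R = closed_riemannian
  have "\<exists>U. open U \<and> p \<in> U \<and> emeasure (volume Z) U < \<infinity>" for p
  proof -
    define i where "i = chart_at Z p"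
    have i: "i \<in> idx Z" "p \<in> chart_dom Z i" using chart_at[OF R] by (auto simp: i_def)
    obtain l r where lr: "chart Z i p \<in> box l r" "cbox l r \<subseteq> chart_img Z i" using chart_box[OF i] .
    define U where "U = {q \<in> chart_dom Z i. chart Z i q \<in> box l r}"
    have bi: "box l r \<subseteq> chart_img Z i" using lr(2) box_subset_cbox by blast
    have U: "open U" "p \<in> U" "U \<subseteq> chart_dom Z i"
      unfolding U_def using i lr open_chart_vimage_box[OF i(1) open_box bi] by auto
    have cU: "chart Z i ` U \<subseteq> cbox l r" using box_subset_cbox by (auto simp: U_def)
    have "continuous_on (cbox l r) (\<lambda>x. sqrt (gram_det Z i x))"
      by (intro continuous_on_real_sqrt continuous_on_subset[OF smooth_on_continuous[OF smooth_gram_det[OF R i(1)]] lr(2)])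
    then have "bounded ((\<lambda>x. sqrt (gram_det Z i x)) ` cbox l r)"
      by (intro compact_imp_bounded compact_continuous_image compact_cbox)
    then obtain C where C: "\<And>x. x \<in> cbox l r \<Longrightarrow> \<bar>sqrt (gram_det Z i x)\<bar> \<le> C" unfolding bounded_iff by auto
    have "emeasure (volume Z) U = (\<integral>\<^sup>+x\<in>chart Z i ` U. ennreal (sqrt (gram_det Z i x)) \<partial>lborel)"
      using is_volume_volume i U unfolding is_volume_def by auto
    also have "\<dots> \<le> (\<integral>\<^sup>+x\<in>cbox l r. ennreal C \<partial>lborel)"
      by (rule nn_integral_mono) (use cU C in \<open>auto simp: indicator_def intro!: ennreal_leI dest: abs_le_D1\<close>)
    also have "\<dots> = ennreal C * emeasure lborel (cbox l r)" by (rule nn_integral_cmult_indicator) simp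
    also have "\<dots> < \<infinity>" using emeasure_lborel_cbox_finite[of l r] by (simp add: ennreal_mult_less_top)
    finally show ?thesis using U by blast
  qed
  then obtain U where U: "\<And>p. open (U p)" "\<And>p. p \<in> U p" "\<And>p. emeasure (volume Z) (U p) < \<infinity>" by metis
  obtain C where C: "finite C" "UNIV \<subseteq> (\<Union>p\<in>C. U p)"
    using compactE_image[OF compact_UNIV, of UNIV U] U(1,2) by (metis UNIV_I UN_iff subsetI)
  have "emeasure (volume Z) (\<Union>p\<in>C. U p) \<le> (\<Sum>p\<in>C. emeasure (volume Z) (U p))"
    by (rule emeasure_subadditive_finite) (use C U(1) in auto)
  also have "\<dots> < \<infinity>" using C(1) U(3) by (auto simp: less_top)
  finally have "emeasure (volume Z) UNIV < \<infinity>" using C(2) by (simp add: top.extremum_unique)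
  then show "emeasure (volume Z) (space (volume Z)) \<noteq> \<infinity>" by simp
qed

end

section \<open>The cylinder\<close>

lemma cylinder_simps [simp]:
  "idx (cylinder Z) = idx Z" "chart_dom (cylinder Z) i = chart_dom Z i \<times> UNIV"
  "chart (cylinder Z) i (z, t) = (chart Z i z, t)"
  "metric (cylinder Z) i (x, t) (v, a) (w, b) = metric Z i x v w + a * b"
  by (simp_all add: cylinder_def)

lemma cylinder_fst_snd:
  "chart (cylinder Z) i p = (chart Z i (fst p), snd p)"
  "metric (cylinder Z) i y v w = metric Z i (fst y) (fst v) (fst w) + snd v * snd w"
  by (simp_all add: cylinder_def split: prod.splits)

lemma chart_img_cylinder [simp]: "chart_img (cylinder Z) i = chart_img Z i \<times> UNIV"
  by (force simp: chart_img_def)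

lemma overlap_cylinder [simp]: "overlap (cylinder Z) i j = overlap Z i j \<times> UNIV"
  by (force simp: overlap_def)

lemma chart_at_cylinder [simp]: "chart_at (cylinder Z) (z, t) = chart_at Z z"
  by (simp add: chart_at_def)

lemma param_cylinder:
  assumes "riemannian_manifold Z" "i \<in> idx Z" "x \<in> chart_img Z i"
  shows "param (cylinder Z) i (x, t) = (param Z i x, t)"
  unfolding param_def[of "cylinder Z"]
proof (rule inv_into_f_eq)
  show "inj_on (chart (cylinder Z) i) (chart_dom (cylinder Z) i)"
    by (rule inj_on_inverseI[where g="\<lambda>(x, t). (param Z i x, t)"]) (use param_chart[OF assms(1,2)] in auto)
qed (use assms param_in_dom chart_param in auto)

lemma transition_cylinder:
  assumes "riemannian_manifold Z" "i \<in> idx Z" "j \<in> idx Z" "x \<in> overlap Z i j"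
  shows "transition (cylinder Z) i j (x, t) = (transition Z i j x, t)"
  using param_cylinder[OF assms(1,2) subsetD[OF overlap_subset assms(4)]] by (simp add: transition_def)

lemma has_derivative_of_fst:
  fixes f :: "'e::euclidean_space \<Rightarrow> 'f::real_normed_vector" and F :: "'e \<times> real \<Rightarrow> 'f"
  assumes "open V" "x \<in> V" "f differentiable (at x)" "\<And>y s. y \<in> V \<Longrightarrow> F (y, s) = f y"
  shows "(F has_derivative (\<lambda>v. pd (fst v) f x)) (at (x, t))"
proof -
  have fst': "(fst has_derivative fst) (at (x, t))"
    by (rule bounded_linear_imp_has_derivative[OF bounded_linear_fst])
  have "((\<lambda>p. f (fst p)) has_derivative (\<lambda>v. pd (fst v) f x)) (at (x, t))"
    using has_derivative_frechet_compose[OF fst', of f] assms(3) by simp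
  then show ?thesis
    by (rule has_derivative_transform_within_open[where s="V \<times> UNIV"]) (use assms in \<open>auto simp: open_Times\<close>)
qed

lemma Ck_on_fst:
  assumes "Ck_on k f V" "open V" shows "Ck_on k (\<lambda>p. f (fst p)) (V \<times> (UNIV :: real set))"
  by (rule Ck_on_inner_linear[OF bounded_linear_fst _ assms(1)]) (use assms(2) in \<open>auto simp: open_Times\<close>)

context
  fixes Z :: "('i, 'a::{t2_space,second_countable_topology}, 'e::euclidean_space) riem"
  assumes R: "riemannian_manifold Z"
begin

lemma pd_transition_cylinder:
  assumes "i \<in> idx Z" "j \<in> idx Z" "x \<in> overlap Z i j"
  shows "pd v (transition (cylinder Z) i j) (x, t) = (pd (fst v) (transition Z i j) x, snd v)"
proof -
  have "((\<lambda>p. (transition Z i j (fst p), snd p)) has_derivative (\<lambda>v. (pd (fst v) (transition Z i j) (fst (x, t)), snd v))) (at (x, t))"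
    by (intro has_derivative_Pair has_derivative_frechet_compose has_derivative_fst has_derivative_snd has_derivative_ident)
       (use smooth_on_differentiable[OF smooth_transition[OF R assms(1,2)] assms(3)] in simp)
  moreover have "frechet_derivative (transition (cylinder Z) i j) (at (x, t))
      = frechet_derivative (\<lambda>p. (transition Z i j (fst p), snd p)) (at (x, t))"
    by (rule frechet_derivative_cong_open[of "overlap Z i j \<times> UNIV"])
       (use assms open_overlap[OF R] transition_cylinder[OF R assms(1,2)] in \<open>auto simp: open_Times\<close>)
  ultimately show ?thesis by (simp add: frechet_derivative_eq)
qed

lemma inner_form_cylinder:
  assumes "i \<in> idx Z" "x \<in> chart_img Z i" shows "inner_form (metric (cylinder Z) i (x, t))"
proof -
  note g = inner_form_metric[OF R assms]
  have l: "linear (metric (cylinder Z) i (x, t) v)" for v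
    by (rule linearI) (simp_all add: cylinder_fst_snd linear_add[OF inner_formD(5)[OF g]] linear_cmul[OF inner_formD(5)[OF g]] algebra_simps)
  have s: "metric (cylinder Z) i (x, t) v w = metric (cylinder Z) i (x, t) w v" for v w
    using inner_formD(2)[OF g] by (simp add: cylinder_fst_snd mult.commute)
  have "metric (cylinder Z) i (x, t) v v > 0" if "v \<noteq> 0" for v
  proof (cases "fst v = 0")
    case True
    then have "snd v \<noteq> 0" using that by (simp add: prod_eq_iff)
    then have "snd v * snd v > 0" using not_real_square_gt_zero[of "snd v"] by blast
    then show ?thesis using inner_formD(4)[OF g, of "fst v"] by (simp add: cylinder_fst_snd add_nonneg_pos)
  next
    case False
    then show ?thesis using inner_formD(3)[OF g, of "fst v"] by (simp add: cylinder_fst_snd add_pos_nonneg)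
  qed
  moreover have "linear (\<lambda>v. metric (cylinder Z) i (x, t) v w)" for w
    by (subst s) (rule l)
  ultimately show ?thesis using l s by (simp add: inner_form_def bilinear_def)
qed

lemma riemannian_manifold_cylinder: "riemannian_manifold (cylinder Z)"
  unfolding riemannian_manifold_def
proof (intro conjI ballI allI impI)
  have "(\<Union>i\<in>idx Z. chart_dom Z i) = UNIV" using R by (simp add: riemannian_manifold_def)
  then have "\<exists>i\<in>idx Z. z \<in> chart_dom Z i" for z by (metis UNIV_I UN_iff)
  then show "(\<Union>i\<in>idx (cylinder Z). chart_dom (cylinder Z) i) = UNIV" by auto
  fix i assume "i \<in> idx (cylinder Z)"
  then have i: "i \<in> idx Z" by simp
  show "open (chart_dom (cylinder Z) i)" using open_chart_dom[OF R i] by (simp add: open_Times)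
  show oi: "open (chart_img (cylinder Z) i)" using open_chart_img[OF R i] by (simp add: open_Times)
  have pe: "param (cylinder Z) i y = (param Z i (fst y), snd y)" if "y \<in> chart_img Z i \<times> UNIV" for y
    using param_cylinder[OF R i, of "fst y" "snd y"] that by auto
  show "homeomorphism (chart_dom (cylinder Z) i) (chart_img (cylinder Z) i) (chart (cylinder Z) i) (param (cylinder Z) i)"
  proof (rule homeomorphismI)
    have "continuous_on (chart_dom Z i \<times> UNIV) (\<lambda>p. (chart Z i (fst p), snd p))"
      by (intro continuous_on_Pair continuous_on_compose2[OF continuous_on_chart[OF R i]] continuous_on_fst continuous_on_snd continuous_on_id) auto
    then show "continuous_on (chart_dom (cylinder Z) i) (chart (cylinder Z) i)"
      by (simp add: cylinder_fst_snd[abs_def])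
    have "continuous_on (chart_img Z i \<times> UNIV) (\<lambda>p. (param Z i (fst p), snd p))"
      by (intro continuous_on_Pair continuous_on_compose2[OF continuous_on_param[OF R i]] continuous_on_fst continuous_on_snd continuous_on_id) auto
    then show "continuous_on (chart_img (cylinder Z) i) (param (cylinder Z) i)"
      using pe by (simp cong: continuous_on_cong)
  qed (use pe param_in_dom[OF R i] param_chart[OF R i] chart_param[OF R i] chart_in_img[OF R] in \<open>auto simp: cylinder_fst_snd\<close>)
  have m: "Ck_on k (\<lambda>y. metric Z i (fst y) (fst v) (fst w) + snd v * snd w) (chart_img Z i \<times> (UNIV :: real set))" for k and v w :: "'e \<times> real"
    using oi by (intro Ck_on_add Ck_on_const Ck_on_fst[OF smooth_onD[OF smooth_metric[OF R i]]] open_chart_img[OF R i]) auto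
  show "smooth_on (chart_img (cylinder Z) i) (\<lambda>x. metric (cylinder Z) i x v w)" for v w
    using m by (simp add: smooth_on_def cylinder_fst_snd)
  fix x assume "x \<in> chart_img (cylinder Z) i"
  then obtain y t where x: "x = (y, t)" "y \<in> chart_img Z i" by auto
  note g = inner_form_cylinder[OF i x(2), of t]
  show "bilinear (metric (cylinder Z) i x)" "metric (cylinder Z) i x v w = metric (cylinder Z) i x w v"
    "v \<noteq> 0 \<Longrightarrow> metric (cylinder Z) i x v v > 0" for v w
    using inner_formD[OF g] by (auto simp: x(1))
next
  fix i j assume "i \<in> idx (cylinder Z)" "j \<in> idx (cylinder Z)"
  then have ij: "i \<in> idx Z" "j \<in> idx Z" by simp_all
  have o: "open (overlap Z i j \<times> (UNIV :: real set))" using open_overlap[OF R ij] by (simp add: open_Times)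
  have "Ck_on k (\<lambda>p. (transition Z i j (fst p), snd p)) (overlap Z i j \<times> (UNIV :: real set))" for k
    by (intro Ck_on_Pair o Ck_on_fst[OF smooth_onD[OF smooth_transition[OF R ij]]] open_overlap[OF R ij]
        Ck_on_linear bounded_linear_snd)
  then have "smooth_on (overlap Z i j \<times> (UNIV :: real set)) (\<lambda>p. (transition Z i j (fst p), snd p))" by (simp add: smooth_on_def)
  then show "smooth_on (overlap (cylinder Z) i j) (transition (cylinder Z) i j)"
    using smooth_on_cong[OF o, of "transition (cylinder Z) i j" "\<lambda>p. (transition Z i j (fst p), snd p)"]
      transition_cylinder[OF R ij] by auto
  fix x v w assume "x \<in> overlap (cylinder Z) i j"
  then obtain y t where x: "x = (y, t)" "y \<in> overlap Z i j" by auto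
  show "metric (cylinder Z) i x v w = metric (cylinder Z) j (transition (cylinder Z) i j x)
      (pd v (transition (cylinder Z) i j) x) (pd w (transition (cylinder Z) i j) x)"
    using metric_transition[OF R ij x(2)]
    by (simp add: x(1) pd_transition_cylinder[OF ij x(2)] transition_cylinder[OF R ij x(2)] cylinder_fst_snd)
qed

text \<open>The Gram matrix has two blocks, that of the slice and the entry 1 of the axis. In the
  Leibniz sum every permutation moving the axial vector \<open>a\<close> picks a zero entry; the
  remaining ones are the permutations of the basis of the slice.\<close>

lemma gram_det_cylinder: "i \<in> idx Z \<Longrightarrow> x \<in> chart_img Z i \<Longrightarrow> gram_det (cylinder Z) i (x, t) = gram_det Z i x"
proof -
  assume i: "i \<in> idx Z" and x: "x \<in> chart_img Z i"
  note g = inner_form_metric[OF R i x]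
  define f :: "'e \<Rightarrow> 'e \<times> real" where "f u = (u, 0)" for u
  define S where "S = f ` Basis"
  define a where "a = (0 :: 'e, 1 :: real)"
  let ?m = "metric (cylinder Z) i (x, t)"
  have B: "Basis = insert a S" by (auto simp: Basis_prod_def S_def f_def a_def)
  have aS: "a \<notin> S" "finite S" by (auto simp: a_def S_def f_def)
  have fS: "bij_betw f Basis S" by (auto simp: bij_betw_def inj_on_def S_def f_def)
  have maS: "?m a b = 0" if "b \<in> S" for b
    using that linear_0[OF inner_formD(6)[OF g]] by (auto simp: S_def f_def a_def cylinder_fst_snd)
  have maa: "?m a a = 1"
    using linear_0[OF inner_formD(6)[OF g]] by (simp add: a_def cylinder_fst_snd)
  let ?T = "\<lambda>p. of_int (sign p) * (\<Prod>b\<in>insert a S. ?m b (p b))"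
  have "gram_det (cylinder Z) i (x, t) = (\<Sum>p | p permutes insert a S. ?T p)"
    by (simp add: gram_det_def B)
  also have "\<dots> = (\<Sum>p | p permutes S. ?T p)"
  proof (rule sum.mono_neutral_right)
    show "finite {p. p permutes insert a S}" using aS by (intro finite_permutations) auto
    show "{p. p permutes S} \<subseteq> {p. p permutes insert a S}" using permutes_subset by blast
    show "\<forall>p\<in>{p. p permutes insert a S} - {p. p permutes S}. ?T p = 0"
    proof
      fix p assume "p \<in> {p. p permutes insert a S} - {p. p permutes S}"
      then have p: "p permutes insert a S" "\<not> p permutes S" by auto
      have "p a \<noteq> a" using p permutes_superset[of p "insert a S" S] by auto
      then have "p a \<in> S" using permutes_in_image[OF p(1), of a] by auto
      then have "(\<Prod>b\<in>insert a S. ?m b (p b)) = 0" using aS maS by (intro prod_zero) auto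
      then show "?T p = 0" by simp
    qed
  qed
  also have "\<dots> = (\<Sum>p | p permutes (Basis :: 'e set). of_int (sign p) * (\<Prod>b\<in>Basis. metric Z i x b (p b)))"
  proof (rule sum.reindex_bij_witness[where i="map_permutation Basis f" and j="map_permutation S fst"])
    have fst: "bij_betw fst S Basis" by (auto simp: bij_betw_def inj_on_def S_def f_def image_image)
    fix p assume "p \<in> {p. p permutes S}"
    then have p: "p permutes S" by simp
    show q: "map_permutation S fst p \<in> {p. p permutes Basis}" using map_permutation_permutes[OF fst p] by simp
    show "map_permutation Basis f (map_permutation S fst p) = p"
      by (rule map_permutation_compose_inv[OF fst p]) (auto simp: S_def f_def)
    let ?q = "map_permutation S fst p"
    have pa: "p a = a" using p aS by (simp add: permutes_not_in)
    have "(\<Prod>b\<in>insert a S. ?m b (p b)) = (\<Prod>b\<in>S. ?m b (p b))" using aS pa maa by simp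
    also have "\<dots> = (\<Prod>b\<in>Basis. ?m (f b) (p (f b)))" by (rule prod.reindex_bij_betw[OF fS, symmetric])
    also have "\<dots> = (\<Prod>b\<in>Basis. metric Z i x b (?q b))"
    proof (rule prod.cong[OF refl])
      fix b :: 'e assume "b \<in> Basis"
      then have fb: "f b \<in> S" by (simp add: S_def)
      then have "?q b = fst (p (f b))" using map_permutation_apply[of fst S "f b" p] fst by (simp add: bij_betw_def f_def)
      moreover have "snd (p (f b)) = 0" using permutes_in_image[OF p, of "f b"] fb by (auto simp: S_def f_def)
      ultimately show "?m (f b) (p (f b)) = metric Z i x b (?q b)" by (simp add: f_def cylinder_fst_snd)
    qed
    finally show "of_int (sign ?q) * (\<Prod>b\<in>Basis. metric Z i x b (?q b)) = ?T p"
      using sign_map_permutation[of fst S p] fst p aS by (simp add: bij_betw_def)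
  next
    fix p assume "p \<in> {p. p permutes (Basis :: 'e set)}"
    then have p: "p permutes Basis" by simp
    show "map_permutation S fst (map_permutation Basis f p) = p"
      by (rule map_permutation_compose_inv[OF fS p]) (auto simp: f_def)
    show "map_permutation Basis f p \<in> {p. p permutes S}" using map_permutation_permutes[OF fS p] by simp
  qed
  finally show ?thesis by (simp add: gram_det_def)
qed

text \<open>Index raising on the cylinder takes \<open>(\<xi>, s)\<close> to
  \<open>(K \<xi>, s)\<close>, so the trace splits into the slice and the axis.\<close>

lemma contract_cylinder:
  assumes "i \<in> idx Z" "x \<in> chart_img Z i" "bilinear B"
  shows "contract (metric (cylinder Z) i (x, t)) B
    = contract (metric Z i x) (\<lambda>v w. B (v, 0) (w, 0)) + B (0, 1) (0, 1)"
proof -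
  obtain K where K: "linear K" "\<And>\<xi> w. metric Z i x (K \<xi>) w = \<xi> \<bullet> w" "\<And>b c. inverse_form (metric Z i x) b c = K b \<bullet> c"
    by (rule inner_form_sharp[OF inner_form_metric[OF R assms(1,2)]]) (rule that; assumption)
  obtain K' where K': "linear K'" "\<And>\<xi> w. metric (cylinder Z) i (x, t) (K' \<xi>) w = \<xi> \<bullet> w"
      "\<And>b c. inverse_form (metric (cylinder Z) i (x, t)) b c = K' b \<bullet> c"
    by (rule inner_form_sharp[OF inner_form_cylinder[OF assms(1,2), of t]]) (rule that; assumption)
  have KK: "K' (\<xi>, s) = (K \<xi>, s)" for \<xi> s
    by (rule inner_form_eqI[OF inner_form_cylinder[OF assms(1,2), of t]])
       (simp only: K'(2), simp add: cylinder_fst_snd K(2) inner_prod_def)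
  have l: "linear (B v)" for v using assms(3) unfolding bilinear_def by blast
  have l': "linear (\<lambda>w. B (v, 0) (w, 0))" for v
    by (rule linearI) (use linear_add[OF l, of "(v,0)" "(_,0)" "(_,0)"] linear_cmul[OF l, of "(v,0)" _ "(_,0)"] in simp_all)
  have "contract (metric (cylinder Z) i (x, t)) B = (\<Sum>b\<in>Basis. B b (K' b))"
    by (rule contract_sharp[OF K'(3) l])
  also have "\<dots> = (\<Sum>b\<in>(\<lambda>u. (u, 0)) ` (Basis :: 'e set). B b (K' b)) + (\<Sum>b\<in>(\<lambda>u. (0, u)) ` (Basis :: real set). B b (K' b))"
    unfolding Basis_prod_def by (rule sum.union_disjoint) auto
  also have "\<dots> = (\<Sum>b\<in>Basis. B (b, 0) (K b, 0)) + B (0, 1) (0, 1)"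
    by (simp add: sum.reindex inj_on_def KK linear_0[OF K(1)])
  also have "(\<Sum>b\<in>Basis. B (b, 0) (K b, 0)) = contract (metric Z i x) (\<lambda>v w. B (v, 0) (w, 0))"
    by (rule contract_sharp[OF K(3) l', symmetric])
  finally show ?thesis .
qed

end

section \<open>The curvature of the cylinder\<close>

lemma pd_of_fst_Pair:
  fixes F :: "'e::euclidean_space \<times> real \<Rightarrow> 'f::real_normed_vector \<times> 'b::real_normed_vector"
  assumes "open V" "x \<in> V" "f differentiable (at x)" "\<And>y s. y \<in> V \<Longrightarrow> F (y, s) = (f y, 0)"
  shows "pd v F (x, t) = (pd (fst v) f x, 0)"
proof -
  have "((\<lambda>p. (f (fst p), 0 :: 'b)) has_derivative (\<lambda>v. (pd (fst v) f x, 0))) (at (x, t))"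
    by (intro has_derivative_Pair has_derivative_const has_derivative_of_fst[OF assms(1-3), where F="\<lambda>p. f (fst p)"]) simp
  then have "(F has_derivative (\<lambda>v. (pd (fst v) f x, 0))) (at (x, t))"
    by (rule has_derivative_transform_within_open[where s="V \<times> UNIV"]) (use assms in \<open>auto simp: open_Times\<close>)
  then show ?thesis by (simp add: frechet_derivative_eq)
qed

context
  fixes Z :: "('i, 'a::{t2_space,second_countable_topology}, real ^ 'm::finite) riem"
  assumes R: "riemannian_manifold Z"
begin

lemma pd_metric_cylinder:
  assumes "i \<in> idx Z" "x \<in> chart_img Z i"
  shows "pd c (\<lambda>y. metric (cylinder Z) i y v w) (x, t) = pd (fst c) (\<lambda>y. metric Z i y (fst v) (fst w)) x"
proof -
  have "((\<lambda>p. metric Z i (fst p) (fst v) (fst w) + snd v * snd w) has_derivative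
      (\<lambda>c. pd (fst c) (\<lambda>y. metric Z i y (fst v) (fst w)) x + 0)) (at (x, t))"
    by (intro has_derivative_add has_derivative_const has_derivative_of_fst[OF open_chart_img[OF R assms(1)] assms(2)])
      (use smooth_on_differentiable[OF smooth_metric[OF R assms(1)] assms(2)] in auto)
  then show ?thesis by (simp add: frechet_derivative_eq cylinder_fst_snd)
qed

text \<open>Read off from the Koszul formula: derivatives of the product metric see only slice
  components, and the axial entry of the metric is constant.\<close>

lemma christoffel_vec_cylinder:
  assumes "i \<in> idx Z" "x \<in> chart_img Z i"
  shows "christoffel_vec (cylinder Z) i (x, t) a b = (christoffel_vec Z i x (fst a) (fst b), 0)"
proof (rule inner_form_eqI[OF inner_form_cylinder[OF R assms]])
  note C = riemannian_manifold_cylinder[OF R]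
  have i: "i \<in> idx (cylinder Z)" "(x, t) \<in> chart_img (cylinder Z) i" using assms by auto
  show "metric (cylinder Z) i (x, t) (christoffel_vec (cylinder Z) i (x, t) a b) w
      = metric (cylinder Z) i (x, t) (christoffel_vec Z i x (fst a) (fst b), 0) w" for w
    unfolding koszul[OF C i] pd_metric_cylinder[OF assms]
    by (simp add: cylinder_fst_snd koszul[OF R assms])
qed

text \<open>Discharges the hypothesis of the curvature context for charts in
  \<open>(real ^ 'm) \<times> real\<close>.\<close>

lemma smooth_christoffel_vec_cylinder:
  assumes "i \<in> idx (cylinder Z)"
  shows "smooth_on (chart_img (cylinder Z) i) (\<lambda>x. christoffel_vec (cylinder Z) i x a b)"
proof -
  have i: "i \<in> idx Z" using assms by simp
  have o: "open (chart_img Z i \<times> (UNIV :: real set))" using open_chart_img[OF R i] by (simp add: open_Times)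
  have "Ck_on k (\<lambda>p. (christoffel_vec Z i (fst p) (fst a) (fst b), 0 :: real)) (chart_img Z i \<times> (UNIV :: real set))" for k
    by (intro Ck_on_Pair o Ck_on_const Ck_on_fst[OF smooth_onD[OF smooth_christoffel_vec[OF R i]]] open_chart_img[OF R i])
  then show ?thesis
    unfolding smooth_on_def chart_img_cylinder using christoffel_vec_cylinder[OF i, where a=a and b=b]
    by (subst Ck_on_cong[OF o, where g="\<lambda>p. (christoffel_vec Z i (fst p) (fst a) (fst b), 0)"]) auto
qed

lemma riemann_cylinder:
  assumes "i \<in> idx Z" "x \<in> chart_img Z i"
  shows "riemann (cylinder Z) i c a b (x, t) = (riemann Z i (fst c) (fst a) (fst b) x, 0)"
proof -
  have "pd c (\<lambda>y. christoffel_vec (cylinder Z) i y a b) (x, t) = (pd (fst c) (\<lambda>y. christoffel_vec Z i y (fst a) (fst b)) x, 0)" for a b c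
    by (rule pd_of_fst_Pair[OF open_chart_img[OF R assms(1)] assms(2)])
       (use smooth_on_differentiable[OF smooth_christoffel_vec[OF R assms(1)] assms(2)] christoffel_vec_cylinder[OF assms(1)] in auto)
  then show ?thesis by (simp add: riemann_def christoffel_vec_cylinder[OF assms])
qed

text \<open>The line is flat: the Ricci form of the cylinder is that of the slice and vanishes on
  the axis, so its trace is unchanged.\<close>

lemma scalar_curvature_loc_cylinder:
  assumes "i \<in> idx Z" "x \<in> chart_img Z i"
  shows "scalar_curvature_loc (cylinder Z) i (x, t) = scalar_curvature_loc Z i x"
proof -
  note C = riemannian_manifold_cylinder[OF R]
  have i: "i \<in> idx (cylinder Z)" "(x, t) \<in> chart_img (cylinder Z) i" using assms by auto
  note bil = bilinear_ricci[OF R smooth_christoffel_vec[OF R] assms]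
  have ric: "ricci (cylinder Z) i a b (x, t) = ricci Z i (fst a) (fst b) x" for a b
  proof -
    have "ricci (cylinder Z) i a b (x, t) = (\<Sum>k\<in>Basis. k \<bullet> riemann (cylinder Z) i k b a (x, t))"
      by (rule ricci_eq[OF C smooth_christoffel_vec_cylinder i])
    also have "\<dots> = (\<Sum>k\<in>(Basis :: ((real ^ 'm) \<times> real) set). fst k \<bullet> riemann Z i (fst k) (fst b) (fst a) x)"
      by (simp add: riemann_cylinder[OF assms] inner_prod_def)
    also have "\<dots> = ricci Z i (fst a) (fst b) x"
      unfolding Basis_prod_def
      by (subst sum.union_disjoint)
        (auto simp: sum.reindex inj_on_def ricci_eq[OF R smooth_christoffel_vec[OF R] assms])
    finally show ?thesis .
  qed
  have l1: "linear (\<lambda>b. ricci Z i a b x)" "linear (\<lambda>a. ricci Z i a b x)" for a b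
    using bil unfolding bilinear_def by blast+
  have "bilinear (\<lambda>(a :: (real ^ 'm) \<times> real) (b :: (real ^ 'm) \<times> real). ricci Z i (fst a) (fst b) x)"
    unfolding bilinear_def
  proof (intro conjI allI)
    fix a :: "(real ^ 'm) \<times> real"
    show "linear (\<lambda>b :: (real ^ 'm) \<times> real. ricci Z i (fst a) (fst b) x)"
      using linear_compose[OF linear_fst l1(1)] by (simp add: o_def)
    show "linear (\<lambda>b :: (real ^ 'm) \<times> real. ricci Z i (fst b) (fst a) x)"
      using linear_compose[OF linear_fst l1(2)] by (simp add: o_def)
  qed
  note bil' = this
  have "scalar_curvature_loc (cylinder Z) i (x, t)
      = contract (metric (cylinder Z) i (x, t)) (\<lambda>a b. ricci (cylinder Z) i a b (x, t))"
    by (rule scalar_curvature_loc_eq[OF C smooth_christoffel_vec_cylinder])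
  also have "\<dots> = contract (metric (cylinder Z) i (x, t)) (\<lambda>a b. ricci Z i (fst a) (fst b) x)"
    by (simp only: ric)
  also have "\<dots> = contract (metric Z i x) (\<lambda>a b. ricci Z i a b x)"
    using contract_cylinder[OF R assms bil', where t=t] linear_0[OF l1(1)] by simp
  also have "\<dots> = scalar_curvature_loc Z i x"
    by (rule scalar_curvature_loc_eq[OF R smooth_christoffel_vec[OF R], symmetric])
  finally show ?thesis .
qed

lemma scalar_curvature_cylinder: "scalar_curvature (cylinder Z) (z, t) = scalar_curvature Z z"
proof -
  have "chart_at Z z \<in> idx Z" "chart Z (chart_at Z z) z \<in> chart_img Z (chart_at Z z)"
    using chart_at[OF R] chart_in_img[OF R] by auto
  then show ?thesis by (simp add: scalar_curvature_def scalar_curvature_loc_cylinder)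
qed

lemma scalar_curvature_chart:
  assumes "i \<in> idx Z" "p \<in> chart_dom Z i"
  shows "scalar_curvature Z p = scalar_curvature_loc Z i (chart Z i p)"
proof -
  define j where "j = chart_at Z p"
  have j: "j \<in> idx Z" "p \<in> chart_dom Z j" using chart_at[OF R] by (auto simp: j_def)
  have "chart Z j p \<in> overlap Z j i" using j assms by (auto simp: overlap_def)
  from scalar_curvature_loc_transition[OF R smooth_christoffel_vec[OF R] j(1) assms(1) this]
  show ?thesis by (simp add: scalar_curvature_def j_def[symmetric] transition_chart[OF R j])
qed

lemma smooth_scalar_curvature_loc:
  assumes "i \<in> idx Z" shows "smooth_on (chart_img Z i) (scalar_curvature_loc Z i)"
  unfolding smooth_on_def scalar_curvature_loc_def[abs_def] ricci_def
  by (intro allI Ck_on_sum Ck_on_mult Ck_on_add Ck_on_diff open_chart_img[OF R assms]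
      smooth_onD[OF smooth_cometric[OF R assms]] smooth_onD[OF smooth_christoffel[OF R assms]]
      smooth_onD[OF smooth_on_pd[OF smooth_christoffel[OF R assms]]])

text \<open>Within one chart the local expression is continuous, and by chart independence it
  represents the curvature on the whole chart domain.\<close>

lemma continuous_scalar_curvature: "continuous_on UNIV (scalar_curvature Z)"
proof (rule continuous_on_chartwise[OF R])
  fix i assume i: "i \<in> idx Z"
  have "continuous_on (chart_dom Z i) (\<lambda>p. scalar_curvature_loc Z i (chart Z i p))"
    by (rule continuous_on_compose2[OF smooth_on_continuous[OF smooth_scalar_curvature_loc[OF i]] continuous_on_chart[OF R i]])
       (use chart_in_img[OF R] in auto)
  then show "continuous_on (chart_dom Z i) (scalar_curvature Z)"
    using scalar_curvature_chart[OF i] by (simp cong: continuous_on_cong)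
qed

end

section \<open>The volume of the cylinder\<close>

context
  fixes Z :: "('i, 'a::{t2_space,second_countable_topology}, real ^ 'm::finite) riem"
  assumes Z: "closed_riemannian_manifold Z"
begin

lemma is_volume_cylinder: "is_volume (cylinder Z) (volume Z \<Otimes>\<^sub>M (lborel :: real measure))"
  unfolding is_volume_def
proof (intro conjI ballI impI)
  note R = closed_riemannian[OF Z]
  note C = riemannian_manifold_cylinder[OF R]
  have s: "sets (volume Z \<Otimes>\<^sub>M (lborel :: real measure)) = sets borel"
    using sets_pair_measure_cong[OF sets_volume[OF Z] sets_lborel] borel_prod by metis
  show "sets (volume Z \<Otimes>\<^sub>M (lborel :: real measure)) = sets borel" by (rule s)
  fix i A assume "i \<in> idx (cylinder Z)" and A: "A \<in> sets borel" "A \<subseteq> chart_dom (cylinder Z) i"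
  then have i: "i \<in> idx Z" by simp
  \<comment> \<open>The length of the fibre of \<open>A\<close> over \<open>z\<close>. Tonelli's
    theorem, used on the manifold and in the chart, reduces the claim to the volume of the
    slice.\<close>
  define F where "F z = emeasure lborel (Pair z -` A)" for z
  have F: "F \<in> borel_measurable borel"
    unfolding F_def using lborel.measurable_emeasure_Pair[of A "borel :: 'a measure"] A(1) borel_prod[where ?'a='a and ?'b=real]
    by (metis sets_lborel sets_pair_measure_cong)
  have A': "A \<in> sets (volume Z \<Otimes>\<^sub>M (lborel :: real measure))" using A(1) s by simp
  have Fd: "F z = F z * indicator (chart_dom Z i) z" for z
  proof (cases "z \<in> chart_dom Z i")
    case False
    then have "Pair z -` A = {}" using A(2) by auto
    then show ?thesis using False by (simp add: F_def)
  qed simp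
  have "emeasure (volume Z \<Otimes>\<^sub>M (lborel :: real measure)) A = (\<integral>\<^sup>+z. F z \<partial>volume Z)"
    unfolding F_def by (rule lborel.emeasure_pair_measure_alt[OF A'])
  also have "\<dots> = (\<integral>\<^sup>+z\<in>chart_dom Z i. F z \<partial>volume Z)" using Fd by presburger
  also have "\<dots> = (\<integral>\<^sup>+x\<in>chart_img Z i. ennreal (sqrt (gram_det Z i x)) * F (param Z i x) \<partial>lborel)"
    by (rule nn_integral_volume_chart[OF R is_volume_volume[OF Z] i F])
  finally have 1: "emeasure (volume Z \<Otimes>\<^sub>M (lborel :: real measure)) A = (\<integral>\<^sup>+x\<in>chart_img Z i. ennreal (sqrt (gram_det Z i x)) * F (param Z i x) \<partial>lborel)" .
  define h where "h y = ennreal (sqrt (gram_det (cylinder Z) i y)) * indicator (chart (cylinder Z) i ` A) y" for y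
  have i': "i \<in> idx (cylinder Z)" using i by simp
  have cA: "chart (cylinder Z) i ` A \<in> sets borel" by (rule chart_image_borel[OF C i' A])
  have csub: "chart (cylinder Z) i ` A \<subseteq> chart_img (cylinder Z) i" using A(2) by (auto simp: chart_img_def)
  have "h = (\<lambda>y. (ennreal (sqrt (gram_det (cylinder Z) i y)) * indicator (chart_img (cylinder Z) i) y) * indicator (chart (cylinder Z) i ` A) y)"
    unfolding h_def by (intro ext) (use csub in \<open>auto split: split_indicator\<close>)
  then have hm: "h \<in> borel_measurable borel"
    by (simp only:) (intro borel_measurable_times_ennreal measurable_density[OF C i'] borel_measurable_indicator cA)
  have hm': "h \<in> borel_measurable (lborel \<Otimes>\<^sub>M lborel)" unfolding lborel_prod using hm by simp
  have "(\<integral>\<^sup>+y\<in>chart (cylinder Z) i ` A. ennreal (sqrt (gram_det (cylinder Z) i y)) \<partial>lborel) = (\<integral>\<^sup>+y. h y \<partial>(lborel \<Otimes>\<^sub>M lborel))"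
    by (simp add: h_def lborel_prod)
  also have "\<dots> = (\<integral>\<^sup>+x. \<integral>\<^sup>+t. h (x, t) \<partial>lborel \<partial>lborel)" by (rule lborel.nn_integral_fst[OF hm', symmetric])
  also have "\<dots> = (\<integral>\<^sup>+x\<in>chart_img Z i. ennreal (sqrt (gram_det Z i x)) * F (param Z i x) \<partial>lborel)"
  proof (rule nn_integral_cong)
    fix x :: "real ^ 'm"
    show "(\<integral>\<^sup>+t. h (x, t) \<partial>lborel) = ennreal (sqrt (gram_det Z i x)) * F (param Z i x) * indicator (chart_img Z i) x"
    proof (cases "x \<in> chart_img Z i")
      case True
      have "h (x, t) = ennreal (sqrt (gram_det Z i x)) * indicator (Pair (param Z i x) -` A) t" for t
        using chart_image_vimage[OF C i' A(2), of "(x, t)"] True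
        by (simp add: h_def gram_det_cylinder[OF R i True] param_cylinder[OF R i True] indicator_def)
      moreover have "Pair (param Z i x) -` A \<in> sets lborel" by (rule sets_Pair1[OF A'])
      ultimately show ?thesis using True by (simp add: F_def nn_integral_cmult_indicator)
    next
      case False
      then have "h (x, t) = 0" for t using csub by (auto simp: h_def indicator_def)
      then show ?thesis using False by simp
    qed
  qed
  finally show "emeasure (volume Z \<Otimes>\<^sub>M (lborel :: real measure)) A = (\<integral>\<^sup>+y\<in>chart (cylinder Z) i ` A. ennreal (sqrt (gram_det (cylinder Z) i y)) \<partial>lborel)"
    using 1 by simp
qed

lemma volume_cylinder: "volume (cylinder Z) = volume Z \<Otimes>\<^sub>M lborel"
proof -
  obtain I where I: "finite I" "I \<subseteq> idx Z" "(\<Union>i\<in>I. chart_dom Z i) = UNIV" using finite_chart_cover[OF Z] by blast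
  have "(\<Union>i\<in>I. chart_dom (cylinder Z) i) = UNIV" using I(3) by (auto simp: set_eq_iff)
  then show ?thesis
    using volume_eqI[OF riemannian_manifold_cylinder[OF closed_riemannian[OF Z]] I(1) _ _ is_volume_cylinder] I(2) by simp
qed

lemma gram_det_cylinder_pos: "i \<in> idx (cylinder Z) \<Longrightarrow> y \<in> chart_img (cylinder Z) i \<Longrightarrow> gram_det (cylinder Z) i y > 0"
  using gram_det_cylinder[OF closed_riemannian[OF Z]] gram_det_pos[OF Z] by auto

end

section \<open>Weak differentials of smooth functions\<close>

definition differential :: "('i, 'a, 'e::euclidean_space) riem \<Rightarrow> ('a \<Rightarrow> real) \<Rightarrow> 'i \<Rightarrow> 'e \<Rightarrow> 'e \<Rightarrow> real" where
  "differential M u i x v = pd v (u \<circ> param M i) x"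

text \<open>\<open>V\<close> is a countable union of closed boxes, on each of which \<open>f\<close>
  is integrable and hence measurable.\<close>

lemma locally_integrable_measurable:
  assumes "open V" "locally_integrable_on V f"
  shows "(\<lambda>x. if x \<in> V then f x else 0) \<in> borel_measurable borel"
proof -
  obtain D where D: "countable D" "D \<subseteq> Pow V" "\<And>X. X \<in> D \<Longrightarrow> \<exists>a b. X = cbox a b" "\<Union>D = V"
    using open_countable_Union_open_cbox[OF assms(1)] by metis
  show ?thesis
  proof (rule measurable_piecewise_restrict[where C="insert (- V) D"])
    fix X assume X: "X \<in> insert (- V) D"
    show "X \<inter> space borel \<in> sets borel" using X D(3)[of X] assms(1) by auto
    show "(\<lambda>x. if x \<in> V then f x else 0) \<in> borel_measurable (restrict_space borel X)"
    proof (cases "X = - V")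
      case True
      then have "(if x \<in> V then f x else 0) = 0" if "x \<in> space (restrict_space borel X)" for x
        using that by (simp add: space_restrict_space)
      then show ?thesis by (simp cong: measurable_cong)
    next
      case False
      then have X': "X \<in> D" using X by simp
      obtain a b where ab: "X = cbox a b" using D(3)[OF X'] by blast
      have "X \<subseteq> V" using D(2) X' by auto
      then have "set_integrable lborel X f" using assms(2) ab compact_cbox unfolding locally_integrable_on_def by blast
      then have m: "(\<lambda>x. indicator X x *\<^sub>R f x) \<in> borel_measurable borel"
        unfolding set_integrable_def by (auto dest: borel_measurable_integrable)
      have "indicator X x *\<^sub>R f x = (if x \<in> V then f x else 0)" if "x \<in> space (restrict_space borel X)" for x
        using that \<open>X \<subseteq> V\<close> by (auto simp: space_restrict_space)
      then show ?thesis
        using measurable_restrict_space1[OF m, of X] by (simp cong: measurable_cong)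
    qed
  qed (use D in auto)
qed

lemma set_integrable_mult_test_function:
  fixes g :: "'e::euclidean_space \<Rightarrow> real"
  assumes "open V" "locally_integrable_on V g" "test_function V \<eta>"
  shows "set_integrable lborel V (\<lambda>x. g x * \<eta> x)"
proof -
  define K where "K = closure {x. \<eta> x \<noteq> 0}"
  have K: "compact K" "K \<subseteq> V" and \<eta>: "smooth_on UNIV \<eta>" using assms(3) by (auto simp: test_function_def K_def)
  have \<eta>0: "\<eta> x = 0" if "x \<notin> K" for x using that closure_subset by (force simp: K_def)
  have c\<eta>: "continuous_on UNIV \<eta>" by (rule smooth_on_continuous[OF \<eta>])
  obtain C where C: "\<And>x. \<bar>\<eta> x\<bar> \<le> C" using bounded_compact_support[OF c\<eta> K(1) \<eta>0] by blast
  have gK: "integrable lborel (\<lambda>x. indicator K x *\<^sub>R g x)"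
    using assms(2) K unfolding locally_integrable_on_def set_integrable_def by blast
  have m: "\<eta> \<in> borel_measurable lborel" using borel_measurable_continuous_onI[OF c\<eta>] by simp
  have "integrable lborel (\<lambda>x. (indicator K x *\<^sub>R g x) * \<eta> x)"
  proof (rule Bochner_Integration.integrable_bound)
    show "integrable lborel (\<lambda>x. (indicator K x *\<^sub>R g x) * C)" using gK by (rule integrable_mult_left)
    show "(\<lambda>x. (indicator K x *\<^sub>R g x) * \<eta> x) \<in> borel_measurable lborel"
      using borel_measurable_integrable[OF gK] m by (rule borel_measurable_times)
    have "\<bar>\<eta> x\<bar> \<le> \<bar>C\<bar>" for x using C[of x] by linarith
    then show "AE x in lborel. norm ((indicat_real K x *\<^sub>R g x) * \<eta> x) \<le> norm ((indicat_real K x *\<^sub>R g x) * C)"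
      by (intro AE_I2) (simp add: abs_mult mult_left_mono)
  qed
  moreover have "(\<lambda>x. (indicator K x *\<^sub>R g x) * \<eta> x) = (\<lambda>x. indicator V x *\<^sub>R (g x * \<eta> x))"
    using K(2) \<eta>0 by (intro ext) (auto simp: indicator_def)
  ultimately show ?thesis by (simp only: set_integrable_def)
qed

lemma locally_integrable_continuous:
  "continuous_on V f \<Longrightarrow> locally_integrable_on V f"
  unfolding locally_integrable_on_def set_integrable_def
  using borel_integrable_compact continuous_on_subset by blast

lemma smooth_on_one_form:
  "smooth_function M u \<Longrightarrow> i \<in> idx M \<Longrightarrow> smooth_on (chart_img M i) (\<lambda>x. differential M u i x v)"
  unfolding differential_def smooth_function_def by (auto intro: smooth_on_pd)

lemma linear_differential:
  "smooth_function M u \<Longrightarrow> i \<in> idx M \<Longrightarrow> x \<in> chart_img M i \<Longrightarrow> linear (differential M u i x)"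
  unfolding differential_def[abs_def] smooth_function_def
  by (intro linear_pd smooth_on_differentiable) auto

context
  fixes M :: "('i, 'a::{t2_space,second_countable_topology}, 'e::euclidean_space) riem"
  assumes R: "riemannian_manifold M"
begin

text \<open>Classical integration by parts in each chart; the transformation law of the 1-form is
  the chain rule.\<close>

lemma is_weak_differential_differential:
  assumes u: "smooth_function M u"
  shows "is_weak_differential M u (differential M u)"
  unfolding is_weak_differential_def one_form_def
proof (intro conjI ballI allI impI)
  fix i assume i: "i \<in> idx M"
  have ui: "smooth_on (chart_img M i) (u \<circ> param M i)" using u i by (simp add: smooth_function_def)
  show "linear (differential M u i x)" if "x \<in> chart_img M i" for x
    by (rule linear_differential[OF u i that])
  show "locally_integrable_on (chart_img M i) (u \<circ> param M i)"
    by (rule locally_integrable_continuous[OF smooth_on_continuous[OF ui]])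
  show "locally_integrable_on (chart_img M i) (\<lambda>x. differential M u i x b)" for b
    by (rule locally_integrable_continuous[OF smooth_on_continuous[OF smooth_on_one_form[OF u i]]])
  fix b \<eta> assume \<eta>: "test_function (chart_img M i) \<eta>"
  have "(LINT x:chart_img M i|lborel. (u \<circ> param M i) x * pd b \<eta> x)
      = - (LINT x:chart_img M i|lborel. pd b (u \<circ> param M i) x * \<eta> x)"
  proof (rule set_integral_by_parts[OF open_chart_img[OF R i] smooth_onD[OF ui]])
    show "Ck_on 1 \<eta> (chart_img M i)"
      using \<eta> by (intro Ck_on_subset[OF smooth_onD, of UNIV]) (auto simp: test_function_def)
    show "compact (closure {x. \<eta> x \<noteq> 0})" "closure {x. \<eta> x \<noteq> 0} \<subseteq> chart_img M i"
      using \<eta> by (auto simp: test_function_def)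
    show "\<eta> x = 0" if "x \<in> chart_img M i - closure {x. \<eta> x \<noteq> 0}" for x
      using that closure_subset[of "{x. \<eta> x \<noteq> 0}"] by auto
  qed
  then show "(LINT x:chart_img M i|lborel. u (param M i x) * pd b \<eta> x)
      = - (LINT x:chart_img M i|lborel. differential M u i x b * \<eta> x)"
    by (simp add: differential_def)
next
  fix i j x v assume "i \<in> idx M" "j \<in> idx M" "x \<in> overlap M i j"
  then show "differential M u i x v = differential M u j (transition M i j x) (pd v (transition M i j) x)"
    unfolding differential_def by (rule smooth_function_transition[OF R u])
qed

text \<open>The difference of the two forms annihilates every test function, so the fundamental
  lemma applies.\<close>

lemma weak_differential_unique:
  assumes u: "smooth_function M u" and \<omega>: "is_weak_differential M u \<omega>" and i: "i \<in> idx M" and b: "b \<in> Basis"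
  shows "AE x in lborel. x \<in> chart_img M i \<longrightarrow> \<omega> i x b = differential M u i x b"
proof -
  let ?V = "chart_img M i"
  have V: "open ?V" by (rule open_chart_img[OF R i])
  have l1: "locally_integrable_on ?V (\<lambda>x. \<omega> i x b)"
    and w1: "\<And>\<eta>. test_function ?V \<eta> \<Longrightarrow> (LINT x:?V|lborel. u (param M i x) * pd b \<eta> x) = - (LINT x:?V|lborel. \<omega> i x b * \<eta> x)"
    using \<omega> i b by (auto simp: is_weak_differential_def)
  have l2: "locally_integrable_on ?V (\<lambda>x. differential M u i x b)"
    and w2: "\<And>\<eta>. test_function ?V \<eta> \<Longrightarrow> (LINT x:?V|lborel. u (param M i x) * pd b \<eta> x) = - (LINT x:?V|lborel. differential M u i x b * \<eta> x)"
    using is_weak_differential_differential[OF u] i b by (auto simp: is_weak_differential_def)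
  have "AE x in lborel. x \<in> ?V \<longrightarrow> \<omega> i x b - differential M u i x b = 0"
  proof (rule fundamental_lemma_calculus_of_variations[OF V])
    show "locally_integrable_on ?V (\<lambda>x. \<omega> i x b - differential M u i x b)"
      using l1 l2 unfolding locally_integrable_on_def by (intro allI impI set_integral_diff(1)) auto
    fix \<eta> assume \<eta>: "test_function ?V \<eta>"
    show "(LINT x:?V|lborel. (\<omega> i x b - differential M u i x b) * \<eta> x) = 0"
      using set_integral_diff(2)[OF set_integrable_mult_test_function[OF V l1 \<eta>] set_integrable_mult_test_function[OF V l2 \<eta>]]
        w1[OF \<eta>] w2[OF \<eta>] by (simp add: left_diff_distrib)
  qed
  then show ?thesis by eventually_elim simp
qed

lemma form_inner_chart:
  assumes \<omega>: "one_form M \<omega>" and \<theta>: "one_form M \<theta>" and i: "i \<in> idx M" "p \<in> chart_dom M i" and j: "j \<in> idx M" "p \<in> chart_dom M j"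
  shows "contract (metric M i (chart M i p)) (\<lambda>v w. \<omega> i (chart M i p) v * \<theta> i (chart M i p) w)
    = contract (metric M j (chart M j p)) (\<lambda>v w. \<omega> j (chart M j p) v * \<theta> j (chart M j p) w)"
proof -
  let ?x = "chart M i p" and ?y = "chart M j p" and ?P = "\<lambda>v. pd v (transition M i j) (chart M i p)"
  have xi: "?x \<in> chart_img M i" and yj: "?y \<in> chart_img M j" using chart_in_img[OF R] i j by auto
  have x: "?x \<in> overlap M i j" using i j by (auto simp: overlap_def)
  have y: "transition M i j ?x = ?y" by (rule transition_chart[OF R i])
  have lin: "linear (\<omega> j ?y)" "linear (\<theta> j ?y)" using \<omega> \<theta> j yj by (auto simp: one_form_def)
  show ?thesis
  proof (rule contract_pullback[OF inner_form_metric[OF R i(1) xi] inner_form_metric[OF R j(1) yj]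
      linear_pd_transition[OF R i(1) j(1) x] bij_is_surj[OF bij_pd_transition[OF R i(1) j(1) x]]])
    show "metric M i ?x v w = metric M j ?y (?P v) (?P w)" for v w
      using metric_transition[OF R i(1) j(1) x] y by simp
    show "\<omega> i ?x v * \<theta> i ?x w = \<omega> j ?y (?P v) * \<theta> j ?y (?P w)" for v w
      using \<omega> \<theta> i j x y by (simp add: one_form_def)
    show "bilinear (\<lambda>v w. \<omega> j ?y v * \<theta> j ?y w)"
      using lin by (auto simp: bilinear_def linear_iff algebra_simps)
  qed
qed

lemma form_norm_sq_chart:
  assumes "one_form M \<omega>" "i \<in> idx M" "p \<in> chart_dom M i"
  shows "form_norm_sq M \<omega> p
    = contract (metric M i (chart M i p)) (\<lambda>v w. \<omega> i (chart M i p) v * \<omega> i (chart M i p) w)"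
proof -
  have "form_norm_sq M \<omega> p = contract (metric M (chart_at M p) (chart M (chart_at M p) p))
      (\<lambda>v w. \<omega> (chart_at M p) (chart M (chart_at M p) p) v * \<omega> (chart_at M p) (chart M (chart_at M p) p) w)"
    by (simp add: form_norm_sq_def Let_def contract_def cometric_def inverse_form_def mult.assoc)
  then show ?thesis using form_inner_chart[OF assms(1,1) chart_at[OF R] assms(2,3)] by simp
qed

lemma form_norm_sq_nonneg:
  assumes \<omega>: "one_form M \<omega>" shows "form_norm_sq M \<omega> p \<ge> 0"
proof -
  have x: "chart M (chart_at M p) p \<in> chart_img M (chart_at M p)" by (rule chart_in_img[OF R chart_at(2)[OF R]])
  then have "linear (\<omega> (chart_at M p) (chart M (chart_at M p) p))"
    using \<omega> chart_at(1)[OF R] by (simp add: one_form_def)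
  then show ?thesis
    unfolding form_norm_sq_chart[OF \<omega> chart_at[OF R]]
    by (rule contract_nonneg(1)[OF inner_form_metric[OF R chart_at(1)[OF R] x]])
qed

text \<open>A null set in chart coordinates pulls back to a null set of the volume, which has a
  Lebesgue density there.\<close>

lemma AE_chart:
  assumes \<sigma>: "is_volume M \<sigma>" and i: "i \<in> idx M" and P: "AE x in lborel. x \<in> chart_img M i \<longrightarrow> P x"
  shows "AE p in \<sigma>. p \<in> chart_dom M i \<longrightarrow> P (chart M i p)"
proof -
  obtain N where N: "{x \<in> space lborel. \<not> (x \<in> chart_img M i \<longrightarrow> P x)} \<subseteq> N" "emeasure lborel N = 0" "N \<in> sets lborel"
    using AE_E[OF P] by blast
  define A where "A = {p \<in> chart_dom M i. chart M i p \<in> N}"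
  have "chart M i \<in> borel_measurable (restrict_space borel (chart_dom M i))"
    by (rule borel_measurable_continuous_on_restrict[OF continuous_on_chart[OF R i]])
  then have "chart M i -` N \<inter> space (restrict_space borel (chart_dom M i)) \<in> sets (restrict_space borel (chart_dom M i))"
    using N(3) by (intro measurable_sets) auto
  moreover have "chart M i -` N \<inter> space (restrict_space borel (chart_dom M i)) = A"
    by (auto simp: A_def space_restrict_space)
  ultimately have A: "A \<in> sets borel"
    using open_chart_dom[OF R i] by (auto simp: sets_restrict_space_iff)
  have "emeasure \<sigma> A = (\<integral>\<^sup>+x\<in>chart M i ` A. ennreal (sqrt (gram_det M i x)) \<partial>lborel)"
    using \<sigma> i A unfolding is_volume_def A_def by auto
  also have "\<dots> = (\<integral>\<^sup>+x. 0 \<partial>(lborel :: 'e measure))"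
  proof (rule nn_integral_cong_AE)
    have "AE x in lborel. x \<notin> N" using N(2,3) by (intro AE_not_in) auto
    then show "AE x in lborel. ennreal (sqrt (gram_det M i x)) * indicator (chart M i ` A) x = 0"
      by eventually_elim (auto simp: A_def indicator_def)
  qed
  finally have "A \<in> null_sets \<sigma>" using A \<sigma> by (auto simp: is_volume_def)
  moreover have "{p \<in> space \<sigma>. \<not> (p \<in> chart_dom M i \<longrightarrow> P (chart M i p))} \<subseteq> A"
    using N(1) chart_in_img[OF R] by (auto simp: A_def)
  ultimately show ?thesis by (rule AE_I')
qed

context
  fixes I
  assumes I: "finite I" "I \<subseteq> idx M" "(\<Union>i\<in>I. chart_dom M i) = UNIV"
    and vol: "is_volume M (volume M)"
    and com: "\<And>i b c. i \<in> idx M \<Longrightarrow> continuous_on (chart_img M i) (\<lambda>x. cometric M i x b c)"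
begin

text \<open>The forms agree almost everywhere in each of finitely many charts. Continuity of
  \<open>cometric\<close> is a hypothesis of this context for the same reason as smoothness of
  \<open>christoffel_vec\<close> above: the results are meant for the cylinder.\<close>

lemma form_norm_sq_weak_differential:
  assumes u: "smooth_function M u" and \<omega>: "is_weak_differential M u \<omega>"
  shows "AE p in volume M. form_norm_sq M \<omega> p = form_norm_sq M (differential M u) p"
proof -
  have o: "one_form M \<omega>" "one_form M (differential M u)"
    using \<omega> is_weak_differential_differential[OF u] by (auto simp: is_weak_differential_def)
  have "AE p in volume M. p \<in> chart_dom M i \<longrightarrow> form_norm_sq M \<omega> p = form_norm_sq M (differential M u) p" if "i \<in> I" for i
  proof -
    have i: "i \<in> idx M" using that I by auto
    have "AE x in lborel. \<forall>b\<in>Basis. x \<in> chart_img M i \<longrightarrow> \<omega> i x b = differential M u i x b"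
      by (rule AE_ball_countable[THEN iffD2]) (use weak_differential_unique[OF u \<omega> i] in \<open>auto intro: countable_finite\<close>)
    then have "AE x in lborel. x \<in> chart_img M i \<longrightarrow> (\<forall>b\<in>Basis. \<omega> i x b = differential M u i x b)"
      by eventually_elim blast
    from AE_chart[OF vol i this] show ?thesis
    proof eventually_elim
      case (elim p)
      then show ?case
        using form_norm_sq_chart[OF o(1) i] form_norm_sq_chart[OF o(2) i] by (simp add: contract_def)
    qed
  qed
  then have "AE p in volume M. \<forall>i\<in>I. p \<in> chart_dom M i \<longrightarrow> form_norm_sq M \<omega> p = form_norm_sq M (differential M u) p"
    by (intro AE_ball_countable[THEN iffD2] ballI) (use I(1) in \<open>auto intro: countable_finite\<close>)
  then show ?thesis by eventually_elim (use I(3) in blast)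
qed

text \<open>For quantities defined through \<open>chart_at\<close>, whose dependence on the point is
  arbitrary, measurability has to come from an expression valid on each of finitely many chart
  domains.\<close>

lemma measurable_chartwise:
  fixes F :: "'a \<Rightarrow> real"
  assumes "\<And>i. i \<in> I \<Longrightarrow> H i \<in> borel_measurable borel" "\<And>i p. i \<in> I \<Longrightarrow> p \<in> chart_dom M i \<Longrightarrow> F p = H i (chart M i p)"
  shows "F \<in> borel_measurable borel"
proof (rule measurable_piecewise_restrict[where C="chart_dom M ` I"])
  fix X assume "X \<in> chart_dom M ` I"
  then obtain i where i: "i \<in> I" "X = chart_dom M i" "i \<in> idx M" using I by auto
  show "X \<inter> space borel \<in> sets borel" using open_chart_dom[OF R i(3)] i by simp
  have "chart M i \<in> borel_measurable (restrict_space borel X)"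
    unfolding i(2) by (rule borel_measurable_continuous_on_restrict[OF continuous_on_chart[OF R i(3)]])
  from measurable_compose[OF this assms(1)[OF i(1)]]
  show "F \<in> borel_measurable (restrict_space borel X)"
    by (rule measurable_cong[THEN iffD1, rotated]) (use assms(2)[OF i(1)] i in \<open>auto simp: space_restrict_space\<close>)
qed (use I in \<open>auto intro: countable_finite\<close>)

lemma measurable_form_norm_sq:
  assumes \<omega>: "is_weak_differential M u \<omega>"
  shows "form_norm_sq M \<omega> \<in> borel_measurable borel"
proof -
  have o: "one_form M \<omega>" using \<omega> by (simp add: is_weak_differential_def)
  define H where "H i x = (\<Sum>b\<in>Basis. \<Sum>c\<in>Basis. (if x \<in> chart_img M i then cometric M i x b c else 0) *
    ((if x \<in> chart_img M i then \<omega> i x b else 0) * (if x \<in> chart_img M i then \<omega> i x c else 0)))" for i x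
  show ?thesis
  proof (rule measurable_chartwise[where H=H])
    fix i assume "i \<in> I"
    then have i: "i \<in> idx M" using I by auto
    have "(\<lambda>x. if x \<in> chart_img M i then \<omega> i x b else 0) \<in> borel_measurable borel" if "b \<in> Basis" for b
      using \<omega> i that by (intro locally_integrable_measurable open_chart_img[OF R i]) (auto simp: is_weak_differential_def)
    then show "H i \<in> borel_measurable borel"
      unfolding H_def[abs_def]
      by (intro borel_measurable_sum borel_measurable_times measurable_extend[OF R i com[OF i]]) auto
    show "form_norm_sq M \<omega> p = H i (chart M i p)" if "p \<in> chart_dom M i" for p
      using form_norm_sq_chart[OF o i that] chart_in_img[OF R that]
      by (simp add: H_def contract_def cometric_def inverse_form_def)
  qed
qed

lemma continuous_form_norm_sq:
  assumes u: "smooth_function M u"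
  shows "continuous_on UNIV (form_norm_sq M (differential M u))"
proof -
  have o: "one_form M (differential M u)"
    using is_weak_differential_differential[OF u] by (auto simp: is_weak_differential_def)
  have "continuous_on (\<Union>i\<in>idx M. chart_dom M i) (form_norm_sq M (differential M u))"
  proof (rule continuous_on_open_UN)
    fix i assume i: "i \<in> idx M"
    show "open (chart_dom M i)" by (rule open_chart_dom[OF R i])
    have "continuous_on (chart_img M i) (\<lambda>x. contract (metric M i x) (\<lambda>v w. differential M u i x v * differential M u i x w))"
      unfolding contract_def inverse_form_def cometric_def[symmetric]
      by (intro continuous_on_sum continuous_on_mult com[OF i] smooth_on_continuous[OF smooth_on_one_form[OF u i]])
    from continuous_on_compose2[OF this continuous_on_chart[OF R i]]
    have "continuous_on (chart_dom M i) (\<lambda>p. contract (metric M i (chart M i p)) (\<lambda>v w. differential M u i (chart M i p) v * differential M u i (chart M i p) w))"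
      using chart_in_img[OF R] by auto
    then show "continuous_on (chart_dom M i) (form_norm_sq M (differential M u))"
      using form_norm_sq_chart[OF o i] by (simp cong: continuous_on_cong)
  qed
  moreover have "(\<Union>i\<in>idx M. chart_dom M i) = UNIV" using R by (simp add: riemannian_manifold_def)
  ultimately show ?thesis by simp
qed

text \<open>Every weak differential has almost everywhere the same norm as the classical one, which
  removes the existential quantifier in \<open>sobolev12\<close>.\<close>

lemma sobolev12_smooth_iff:
  assumes u: "smooth_function M u" "u \<in> borel_measurable borel"
  shows "u \<in> sobolev12 M \<longleftrightarrow> integrable (volume M) (\<lambda>p. (u p)\<^sup>2) \<and> integrable (volume M) (form_norm_sq M (differential M u))"
proof -
  have s: "sets (volume M) = sets borel" using vol by (simp add: is_volume_def)
  have m: "h \<in> borel_measurable (volume M)" if "h \<in> borel_measurable borel" for h :: "'a \<Rightarrow> real"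
    using that by (simp only: measurable_cong_sets[OF s refl])
  have "integrable (volume M) (form_norm_sq M \<omega>) \<longleftrightarrow> integrable (volume M) (form_norm_sq M (differential M u))"
    if "is_weak_differential M u \<omega>" for \<omega>
    by (intro integrable_cong_AE m measurable_form_norm_sq[OF that] form_norm_sq_weak_differential[OF u(1) that]
      measurable_form_norm_sq[OF is_weak_differential_differential[OF u(1)]])
  then have "(\<exists>\<omega>. is_weak_differential M u \<omega> \<and> integrable (volume M) (form_norm_sq M \<omega>))
      \<longleftrightarrow> integrable (volume M) (form_norm_sq M (differential M u))"
    using is_weak_differential_differential[OF u(1)] by blast
  then show ?thesis using u(2) by (simp add: sobolev12_def)
qed

lemma yamabe_quotient_smooth:
  assumes u: "smooth_function M u" "u \<in> borel_measurable borel" and S: "scalar_curvature M \<in> borel_measurable borel"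
  shows "yamabe_quotient M u =
    (LINT p|volume M. alpha DIM('e) * form_norm_sq M (differential M u) p + scalar_curvature M p * (u p)\<^sup>2)
    / (LINT p|volume M. \<bar>u p\<bar> powr (2 * real DIM('e) / (real DIM('e) - 2))) powr ((real DIM('e) - 2) / real DIM('e))"
proof -
  have s: "sets (volume M) = sets borel" using vol by (simp add: is_volume_def)
  have w: "is_weak_differential M u (weak_differential M u)"
    unfolding weak_differential_def
    by (rule someI[where P="is_weak_differential M u", OF is_weak_differential_differential[OF u(1)]])
  have "(LINT p|volume M. alpha DIM('e) * form_norm_sq M (weak_differential M u) p + scalar_curvature M p * (u p)\<^sup>2)
    = (LINT p|volume M. alpha DIM('e) * form_norm_sq M (differential M u) p + scalar_curvature M p * (u p)\<^sup>2)"
  proof (rule integral_cong_AE)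
    have m: "h \<in> borel_measurable (volume M)" if "h \<in> borel_measurable borel" for h :: "'a \<Rightarrow> real"
      using that by (simp only: measurable_cong_sets[OF s refl])
    show "(\<lambda>p. alpha DIM('e) * form_norm_sq M (weak_differential M u) p + scalar_curvature M p * (u p)\<^sup>2) \<in> borel_measurable (volume M)"
      "(\<lambda>p. alpha DIM('e) * form_norm_sq M (differential M u) p + scalar_curvature M p * (u p)\<^sup>2) \<in> borel_measurable (volume M)"
      using measurable_form_norm_sq[OF w] measurable_form_norm_sq[OF is_weak_differential_differential[OF u(1)]] u(2) S
      by (auto intro!: m)
    show "AE p in volume M. alpha DIM('e) * form_norm_sq M (weak_differential M u) p + scalar_curvature M p * (u p)\<^sup>2
        = alpha DIM('e) * form_norm_sq M (differential M u) p + scalar_curvature M p * (u p)\<^sup>2"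
      using form_norm_sq_weak_differential[OF u(1) w] by eventually_elim simp
  qed
  then show ?thesis by (simp add: yamabe_quotient_def Let_def)
qed

end

end

section \<open>Green's formula on a closed manifold\<close>

text \<open>Used in two ways: with a test function \<eta> it gives a smooth function on the
  manifold; with a local expression such as \<open>chart_laplacian Z i f\<close> it is merely a
  total function, to be multiplied by something supported in the chart.\<close>

definition chart_bump :: "('i, 'a, 'e) riem \<Rightarrow> 'i \<Rightarrow> ('e \<Rightarrow> real) \<Rightarrow> 'a \<Rightarrow> real" where
  "chart_bump M i \<eta> p = (if p \<in> chart_dom M i then \<eta> (chart M i p) else 0)"

definition form_inner ::
  "('i, 'a, 'e::euclidean_space) riem \<Rightarrow> ('i \<Rightarrow> 'e \<Rightarrow> 'e \<Rightarrow> real) \<Rightarrow> ('i \<Rightarrow> 'e \<Rightarrow> 'e \<Rightarrow> real) \<Rightarrow> 'a \<Rightarrow> real" where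
  "form_inner M \<omega> \<theta> p = (let i = chart_at M p; x = chart M i p in
     contract (metric M i x) (\<lambda>v w. \<omega> i x v * \<theta> i x w))"

definition chart_laplacian :: "('i, 'a, 'e::euclidean_space) riem \<Rightarrow> 'i \<Rightarrow> ('a \<Rightarrow> real) \<Rightarrow> 'e \<Rightarrow> real" where
  "chart_laplacian M i f = laplacian_loc M i (f \<circ> param M i)"

lemma one_form_differential: "riemannian_manifold M \<Longrightarrow> smooth_function M u \<Longrightarrow> one_form M (differential M u)"
  using is_weak_differential_differential by (auto simp: is_weak_differential_def)

lemma set_lebesgue_integral_sum:
  fixes f :: "'b \<Rightarrow> 'c \<Rightarrow> real"
  assumes "\<And>b. set_integrable M V (f b)"
  shows "(LINT x:V|M. \<Sum>b\<in>B. f b x) = (\<Sum>b\<in>B. (LINT x:V|M. f b x))"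
  unfolding set_lebesgue_integral_def scaleR_sum_right
  by (rule Bochner_Integration.integral_sum) (use assms in \<open>simp add: set_integrable_def\<close>)

lemma continuous_AE_eq_0_on_open:
  fixes g :: "'e::euclidean_space \<Rightarrow> real"
  assumes "open V" "continuous_on V g" "AE x in lborel. x \<in> V \<longrightarrow> g x = 0" "x \<in> V"
  shows "g x = 0"
proof (rule ccontr)
  assume "g x \<noteq> 0"
  define U where "U = {x \<in> V. g x \<noteq> 0}"
  have o: "open U"
    using continuous_open_preimage[OF assms(2,1) open_Compl[OF closed_singleton[of 0]]] by (simp add: U_def vimage_def Int_def)
  have "emeasure lborel U = 0"
    using assms(3) o AE_iff_measurable[of U lborel "\<lambda>x. x \<in> V \<longrightarrow> g x = 0"] by (auto simp: U_def)
  then have "negligible U" using o by (simp add: negligible_iff_null_sets null_sets_completionI null_setsI)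
  then show False using open_not_negligible[OF o] \<open>g x \<noteq> 0\<close> assms(4) by (auto simp: U_def)
qed

context
  fixes Z :: "('i, 'a::{t2_space,second_countable_topology}, real ^ 'm::finite) riem"
  assumes Z: "closed_riemannian_manifold Z"
begin

lemma closed_param_image:
  assumes "i \<in> idx Z" "compact K" "K \<subseteq> chart_img Z i"
  shows "closed (param Z i ` K)"
  using assms closed_riemannian[OF Z]
  by (intro compact_imp_closed compact_continuous_image continuous_on_subset[OF continuous_on_param])

lemma param_image_iff:
  assumes "i \<in> idx Z" "K \<subseteq> chart_img Z i"
  shows "p \<in> param Z i ` K \<longleftrightarrow> p \<in> chart_dom Z i \<and> chart Z i p \<in> K"
proof
  assume "p \<in> param Z i ` K"
  then obtain x where "x \<in> K" "p = param Z i x" by blast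
  then show "p \<in> chart_dom Z i \<and> chart Z i p \<in> K"
    using assms param_in_dom[OF closed_riemannian[OF Z]] chart_param[OF closed_riemannian[OF Z]] by auto
next
  assume "p \<in> chart_dom Z i \<and> chart Z i p \<in> K"
  then show "p \<in> param Z i ` K"
    using param_chart[OF closed_riemannian[OF Z] assms(1), of p] by (metis image_eqI)
qed

lemma open_chart_preimage:
  "i \<in> idx Z \<Longrightarrow> open U \<Longrightarrow> open {x \<in> chart_img Z i. param Z i x \<in> U}"
  using continuous_open_preimage[OF continuous_on_param open_chart_img] closed_riemannian[OF Z]
  by (simp add: vimage_def Int_def)

text \<open>Seen from another chart, the function is \<eta> composed with a transition map on the
  overlap. Near a point outside \<open>chart_dom Z i\<close> it vanishes, because the image of the
  compact support is closed in the Hausdorff space.\<close>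

lemma smooth_chart_bump:
  assumes i: "i \<in> idx Z" and \<eta>: "test_function (chart_img Z i) \<eta>"
  shows "smooth_function Z (chart_bump Z i \<eta>)"
  unfolding smooth_function_def smooth_on_def
proof (intro ballI allI)
  note R = closed_riemannian[OF Z]
  define K where "K = closure {x. \<eta> x \<noteq> 0}"
  have K: "compact K" "K \<subseteq> chart_img Z i" and \<eta>s: "smooth_on UNIV \<eta>" using \<eta> by (auto simp: test_function_def K_def)
  have \<eta>0: "\<eta> x = 0" if "x \<notin> K" for x using that closure_subset[of "{x. \<eta> x \<noteq> 0}"] by (auto simp: K_def)
  fix j k assume j: "j \<in> idx Z"
  show "Ck_on k (chart_bump Z i \<eta> \<circ> param Z j) (chart_img Z j)"
  proof (rule Ck_on_local)
    fix x assume x: "x \<in> chart_img Z j"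
    show "\<exists>W. open W \<and> x \<in> W \<and> Ck_on k (chart_bump Z i \<eta> \<circ> param Z j) W"
    proof (cases "param Z j x \<in> chart_dom Z i")
      case True
      have o: "open (overlap Z j i)" by (rule open_overlap[OF R j i])
      have "Ck_on k (\<lambda>x. \<eta> (transition Z j i x)) (overlap Z j i)"
        by (rule Ck_on_compose[OF o smooth_onD[OF smooth_transition[OF R j i]] smooth_onD[OF \<eta>s]]) simp
      moreover have "\<eta> (transition Z j i y) = (chart_bump Z i \<eta> \<circ> param Z j) y" if "y \<in> overlap Z j i" for y
        using that overlap_iff[OF R j] by (auto simp: chart_bump_def transition_def)
      ultimately have "Ck_on k (chart_bump Z i \<eta> \<circ> param Z j) (overlap Z j i)"
        using Ck_on_cong[OF o, of "\<lambda>x. \<eta> (transition Z j i x)"] by blast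
      then show ?thesis using o x True overlap_iff[OF R j] by blast
    next
      case False
      define W where "W = {y \<in> chart_img Z j. param Z j y \<in> - param Z i ` K}"
      have o: "open W" unfolding W_def
        by (intro open_chart_preimage j open_Compl closed_param_image i K)
      have "(chart_bump Z i \<eta> \<circ> param Z j) y = 0" if "y \<in> W" for y
        using that param_image_iff[OF i K(2)] \<eta>0 by (auto simp: W_def chart_bump_def)
      then have "Ck_on k (chart_bump Z i \<eta> \<circ> param Z j) W"
        using Ck_on_cong[OF o, of "chart_bump Z i \<eta> \<circ> param Z j" "\<lambda>_. 0"] by simp
      moreover have "x \<in> W" using x False param_image_iff[OF i K(2)] by (simp add: W_def)
      ultimately show ?thesis using o by blast
    qed
  qed
qed

text \<open>An index is a chart together with the two corners of a box. By compactness finitely many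
  box bumps have a positive sum, and division by it normalizes them.\<close>

lemma partition_of_unity:
  obtains T :: "('i \<times> (real ^ 'm) \<times> (real ^ 'm)) set" and \<rho>
  where "finite T" "\<And>\<tau>. \<tau> \<in> T \<Longrightarrow> fst \<tau> \<in> idx Z"
    "\<And>\<tau>. \<tau> \<in> T \<Longrightarrow> cbox (fst (snd \<tau>)) (snd (snd \<tau>)) \<subseteq> chart_img Z (fst \<tau>)"
    "\<And>\<tau>. \<tau> \<in> T \<Longrightarrow> smooth_function Z (\<rho> \<tau>)"
    "\<And>\<tau> p. \<tau> \<in> T \<Longrightarrow> \<rho> \<tau> p \<ge> 0"
    "\<And>\<tau> p. \<tau> \<in> T \<Longrightarrow> \<rho> \<tau> p \<noteq> 0 \<Longrightarrow>
      p \<in> chart_dom Z (fst \<tau>) \<and> chart Z (fst \<tau>) p \<in> cbox (fst (snd \<tau>)) (snd (snd \<tau>))"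
    "\<And>p. (\<Sum>\<tau>\<in>T. \<rho> \<tau> p) = 1"
proof -
  note R = closed_riemannian[OF Z]
  define S where "S = {\<tau> :: 'i \<times> (real ^ 'm) \<times> (real ^ 'm). fst \<tau> \<in> idx Z \<and> cbox (fst (snd \<tau>)) (snd (snd \<tau>)) \<subseteq> chart_img Z (fst \<tau>)}"
  define \<beta> where "\<beta> \<tau> = chart_bump Z (fst \<tau>) (box_bump 1 (fst (snd \<tau>)) (snd (snd \<tau>)))" for \<tau>
  have sm: "smooth_function Z (\<beta> \<tau>)" if "\<tau> \<in> S" for \<tau>
    unfolding \<beta>_def using that by (intro smooth_chart_bump test_function_box_bump) (auto simp: S_def)
  have b0: "\<beta> \<tau> p \<ge> 0" for \<tau> p by (simp add: \<beta>_def chart_bump_def box_bump_nonneg)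
  have bs: "p \<in> chart_dom Z (fst \<tau>) \<and> chart Z (fst \<tau>) p \<in> cbox (fst (snd \<tau>)) (snd (snd \<tau>))" if "\<beta> \<tau> p \<noteq> 0" for \<tau> p
  proof -
    have "p \<in> chart_dom Z (fst \<tau>)" "box_bump 1 (fst (snd \<tau>)) (snd (snd \<tau>)) (chart Z (fst \<tau>) p) \<noteq> 0"
      using that by (auto simp: \<beta>_def chart_bump_def split: if_splits)
    then show ?thesis
      using box_bump_eq_0[of 1 "chart Z (fst \<tau>) p" "fst (snd \<tau>)" "snd (snd \<tau>)"] box_subset_cbox[of "fst (snd \<tau>)" "snd (snd \<tau>)"] by auto
  qed
  have opn: "open {p. \<beta> \<tau> p > 0}" if "\<tau> \<in> S" for \<tau>
    by (intro open_Collect_less continuous_on_const smooth_function_continuous[OF closed_riemannian[OF Z]] sm that)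
  have "UNIV \<subseteq> (\<Union>\<tau>\<in>S. {p. \<beta> \<tau> p > 0})"
  proof
    fix p
    have i: "chart_at Z p \<in> idx Z" "p \<in> chart_dom Z (chart_at Z p)" using chart_at[OF R] by auto
    obtain l r where lr: "chart Z (chart_at Z p) p \<in> box l r" "cbox l r \<subseteq> chart_img Z (chart_at Z p)"
      using chart_box[OF Z i] .
    have "(chart_at Z p, l, r) \<in> S" using i lr by (simp add: S_def)
    moreover have "\<beta> (chart_at Z p, l, r) p > 0" using lr i box_bump_pos_iff[of 1 l r "chart Z (chart_at Z p) p"] by (simp add: \<beta>_def chart_bump_def)
    ultimately show "p \<in> (\<Union>\<tau>\<in>S. {p. \<beta> \<tau> p > 0})" by blast
  qed
  from compactE_image[OF compact_UNIV[OF Z] opn this]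
  obtain T where T: "T \<subseteq> S" "finite T" "UNIV \<subseteq> (\<Union>\<tau>\<in>T. {p. \<beta> \<tau> p > 0})" by metis
  define s where "s p = (\<Sum>\<tau>\<in>T. \<beta> \<tau> p)" for p
  have s: "s p > 0" for p
  proof -
    obtain \<tau> where "\<tau> \<in> T" "\<beta> \<tau> p > 0" using T(3) by blast
    then show ?thesis unfolding s_def by (intro sum_pos2[OF T(2)]) (use b0 in auto)
  qed
  show thesis
  proof (rule that[OF T(2), of "\<lambda>\<tau> p. \<beta> \<tau> p / s p"])
    fix \<tau> p assume \<tau>: "\<tau> \<in> T"
    then have S: "\<tau> \<in> S" using T(1) by auto
    then show "fst \<tau> \<in> idx Z" "cbox (fst (snd \<tau>)) (snd (snd \<tau>)) \<subseteq> chart_img Z (fst \<tau>)" by (auto simp: S_def)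
    show "smooth_function Z (\<lambda>p. \<beta> \<tau> p / s p)"
      unfolding smooth_function_def smooth_on_def o_def
    proof (intro ballI allI Ck_on_divide open_chart_img[OF R])
      fix i k assume i: "i \<in> idx Z"
      have *: "Ck_on k (\<lambda>x. \<beta> \<tau> (param Z i x)) (chart_img Z i)" if "\<tau> \<in> T" for \<tau>
        using sm[of \<tau>] that T(1) i by (auto simp: smooth_function_def smooth_on_def o_def)
      show "Ck_on k (\<lambda>x. \<beta> \<tau> (param Z i x)) (chart_img Z i)" by (rule *[OF \<tau>])
      show "Ck_on k (\<lambda>x. s (param Z i x)) (chart_img Z i)"
        unfolding s_def by (intro Ck_on_sum open_chart_img[OF R i] *)
      show "s (param Z i x) \<noteq> 0" for x using s[of "param Z i x"] by simp
    qed
    show "\<beta> \<tau> p / s p \<ge> 0" using b0 s[of p] by (simp add: less_imp_le)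
    show "p \<in> chart_dom Z (fst \<tau>) \<and> chart Z (fst \<tau>) p \<in> cbox (fst (snd \<tau>)) (snd (snd \<tau>))" if "\<beta> \<tau> p / s p \<noteq> 0"
      using bs that by auto
  next
    fix p show "(\<Sum>\<tau>\<in>T. \<beta> \<tau> p / s p) = 1"
      using s[of p] by (simp add: sum_divide_distrib[symmetric] s_def[symmetric])
  qed
qed

text \<open>By compactness the function is bounded, and the volume is finite.\<close>

lemma integrable_continuous:
  fixes h :: "'a \<Rightarrow> real"
  assumes "continuous_on UNIV h" shows "integrable (volume Z) h"
proof -
  interpret finite_measure "volume Z" by (rule finite_measure_volume[OF Z])
  have "compact (range h)" by (rule compact_continuous_image[OF assms compact_UNIV[OF Z]])
  then obtain C where C: "\<And>p. \<bar>h p\<bar> \<le> C" unfolding compact_eq_bounded_closed bounded_iff by auto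
  have "h \<in> borel_measurable borel" using assms by (rule borel_measurable_continuous_onI)
  then have "h \<in> borel_measurable (volume Z)" by (simp only: measurable_cong_sets[OF sets_volume[OF Z] refl])
  then show ?thesis by (intro integrable_const_bound[where B=C]) (use C in auto)
qed

lemma form_inner_at_chart:
  assumes "smooth_function Z u" "smooth_function Z v" "i \<in> idx Z" "p \<in> chart_dom Z i"
  shows "form_inner Z (differential Z u) (differential Z v) p
    = contract (metric Z i (chart Z i p)) (\<lambda>a b. differential Z u i (chart Z i p) a * differential Z v i (chart Z i p) b)"
  unfolding form_inner_def Let_def using closed_riemannian[OF Z] assms
  by (intro form_inner_chart one_form_differential chart_at)

lemma continuous_form_inner:
  assumes "smooth_function Z u" "smooth_function Z v"
  shows "continuous_on UNIV (form_inner Z (differential Z u) (differential Z v))"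
proof (rule continuous_on_chartwise[OF closed_riemannian[OF Z]])
  note R = closed_riemannian[OF Z]
  fix i assume i: "i \<in> idx Z"
  have "continuous_on (chart_img Z i) (\<lambda>x. contract (metric Z i x) (\<lambda>a b. differential Z u i x a * differential Z v i x b))"
    unfolding contract_def inverse_form_def cometric_def[symmetric]
    by (intro continuous_on_sum continuous_on_mult smooth_on_continuous[OF smooth_cometric[OF R i]]
        smooth_on_continuous[OF smooth_on_one_form[OF _ i]] assms)
  from continuous_on_compose2[OF this continuous_on_chart[OF R i]]
  have "continuous_on (chart_dom Z i) (\<lambda>p. contract (metric Z i (chart Z i p)) (\<lambda>a b. differential Z u i (chart Z i p) a * differential Z v i (chart Z i p) b))"
    using chart_in_img[OF R] by auto
  then show "continuous_on (chart_dom Z i) (form_inner Z (differential Z u) (differential Z v))"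
    using form_inner_at_chart[OF assms i] by (simp cong: continuous_on_cong)
qed

lemma flux_smooth:
  assumes "i \<in> idx Z" "smooth_function Z f"
  shows "smooth_on (chart_img Z i) (\<lambda>y. sqrt (gram_det Z i y) * (\<Sum>c\<in>Basis. cometric Z i y b c * pd c (f \<circ> param Z i) y))"
  using smooth_gram_det[OF closed_riemannian[OF Z] assms(1)] gram_det_pos[OF Z assms(1)]
    smooth_cometric[OF closed_riemannian[OF Z] assms(1)] smooth_on_pd[of "chart_img Z i" "f \<circ> param Z i"] assms
  unfolding smooth_on_def smooth_function_def
  by (intro allI Ck_on_mult Ck_on_sum Ck_on_sqrt open_chart_img[OF closed_riemannian[OF Z]]) blast+

lemma continuous_on_chart_laplacian:
  assumes "i \<in> idx Z" "smooth_function Z f"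
  shows "continuous_on (chart_img Z i) (chart_laplacian Z i f)"
proof -
  have "sqrt (gram_det Z i x) \<noteq> 0" if "x \<in> chart_img Z i" for x using gram_det_pos[OF Z assms(1) that] by simp
  then show ?thesis
    unfolding chart_laplacian_def laplacian_loc_def[abs_def]
    by (intro continuous_on_divide continuous_on_sum continuous_on_real_sqrt smooth_on_continuous[OF smooth_on_pd[OF flux_smooth[OF assms]]]
      smooth_on_continuous[OF smooth_gram_det[OF closed_riemannian[OF Z] assms(1)]]) auto
qed

text \<open>Integration by parts in a single chart, possible because \<psi> is supported there;
  \<open>F\<close> is the flux whose divergence defines the Laplacian.\<close>

lemma green_chart:
  assumes i: "i \<in> idx Z" and f: "smooth_function Z f" and \<psi>: "smooth_function Z \<psi>"
    and K: "compact K" "K \<subseteq> chart_img Z i" and supp: "\<And>p. \<psi> p \<noteq> 0 \<Longrightarrow> p \<in> chart_dom Z i \<and> chart Z i p \<in> K"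
  shows "(LINT p|volume Z. form_inner Z (differential Z \<psi>) (differential Z f) p)
    = - (LINT p|volume Z. \<psi> p * chart_bump Z i (chart_laplacian Z i f) p)"
proof -
  note R = closed_riemannian[OF Z]
  let ?V = "chart_img Z i" and ?v = "volume Z"
  have V: "open ?V" by (rule open_chart_img[OF R i])
  let ?\<psi> = "\<psi> \<circ> param Z i" and ?f = "f \<circ> param Z i"
  let ?g = "\<lambda>x. sqrt (gram_det Z i x)"
  define F where "F b y = ?g y * (\<Sum>c\<in>Basis. cometric Z i y b c * pd c ?f y)" for b y
  have gpos: "?g x > 0" if "x \<in> ?V" for x using gram_det_pos[OF Z i that] by simp
  have F: "Ck_on k (F b) ?V" for k b unfolding F_def by (rule smooth_onD[OF flux_smooth[OF i f]])
  have \<psi>s: "smooth_on ?V ?\<psi>" using \<psi> i by (simp add: smooth_function_def)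
  have \<psi>0: "?\<psi> x = 0" if "x \<in> ?V - K" for x using supp[of "param Z i x"] that chart_param[OF R i] by auto
  have oVK: "open (?V - K)" using V K by (simp add: Diff_eq compact_imp_closed open_Compl open_Int)
  have d\<psi>0: "pd b ?\<psi> x = 0" if "x \<in> ?V - K" for x b
    using frechet_derivative_cong_open[OF oVK that, of ?\<psi> "\<lambda>x. 0"] \<psi>0 by (simp add: frechet_derivative_const)
  let ?A = "param Z i ` K"
  \<comment> \<open>The closed set \<open>?A\<close> contains the support of \<psi>, so \<psi>
    vanishes in a neighbourhood of \<open>p\<close>, and its differential vanishes at
    \<open>p\<close> whatever chart \<open>chart_at\<close> picks.\<close>
  have inner0: "form_inner Z (differential Z \<psi>) (differential Z f) p = 0" if p: "p \<notin> chart_dom Z i" for p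
  proof -
    let ?j = "chart_at Z p"
    have j: "?j \<in> idx Z" "p \<in> chart_dom Z ?j" using chart_at[OF R] by auto
    define W where "W = {y \<in> chart_img Z ?j. param Z ?j y \<in> - ?A}"
    have "open W" unfolding W_def by (intro open_chart_preimage j open_Compl closed_param_image i K)
    moreover have "chart Z ?j p \<in> W"
      using p chart_in_img[OF R j(2)] param_chart[OF R j] param_image_iff[OF i K(2)] by (simp add: W_def)
    moreover have "(\<psi> \<circ> param Z ?j) y = 0" if "y \<in> W" for y
      using that supp[of "param Z ?j y"] param_image_iff[OF i K(2)] by (auto simp: W_def)
    ultimately have "pd b (\<psi> \<circ> param Z ?j) (chart Z ?j p) = 0" for b
      using frechet_derivative_cong_open[of W "chart Z ?j p" "\<psi> \<circ> param Z ?j" "\<lambda>x. 0"] by (simp add: frechet_derivative_const)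
    then show ?thesis unfolding form_inner_at_chart[OF \<psi> f j] by (simp add: differential_def contract_def)
  qed
  have restrict: "(LINT p|?v. h p) = (LINT p:chart_dom Z i|?v. h p)" if "\<And>p. p \<notin> chart_dom Z i \<Longrightarrow> h p = 0" for h :: "'a \<Rightarrow> real"
    unfolding set_lebesgue_integral_def
    by (rule Bochner_Integration.integral_cong) (use that in \<open>auto simp: indicator_def\<close>)
  have g0: "gram_det Z i x \<ge> 0" if "x \<in> ?V" for x using gram_det_pos[OF Z i that] by simp
  have lhs: "(LINT p|?v. form_inner Z (differential Z \<psi>) (differential Z f) p)
      = (LINT x:?V|lborel. \<Sum>b\<in>Basis. F b x * pd b ?\<psi> x)"
  proof -
    have "(LINT p|?v. form_inner Z (differential Z \<psi>) (differential Z f) p)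
        = (LINT p:chart_dom Z i|?v. form_inner Z (differential Z \<psi>) (differential Z f) p)"
      by (rule restrict[OF inner0])
    also have "\<dots> = (LINT x:?V|lborel. ?g x * form_inner Z (differential Z \<psi>) (differential Z f) (param Z i x))"
      by (rule integral_volume_chart[OF R is_volume_volume[OF Z] i borel_measurable_continuous_onI[OF continuous_form_inner[OF \<psi> f]] g0])
    also have "\<dots> = (LINT x:?V|lborel. \<Sum>b\<in>Basis. F b x * pd b ?\<psi> x)"
    proof (rule set_lebesgue_integral_cong)
      show "\<forall>x. x \<in> ?V \<longrightarrow> ?g x * form_inner Z (differential Z \<psi>) (differential Z f) (param Z i x) = (\<Sum>b\<in>Basis. F b x * pd b ?\<psi> x)"
      proof (intro allI impI)
        fix x assume x: "x \<in> ?V"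
        show "?g x * form_inner Z (differential Z \<psi>) (differential Z f) (param Z i x) = (\<Sum>b\<in>Basis. F b x * pd b ?\<psi> x)"
          unfolding form_inner_at_chart[OF \<psi> f i param_in_dom[OF R i x]] chart_param[OF R i x]
          by (simp add: contract_def F_def differential_def cometric_def inverse_form_def sum_distrib_left sum_distrib_right mult.commute mult.left_commute)
      qed
    qed (use V in simp)
    finally show ?thesis .
  qed
  have int: "set_integrable lborel ?V (\<lambda>x. F b x * pd b ?\<psi> x)" "set_integrable lborel ?V (\<lambda>x. pd b (F b) x * ?\<psi> x)" for b
    using d\<psi>0 \<psi>0 smooth_on_continuous[OF \<psi>s] smooth_on_continuous[OF smooth_on_pd[OF \<psi>s]] Ck_on_imp_continuous[OF F] F[of 1]
    by (auto intro!: set_integrable_compact_support[OF _ K] continuous_on_mult)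
  have "(LINT x:?V|lborel. \<Sum>b\<in>Basis. F b x * pd b ?\<psi> x) = (\<Sum>b\<in>Basis. (LINT x:?V|lborel. F b x * pd b ?\<psi> x))"
    by (rule set_lebesgue_integral_sum[OF int(1)])
  also have "\<dots> = (\<Sum>b\<in>Basis. - (LINT x:?V|lborel. pd b (F b) x * ?\<psi> x))"
    by (intro sum.cong refl set_integral_by_parts[OF V F smooth_onD[OF \<psi>s] K \<psi>0])
  also have "\<dots> = - (LINT x:?V|lborel. \<Sum>b\<in>Basis. pd b (F b) x * ?\<psi> x)"
    by (simp only: sum_negf set_lebesgue_integral_sum[OF int(2)])
  also have "(LINT x:?V|lborel. \<Sum>b\<in>Basis. pd b (F b) x * ?\<psi> x)
      = (LINT x:?V|lborel. ?g x * (\<psi> (param Z i x) * chart_bump Z i (chart_laplacian Z i f) (param Z i x)))"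
  proof (rule set_lebesgue_integral_cong)
    show "\<forall>x. x \<in> ?V \<longrightarrow> (\<Sum>b\<in>Basis. pd b (F b) x * ?\<psi> x) = ?g x * (\<psi> (param Z i x) * chart_bump Z i (chart_laplacian Z i f) (param Z i x))"
    proof (intro allI impI)
      fix x assume x: "x \<in> ?V"
      have "chart_bump Z i (chart_laplacian Z i f) (param Z i x) = (\<Sum>b\<in>Basis. pd b (F b) x) / ?g x"
        using param_in_dom[OF R i x] chart_param[OF R i x]
        by (simp add: chart_bump_def chart_laplacian_def laplacian_loc_def F_def[abs_def])
      then show "(\<Sum>b\<in>Basis. pd b (F b) x * ?\<psi> x) = ?g x * (\<psi> (param Z i x) * chart_bump Z i (chart_laplacian Z i f) (param Z i x))"
        using gpos[OF x] by (simp add: sum_distrib_right[symmetric])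
    qed
  qed (use V in simp)
  also have "\<dots> = (LINT p:chart_dom Z i|?v. \<psi> p * chart_bump Z i (chart_laplacian Z i f) p)"
  proof (rule integral_volume_chart[OF R is_volume_volume[OF Z] i _ g0, symmetric])
    have "continuous_on (chart_dom Z i) (\<lambda>p. chart_laplacian Z i f (chart Z i p))"
      by (rule continuous_on_compose2[OF continuous_on_chart_laplacian[OF i f] continuous_on_chart[OF R i]]) (use chart_in_img[OF R] in auto)
    then have "(\<lambda>p. if p \<in> chart_dom Z i then chart_laplacian Z i f (chart Z i p) else 0) \<in> borel_measurable borel"
      using open_chart_dom[OF R i]
      by (intro measurable_If_restrict_space_iff[THEN iffD2]) (auto intro!: borel_measurable_continuous_on_restrict)
    then show "(\<lambda>p. \<psi> p * chart_bump Z i (chart_laplacian Z i f) p) \<in> borel_measurable borel"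
      using borel_measurable_continuous_onI[OF smooth_function_continuous[OF closed_riemannian[OF Z] \<psi>]]
      by (auto simp: chart_bump_def[abs_def])
  qed
  also have "\<dots> = (LINT p|?v. \<psi> p * chart_bump Z i (chart_laplacian Z i f) p)"
    by (rule restrict[symmetric]) (simp add: chart_bump_def)
  finally show ?thesis by (simp only: lhs)
qed

text \<open>Tested against bump functions supported in the overlap, both local expressions give the same
  Dirichlet form.\<close>

lemma chart_laplacian_transition:
  assumes i: "i \<in> idx Z" and j: "j \<in> idx Z" and f: "smooth_function Z f" and p: "p \<in> chart_dom Z i" "p \<in> chart_dom Z j"
  shows "chart_laplacian Z i f (chart Z i p) = chart_laplacian Z j f (chart Z j p)"
proof -
  note R = closed_riemannian[OF Z]
  let ?V = "overlap Z i j" and ?v = "volume Z"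
  have V: "open ?V" and sub: "?V \<subseteq> chart_img Z i" by (rule open_overlap[OF R i j], rule overlap_subset)
  let ?L = "\<lambda>k p. chart_bump Z k (chart_laplacian Z k f) p"
  \<comment> \<open>The density is included so that the integral of \<open>g\<close> against a test
    function is an integral over the manifold.\<close>
  define g where "g x = sqrt (gram_det Z i x) * (chart_laplacian Z i f x - chart_laplacian Z j f (transition Z i j x))" for x
  have c: "continuous_on ?V g"
    unfolding g_def
    by (intro continuous_on_mult continuous_on_diff continuous_on_real_sqrt
        continuous_on_subset[OF smooth_on_continuous[OF smooth_gram_det[OF R i]] sub]
        continuous_on_subset[OF continuous_on_chart_laplacian[OF i f] sub]
        continuous_on_compose2[OF continuous_on_chart_laplacian[OF j f] smooth_on_continuous[OF smooth_transition[OF R i j]]])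
      (use transition_img[OF R i j] in auto)
  have Lm: "?L k \<in> borel_measurable borel" if k: "k \<in> idx Z" for k
  proof -
    have "continuous_on (chart_dom Z k) (\<lambda>p. chart_laplacian Z k f (chart Z k p))"
      by (rule continuous_on_compose2[OF continuous_on_chart_laplacian[OF k f] continuous_on_chart[OF R k]]) (use chart_in_img[OF R] in auto)
    then have "(\<lambda>p. if p \<in> chart_dom Z k then chart_laplacian Z k f (chart Z k p) else 0) \<in> borel_measurable borel"
      using open_chart_dom[OF R k]
      by (intro measurable_If_restrict_space_iff[THEN iffD2]) (auto intro!: borel_measurable_continuous_on_restrict)
    then show ?thesis by (simp add: chart_bump_def[abs_def])
  qed
  have "AE x in lborel. x \<in> ?V \<longrightarrow> g x = 0"
  proof (rule fundamental_lemma_calculus_of_variations[OF V locally_integrable_continuous[OF c]])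
    fix \<eta> assume \<eta>: "test_function ?V \<eta>"
    define K where "K = closure {x. \<eta> x \<noteq> 0}"
    have K: "compact K" "K \<subseteq> ?V" using \<eta> by (auto simp: test_function_def K_def)
    have \<eta>0: "\<eta> x = 0" if "x \<notin> K" for x using that closure_subset[of "{x. \<eta> x \<noteq> 0}"] by (auto simp: K_def)
    have \<eta>i: "test_function (chart_img Z i) \<eta>" using \<eta> sub by (auto simp: test_function_def)
    define \<psi> where "\<psi> = chart_bump Z i \<eta>"
    have \<psi>: "smooth_function Z \<psi>" unfolding \<psi>_def by (rule smooth_chart_bump[OF i \<eta>i])
    have supp: "q \<in> chart_dom Z i \<and> chart Z i q \<in> K" if "\<psi> q \<noteq> 0" for q
      using that \<eta>0 by (auto simp: \<psi>_def chart_bump_def split: if_splits)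
    \<comment> \<open>The same support seen in chart \<open>j\<close>, so that
      \<open>green_chart\<close> applies in both charts.\<close>
    define K' where "K' = transition Z i j ` K"
    have K': "compact K'" "K' \<subseteq> chart_img Z j"
      unfolding K'_def using K(2) transition_img[OF R i j]
      by (auto intro!: compact_continuous_image[OF _ K(1)] continuous_on_subset[OF smooth_on_continuous[OF smooth_transition[OF R i j]] K(2)])
    have supp': "q \<in> chart_dom Z j \<and> chart Z j q \<in> K'" if "\<psi> q \<noteq> 0" for q
    proof -
      have q: "q \<in> chart_dom Z i" "chart Z i q \<in> K" using supp[OF that] by auto
      then have "q \<in> chart_dom Z j" using overlap_iff[OF R i] K(2) param_chart[OF R i] by (metis subsetD)
      moreover have "chart Z j q \<in> K'"
        unfolding K'_def using q(2) transition_chart[OF R i q(1), of j] by (metis image_eqI)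
      ultimately show ?thesis by blast
    qed
    have Ki: "K \<subseteq> chart_img Z i" using K(2) sub by blast
    have "(LINT q|?v. \<psi> q * ?L i q) = (LINT q|?v. \<psi> q * ?L j q)"
      using green_chart[OF i f \<psi> K(1) Ki supp] green_chart[OF j f \<psi> K' supp'] by simp
    moreover have "(LINT q|?v. \<psi> q * ?L k q) = (LINT x:chart_img Z i|lborel. sqrt (gram_det Z i x) * (\<psi> (param Z i x) * ?L k (param Z i x)))"
      if k: "k \<in> idx Z" for k
    proof -
      have "(LINT q|?v. \<psi> q * ?L k q) = (LINT q:chart_dom Z i|?v. \<psi> q * ?L k q)"
        unfolding set_lebesgue_integral_def
        by (rule Bochner_Integration.integral_cong) (use supp in \<open>auto simp: indicator_def\<close>)
      also have "\<dots> = (LINT x:chart_img Z i|lborel. sqrt (gram_det Z i x) * (\<psi> (param Z i x) * ?L k (param Z i x)))"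
        using borel_measurable_continuous_onI[OF smooth_function_continuous[OF closed_riemannian[OF Z] \<psi>]] Lm[OF k] gram_det_pos[OF Z i]
        by (intro integral_volume_chart[OF R is_volume_volume[OF Z] i]) (auto simp: less_imp_le)
      finally show ?thesis .
    qed
    moreover have "(LINT x:chart_img Z i|lborel. sqrt (gram_det Z i x) * (\<psi> (param Z i x) * ?L k (param Z i x)))
        = (LINT x:?V|lborel. sqrt (gram_det Z i x) * (\<eta> x * ?L k (param Z i x)))" for k
      unfolding set_lebesgue_integral_def
    proof (rule Bochner_Integration.integral_cong[OF refl])
      fix x
      show "indicator (chart_img Z i) x *\<^sub>R (sqrt (gram_det Z i x) * (\<psi> (param Z i x) * ?L k (param Z i x)))
          = indicator ?V x *\<^sub>R (sqrt (gram_det Z i x) * (\<eta> x * ?L k (param Z i x)))"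
        using sub K(2) \<eta>0[of x] param_in_dom[OF R i, of x] chart_param[OF R i, of x]
        by (auto simp: indicator_def \<psi>_def chart_bump_def)
    qed
    ultimately have eq: "(LINT x:?V|lborel. sqrt (gram_det Z i x) * (\<eta> x * ?L i (param Z i x)))
        = (LINT x:?V|lborel. sqrt (gram_det Z i x) * (\<eta> x * ?L j (param Z i x)))" using i j by simp
    have Li: "?L i (param Z i x) = chart_laplacian Z i f x" and Lj: "?L j (param Z i x) = chart_laplacian Z j f (transition Z i j x)"
      if "x \<in> ?V" for x
      using that overlap_iff[OF R i, of x j] param_in_dom[OF R i, of x] chart_param[OF R i, of x]
      by (auto simp: chart_bump_def transition_def)
    have int: "set_integrable lborel ?V (\<lambda>x. sqrt (gram_det Z i x) * (\<eta> x * G x))" if "continuous_on ?V G" for G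
    proof (rule set_integrable_compact_support[OF _ K])
      have "continuous_on ?V \<eta>" using \<eta> smooth_on_continuous[of UNIV \<eta>] continuous_on_subset by (auto simp: test_function_def)
      then show "continuous_on ?V (\<lambda>x. sqrt (gram_det Z i x) * (\<eta> x * G x))"
        by (intro continuous_on_mult that continuous_on_real_sqrt continuous_on_subset[OF smooth_on_continuous[OF smooth_gram_det[OF R i]] sub])
    qed (use \<eta>0 in auto)
    have "(LINT x:?V|lborel. g x * \<eta> x) = (LINT x:?V|lborel. sqrt (gram_det Z i x) * (\<eta> x * chart_laplacian Z i f x)
        - sqrt (gram_det Z i x) * (\<eta> x * chart_laplacian Z j f (transition Z i j x)))"
      by (simp add: g_def algebra_simps)
    also have "\<dots> = (LINT x:?V|lborel. sqrt (gram_det Z i x) * (\<eta> x * chart_laplacian Z i f x))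
        - (LINT x:?V|lborel. sqrt (gram_det Z i x) * (\<eta> x * chart_laplacian Z j f (transition Z i j x)))"
    proof (rule set_integral_diff(2))
      show "set_integrable lborel ?V (\<lambda>x. sqrt (gram_det Z i x) * (\<eta> x * chart_laplacian Z i f x))"
        by (rule int[OF continuous_on_subset[OF continuous_on_chart_laplacian[OF i f] sub]])
      show "set_integrable lborel ?V (\<lambda>x. sqrt (gram_det Z i x) * (\<eta> x * chart_laplacian Z j f (transition Z i j x)))"
        by (rule int, rule continuous_on_compose2[OF continuous_on_chart_laplacian[OF j f] smooth_on_continuous[OF smooth_transition[OF R i j]]])
           (use transition_img[OF R i j] in auto)
    qed
    also have "\<dots> = (LINT x:?V|lborel. sqrt (gram_det Z i x) * (\<eta> x * ?L i (param Z i x)))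
        - (LINT x:?V|lborel. sqrt (gram_det Z i x) * (\<eta> x * ?L j (param Z i x)))"
      using Li Lj V by (intro arg_cong2[where f="(-)"] set_lebesgue_integral_cong) auto
    finally show "(LINT x:?V|lborel. g x * \<eta> x) = 0" using eq by simp
  qed
  moreover have x: "chart Z i p \<in> ?V" using p by (auto simp: overlap_def)
  ultimately have "g (chart Z i p) = 0" by (rule continuous_AE_eq_0_on_open[OF V c])
  then show ?thesis
    using gram_det_pos[OF Z i chart_in_img[OF R p(1)]] transition_chart[OF R i p(1), of j] by (simp add: g_def)
qed

lemma laplacian_chart:
  assumes "i \<in> idx Z" "smooth_function Z f" "p \<in> chart_dom Z i"
  shows "laplacian Z f p = chart_laplacian Z i f (chart Z i p)"
  using chart_laplacian_transition[OF chart_at(1)[OF closed_riemannian[OF Z]] assms(1,2) chart_at(2)[OF closed_riemannian[OF Z]] assms(3)]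
  by (simp add: laplacian_def chart_laplacian_def)

text \<open>Linearity of the differential; it reassembles the pieces of a partition of
  unity.\<close>

lemma form_inner_sum:
  assumes T: "finite T" and \<psi>: "\<And>\<tau>. \<tau> \<in> T \<Longrightarrow> smooth_function Z (\<psi> \<tau>)" and f: "smooth_function Z f"
    and s: "\<And>p. (\<Sum>\<tau>\<in>T. \<psi> \<tau> p) = u p"
  shows "(\<Sum>\<tau>\<in>T. form_inner Z (differential Z (\<psi> \<tau>)) (differential Z f) p) = form_inner Z (differential Z u) (differential Z f) p"
proof -
  note R = closed_riemannian[OF Z]
  let ?i = "chart_at Z p" and ?x = "chart Z (chart_at Z p) p"
  have x: "?x \<in> chart_img Z ?i" by (rule chart_in_img[OF R chart_at(2)[OF R]])
  have "((\<lambda>y. \<Sum>\<tau>\<in>T. (\<psi> \<tau> \<circ> param Z ?i) y) has_derivative (\<lambda>v. \<Sum>\<tau>\<in>T. pd v (\<psi> \<tau> \<circ> param Z ?i) ?x)) (at ?x)"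
  proof (rule has_derivative_sum)
    fix \<tau> assume "\<tau> \<in> T"
    then have "smooth_on (chart_img Z ?i) (\<psi> \<tau> \<circ> param Z ?i)"
      using \<psi> chart_at(1)[OF R] by (simp add: smooth_function_def)
    from frechet_derivative_works[THEN iffD1, OF smooth_on_differentiable[OF this x]]
    show "((\<lambda>y. (\<psi> \<tau> \<circ> param Z ?i) y) has_derivative (\<lambda>v. pd v (\<psi> \<tau> \<circ> param Z ?i) ?x)) (at ?x)" .
  qed
  moreover have "(\<lambda>y. \<Sum>\<tau>\<in>T. (\<psi> \<tau> \<circ> param Z ?i) y) = u \<circ> param Z ?i" using s by auto
  ultimately have "differential Z u ?i ?x v = (\<Sum>\<tau>\<in>T. differential Z (\<psi> \<tau>) ?i ?x v)" for v
    by (simp add: differential_def frechet_derivative_eq)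
  then show ?thesis
    unfolding form_inner_def Let_def contract_def
    by (simp add: sum_distrib_left sum_distrib_right sum.swap[of _ T])
qed

text \<open>The equation is tested against \<open>f\<close> itself. A partition of unity cuts
  \<open>f\<close> into pieces supported in single charts, where \<open>green_chart\<close> applies
  and the local Laplacian is the global one.\<close>

lemma energy_identity:
  assumes f: "smooth_function Z f" and e: "\<And>p. conf_laplacian n Z f p = 0" and n: "alpha n \<noteq> 0"
  shows "(LINT p|volume Z. alpha n * form_norm_sq Z (differential Z f) p + scalar_curvature Z p * (f p)\<^sup>2) = 0"
proof -
  note R = closed_riemannian[OF Z]
  let ?v = "volume Z"
  have lap: "laplacian Z f p = scalar_curvature Z p * f p / alpha n" for p
    using e[of p] n by (simp add: conf_laplacian_def field_simps)
  obtain T :: "('i \<times> (real ^ 'm) \<times> (real ^ 'm)) set" and \<rho> where T: "finite T" "\<And>\<tau>. \<tau> \<in> T \<Longrightarrow> fst \<tau> \<in> idx Z"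
    "\<And>\<tau>. \<tau> \<in> T \<Longrightarrow> cbox (fst (snd \<tau>)) (snd (snd \<tau>)) \<subseteq> chart_img Z (fst \<tau>)"
    "\<And>\<tau>. \<tau> \<in> T \<Longrightarrow> smooth_function Z (\<rho> \<tau>)"
    "\<And>\<tau> p. \<tau> \<in> T \<Longrightarrow> \<rho> \<tau> p \<ge> 0"
    "\<And>\<tau> p. \<tau> \<in> T \<Longrightarrow> \<rho> \<tau> p \<noteq> 0 \<Longrightarrow>
      p \<in> chart_dom Z (fst \<tau>) \<and> chart Z (fst \<tau>) p \<in> cbox (fst (snd \<tau>)) (snd (snd \<tau>))"
    "\<And>p. (\<Sum>\<tau>\<in>T. \<rho> \<tau> p) = 1" by (rule partition_of_unity) (rule that; assumption)
  have cf: "continuous_on UNIV f" by (rule smooth_function_continuous[OF closed_riemannian[OF Z] f])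
  have cR: "continuous_on UNIV (scalar_curvature Z)" by (rule continuous_scalar_curvature[OF R])
  have \<psi>: "smooth_function Z (\<lambda>p. \<rho> \<tau> p * f p)" if "\<tau> \<in> T" for \<tau> by (rule smooth_function_mult[OF closed_riemannian[OF Z] T(4)[OF that] f])
  have s: "(\<Sum>\<tau>\<in>T. \<rho> \<tau> p * f p) = f p" for p using T(7)[of p] by (simp add: sum_distrib_right[symmetric])
  have fn: "form_norm_sq Z (differential Z f) p = form_inner Z (differential Z f) (differential Z f) p" for p
    using form_norm_sq_chart[OF R one_form_differential[OF R f] chart_at[OF R]] by (simp add: form_inner_def Let_def)
  have cI: "continuous_on UNIV (form_inner Z (differential Z (\<lambda>p. \<rho> \<tau> p * f p)) (differential Z f))" if "\<tau> \<in> T" for \<tau>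
    by (rule continuous_form_inner[OF \<psi>[OF that] f])
  have ch: "continuous_on UNIV (\<lambda>p. \<rho> \<tau> p * f p * (scalar_curvature Z p * f p / alpha n))" if "\<tau> \<in> T" for \<tau>
    using smooth_function_continuous[OF closed_riemannian[OF Z] T(4)[OF that]] n by (intro continuous_on_mult continuous_on_divide cf cR continuous_on_const) auto
  have "(LINT p|?v. form_norm_sq Z (differential Z f) p)
      = (LINT p|?v. (\<Sum>\<tau>\<in>T. form_inner Z (differential Z (\<lambda>p. \<rho> \<tau> p * f p)) (differential Z f) p))"
    by (intro Bochner_Integration.integral_cong refl) (simp only: fn form_inner_sum[OF T(1) \<psi> f s])
  also have "\<dots> = (\<Sum>\<tau>\<in>T. (LINT p|?v. form_inner Z (differential Z (\<lambda>p. \<rho> \<tau> p * f p)) (differential Z f) p))"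
    by (intro Bochner_Integration.integral_sum integrable_continuous cI)
  also have "\<dots> = (\<Sum>\<tau>\<in>T. - (LINT p|?v. \<rho> \<tau> p * f p * (scalar_curvature Z p * f p / alpha n)))"
  proof (rule sum.cong[OF refl])
    fix \<tau> assume \<tau>: "\<tau> \<in> T"
    have "(LINT p|?v. form_inner Z (differential Z (\<lambda>p. \<rho> \<tau> p * f p)) (differential Z f) p)
        = - (LINT p|?v. \<rho> \<tau> p * f p * chart_bump Z (fst \<tau>) (chart_laplacian Z (fst \<tau>) f) p)"
      by (rule green_chart[OF T(2)[OF \<tau>] f \<psi>[OF \<tau>] compact_cbox T(3)[OF \<tau>]]) (use T(6)[OF \<tau>] in auto)
    also have "(LINT p|?v. \<rho> \<tau> p * f p * chart_bump Z (fst \<tau>) (chart_laplacian Z (fst \<tau>) f) p)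
        = (LINT p|?v. \<rho> \<tau> p * f p * (scalar_curvature Z p * f p / alpha n))"
    proof (rule Bochner_Integration.integral_cong[OF refl])
      fix p
      show "\<rho> \<tau> p * f p * chart_bump Z (fst \<tau>) (chart_laplacian Z (fst \<tau>) f) p = \<rho> \<tau> p * f p * (scalar_curvature Z p * f p / alpha n)"
      proof (cases "\<rho> \<tau> p = 0")
        case False
        then have "p \<in> chart_dom Z (fst \<tau>)" using T(6)[OF \<tau>, of p] by simp
        then have "chart_bump Z (fst \<tau>) (chart_laplacian Z (fst \<tau>) f) p = scalar_curvature Z p * f p / alpha n"
          unfolding lap[symmetric] using laplacian_chart[OF T(2)[OF \<tau>] f] by (simp add: chart_bump_def)
        then show ?thesis by (simp only:)
      qed simp
    qed
    finally show "(LINT p|?v. form_inner Z (differential Z (\<lambda>p. \<rho> \<tau> p * f p)) (differential Z f) p)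
      = - (LINT p|?v. \<rho> \<tau> p * f p * (scalar_curvature Z p * f p / alpha n))" .
  qed
  also have "\<dots> = - (LINT p|?v. (\<Sum>\<tau>\<in>T. \<rho> \<tau> p * f p * (scalar_curvature Z p * f p / alpha n)))"
    by (simp only: sum_negf Bochner_Integration.integral_sum[OF integrable_continuous[OF ch]])
  also have "(\<lambda>p. \<Sum>\<tau>\<in>T. \<rho> \<tau> p * f p * (scalar_curvature Z p * f p / alpha n)) = (\<lambda>p. scalar_curvature Z p * (f p)\<^sup>2 / alpha n)"
    by (intro ext, simp only: sum_distrib_right[symmetric] T(7)) (simp add: power2_eq_square)
  finally have "(LINT p|?v. form_norm_sq Z (differential Z f) p) = - (LINT p|?v. scalar_curvature Z p * (f p)\<^sup>2) / alpha n" by simp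
  moreover have "integrable ?v (form_norm_sq Z (differential Z f))" unfolding fn[abs_def]
    by (intro integrable_continuous continuous_form_inner f)
  moreover have "integrable ?v (\<lambda>p. scalar_curvature Z p * (f p)\<^sup>2)"
    by (intro integrable_continuous continuous_on_mult cR continuous_on_power cf)
  ultimately show ?thesis using n by simp
qed

end

section \<open>The Sobolev inequality\<close>

lemma ennreal_prod_eq_top_nonzero:
  fixes f :: "'i \<Rightarrow> ennreal"
  assumes "finite K" "\<And>i. i \<in> K \<Longrightarrow> f i \<noteq> 0" "j \<in> K" "f j = top"
  shows "(\<Prod>i\<in>K. f i) = top"
proof -
  have "(\<Prod>i\<in>K - {j}. f i) \<noteq> 0" using assms by (simp add: prod_zero_iff)
  then show ?thesis using assms by (simp add: prod.remove)
qed

lemma prod_mono_ennreal: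
  fixes f g :: "'i \<Rightarrow> ennreal"
  shows "(\<And>i. i \<in> A \<Longrightarrow> f i \<le> g i) \<Longrightarrow> prod f A \<le> prod g A"
  by (induction A rule: infinite_finite_induct) (auto intro: mult_mono)

lemma geom_mean_le:
  fixes a :: "'i \<Rightarrow> real"
  assumes "finite K" "K \<noteq> {}" "\<And>i. i \<in> K \<Longrightarrow> a i \<ge> 0" "F \<ge> 0" "F ^ card K \<le> (\<Prod>i\<in>K. a i)"
  shows "F \<le> (\<Sum>i\<in>K. a i / card K)"
proof -
  have c: "card K > 0" using assms(1,2) by (simp add: card_gt_0_iff)
  have "F = (F ^ card K) powr (1 / card K)"
    using c assms(4) by (cases "F = 0") (auto simp: powr_realpow[symmetric] powr_powr)
  also have "\<dots> \<le> (\<Prod>i\<in>K. a i) powr (1 / card K)" using assms(4,5) by (intro powr_mono2) auto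
  also have "\<dots> \<le> (\<Sum>i\<in>K. a i / card K)" by (rule arith_geom_mean[OF assms(1-3)])
  finally show ?thesis .
qed

text \<open>Hoelder's inequality, stated with natural powers so that it makes sense in \<open>ennreal\<close>.\<close>

lemma nn_integral_power_le_prod:
  fixes F :: "'a \<Rightarrow> ennreal" and h :: "'i \<Rightarrow> 'a \<Rightarrow> ennreal"
  assumes K: "finite K" "K \<noteq> {}" and [measurable]: "F \<in> borel_measurable M" "\<And>i. i \<in> K \<Longrightarrow> h i \<in> borel_measurable M"
    and le: "\<And>x. x \<in> space M \<Longrightarrow> F x ^ card K \<le> (\<Prod>i\<in>K. h i x)"
  shows "(\<integral>\<^sup>+x. F x \<partial>M) ^ card K \<le> (\<Prod>i\<in>K. \<integral>\<^sup>+x. h i x \<partial>M)"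
proof -
  let ?I = "\<lambda>i. \<integral>\<^sup>+x. h i x \<partial>M"
  have c: "card K > 0" using K by (simp add: card_gt_0_iff)
  \<comment> \<open>The integrals are going to be normalized, which requires them to be finite and
    nonzero. If one is 0, then \<open>F\<close> vanishes almost everywhere; if none is 0 and one is
    infinite, so is the product.\<close>
  consider (zero) j where "j \<in> K" "?I j = 0" | (inf) j where "\<And>i. i \<in> K \<Longrightarrow> ?I i \<noteq> 0" "j \<in> K" "?I j = top"
    | (fin) "\<And>i. i \<in> K \<Longrightarrow> ?I i \<noteq> 0 \<and> ?I i \<noteq> top" by blast
  then show ?thesis
  proof cases
    case zero
    then have "AE x in M. h j x = 0" by (simp add: nn_integral_0_iff_AE)
    then have "AE x in M. F x = 0"
    proof (rule AE_mp, intro AE_I2 impI)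
      fix x assume x: "x \<in> space M" "h j x = 0"
      have "(\<Prod>i\<in>K. h i x) = 0" by (rule prod_zero[OF K(1)]) (use zero(1) x(2) in blast)
      then have "F x ^ card K \<le> 0" using le[OF x(1)] by (simp only:)
      then show "F x = 0" using c by simp
    qed
    then have "(\<integral>\<^sup>+x. F x \<partial>M) = 0" by (simp add: nn_integral_0_iff_AE)
    then show ?thesis using c by (simp add: power_0_left)
  next
    case inf
    then have "(\<Prod>i\<in>K. ?I i) = top" by (intro ennreal_prod_eq_top_nonzero[OF K(1)]) auto
    then show ?thesis by simp
  next
    case fin
    define H where "H i = enn2real (?I i)" for i
    have H: "ennreal (H i) = ?I i" "H i > 0" if "i \<in> K" for i
      using fin[OF that] by (auto simp: H_def less_top enn2real_positive_iff zero_less_iff_neq_zero)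
    \<comment> \<open>The geometric mean of the integrals, which is the bound to be proved.\<close>
    define P where "P = (\<Prod>i\<in>K. H i) powr (1 / card K)"
    have prodH: "(\<Prod>i\<in>K. H i) > 0" using H by (intro prod_pos) auto
    have P: "P > 0" "P ^ card K = (\<Prod>i\<in>K. H i)"
      using prodH c by (auto simp: P_def powr_realpow[symmetric] powr_powr)
    \<comment> \<open>The inequality of the means for the normalized factors
      \<open>h i x / H i\<close>. Each summand has integral \<open>P / card K\<close>, so the
      right-hand side integrates to \<open>P\<close>.\<close>
    have pw: "F x \<le> (\<Sum>i\<in>K. ennreal (P / (card K * H i)) * h i x)" if x: "x \<in> space M" for x
    proof (cases "\<exists>i\<in>K. h i x = top")
      case True
      then obtain j where j: "j \<in> K" "h j x = top" by blast
      have "ennreal (P / (card K * H j)) \<noteq> 0" using P H j c by (simp add: ennreal_eq_0_iff not_le)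
      then have "(\<Sum>i\<in>K. ennreal (P / (card K * H i)) * h i x) = top"
        by (subst ennreal_sum_eq_top) (use j K(1) in \<open>auto intro!: bexI[of _ j]\<close>)
      then show ?thesis by simp
    next
      case False
      define a where "a i = enn2real (h i x)" for i
      have a: "h i x = ennreal (a i)" "a i \<ge> 0" if "i \<in> K" for i using False that by (auto simp: a_def less_top)
      have "(\<Prod>i\<in>K. h i x) = ennreal (\<Prod>i\<in>K. a i)" using a by (simp add: prod_ennreal)
      then have Fk: "F x ^ card K \<le> ennreal (\<Prod>i\<in>K. a i)" using le[OF x] by simp
      then have "F x ^ card K < top" using ennreal_less_top le_less_trans by blast
      then have "F x < top" using c by (simp add: power_less_top_ennreal)
      then obtain f where f: "F x = ennreal f" "f \<ge> 0" by (cases "F x") auto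
      have pa: "(\<Prod>i\<in>K. a i) \<ge> 0" using a by (intro prod_nonneg) auto
      have "f ^ card K \<le> (\<Prod>i\<in>K. a i)" using Fk f pa by (simp add: ennreal_power)
      then have "(f / P) ^ card K \<le> (\<Prod>i\<in>K. a i / H i)"
        using P prodH by (simp add: power_divide prod_dividef divide_right_mono)
      then have "f / P \<le> (\<Sum>i\<in>K. a i / H i / card K)"
        using geom_mean_le[OF K, of "\<lambda>i. a i / H i" "f / P"] a H f(2) P by (simp add: less_imp_le)
      then have "f \<le> P * (\<Sum>i\<in>K. a i / H i / card K)" using P(1) by (simp add: field_simps)
      also have "\<dots> = (\<Sum>i\<in>K. P / (card K * H i) * a i)" by (simp add: sum_distrib_left mult.commute)
      finally have "ennreal f \<le> ennreal (\<Sum>i\<in>K. P / (card K * H i) * a i)" by (rule ennreal_leI)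
      also have "\<dots> = (\<Sum>i\<in>K. ennreal (P / (card K * H i) * a i))"
        using a(2) H(2) P(1) by (intro sum_ennreal[symmetric]) (simp add: less_imp_le)
      also have "\<dots> = (\<Sum>i\<in>K. ennreal (P / (card K * H i)) * h i x)"
        by (rule sum.cong[OF refl]) (simp only: a ennreal_mult'')
      finally show ?thesis using f by simp
    qed
    have "(\<integral>\<^sup>+x. F x \<partial>M) \<le> (\<integral>\<^sup>+x. (\<Sum>i\<in>K. ennreal (P / (card K * H i)) * h i x) \<partial>M)"
      by (rule nn_integral_mono[OF pw])
    also have "\<dots> = (\<Sum>i\<in>K. ennreal (P / (card K * H i)) * ?I i)"
      by (subst nn_integral_sum) (auto intro!: sum.cong nn_integral_cmult)
    also have "\<dots> = (\<Sum>i\<in>K. ennreal (P / card K))"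
    proof (rule sum.cong[OF refl])
      fix i assume i: "i \<in> K"
      show "ennreal (P / (card K * H i)) * ?I i = ennreal (P / card K)"
        unfolding H(1)[OF i, symmetric] using H(2)[OF i] P by (subst ennreal_mult[symmetric]) (auto simp: less_imp_le)
    qed
    also have "\<dots> = ennreal P" using c P(1) by (simp add: ennreal_of_nat_eq_real_of_nat ennreal_mult[symmetric])
    finally have "(\<integral>\<^sup>+x. F x \<partial>M) ^ card K \<le> ennreal P ^ card K" by (rule power_mono) simp
    also have "\<dots> = (\<Prod>i\<in>K. ?I i)"
    proof -
      have "ennreal P ^ card K = ennreal (\<Prod>i\<in>K. H i)" using P by (simp add: ennreal_power)
      also have "\<dots> = (\<Prod>i\<in>K. ennreal (H i))" using H(2) by (intro prod_ennreal[symmetric]) (simp add: less_imp_le)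
      finally show ?thesis using H(1) by simp
    qed
    finally show ?thesis .
  qed
qed

text \<open>The constant is absorbed into one of the factors, so the exponent stays the
  same.\<close>

lemma nn_integral_power_le_prod_cmult:
  fixes F :: "'a \<Rightarrow> ennreal" and h :: "'i \<Rightarrow> 'a \<Rightarrow> ennreal"
  assumes K: "finite K" "K \<noteq> {}" and [measurable]: "F \<in> borel_measurable M" "\<And>i. i \<in> K \<Longrightarrow> h i \<in> borel_measurable M"
    and le: "\<And>x. x \<in> space M \<Longrightarrow> F x ^ card K \<le> c * (\<Prod>i\<in>K. h i x)"
  shows "(\<integral>\<^sup>+x. F x \<partial>M) ^ card K \<le> c * (\<Prod>i\<in>K. \<integral>\<^sup>+x. h i x \<partial>M)"
proof -
  obtain j where j: "j \<in> K" using K by blast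
  define h' where "h' i x = (if i = j then c * h i x else h i x)" for i x
  have h': "(\<Prod>i\<in>K. g (h' i)) = g (h' j) * (\<Prod>i\<in>K - {j}. g (h i))" for g :: "('a \<Rightarrow> ennreal) \<Rightarrow> ennreal"
    using j K(1) by (simp add: prod.remove h'_def[abs_def])
  have "(\<integral>\<^sup>+x. F x \<partial>M) ^ card K \<le> (\<Prod>i\<in>K. \<integral>\<^sup>+x. h' i x \<partial>M)"
  proof (rule nn_integral_power_le_prod[OF K])
    show "h' i \<in> borel_measurable M" if "i \<in> K" for i
      using that unfolding h'_def[abs_def] by (cases "i = j") simp_all
    show "F x ^ card K \<le> (\<Prod>i\<in>K. h' i x)" if "x \<in> space M" for x
      using le[OF that] h'[of "\<lambda>f. f x"] j K(1) by (simp add: h'_def prod.remove[of K j] mult.assoc)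
  qed simp
  also have "\<dots> = c * (\<Prod>i\<in>K. \<integral>\<^sup>+x. h i x \<partial>M)"
    using h'[of "\<lambda>f. \<integral>\<^sup>+x. f x \<partial>M"] j K(1)
    by (simp add: h'_def nn_integral_cmult prod.remove[of K j] mult.assoc)
  finally show ?thesis .
qed

text \<open>The inequality of Loomis and Whitney; the factors \<open>G i\<close> with \<open>i \<notin> I\<close> depend on all the variables
  already, those with \<open>i \<in> I\<close> do not depend on the variable \<open>i\<close>.\<close>

lemma loomis_whitney_PiM:
  fixes F :: "('i \<Rightarrow> real) \<Rightarrow> ennreal" and G :: "'i \<Rightarrow> ('i \<Rightarrow> real) \<Rightarrow> ennreal"
  assumes "finite I" and T: "finite T" "card T = Suc k" "k \<ge> 1" "I \<subseteq> T"
    and "F \<in> borel_measurable (\<Pi>\<^sub>M i\<in>I. lborel)" "\<And>i. i \<in> T \<Longrightarrow> G i \<in> borel_measurable (\<Pi>\<^sub>M i\<in>I - {i}. lborel)"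
    and "\<And>x. x \<in> space (\<Pi>\<^sub>M i\<in>I. lborel) \<Longrightarrow> F x ^ k \<le> (\<Prod>i\<in>T. G i (restrict x (I - {i})))"
  shows "(\<integral>\<^sup>+x. F x \<partial>(\<Pi>\<^sub>M i\<in>I. lborel)) ^ k \<le> (\<Prod>i\<in>T. \<integral>\<^sup>+x. G i x \<partial>(\<Pi>\<^sub>M i\<in>I - {i}. lborel))"
proof -
  interpret product_sigma_finite "\<lambda>_ :: 'i. lborel :: real measure" by standard
  show ?thesis
    using assms(1,5-8)
  proof (induction I arbitrary: F G rule: finite_induct)
    case empty
    have "F (\<lambda>_. undefined) ^ k \<le> (\<Prod>i\<in>T. G i (\<lambda>_. undefined))"
      using empty.prems(4)[of "\<lambda>_. undefined"] by (simp add: space_PiM restrict_def)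
    then show ?case by (simp add: PiM_empty nn_integral_count_space_finite)
  next
    case (insert j I)
    note [measurable] = insert.prems(2)
    have jT: "j \<in> T" and IT: "I \<subseteq> T" using insert.prems(1) by auto
    \<comment> \<open>Integration over the new variable \<open>j\<close>. The factor
      \<open>G j\<close> does not depend on it, so Hoelder's inequality is applied to the other
      \<open>k\<close> factors, and \<open>k\<close> is just the exponent on the left.\<close>
    define F' where "F' x = (\<integral>\<^sup>+y. F (x(j := y)) \<partial>lborel)" for x
    define G' where "G' i x = (if i = j then G j x else \<integral>\<^sup>+y. G i (x(j := y)) \<partial>lborel)" for i x
    have upd: "insert j I - {i} = insert j (I - {i})" if "i \<noteq> j" for i using that by auto
    have Ij: "insert j I - {j} = I" "I - {j} = I" using insert.hyps by auto
    have Gm: "G i \<in> borel_measurable (\<Pi>\<^sub>M i\<in>insert j (I - {i}). lborel)" if "i \<in> T" "i \<noteq> j" for i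
      using insert.prems(3)[OF that(1)] upd[OF that(2)] by simp
    have par: "(\<lambda>x. \<integral>\<^sup>+y. f (x(j := y)) \<partial>lborel) \<in> borel_measurable (\<Pi>\<^sub>M i\<in>J. lborel)"
      if "f \<in> borel_measurable (\<Pi>\<^sub>M i\<in>insert j J. lborel)" for f :: "('i \<Rightarrow> real) \<Rightarrow> ennreal" and J
      using measurable_compose[OF measurable_add_dim that] by (intro lborel.borel_measurable_nn_integral) (simp add: split_def)
    have mF': "F' \<in> borel_measurable (\<Pi>\<^sub>M i\<in>I. lborel)" unfolding F'_def by (rule par) simp
    have mG': "G' i \<in> borel_measurable (\<Pi>\<^sub>M i\<in>I - {i}. lborel)" if "i \<in> T" for i
    proof (cases "i = j")
      case True
      then show ?thesis using insert.prems(3)[OF jT] Ij unfolding G'_def[abs_def] by simp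
    next
      case False
      then show ?thesis using par[OF Gm[OF that False]] unfolding G'_def[abs_def] by simp
    qed
    have "F' x ^ k \<le> (\<Prod>i\<in>T. G' i (restrict x (I - {i})))" if x: "x \<in> space (\<Pi>\<^sub>M i\<in>I. lborel)" for x
    proof -
      have "card (T - {j}) = k" using T(2) jT by simp
      moreover from this have "T - {j} \<noteq> {}" using T(3) by (metis card.empty not_one_le_zero)
      ultimately have cT: "card (T - {j}) = k" "finite (T - {j})" "T - {j} \<noteq> {}" using T(1) by blast+
      have xI: "restrict x I = x" using x by (auto simp: space_PiM PiE_def extensional_restrict)
      have sec: "(\<lambda>y. f (z(j := y))) \<in> borel_measurable lborel"
        if f: "f \<in> borel_measurable (\<Pi>\<^sub>M i\<in>insert j J. lborel)" and z: "z \<in> space (\<Pi>\<^sub>M i\<in>J. lborel)" for f :: "('i \<Rightarrow> real) \<Rightarrow> ennreal" and J z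
        using measurable_compose[OF measurable_Pair1'[OF z] measurable_compose[OF measurable_add_dim f]] by simp
      have zr: "restrict x (I - {i}) \<in> space (\<Pi>\<^sub>M i\<in>I - {i}. lborel)" for i by (auto simp: space_PiM)
      have "F' x ^ card (T - {j}) \<le> G j x * (\<Prod>i\<in>T - {j}. \<integral>\<^sup>+y. G i ((restrict x (I - {i}))(j := y)) \<partial>lborel)"
        unfolding F'_def
      proof (rule nn_integral_power_le_prod_cmult[OF cT(2,3)])
        show "(\<lambda>y. F (x(j := y))) \<in> borel_measurable lborel" by (rule sec[OF _ x]) simp
        show "(\<lambda>y. G i ((restrict x (I - {i}))(j := y))) \<in> borel_measurable lborel" if "i \<in> T - {j}" for i
          using that by (intro sec[OF _ zr] Gm) auto
        fix y :: real
        have "restrict (x(j := y)) I = restrict x I" by (rule restrict_ext) (use insert.hyps(2) in auto)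
        then have rj: "restrict (x(j := y)) I = x" using xI by simp
        have "x(j := y) \<in> space (\<Pi>\<^sub>M i\<in>insert j I. lborel)"
          using x by (auto simp: space_PiM PiE_def extensional_def)
        from insert.prems(4)[OF this]
        have e1: "F (x(j := y)) ^ k \<le> (\<Prod>i\<in>T. G i (restrict (x(j := y)) (insert j I - {i})))" .
        have e2: "(\<Prod>i\<in>T. G i (restrict (x(j := y)) (insert j I - {i})))
            = G j x * (\<Prod>i\<in>T - {j}. G i (restrict (x(j := y)) (insert j I - {i})))"
          using T(1) jT by (simp add: prod.remove Ij rj)
        have e3: "(\<Prod>i\<in>T - {j}. G i (restrict (x(j := y)) (insert j I - {i})))
            = (\<Prod>i\<in>T - {j}. G i ((restrict x (I - {i}))(j := y)))"
          by (rule prod.cong[OF refl]) (auto intro!: arg_cong[where f="G _"] simp: restrict_def fun_eq_iff)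
        show "F (x(j := y)) ^ card (T - {j}) \<le> G j x * (\<Prod>i\<in>T - {j}. G i ((restrict x (I - {i}))(j := y)))"
          unfolding cT(1) e3[symmetric] e2[symmetric] by (rule e1)
      qed
      also have "\<dots> = (\<Prod>i\<in>T. G' i (restrict x (I - {i})))"
        using T(1) jT xI by (simp add: prod.remove[of T j] G'_def Ij)
      finally show ?thesis using cT(1) by simp
    qed
    from insert.IH[OF IT mF' mG' this]
    have "(\<integral>\<^sup>+x. F' x \<partial>(\<Pi>\<^sub>M i\<in>I. lborel)) ^ k \<le> (\<Prod>i\<in>T. \<integral>\<^sup>+x. G' i x \<partial>(\<Pi>\<^sub>M i\<in>I - {i}. lborel))" .
    moreover have "(\<integral>\<^sup>+x. F' x \<partial>(\<Pi>\<^sub>M i\<in>I. lborel)) = (\<integral>\<^sup>+x. F x \<partial>(\<Pi>\<^sub>M i\<in>insert j I. lborel))"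
      unfolding F'_def by (rule product_nn_integral_insert[symmetric]) (use insert.hyps in simp_all)
    moreover have "(\<integral>\<^sup>+x. G' i x \<partial>(\<Pi>\<^sub>M i\<in>I - {i}. lborel)) = (\<integral>\<^sup>+x. G i x \<partial>(\<Pi>\<^sub>M i\<in>insert j I - {i}. lborel))"
      if i: "i \<in> T" for i
    proof (cases "i = j")
      case True
      then show ?thesis by (simp add: G'_def Ij)
    next
      case False
      then show ?thesis
        unfolding G'_def upd[OF False] using insert.hyps Gm[OF i False]
        by (subst product_nn_integral_insert) simp_all
    qed
    ultimately show ?case by simp
  qed
qed

text \<open>Integrating \<open>H b\<close> along the line in direction \<open>b\<close> gives a
  function independent of the coordinate \<open>b\<close>, as the version for product measures
  requires; \<open>S\<close> passes from coordinates to vectors.\<close>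

lemma loomis_whitney:
  fixes F :: "'e::euclidean_space \<Rightarrow> ennreal"
  assumes k: "DIM('e) = Suc k" "k \<ge> 1" and F: "F \<in> borel_measurable borel"
    and H: "\<And>b. b \<in> Basis \<Longrightarrow> H b \<in> borel_measurable borel"
    and le: "\<And>x. F x ^ k \<le> (\<Prod>b\<in>Basis. \<integral>\<^sup>+t. H b (x + t *\<^sub>R b) \<partial>lborel)"
  shows "(\<integral>\<^sup>+x. F x \<partial>lborel) ^ k \<le> (\<Prod>b\<in>Basis. \<integral>\<^sup>+x. H b x \<partial>lborel)"
proof -
  interpret product_sigma_finite "\<lambda>_ :: 'e. lborel :: real measure" by standard
  let ?B = "Basis :: 'e set"
  define S where "S z = (\<Sum>b\<in>?B. z b *\<^sub>R b)" for z :: "'e \<Rightarrow> real"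
  have Sm: "S \<in> borel_measurable (\<Pi>\<^sub>M b\<in>?B. lborel)"
    unfolding S_def[abs_def] by (intro borel_measurable_sum borel_measurable_scaleR measurable_compose[OF measurable_component_singleton]) auto
  have tr: "(\<integral>\<^sup>+x. f x \<partial>lborel) = (\<integral>\<^sup>+z. f (S z) \<partial>(\<Pi>\<^sub>M b\<in>?B. lborel))" if "f \<in> borel_measurable borel" for f :: "'e \<Rightarrow> ennreal"
  proof -
    have "(\<integral>\<^sup>+x. f x \<partial>lborel) = (\<integral>\<^sup>+x. f x \<partial>distr (\<Pi>\<^sub>M b\<in>?B. lborel) borel S)"
      unfolding S_def[abs_def] by (subst lborel_eq) simp
    also have "\<dots> = (\<integral>\<^sup>+z. f (S z) \<partial>(\<Pi>\<^sub>M b\<in>?B. lborel))" by (rule nn_integral_distr[OF Sm]) (use that in simp)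
    finally show ?thesis .
  qed
  define G where "G b z = (\<integral>\<^sup>+t. H b (S (z(b := t))) \<partial>lborel)" for b z
  have ins: "insert b (?B - {b}) = ?B" if "b \<in> ?B" for b using that by auto
  have HS: "(\<lambda>z. H b (S z)) \<in> borel_measurable (\<Pi>\<^sub>M b\<in>insert b (?B - {b}). lborel)" if "b \<in> ?B" for b
    unfolding ins[OF that] by (rule measurable_compose[OF Sm H[OF that]])
  have Su: "S (z(b := t)) = S z + (t - z b) *\<^sub>R b" if "b \<in> ?B" for z b t
  proof -
    have "S (z(b := t)) = t *\<^sub>R b + (\<Sum>c\<in>?B - {b}. z c *\<^sub>R c)"
      unfolding S_def using that by (subst sum.remove[of _ b]) (auto intro!: sum.cong)
    moreover have "S z = z b *\<^sub>R b + (\<Sum>c\<in>?B - {b}. z c *\<^sub>R c)"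
      unfolding S_def using that by (subst sum.remove[of _ b]) auto
    ultimately show ?thesis by (simp add: algebra_simps)
  qed
  have Srestr: "S ((restrict z (?B - {b}))(b := t)) = S (z(b := t))" for z b t
    unfolding S_def by (rule sum.cong) (auto simp: restrict_def)
  have "(\<integral>\<^sup>+z. F (S z) \<partial>(\<Pi>\<^sub>M b\<in>?B. lborel)) ^ k \<le> (\<Prod>b\<in>?B. \<integral>\<^sup>+z. G b z \<partial>(\<Pi>\<^sub>M c\<in>?B - {b}. lborel))"
  proof (rule loomis_whitney_PiM)
    show "(\<lambda>z. F (S z)) \<in> borel_measurable (\<Pi>\<^sub>M b\<in>?B. lborel)" by (rule measurable_compose[OF Sm F])
    show "G b \<in> borel_measurable (\<Pi>\<^sub>M c\<in>?B - {b}. lborel)" if "b \<in> ?B" for b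
      unfolding G_def[abs_def] using measurable_compose[OF measurable_add_dim HS[OF that]]
      by (intro lborel.borel_measurable_nn_integral) (simp add: split_def)
    fix z
    have "F (S z) ^ k \<le> (\<Prod>b\<in>?B. \<integral>\<^sup>+t. H b (S z + t *\<^sub>R b) \<partial>lborel)" by (rule le)
    also have "\<dots> = (\<Prod>b\<in>?B. G b (restrict z (?B - {b})))"
    proof (rule prod.cong[OF refl])
      fix b assume b: "b \<in> ?B"
      have m: "(\<lambda>t. H b (S z + t *\<^sub>R b)) \<in> borel_measurable borel"
        by (rule measurable_compose[OF _ H[OF b]]) measurable
      \<comment> \<open>The two parametrizations of the line differ by the shift
        \<open>z b\<close>.\<close>
      show "(\<integral>\<^sup>+t. H b (S z + t *\<^sub>R b) \<partial>lborel) = G b (restrict z (?B - {b}))"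
        unfolding G_def Srestr unfolding Su[OF b] using nn_integral_real_affine[OF m, of 1 "- z b"] by simp
    qed
    finally show "F (S z) ^ k \<le> (\<Prod>b\<in>?B. G b (restrict z (?B - {b})))" .
  qed (use k in auto)
  moreover have "(\<integral>\<^sup>+z. G b z \<partial>(\<Pi>\<^sub>M c\<in>?B - {b}. lborel)) = (\<integral>\<^sup>+x. H b x \<partial>lborel)" if b: "b \<in> ?B" for b
    unfolding G_def tr[OF H[OF b]] using product_nn_integral_insert[OF _ _ HS[OF b]] unfolding ins[OF b] by simp
  ultimately show ?thesis unfolding tr[OF F] by simp
qed

section \<open>From Loomis-Whitney to Sobolev\<close>

lemma DERIV_powr_max:
  fixes c :: real assumes "c > 1" "s \<ge> 0"
  shows "((\<lambda>s. max s 0 powr c) has_real_derivative c * s powr (c - 1)) (at s)"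
proof (cases "s > 0")
  case True
  have "((\<lambda>s. s powr c) has_real_derivative c * s powr (c - 1)) (at s)" by (rule has_real_derivative_powr[OF True])
  then show ?thesis
    by (rule has_field_derivative_transform_within_open[of _ _ _ "{0<..}"]) (use True in auto)
next
  \<comment> \<open>At 0 the maximum makes the left difference quotient vanish, while the right one
    is the power \<open>c - 1 > 0\<close> of the increment.\<close>
  case False
  then have s: "s = 0" using assms by simp
  have "((\<lambda>h. (max (0 + h) 0 powr c - max 0 0 powr c) / h) \<longlongrightarrow> 0) (at 0)"
    unfolding filterlim_at_split
  proof
    show "((\<lambda>h. (max (0 + h) 0 powr c - max 0 0 powr c) / h) \<longlongrightarrow> 0) (at_left 0)"
      by (rule Lim_transform_eventually[of "\<lambda>_. 0"]) (auto simp: eventually_at_filter)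
    have "((\<lambda>h. h powr (c - 1)) \<longlongrightarrow> 0 powr (c - 1)) (at_right (0::real))"
      by (rule tendsto_powr2) (use assms in \<open>auto simp: eventually_at_filter\<close>)
    then show "((\<lambda>h. (max (0 + h) 0 powr c - max 0 0 powr c) / h) \<longlongrightarrow> 0) (at_right 0)"
      using assms by (auto elim!: Lim_transform_eventually simp: eventually_at_filter powr_diff)
  qed
  then show ?thesis using s assms by (simp add: DERIV_def)
qed

text \<open>The fundamental theorem of calculus on a segment ending at \<open>x\<close> and
  starting, in direction \<open>- b\<close>, at a point outside the support, where the function is
  0.\<close>

lemma powr_le_line_integral:
  fixes v :: "'e::euclidean_space \<Rightarrow> real"
  assumes v: "Ck_on 1 v UNIV" "\<And>x. v x \<ge> 0" and K: "compact K" "\<And>x. x \<notin> K \<Longrightarrow> v x = 0" and b: "b \<in> Basis" and c: "c > 1"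
  shows "ennreal (v x powr c) \<le> (\<integral>\<^sup>+t. ennreal \<bar>c * v (x + t *\<^sub>R b) powr (c - 1) * pd b v (x + t *\<^sub>R b)\<bar> \<partial>lborel)"
proof -
  define f where "f t = c * v (x + t *\<^sub>R b) powr (c - 1) * pd b v (x + t *\<^sub>R b)" for t
  define F where "F t = v (x + t *\<^sub>R b) powr c" for t
  have dv: "((\<lambda>t. v (x + t *\<^sub>R b)) has_real_derivative pd b v (x + t *\<^sub>R b)) (at t)" for t
  proof -
    have "((\<lambda>t. x + t *\<^sub>R b) has_derivative (\<lambda>h. h *\<^sub>R b)) (at t)" by (auto intro!: derivative_eq_intros)
    from has_derivative_compose[OF this Ck_on_has_derivative[of 0 v UNIV]] v(1)
    have "((\<lambda>t. v (x + t *\<^sub>R b)) has_derivative (\<lambda>h. pd (h *\<^sub>R b) v (x + t *\<^sub>R b))) (at t)" by simp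
    moreover have "pd (h *\<^sub>R b) v y = pd b v y * h" for h y using linear_cmul[OF linear_pd[of v y]] v(1) by simp
    ultimately show ?thesis by (simp add: has_field_derivative_def)
  qed
  have dF: "(F has_real_derivative f t) (at t)" for t
    using DERIV_chain2[OF DERIV_powr_max[OF c v(2)] dv] v(2) by (simp add: F_def[abs_def] f_def max_absorb1)
  have cf: "continuous_on UNIV f"
  proof -
    have l: "continuous_on UNIV (\<lambda>t. x + t *\<^sub>R b)" by (intro continuous_intros)
    have "continuous_on UNIV (\<lambda>t. v (x + t *\<^sub>R b))" "continuous_on UNIV (\<lambda>t. pd b v (x + t *\<^sub>R b))"
      using v(1) by (auto intro!: continuous_on_compose2[OF _ l] Ck_on_imp_continuous[of 1 v])
    then show ?thesis unfolding f_def using v(2) c by (intro continuous_on_mult continuous_on_powr' continuous_on_const) auto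
  qed
  obtain r where r: "\<And>y. y \<in> K \<Longrightarrow> norm y \<le> r" using compact_imp_bounded[OF K(1)] unfolding bounded_iff by blast
  \<comment> \<open>So far back that \<open>x + a *\<^sub>R b\<close> has norm greater than
    \<open>r\<close> and therefore lies outside \<open>K\<close>.\<close>
  define a where "a = - (norm x + \<bar>r\<bar> + 1)"
  have a: "a \<le> 0" unfolding a_def using norm_ge_zero[of x] abs_ge_zero[of r] by linarith
  have "norm (x + a *\<^sub>R b) \<ge> \<bar>a\<bar> - norm x"
    using norm_triangle_ineq4[of "x + a *\<^sub>R b" x] b by simp
  moreover have "\<bar>a\<bar> - norm x > r" by (simp add: a_def)
  ultimately have "x + a *\<^sub>R b \<notin> K" using r by force
  then have Fa: "F a = 0" using K(2) by (simp add: F_def)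
  have FTC: "has_bochner_integral lborel (\<lambda>t. indicator {a..0} t *\<^sub>R f t) (F 0 - F a)"
    using a dF continuous_on_subset[OF cf subset_UNIV]
    by (intro has_bochner_integral_FTC_Icc) (auto simp: has_real_derivative_iff_has_vector_derivative intro: has_vector_derivative_at_within)
  have "ennreal (v x powr c) = ennreal (norm (F 0 - F a))" by (simp add: Fa) (simp add: F_def)
  also have "\<dots> \<le> (\<integral>\<^sup>+t. ennreal (norm (indicator {a..0} t *\<^sub>R f t)) \<partial>lborel)"
    by (rule has_bochner_integral_norm_bound[OF FTC])
  also have "\<dots> \<le> (\<integral>\<^sup>+t. ennreal \<bar>f t\<bar> \<partial>lborel)"
    by (rule nn_integral_mono) (auto simp: indicator_def intro: ennreal_leI)
  finally show ?thesis by (simp add: f_def)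
qed

text \<open>With \<open>X\<close> the integral on the left and \<open>c = 2 (n - 1) / (n - 2)\<close>, the Loomis-Whitney and
  Cauchy-Schwarz inequalities give \<open>X\<^sup>2\<^sup>n\<^sup>-\<^sup>2 \<le> X\<^sup>n (c\<^sup>2 B)\<^sup>n\<close>, and \<open>X\<close> is finite by
  compactness of the support; hence \<open>X \<le> max 1 (X\<^sup>n\<^sup>-\<^sup>2)\<close> is bounded as stated.\<close>

lemma sobolev_inequality:
  fixes v :: "'e::euclidean_space \<Rightarrow> real"
  assumes n: "DIM('e) = n" "n \<ge> 3" and v: "Ck_on 1 v UNIV" "\<And>x. v x \<ge> 0"
    and K: "compact K" "\<And>x. x \<notin> K \<Longrightarrow> v x = 0"
    and B: "\<And>b. b \<in> Basis \<Longrightarrow> (\<integral>\<^sup>+x. ennreal ((pd b v x)\<^sup>2) \<partial>lborel) \<le> B"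
  shows "(\<integral>\<^sup>+x. ennreal (v x powr (2 * real n / (real n - 2))) \<partial>lborel)
    \<le> 1 + (ennreal ((2 * (real n - 1) / (real n - 2))\<^sup>2) * B) ^ n"
proof -
  define c where "c = 2 * (real n - 1) / (real n - 2)"
  define p where "p = 2 * real n / (real n - 2)"
  have c: "c > 1" using n(2) by (simp add: c_def field_simps)
  have p: "p > 0" using n(2) by (simp add: p_def)
  \<comment> \<open>The first identity serves the Cauchy-Schwarz step, the second matches the powers
    in the Loomis-Whitney step; together they determine \<open>c\<close> and
    \<open>p\<close>.\<close>
  have pc: "2 * (c - 1) = p" "p * (real n - 1) = c * real n" using n(2) by (simp_all add: c_def p_def field_simps)
  obtain k where k: "n = Suc k" "k \<ge> 1" using n(2) by (cases n) auto
  have cv: "continuous_on UNIV v" by (rule Ck_on_imp_continuous[OF v(1)])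
  have mv [measurable]: "v \<in> borel_measurable borel" by (rule borel_measurable_continuous_onI[OF cv])
  have md [measurable]: "pd b v \<in> borel_measurable borel" for b using v(1) by (intro borel_measurable_continuous_onI) simp
  define X where "X = (\<integral>\<^sup>+x. ennreal (v x powr p) \<partial>lborel)"
  define D where "D b x = ennreal \<bar>c * v x powr (c - 1) * pd b v x\<bar>" for b x
  have mD: "D b \<in> borel_measurable borel" for b unfolding D_def[abs_def] by measurable
  have "X ^ k \<le> (\<Prod>b\<in>(Basis :: 'e set). \<integral>\<^sup>+x. D b x \<partial>lborel)"
    unfolding X_def
  proof (rule loomis_whitney)
    fix x
    have "ennreal (v x powr p) ^ k = ennreal (v x powr c) ^ card (Basis :: 'e set)"
    proof (cases "v x = 0")
      case True
      then show ?thesis using k n by simp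
    next
      case False
      then have "v x > 0" using v(2)[of x] by simp
      then have "(v x powr e) ^ m = v x powr (e * real m)" for e m
        using powr_realpow[of "v x powr e" m] by (simp add: powr_powr)
      moreover have "p * real k = c * real n" using pc(2) k(1) by simp
      ultimately have "(v x powr p) ^ k = (v x powr c) ^ n" by simp
      then show ?thesis using n(1) by (simp add: ennreal_power)
    qed
    also have "\<dots> = (\<Prod>b\<in>(Basis :: 'e set). ennreal (v x powr c))" by simp
    also have "\<dots> \<le> (\<Prod>b\<in>(Basis :: 'e set). \<integral>\<^sup>+t. D b (x + t *\<^sub>R b) \<partial>lborel)"
      unfolding D_def by (intro prod_mono_ennreal powr_le_line_integral[OF v K _ c]) auto
    finally show "ennreal (v x powr p) ^ k \<le> (\<Prod>b\<in>(Basis :: 'e set). \<integral>\<^sup>+t. D b (x + t *\<^sub>R b) \<partial>lborel)" .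
  qed (use k n mD in auto)
  moreover have Y: "(\<integral>\<^sup>+x. D b x \<partial>lborel) ^ 2 \<le> X * (ennreal (c\<^sup>2) * B)" if b: "b \<in> Basis" for b :: 'e
  proof -
    \<comment> \<open>Cauchy-Schwarz as Hoelder's inequality with the two-element index type
      \<open>bool\<close>.\<close>
    define h where "h i x = (if i then ennreal (v x powr p) else ennreal (c\<^sup>2 * (pd b v x)\<^sup>2))" for i x
    have "(\<integral>\<^sup>+x. D b x \<partial>lborel) ^ card (UNIV :: bool set) \<le> (\<Prod>i\<in>UNIV. \<integral>\<^sup>+x. h i x \<partial>lborel)"
    proof (rule nn_integral_power_le_prod)
      show "D b \<in> borel_measurable lborel" using mD by simp
      show "h i \<in> borel_measurable lborel" for i unfolding h_def[abs_def] by (cases i) simp_all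
      fix x
      have "(v x powr (c - 1))\<^sup>2 = v x powr p"
        using v(2)[of x] pc(1) by (cases "v x = 0") (simp_all add: powr_realpow[symmetric] powr_powr mult.commute)
      then have "\<bar>c * v x powr (c - 1) * pd b v x\<bar>\<^sup>2 = v x powr p * (c\<^sup>2 * (pd b v x)\<^sup>2)"
        by (simp add: power_mult_distrib)
      then have "(D b x)\<^sup>2 = h True x * h False x"
        unfolding D_def h_def by (subst ennreal_power) (simp_all add: ennreal_mult[symmetric])
      then show "D b x ^ card (UNIV :: bool set) \<le> (\<Prod>i\<in>UNIV. h i x)"
        by (simp add: UNIV_bool mult.commute power2_eq_square)
    qed auto
    also have "\<dots> = X * (\<integral>\<^sup>+x. ennreal (c\<^sup>2) * ennreal ((pd b v x)\<^sup>2) \<partial>lborel)"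
      by (simp add: UNIV_bool h_def X_def ennreal_mult mult.commute)
    also have "\<dots> = X * (ennreal (c\<^sup>2) * (\<integral>\<^sup>+x. ennreal ((pd b v x)\<^sup>2) \<partial>lborel))" by (simp add: nn_integral_cmult)
    also have "\<dots> \<le> X * (ennreal (c\<^sup>2) * B)" by (intro mult_left_mono B b) simp_all
    finally show ?thesis by simp
  qed
  ultimately have XX: "(X ^ k)\<^sup>2 \<le> (X * (ennreal (c\<^sup>2) * B)) ^ n"
  proof -
    assume le: "X ^ k \<le> (\<Prod>b\<in>(Basis :: 'e set). \<integral>\<^sup>+x. D b x \<partial>lborel)"
    have "(X ^ k)\<^sup>2 \<le> (\<Prod>b\<in>(Basis :: 'e set). \<integral>\<^sup>+x. D b x \<partial>lborel)\<^sup>2" by (rule power_mono[OF le]) simp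
    also have "\<dots> = (\<Prod>b\<in>(Basis :: 'e set). (\<integral>\<^sup>+x. D b x \<partial>lborel)\<^sup>2)" by (simp add: prod_power_distrib)
    also have "\<dots> \<le> (\<Prod>b\<in>(Basis :: 'e set). X * (ennreal (c\<^sup>2) * B))" by (intro prod_mono_ennreal Y)
    also have "\<dots> = (X * (ennreal (c\<^sup>2) * B)) ^ n" using n(1) by simp
    finally show ?thesis .
  qed
  have Xfin: "X < top"
  proof -
    obtain C where C: "\<And>x. \<bar>v x\<bar> \<le> C" "C \<ge> 0" using bounded_compact_support[OF cv K] by blast
    have "X \<le> (\<integral>\<^sup>+x. ennreal (C powr p) * indicator K x \<partial>lborel)"
      unfolding X_def
    proof (rule nn_integral_mono)
      fix x
      show "ennreal (v x powr p) \<le> ennreal (C powr p) * indicator K x"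
        using C(1)[of x] K(2)[of x] v(2)[of x] p by (cases "x \<in> K") (auto intro!: ennreal_leI powr_mono2)
    qed
    also have "\<dots> = ennreal (C powr p) * emeasure lborel K"
      using K(1) by (intro nn_integral_cmult_indicator) (simp add: borel_compact)
    also have "\<dots> < top" using emeasure_compact_finite[OF K(1)] by (simp add: ennreal_mult_less_top)
    finally show ?thesis .
  qed
  show ?thesis
  proof (cases "X \<le> 1")
    case True
    then show ?thesis unfolding X_def p_def by (rule order_trans) simp
  next
    case False
    then have X1: "X \<ge> 1" by simp
    \<comment> \<open>The exponent 2n - 2 is split so that the n-th power of \<open>X\<close> can be
      cancelled, for which \<open>X\<close> has to be finite and nonzero.\<close>
    have "k * 2 = n + (n - 2)" using k n(2) by simp
    then have "X ^ n * X ^ (n - 2) \<le> X ^ n * (ennreal (c\<^sup>2) * B) ^ n"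
      using XX by (simp add: power_mult[symmetric] power_add[symmetric] power_mult_distrib)
    moreover have "X ^ n \<noteq> 0" "X ^ n \<noteq> top" using False Xfin by (auto simp: power_eq_top_ennreal_iff)
    ultimately have "X ^ (n - 2) \<le> (ennreal (c\<^sup>2) * B) ^ n" by (simp add: ennreal_mult_le_mult_iff)
    moreover have "X \<le> X ^ (n - 2)" using X1 n(2) power_increasing[of 1 "n - 2" X] by simp
    ultimately have "X \<le> (ennreal (c\<^sup>2) * B) ^ n" by (rule order_trans[rotated])
    then show ?thesis unfolding X_def p_def c_def by (rule order_trans) simp
  qed
qed

lemma nn_integral_lborel_fatou_le:
  fixes f :: "nat \<Rightarrow> 'e::euclidean_space \<Rightarrow> real"
  assumes "\<And>m. f m \<in> borel_measurable borel" "\<And>x. (\<lambda>m. f m x) \<longlonglongrightarrow> g x"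
    and le: "\<And>m. (\<integral>\<^sup>+x. ennreal (f m x) \<partial>lborel) \<le> L"
  shows "(\<integral>\<^sup>+x. ennreal (g x) \<partial>lborel) \<le> L"
proof -
  have [measurable]: "(\<lambda>x. ennreal (f m x)) \<in> borel_measurable lborel" for m using assms(1) by simp
  have "liminf (\<lambda>m. ennreal (f m x)) = ennreal (g x)" for x
    by (rule lim_imp_Liminf) (auto intro!: tendsto_ennrealI assms(2))
  then have "(\<integral>\<^sup>+x. ennreal (g x) \<partial>lborel) = (\<integral>\<^sup>+x. liminf (\<lambda>m. ennreal (f m x)) \<partial>lborel)" by simp
  also have "\<dots> \<le> liminf (\<lambda>m. \<integral>\<^sup>+x. ennreal (f m x) \<partial>lborel)" by (rule nn_integral_liminf) measurable
  also have "\<dots> \<le> L" by (intro Liminf_le) (use le in auto)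
  finally show ?thesis .
qed

text \<open>Cutting off with dilates of one bump gives compact supports. The derivatives of the
  cutoffs are bounded uniformly in \<open>m\<close>, so \<open>sobolev_inequality\<close> holds with
  one constant, and Fatou's lemma passes to the limit.\<close>

lemma sobolev_embedding:
  fixes v :: "'e::euclidean_space \<Rightarrow> real"
  assumes n: "DIM('e) = n" "n \<ge> 3" and v: "Ck_on 1 v UNIV" "\<And>x. v x \<ge> 0"
    and L: "(\<integral>\<^sup>+x. ennreal ((v x)\<^sup>2) \<partial>lborel) < top"
    and D: "\<And>b. b \<in> Basis \<Longrightarrow> (\<integral>\<^sup>+x. ennreal ((pd b v x)\<^sup>2) \<partial>lborel) < top"
  shows "(\<integral>\<^sup>+x. ennreal (v x powr (2 * real n / (real n - 2))) \<partial>lborel) < top"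
proof -
  define p where "p = 2 * real n / (real n - 2)"
  have p: "p > 0" using n(2) by (simp add: p_def)
  define \<eta> where "\<eta> = box_bump 1 (- One) (One :: 'e)"
  have sm: "smooth_on UNIV \<eta>" unfolding \<eta>_def by (rule smooth_on_box_bump) simp
  have \<eta>0: "\<eta> x = 0" if "x \<notin> cbox (- One) One" for x
    unfolding \<eta>_def by (rule box_bump_eq_0) (use that box_subset_cbox in auto)
  have \<eta>b: "0 \<le> \<eta> x" "\<eta> x \<le> 1" for x unfolding \<eta>_def by (rule box_bump_nonneg box_bump_le_1)+
  have "\<exists>C\<ge>0. \<forall>x. \<bar>pd b \<eta> x\<bar> \<le> C" for b
  proof -
    have pd0: "pd b \<eta> x = 0" if "x \<notin> cbox (- One) One" for x by (rule pd_outside_support[OF closed_cbox \<eta>0 that])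
    obtain C where "\<And>x. \<bar>pd b \<eta> x\<bar> \<le> C" "C \<ge> 0"
      by (rule bounded_compact_support[of "pd b \<eta>" "cbox (- One) One"])
        (use smooth_on_continuous[OF smooth_on_pd[OF sm]] pd0 in auto)
    then show ?thesis by blast
  qed
  then obtain C where C: "\<And>b. C b \<ge> 0" "\<And>b x. \<bar>pd b \<eta> x\<bar> \<le> C b" by metis
  define w where "w m x = v x * \<eta> (x /\<^sub>R real (Suc m))" for m x
  have bl: "bounded_linear (\<lambda>x :: 'e. x /\<^sub>R real (Suc m))" for m by (rule bounded_linear_scaleR_right)
  have c\<eta>: "Ck_on 1 (\<lambda>x. \<eta> (x /\<^sub>R real (Suc m))) UNIV" for m
    by (rule Ck_on_inner_linear[OF bl _ smooth_onD[OF sm]]) auto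
  have w: "Ck_on 1 (w m) UNIV" for m unfolding w_def by (rule Ck_on_mult[OF _ v(1) c\<eta>]) simp
  have w0: "w m x = 0" if "x \<notin> (\<lambda>y. real (Suc m) *\<^sub>R y) ` cbox (- One) One" for m x
  proof -
    have "x /\<^sub>R real (Suc m) \<notin> cbox (- One) One"
    proof
      assume "x /\<^sub>R real (Suc m) \<in> cbox (- One) One"
      moreover have "x = real (Suc m) *\<^sub>R (x /\<^sub>R real (Suc m))" by simp
      ultimately show False using that by blast
    qed
    then show ?thesis unfolding w_def by (simp add: \<eta>0)
  qed
  have [measurable]: "v \<in> borel_measurable borel" "pd b v \<in> borel_measurable borel" for b
    using v(1) Ck_on_imp_continuous[OF v(1)] by (auto intro!: borel_measurable_continuous_onI)
  \<comment> \<open>Summed over all directions so that one bound serves for every \<open>b\<close>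
    and every \<open>m\<close>.\<close>
  define B where "B = (\<Sum>b\<in>(Basis :: 'e set). ennreal (2 * (C b)\<^sup>2) * (\<integral>\<^sup>+x. ennreal ((v x)\<^sup>2) \<partial>lborel)
    + ennreal 2 * (\<integral>\<^sup>+x. ennreal ((pd b v x)\<^sup>2) \<partial>lborel))"
  have B: "(\<integral>\<^sup>+x. ennreal ((pd b (w m) x)\<^sup>2) \<partial>lborel) \<le> B" if b: "b \<in> Basis" for b m
  proof -
    have "(pd b (w m) x)\<^sup>2 \<le> 2 * (C b)\<^sup>2 * (v x)\<^sup>2 + 2 * (pd b v x)\<^sup>2" for x
    proof -
      let ?y = "x /\<^sub>R real (Suc m)"
      have d\<eta>: "\<eta> differentiable (at y)" for y by (rule smooth_on_differentiable[OF sm]) simp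
      have "((\<lambda>x. \<eta> (x /\<^sub>R real (Suc m))) has_derivative (\<lambda>u. pd (u /\<^sub>R real (Suc m)) \<eta> ?y)) (at x)"
        by (rule has_derivative_frechet_compose[OF bounded_linear_imp_has_derivative[OF bl] d\<eta>])
      then have "pd b (\<lambda>x. \<eta> (x /\<^sub>R real (Suc m))) x = pd (b /\<^sub>R real (Suc m)) \<eta> ?y"
        by (simp only: frechet_derivative_eq)
      also have "\<dots> = pd b \<eta> ?y / real (Suc m)"
        using linear_scale[OF linear_pd[OF d\<eta>]] by (simp add: field_simps)
      finally have e: "pd b (\<lambda>x. \<eta> (x /\<^sub>R real (Suc m))) x = pd b \<eta> ?y / real (Suc m)" .
      have dv: "v differentiable (at x)" "(\<lambda>x. \<eta> (x /\<^sub>R real (Suc m))) differentiable (at x)"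
        using Ck_on_differentiable[of 0 v UNIV x] Ck_on_differentiable[of 0 "\<lambda>x. \<eta> (x /\<^sub>R real (Suc m))" UNIV x] v(1) c\<eta>[of m]
        by simp_all
      have pe: "pd b (w m) x = v x * (pd b \<eta> ?y / real (Suc m)) + pd b v x * \<eta> ?y"
        unfolding w_def pd_mult[OF dv] e ..
      have "\<bar>pd b \<eta> ?y / real (Suc m)\<bar> \<le> \<bar>pd b \<eta> ?y\<bar>" by (simp add: divide_le_eq field_simps)
      then have "\<bar>v x * (pd b \<eta> ?y / real (Suc m))\<bar> \<le> \<bar>C b * v x\<bar>"
        unfolding abs_mult using C(2)[of ?y b] C(1)[of b] v(2)[of x] by (subst mult.commute) (intro mult_mono; simp)
      then have 1: "(v x * (pd b \<eta> ?y / real (Suc m)))\<^sup>2 \<le> (C b * v x)\<^sup>2" by (simp only: abs_le_square_iff)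
      have "\<bar>pd b v x * \<eta> ?y\<bar> \<le> \<bar>pd b v x\<bar>" unfolding abs_mult using \<eta>b[of ?y] by (simp add: mult_left_le)
      then have 2: "(pd b v x * \<eta> ?y)\<^sup>2 \<le> (pd b v x)\<^sup>2" by (simp only: abs_le_square_iff)
      have "(a + b)\<^sup>2 \<le> 2 * a\<^sup>2 + 2 * b\<^sup>2" for a b :: real using sum_squares_bound[of a b] by (simp add: power2_sum)
      from order_trans[OF this add_mono[OF mult_left_mono[OF 1] mult_left_mono[OF 2]]]
      show ?thesis unfolding pe by (simp add: power_mult_distrib)
    qed
    then have "(\<integral>\<^sup>+x. ennreal ((pd b (w m) x)\<^sup>2) \<partial>lborel)
        \<le> (\<integral>\<^sup>+x. ennreal (2 * (C b)\<^sup>2) * ennreal ((v x)\<^sup>2) + ennreal 2 * ennreal ((pd b v x)\<^sup>2) \<partial>lborel)"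
      by (intro nn_integral_mono) (simp add: ennreal_mult[symmetric] ennreal_plus[symmetric] ennreal_leI del: ennreal_plus ennreal_numeral)
    also have "\<dots> = ennreal (2 * (C b)\<^sup>2) * (\<integral>\<^sup>+x. ennreal ((v x)\<^sup>2) \<partial>lborel) + ennreal 2 * (\<integral>\<^sup>+x. ennreal ((pd b v x)\<^sup>2) \<partial>lborel)"
      by (subst nn_integral_add) (auto simp: nn_integral_cmult simp del: ennreal_numeral)
    also have "\<dots> \<le> B" unfolding B_def by (rule member_le_sum[OF b]) auto
    finally show ?thesis .
  qed
  have wp: "w m x \<ge> 0" for m x using v(2) \<eta>b by (simp add: w_def)
  define S where "S = 1 + (ennreal ((2 * (real n - 1) / (real n - 2))\<^sup>2) * B) ^ n"
  have le: "(\<integral>\<^sup>+x. ennreal (w m x powr p) \<partial>lborel) \<le> S" for m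
    unfolding p_def S_def
    by (rule sobolev_inequality[OF n w wp _ w0 B]) (auto intro!: compact_scaling)
  have "B < top" unfolding B_def using L D by (auto simp: ennreal_mult_less_top)
  then have S: "S < top" unfolding S_def by (simp add: ennreal_mult_less_top power_less_top_ennreal)
  have cw: "(\<lambda>m. w m x powr p) \<longlonglongrightarrow> (v x * \<eta> 0) powr p" for x
  proof (rule tendsto_powr')
    have "(\<lambda>m. inverse (real (Suc m)) *\<^sub>R x) \<longlonglongrightarrow> 0 *\<^sub>R x"
      by (intro tendsto_scaleR LIMSEQ_inverse_real_of_nat tendsto_const)
    then have "(\<lambda>m. \<eta> (x /\<^sub>R real (Suc m))) \<longlonglongrightarrow> \<eta> 0"
      using smooth_on_continuous[OF sm] by (intro continuous_on_tendsto_compose[of UNIV \<eta>]) auto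
    then show "(\<lambda>m. w m x) \<longlonglongrightarrow> v x * \<eta> 0" unfolding w_def by (intro tendsto_mult tendsto_const)
  qed (use p wp in auto)
  \<comment> \<open>The cutoffs converge to the constant \<open>\<eta> 0\<close>, which is not
    normalized to 1 but is positive and can be divided out.\<close>
  have "(\<integral>\<^sup>+x. ennreal ((v x * \<eta> 0) powr p) \<partial>lborel) \<le> S"
  proof (rule nn_integral_lborel_fatou_le[OF _ cw le])
    fix m
    have "w m \<in> borel_measurable borel" using Ck_on_imp_continuous[OF w] by (rule borel_measurable_continuous_onI)
    then show "(\<lambda>x. w m x powr p) \<in> borel_measurable borel" by measurable
  qed
  also have "(\<integral>\<^sup>+x. ennreal ((v x * \<eta> 0) powr p) \<partial>lborel) = ennreal (\<eta> 0 powr p) * (\<integral>\<^sup>+x. ennreal (v x powr p) \<partial>lborel)"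
    by (subst nn_integral_cmult[symmetric]) (auto simp: powr_mult v(2) \<eta>b ennreal_mult mult.commute)
  finally have "ennreal (\<eta> 0 powr p) * (\<integral>\<^sup>+x. ennreal (v x powr p) \<partial>lborel) < top" using S by (rule le_less_trans)
  moreover have "\<eta> 0 > 0" unfolding \<eta>_def by (subst box_bump_pos_iff) (auto simp: mem_box)
  ultimately show ?thesis unfolding p_def[symmetric] by (auto simp: ennreal_mult_less_top)
qed

section \<open>Energies on the cylinder\<close>

definition slice :: "('a \<times> real \<Rightarrow> 'b) \<Rightarrow> real \<Rightarrow> 'a \<Rightarrow> 'b" where
  "slice u t z = u (z, t)"

text \<open>Defined without charts, as the axis has a global coordinate.\<close>

definition axial_deriv :: "('a \<times> real \<Rightarrow> real) \<Rightarrow> 'a \<times> real \<Rightarrow> real" where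
  "axial_deriv u p = deriv (\<lambda>s. u (fst p, s)) (snd p)"

lemma bilinear_mult_linear:
  fixes l :: "'e::real_vector \<Rightarrow> real"
  assumes "linear l" shows "bilinear (\<lambda>v w. l v * l w)"
  unfolding bilinear_def
  by (auto intro!: linearI simp: linear_add[OF assms] linear_scale[OF assms] algebra_simps)

context
  fixes Z :: "('i, 'a::{t2_space,second_countable_topology}, real ^ 'm::finite) riem"
  assumes R: "riemannian_manifold Z"
begin

lemma cometric_cylinder:
  assumes "i \<in> idx Z" "x \<in> chart_img Z i"
  shows "cometric (cylinder Z) i (x, t) b c = cometric Z i x (fst b) (fst c) + snd b * snd c"
proof -
  obtain K where K: "linear K" "\<And>\<xi> w. metric Z i x (K \<xi>) w = \<xi> \<bullet> w" "\<And>b c. inverse_form (metric Z i x) b c = K b \<bullet> c"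
    by (rule inner_form_sharp[OF inner_form_metric[OF R assms(1,2)]]) (rule that; assumption)
  obtain K' where K': "linear K'" "\<And>\<xi> w. metric (cylinder Z) i (x, t) (K' \<xi>) w = \<xi> \<bullet> w"
      "\<And>b c. inverse_form (metric (cylinder Z) i (x, t)) b c = K' b \<bullet> c"
    by (rule inner_form_sharp[OF inner_form_cylinder[OF R assms(1,2), of t]]) (rule that; assumption)
  have KK: "K' b = (K (fst b), snd b)"
    by (rule inner_form_eqI[OF inner_form_cylinder[OF R assms(1,2), of t]])
       (simp only: K'(2), simp add: cylinder_fst_snd K(2) inner_prod_def)
  show ?thesis
    using K(3) K'(3) unfolding cometric_def inverse_form_def by (simp add: KK inner_prod_def)
qed

lemma continuous_on_cometric_cylinder:
  assumes "i \<in> idx (cylinder Z)"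
  shows "continuous_on (chart_img (cylinder Z) i) (\<lambda>y. cometric (cylinder Z) i y b c)"
proof -
  have i: "i \<in> idx Z" using assms by simp
  have "continuous_on (chart_img Z i \<times> UNIV) (\<lambda>y :: _ \<times> real. cometric Z i (fst y) (fst b) (fst c) + snd b * snd c)"
    by (intro continuous_on_add continuous_on_const
        continuous_on_compose2[OF smooth_on_continuous[OF smooth_cometric[OF R i]]] continuous_on_fst continuous_on_id) auto
  then show ?thesis
    unfolding chart_img_cylinder by (rule continuous_on_eq) (auto simp: cometric_cylinder[OF i])
qed

context
  fixes u
  assumes u: "smooth_function (cylinder Z) u"
begin

lemma smooth_cylinder_chart:
  assumes "i \<in> idx Z"
  shows "smooth_on (chart_img Z i \<times> UNIV) (u \<circ> param (cylinder Z) i)"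
  using u assms by (simp add: smooth_function_def)

lemma smooth_slice: "smooth_function Z (slice u t)"
  unfolding smooth_function_def smooth_on_def
proof (intro ballI allI)
  fix i k assume i: "i \<in> idx Z"
  have o: "open (chart_img Z i)" by (rule open_chart_img[OF R i])
  have "Ck_on k (\<lambda>x. (x, t)) (chart_img Z i)"
    by (rule Ck_on_Pair[OF o Ck_on_linear[OF bounded_linear_ident o] Ck_on_const])
  from Ck_on_compose[OF o this smooth_onD[OF smooth_cylinder_chart[OF i]]]
  have "Ck_on k (\<lambda>x. (u \<circ> param (cylinder Z) i) (x, t)) (chart_img Z i)" by auto
  then show "Ck_on k (slice u t \<circ> param Z i) (chart_img Z i)"
    by (rule Ck_on_cong[OF o, THEN iffD1, rotated]) (simp add: slice_def param_cylinder[OF R i])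
qed

lemma pd_slice:
  assumes i: "i \<in> idx Z" and x: "x \<in> chart_img Z i"
  shows "pd v (slice u t \<circ> param Z i) x = pd (v, 0) (u \<circ> param (cylinder Z) i) (x, t)"
proof -
  have "((\<lambda>x. (x, t)) has_derivative (\<lambda>v. (v, 0))) (at x)" by (intro derivative_intros)
  from has_derivative_frechet_compose[OF this, of "u \<circ> param (cylinder Z) i"]
  have "((\<lambda>x. (u \<circ> param (cylinder Z) i) (x, t)) has_derivative (\<lambda>v. pd (v, 0) (u \<circ> param (cylinder Z) i) (x, t))) (at x)"
    using smooth_on_differentiable[OF smooth_cylinder_chart[OF i], of "(x, t)"] x by auto
  from frechet_derivative_eq[OF this]
  show ?thesis
    using frechet_derivative_cong_open[OF open_chart_img[OF R i] x, of "slice u t \<circ> param Z i" "\<lambda>x. (u \<circ> param (cylinder Z) i) (x, t)"]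
    by (simp add: slice_def param_cylinder[OF R i])
qed

lemma axial_has_derivative:
  assumes i: "i \<in> idx Z" and z: "z \<in> chart_dom Z i"
  shows "((\<lambda>s. u (z, s)) has_real_derivative pd (0, 1) (u \<circ> param (cylinder Z) i) (chart Z i z, t)) (at t)"
proof -
  let ?x = "chart Z i z"
  have x: "?x \<in> chart_img Z i" by (rule chart_in_img[OF R z])
  have d: "(u \<circ> param (cylinder Z) i) differentiable (at (?x, t))"
    using smooth_on_differentiable[OF smooth_cylinder_chart[OF i], of "(?x, t)"] x by auto
  have "((\<lambda>s. (?x, s)) has_derivative (\<lambda>s. (0, s))) (at t)" by (intro derivative_intros)
  from has_derivative_frechet_compose[OF this, of "u \<circ> param (cylinder Z) i"] d
  have "((\<lambda>s. (u \<circ> param (cylinder Z) i) (?x, s)) has_derivative (\<lambda>s. pd (0, s) (u \<circ> param (cylinder Z) i) (?x, t))) (at t)" by simp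
  moreover have "(\<lambda>s. (u \<circ> param (cylinder Z) i) (?x, s)) = (\<lambda>s. u (z, s))"
    by (simp add: param_cylinder[OF R i x] param_chart[OF R i z])
  moreover have "(\<lambda>s. pd (0, s) (u \<circ> param (cylinder Z) i) (?x, t)) = (*) (pd (0, 1) (u \<circ> param (cylinder Z) i) (?x, t))"
  proof
    show "pd (0, s) (u \<circ> param (cylinder Z) i) (?x, t) = pd (0, 1) (u \<circ> param (cylinder Z) i) (?x, t) * s" for s
      using linear_scale[OF linear_pd[OF d], of s "(0, 1)"] by simp
  qed
  ultimately show ?thesis unfolding has_field_derivative_def by (simp only:)
qed

lemma has_axial_deriv: "((\<lambda>s. u (z, s)) has_real_derivative axial_deriv u (z, t)) (at t)"
proof -
  note h = axial_has_derivative[OF chart_at(1)[OF R] chart_at(2)[OF R], of z t]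
  show ?thesis unfolding axial_deriv_def using h DERIV_imp_deriv[OF h] by simp
qed

lemma axial_deriv_chart:
  assumes "i \<in> idx Z" "z \<in> chart_dom Z i"
  shows "axial_deriv u (z, t) = pd (0, 1) (u \<circ> param (cylinder Z) i) (chart Z i z, t)"
  by (rule DERIV_unique[OF has_axial_deriv axial_has_derivative[OF assms]])

lemma continuous_axial_deriv: "continuous_on UNIV (axial_deriv u)"
proof (rule continuous_on_chartwise[OF riemannian_manifold_cylinder[OF R]])
  fix i assume "i \<in> idx (cylinder Z)"
  then have i: "i \<in> idx Z" by simp
  have "continuous_on (chart_dom Z i \<times> UNIV) (\<lambda>p. (chart Z i (fst p), snd p))"
    by (intro continuous_on_Pair continuous_on_compose2[OF continuous_on_chart[OF R i]] continuous_on_fst continuous_on_snd continuous_on_id) auto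
  then have "continuous_on (chart_dom Z i \<times> UNIV) (\<lambda>p. pd (0, 1) (u \<circ> param (cylinder Z) i) (chart Z i (fst p), snd p))"
    by (rule continuous_on_compose2[OF smooth_on_continuous[OF smooth_on_pd[OF smooth_cylinder_chart[OF i]]]]) (use chart_in_img[OF R] in auto)
  then have "continuous_on (chart_dom Z i \<times> UNIV) (axial_deriv u)"
    by (rule continuous_on_eq) (auto simp: axial_deriv_chart[OF i])
  then show "continuous_on (chart_dom (cylinder Z) i) (axial_deriv u)" by simp
qed

text \<open>Slice and axis are orthogonal, so the norm splits as in the theorem of Pythagoras; this
  is the source of the decomposition of the energy.\<close>

lemma form_norm_sq_cylinder:
  "form_norm_sq (cylinder Z) (differential (cylinder Z) u) (z, t)
    = form_norm_sq Z (differential Z (slice u t)) z + (axial_deriv u (z, t))\<^sup>2"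
proof -
  note Rc = riemannian_manifold_cylinder[OF R]
  let ?i = "chart_at Z z" let ?x = "chart Z ?i z" let ?C = "cylinder Z"
  have i: "?i \<in> idx Z" "z \<in> chart_dom Z ?i" by (rule chart_at[OF R])+
  have x: "?x \<in> chart_img Z ?i" by (rule chart_in_img[OF R i(2)])
  let ?\<omega> = "differential ?C u ?i (?x, t)"
  have l: "linear ?\<omega>" by (rule linear_differential[OF u]) (use i x in simp_all)
  have bil: "bilinear (\<lambda>v w. ?\<omega> v * ?\<omega> w)"
    by (rule bilinear_mult_linear[OF l])
  have "form_norm_sq ?C (differential ?C u) (z, t)
    = contract (metric ?C ?i (?x, t)) (\<lambda>v w. ?\<omega> v * ?\<omega> w)"
    using form_norm_sq_chart[OF Rc one_form_differential[OF Rc u], of ?i "(z, t)"] i by simp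
  also have "\<dots> = contract (metric Z ?i ?x) (\<lambda>v w. ?\<omega> (v, 0) * ?\<omega> (w, 0)) + ?\<omega> (0, 1) * ?\<omega> (0, 1)"
    by (rule contract_cylinder[OF R i(1) x bil])
  also have "(\<lambda>v w. ?\<omega> (v, 0) * ?\<omega> (w, 0)) = (\<lambda>v w. differential Z (slice u t) ?i ?x v * differential Z (slice u t) ?i ?x w)"
    unfolding differential_def pd_slice[OF i(1) x] ..
  also have "contract (metric Z ?i ?x) (\<lambda>v w. differential Z (slice u t) ?i ?x v * differential Z (slice u t) ?i ?x w)
    = form_norm_sq Z (differential Z (slice u t)) z"
    by (rule form_norm_sq_chart[OF R one_form_differential[OF R smooth_slice] i, symmetric])
  also have "?\<omega> (0, 1) = axial_deriv u (z, t)" unfolding differential_def axial_deriv_chart[OF i] ..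
  finally show ?thesis by (simp add: power2_eq_square)
qed

lemma smooth_axial_scaling: "smooth_function (cylinder Z) (\<lambda>p. u (fst p, s * snd p))"
  unfolding smooth_function_def smooth_on_def
proof (intro ballI allI)
  fix i k assume "i \<in> idx (cylinder Z)"
  then have i: "i \<in> idx Z" by simp
  have o: "open (chart_img Z i \<times> (UNIV :: real set))" by (intro open_Times open_chart_img[OF R i] open_UNIV)
  have "bounded_linear (\<lambda>y :: (real ^ 'm) \<times> real. (fst y, s * snd y))"
    by (intro bounded_linear_Pair bounded_linear_fst bounded_linear_const_mult bounded_linear_snd)
  then have "Ck_on k (\<lambda>y. (u \<circ> param (cylinder Z) i) (fst y, s * snd y)) (chart_img Z i \<times> UNIV)"
    by (rule Ck_on_inner_linear[OF _ o smooth_onD[OF smooth_cylinder_chart[OF i]]]) auto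
  then show "Ck_on k ((\<lambda>p. u (fst p, s * snd p)) \<circ> param (cylinder Z) i) (chart_img (cylinder Z) i)"
    unfolding chart_img_cylinder
    by (rule Ck_on_cong[OF o, THEN iffD1, rotated]) (auto simp: param_cylinder[OF R i])
qed

lemma slice_axial_scaling: "slice (\<lambda>p. u (fst p, s * snd p)) t = slice u (s * t)"
  by (auto simp: slice_def)

lemma axial_deriv_axial_scaling:
  "axial_deriv (\<lambda>p. u (fst p, s * snd p)) (z, t) = s * axial_deriv u (z, s * t)"
proof -
  have "((\<lambda>t. u (z, s * t)) has_real_derivative axial_deriv u (z, s * t) * s) (at t)"
    by (rule DERIV_chain2[OF has_axial_deriv]) (auto intro!: derivative_eq_intros)
  then show ?thesis unfolding axial_deriv_def by (simp add: DERIV_imp_deriv axial_deriv_def mult.commute)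
qed

end

lemma smooth_function_prod_cylinder:
  fixes \<phi> :: "real \<Rightarrow> real"
  assumes f: "smooth_function Z f" and \<phi>: "smooth_on UNIV \<phi>"
  shows "smooth_function (cylinder Z) (\<lambda>p. f (fst p) * \<phi> (snd p))"
  unfolding smooth_function_def smooth_on_def
proof (intro ballI allI)
  fix i k assume "i \<in> idx (cylinder Z)"
  then have i: "i \<in> idx Z" by simp
  have o: "open (chart_img Z i \<times> (UNIV :: real set))" by (intro open_Times open_chart_img[OF R i] open_UNIV)
  have f': "Ck_on k (f \<circ> param Z i) (chart_img Z i)" using f i unfolding smooth_function_def smooth_on_def by blast
  have 1: "Ck_on k (\<lambda>y. (f \<circ> param Z i) (fst y)) (chart_img Z i \<times> (UNIV :: real set))"
    by (rule Ck_on_fst[OF f' open_chart_img[OF R i]])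
  have 2: "Ck_on k (\<lambda>y. \<phi> (snd y)) (chart_img Z i \<times> (UNIV :: real set))"
    by (rule Ck_on_inner_linear[OF bounded_linear_snd o smooth_onD[OF \<phi>]]) auto
  from Ck_on_mult[OF o 1 2]
  show "Ck_on k ((\<lambda>p. f (fst p) * \<phi> (snd p)) \<circ> param (cylinder Z) i) (chart_img (cylinder Z) i)"
    unfolding chart_img_cylinder
    by (rule Ck_on_cong[OF o, THEN iffD1, rotated]) (auto simp: param_cylinder[OF R i])
qed

lemma form_norm_sq_scale:
  assumes f: "smooth_function Z f"
  shows "form_norm_sq Z (differential Z (\<lambda>z. f z * c)) z = form_norm_sq Z (differential Z f) z * c\<^sup>2"
proof -
  let ?i = "chart_at Z z" let ?x = "chart Z ?i z"
  have i: "?i \<in> idx Z" "z \<in> chart_dom Z ?i" by (rule chart_at[OF R])+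
  have x: "?x \<in> chart_img Z ?i" by (rule chart_in_img[OF R i(2)])
  have d: "(f \<circ> param Z ?i) differentiable (at ?x)"
    using smooth_on_differentiable[of "chart_img Z ?i" "f \<circ> param Z ?i" ?x] f i x by (simp add: smooth_function_def)
  have "((\<lambda>y. (f \<circ> param Z ?i) y * c) has_derivative (\<lambda>v. pd v (f \<circ> param Z ?i) ?x * c)) (at ?x)"
    by (rule has_derivative_mult_left[OF d[unfolded frechet_derivative_works]])
  from frechet_derivative_eq[OF this]
  have "differential Z (\<lambda>z. f z * c) ?i ?x v = differential Z f ?i ?x v * c" for v
    by (simp add: differential_def o_def)
  then show ?thesis
    unfolding form_norm_sq_def Let_def by (simp add: sum_distrib_right sum_distrib_left power2_eq_square ac_simps)
qed

end

abbreviation (input) cyl_vol :: "('i, 'a::topological_space, 'e::euclidean_space) riem \<Rightarrow> ('a \<times> real) measure" where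
  "cyl_vol Z \<equiv> volume Z \<Otimes>\<^sub>M lborel"

section \<open>The Sobolev embedding on the cylinder\<close>

lemma continuous_on_compact_bounded:
  fixes f :: "'b::topological_space \<Rightarrow> real"
  assumes "continuous_on K f" "compact K"
  obtains C where "\<And>x. x \<in> K \<Longrightarrow> \<bar>f x\<bar> \<le> C"
  using compact_imp_bounded[OF compact_continuous_image[OF assms]] unfolding bounded_iff by auto

context
  fixes Z :: "('i, 'a::{t2_space,second_countable_topology}, real ^ 'm::finite) riem"
  assumes Z: "closed_riemannian_manifold Z"
begin

lemma sets_cyl_vol: "sets (cyl_vol Z) = sets borel"
  using is_volume_cylinder[OF Z] by (simp add: is_volume_def)

lemma cyl_vol_measurable: "f \<in> borel_measurable borel \<Longrightarrow> f \<in> borel_measurable (cyl_vol Z)"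
  by (simp only: measurable_cong_sets[OF sets_cyl_vol refl])

text \<open>On the compact set \<open>K\<close> the volume density is bounded and bounded away from
  0, and on the cylinder it does not depend on the axial coordinate. Hence one constant compares
  volume and Lebesgue measure on the whole noncompact strip over \<open>K\<close>.\<close>

lemma chart_strip_comparison:
  assumes i: "i \<in> idx Z" and K: "compact K" "K \<subseteq> chart_img Z i"
  shows "\<exists>c\<ge>0. (\<forall>F\<in>borel_measurable borel.
      (\<integral>\<^sup>+y. F (param (cylinder Z) i y) * indicator (K \<times> UNIV) y \<partial>lborel) \<le> ennreal c * (\<integral>\<^sup>+p. F p \<partial>cyl_vol Z)) \<and>
    (\<forall>F\<in>borel_measurable borel. (\<forall>z t. F (z, t) \<noteq> 0 \<longrightarrow> z \<in> chart_dom Z i \<and> chart Z i z \<in> K) \<longrightarrow>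
      (\<integral>\<^sup>+p. F p \<partial>cyl_vol Z) \<le> ennreal c * (\<integral>\<^sup>+y. F (param (cylinder Z) i y) * indicator (K \<times> UNIV) y \<partial>lborel))"
proof -
  note R = closed_riemannian[OF Z]
  note Rc = riemannian_manifold_cylinder[OF R]
  have ic: "i \<in> idx (cylinder Z)" using i by simp
  let ?g = "\<lambda>x. sqrt (gram_det Z i x)"
  let ?img = "chart_img Z i \<times> (UNIV :: real set)"
  have cg: "continuous_on K ?g"
    by (rule continuous_on_subset[OF _ K(2)])
      (intro continuous_intros smooth_on_continuous[OF smooth_gram_det[OF R i]])
  have gp: "?g x > 0" if "x \<in> chart_img Z i" for x using gram_det_pos[OF Z i that] by simp
  have cg': "continuous_on K (\<lambda>x. inverse (?g x))" by (rule continuous_on_inverse[OF cg]) (use gp K(2) in force)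
  obtain c1 where c1: "\<And>x. x \<in> K \<Longrightarrow> ?g x \<le> c1"
    using compact_imp_bounded[OF compact_continuous_image[OF cg K(1)]] unfolding bounded_iff by (auto simp: abs_le_iff)
  obtain c2 where c2: "\<And>x. x \<in> K \<Longrightarrow> inverse (?g x) \<le> c2"
    using compact_imp_bounded[OF compact_continuous_image[OF cg' K(1)]] unfolding bounded_iff by (auto simp: abs_le_iff)
  \<comment> \<open>One constant for both directions: \<open>c1\<close> bounds the density,
    \<open>c2\<close> its reciprocal.\<close>
  define c where "c = max 0 (max c1 c2)"
  have c: "c \<ge> 0" "\<And>x. x \<in> K \<Longrightarrow> ?g x \<le> c" "\<And>x. x \<in> K \<Longrightarrow> 1 \<le> c * ?g x"
  proof -
    show "c \<ge> 0" by (simp add: c_def)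
    show "?g x \<le> c" if "x \<in> K" for x using c1[OF that] by (simp add: c_def)
    show "1 \<le> c * ?g x" if "x \<in> K" for x
    proof -
      have "?g x > 0" using gp K(2) that by auto
      moreover from this have "inverse (?g x) * ?g x = 1" by simp
      moreover have "inverse (?g x) \<le> c" using c2[OF that] by (simp add: c_def)
      ultimately show ?thesis by (metis less_imp_le mult_right_mono)
    qed
  qed
  have mK: "K \<times> (UNIV :: real set) \<in> sets borel" by (intro borel_closed closed_Times compact_imp_closed K closed_UNIV)
  have tr: "(\<integral>\<^sup>+p. F p * indicator (chart_dom Z i \<times> UNIV) p \<partial>cyl_vol Z)
      = (\<integral>\<^sup>+y. ennreal (?g (fst y)) * F (param (cylinder Z) i y) * indicator ?img y \<partial>lborel)"
    if F: "F \<in> borel_measurable borel" for F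
  proof -
    have "(\<integral>\<^sup>+p. F p * indicator (chart_dom Z i \<times> UNIV) p \<partial>cyl_vol Z)
      = (\<integral>\<^sup>+y. ennreal (sqrt (gram_det (cylinder Z) i y)) * F (param (cylinder Z) i y) * indicator ?img y \<partial>lborel)"
      using nn_integral_volume_chart[OF Rc is_volume_cylinder[OF Z] ic F] by simp
    also have "\<dots> = (\<integral>\<^sup>+y. ennreal (?g (fst y)) * F (param (cylinder Z) i y) * indicator ?img y \<partial>lborel)"
      by (intro nn_integral_cong) (auto simp: gram_det_cylinder[OF R i] split: split_indicator)
    finally show ?thesis .
  qed
  let ?pm = "\<lambda>y. if y \<in> chart_img (cylinder Z) i then param (cylinder Z) i y else undefined"
  have pm: "?pm \<in> borel \<rightarrow>\<^sub>M borel" by (rule measurable_param[OF Rc ic])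
  have mg: "(\<lambda>y. ennreal (?g (fst y)) * F (param (cylinder Z) i y) * indicator ?img y) \<in> borel_measurable lborel"
    if F: "F \<in> borel_measurable borel" for F
  proof -
    have "(\<lambda>y. (ennreal (sqrt (gram_det (cylinder Z) i y)) * indicator (chart_img (cylinder Z) i) y) * F (?pm y)) \<in> borel_measurable borel"
      by (intro borel_measurable_times_ennreal measurable_density[OF Rc ic] measurable_compose[OF pm F])
    also have "(\<lambda>y. (ennreal (sqrt (gram_det (cylinder Z) i y)) * indicator (chart_img (cylinder Z) i) y) * F (?pm y))
        = (\<lambda>y. ennreal (?g (fst y)) * F (param (cylinder Z) i y) * indicator ?img y)"
      by (rule ext) (auto simp: gram_det_cylinder[OF R i] split: split_indicator)
    finally show ?thesis by simp
  qed
  have mk: "(\<lambda>y. F (param (cylinder Z) i y) * indicator (K \<times> UNIV) y) \<in> borel_measurable lborel"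
    if F: "F \<in> borel_measurable borel" for F :: "_ \<Rightarrow> ennreal"
  proof -
    have "(\<lambda>y. F (?pm y) * indicator (K \<times> UNIV) y) \<in> borel_measurable borel"
      by (intro borel_measurable_times_ennreal measurable_compose[OF pm F] borel_measurable_indicator mK)
    also have "(\<lambda>y. F (?pm y) * indicator (K \<times> UNIV) y) = (\<lambda>y. F (param (cylinder Z) i y) * indicator (K \<times> UNIV) y)"
      using K(2) by (intro ext) (auto split: split_indicator)
    finally show ?thesis by simp
  qed
  show ?thesis
  proof (intro exI conjI ballI impI)
    show "c \<ge> 0" by (rule c(1))
  next
    fix F :: "'a \<times> real \<Rightarrow> ennreal" assume F: "F \<in> borel_measurable borel"
    have "(\<integral>\<^sup>+y. F (param (cylinder Z) i y) * indicator (K \<times> UNIV) y \<partial>lborel)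
      \<le> (\<integral>\<^sup>+y. ennreal c * (ennreal (?g (fst y)) * F (param (cylinder Z) i y) * indicator ?img y) \<partial>lborel)"
    proof (rule nn_integral_mono)
      fix y
      show "F (param (cylinder Z) i y) * indicator (K \<times> UNIV) y
        \<le> ennreal c * (ennreal (?g (fst y)) * F (param (cylinder Z) i y) * indicator ?img y)"
      proof (cases "fst y \<in> K")
        case True
        then have "1 \<le> ennreal (c * ?g (fst y))" using c(3) by simp
        from mult_right_mono[OF this, of "F (param (cylinder Z) i y)"] True K(2) c(1)
        show ?thesis by (auto simp: ennreal_mult' mult.assoc indicator_def mem_Times_iff)
      qed (auto simp: indicator_def mem_Times_iff)
    qed
    also have "\<dots> = ennreal c * (\<integral>\<^sup>+p. F p * indicator (chart_dom Z i \<times> UNIV) p \<partial>cyl_vol Z)"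
      unfolding tr[OF F] by (rule nn_integral_cmult[OF mg[OF F]])
    also have "\<dots> \<le> ennreal c * (\<integral>\<^sup>+p. F p \<partial>cyl_vol Z)"
      by (intro mult_left_mono nn_integral_mono) (auto split: split_indicator)
    finally show "(\<integral>\<^sup>+y. F (param (cylinder Z) i y) * indicator (K \<times> UNIV) y \<partial>lborel) \<le> ennreal c * (\<integral>\<^sup>+p. F p \<partial>cyl_vol Z)" .
  next
    fix F :: "'a \<times> real \<Rightarrow> ennreal"
    assume F: "F \<in> borel_measurable borel" and s: "\<forall>z t. F (z, t) \<noteq> 0 \<longrightarrow> z \<in> chart_dom Z i \<and> chart Z i z \<in> K"
    have "(\<integral>\<^sup>+p. F p \<partial>cyl_vol Z) = (\<integral>\<^sup>+p. F p * indicator (chart_dom Z i \<times> UNIV) p \<partial>cyl_vol Z)"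
      by (intro nn_integral_cong) (use s in \<open>auto split: split_indicator\<close>)
    also have "\<dots> \<le> (\<integral>\<^sup>+y. ennreal c * (F (param (cylinder Z) i y) * indicator (K \<times> UNIV) y) \<partial>lborel)"
      unfolding tr[OF F]
    proof (rule nn_integral_mono)
      fix y
      show "ennreal (?g (fst y)) * F (param (cylinder Z) i y) * indicator ?img y
        \<le> ennreal c * (F (param (cylinder Z) i y) * indicator (K \<times> UNIV) y)"
      proof (cases "fst y \<in> K")
        case True
        then have "ennreal (?g (fst y)) \<le> ennreal c" using c(2) by (simp add: ennreal_leI)
        from mult_right_mono[OF this, of "F (param (cylinder Z) i y)"] True K(2)
        show ?thesis by (auto simp: indicator_def mem_Times_iff)
      next
        case False
        have "F (param (cylinder Z) i y) = 0" if "fst y \<in> chart_img Z i"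
          using s[rule_format, of "param Z i (fst y)" "snd y"] False chart_param[OF R i that] param_cylinder[OF R i that, of "snd y"] by auto
        then show ?thesis by (auto simp: indicator_def mem_Times_iff)
      qed
    qed
    also have "\<dots> = ennreal c * (\<integral>\<^sup>+y. F (param (cylinder Z) i y) * indicator (K \<times> UNIV) y \<partial>lborel)"
      by (rule nn_integral_cmult[OF mk[OF F]])
    finally show "(\<integral>\<^sup>+p. F p \<partial>cyl_vol Z) \<le> ennreal c * (\<integral>\<^sup>+y. F (param (cylinder Z) i y) * indicator (K \<times> UNIV) y \<partial>lborel)" .
  qed
qed

text \<open>Cauchy-Schwarz between a covector and a tangent vector; it bounds coordinate derivatives
  by the intrinsic norm.\<close>

lemma pd_le_form_norm_sq:
  assumes u: "smooth_function (cylinder Z) u" and i: "i \<in> idx Z" and x: "x \<in> chart_img Z i"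
  shows "(pd b (u \<circ> param (cylinder Z) i) (x, t))\<^sup>2
    \<le> metric (cylinder Z) i (x, t) b b * form_norm_sq (cylinder Z) (differential (cylinder Z) u) (param (cylinder Z) i (x, t))"
proof -
  note R = closed_riemannian[OF Z]
  note Rc = riemannian_manifold_cylinder[OF R]
  let ?C = "cylinder Z"
  have ic: "i \<in> idx ?C" "(x, t) \<in> chart_img ?C i" using i x by auto
  have "(differential ?C u i (x, t) b)\<^sup>2
    \<le> metric ?C i (x, t) b b * contract (metric ?C i (x, t)) (\<lambda>v w. differential ?C u i (x, t) v * differential ?C u i (x, t) w)"
    by (rule contract_nonneg(2)[OF inner_form_cylinder[OF R i x] linear_differential[OF u ic]])
  also have "contract (metric ?C i (x, t)) (\<lambda>v w. differential ?C u i (x, t) v * differential ?C u i (x, t) w)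
    = form_norm_sq ?C (differential ?C u) (param ?C i (x, t))"
    using form_norm_sq_chart[OF Rc one_form_differential[OF Rc u] ic(1) param_in_dom[OF Rc ic]] by (simp only: chart_param[OF Rc ic])
  finally show ?thesis by (simp add: differential_def)
qed

end

context
  fixes Z :: "('i, 'a::{t2_space,second_countable_topology}, real ^ 'm::finite) riem" and n :: nat
  assumes Z: "closed_riemannian_manifold Z" and n: "n \<ge> 3" "CARD('m) = n - 1"
begin

text \<open>In the chart, the product of \<rho> and \<open>u\<close> extends by 0 to a function
  \<open>h\<close> on the whole Euclidean space. Its support lies in the strip over
  \<open>K\<close>, which is unbounded along the axis; therefore \<open>sobolev_embedding\<close> is
  applied and not the inequality for compact supports.\<close>

lemma sobolev_local:
  assumes u: "smooth_function (cylinder Z) u" "\<And>p. u p \<ge> 0"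
    and L: "integrable (volume Z \<Otimes>\<^sub>M (lborel :: real measure)) (\<lambda>p. (u p)\<^sup>2)"
      "integrable (volume Z \<Otimes>\<^sub>M (lborel :: real measure)) (form_norm_sq (cylinder Z) (differential (cylinder Z) u))"
    and cS: "continuous_on UNIV (form_norm_sq (cylinder Z) (differential (cylinder Z) u))"
    and i: "i \<in> idx Z" and K: "compact K" "K \<subseteq> chart_img Z i"
    and \<rho>: "smooth_function Z \<rho>" "\<And>z. \<rho> z \<ge> 0" "\<And>z. \<rho> z \<le> 1" "\<And>z. \<rho> z \<noteq> 0 \<Longrightarrow> z \<in> chart_dom Z i \<and> chart Z i z \<in> K"
  shows "(\<integral>\<^sup>+p. ennreal ((\<rho> (fst p) * u p) powr (2 * real n / (real n - 2))) \<partial>(volume Z \<Otimes>\<^sub>M (lborel :: real measure))) < top"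
proof -
  note R = closed_riemannian[OF Z]
  note Rc = riemannian_manifold_cylinder[OF R]
  let ?C = "cylinder Z" and ?P = "volume Z \<Otimes>\<^sub>M (lborel :: real measure)"
  let ?S = "form_norm_sq ?C (differential ?C u)"
  let ?V = "chart_img Z i \<times> (UNIV :: real set)" and ?KU = "K \<times> (UNIV :: real set)"
  define U where "U = u \<circ> param ?C i"
  define r where "r = \<rho> \<circ> param Z i"
  define h where "h y = (if y \<in> ?V then r (fst y) * U y else 0)" for y
  have oV: "open (chart_img Z i)" by (rule open_chart_img[OF R i])
  then have oV': "open ?V" by (intro open_Times open_UNIV)
  have sU: "smooth_on ?V U" unfolding U_def by (rule smooth_cylinder_chart[OF R u(1) i])
  have sr: "smooth_on (chart_img Z i) r" using \<rho>(1) i unfolding r_def smooth_function_def by blast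
  have r0: "r x = 0" if "x \<in> chart_img Z i - K" for x
    using \<rho>(4)[of "param Z i x"] that chart_param[OF R i, of x] by (auto simp: r_def)
  have clK: "closed ?KU" by (intro closed_Times compact_imp_closed K closed_UNIV)
  have h1: "Ck_on 1 h UNIV"
    unfolding h_def
    by (rule Ck_on_extend_0[OF oV' Ck_on_mult[OF oV' Ck_on_fst[OF smooth_onD[OF sr] oV] smooth_onD[OF sU]] clK])
      (use K(2) in \<open>auto intro!: r0\<close>)
  have hp: "h y \<ge> 0" for y using \<rho>(2) u(2) by (simp add: h_def r_def U_def)
  have h0: "h y = 0" if "y \<notin> ?KU" for y
  proof (cases "y \<in> ?V")
    case True
    then have "r (fst y) = 0" using that by (intro r0) auto
    then show ?thesis by (simp add: h_def)
  qed (simp add: h_def)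
  obtain c :: real where c: "c \<ge> 0"
    "\<forall>F\<in>borel_measurable borel.
      (\<integral>\<^sup>+y. F (param ?C i y) * indicator ?KU y \<partial>lborel) \<le> ennreal c * (\<integral>\<^sup>+p. F p \<partial>?P)"
    "\<forall>F\<in>borel_measurable borel. (\<forall>z t. F (z, t) \<noteq> 0 \<longrightarrow> z \<in> chart_dom Z i \<and> chart Z i z \<in> K) \<longrightarrow>
      (\<integral>\<^sup>+p. F p \<partial>?P) \<le> ennreal c * (\<integral>\<^sup>+y. F (param ?C i y) * indicator ?KU y \<partial>lborel)"
    using chart_strip_comparison[OF Z i K] by blast
  have mu: "u \<in> borel_measurable borel"
    by (rule borel_measurable_continuous_onI[OF smooth_function_continuous[OF Rc u(1)]])
  have mS: "?S \<in> borel_measurable borel" by (rule borel_measurable_continuous_onI[OF cS])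
  have m\<rho>: "(\<lambda>p. \<rho> (fst p)) \<in> borel_measurable (borel :: ('a \<times> real) measure)"
    by (intro borel_measurable_continuous_onI continuous_on_compose2[OF smooth_function_continuous[OF R \<rho>(1)]] continuous_on_fst continuous_on_id) auto
  have Sp: "?S p \<ge> 0" for p by (rule form_norm_sq_nonneg[OF Rc one_form_differential[OF Rc u(1)]])
  \<comment> \<open>Each integrand below lives on the strip and is dominated there by a combination
    of the energy density and the square of \<open>u\<close>, whose integrals
    \<open>chart_strip_comparison\<close> carries over from the cylinder.\<close>
  have bound: "(\<integral>\<^sup>+y. ennreal (f y) \<partial>lborel) < top"
    if f: "\<And>y. y \<in> ?KU \<Longrightarrow> f y \<le> a * ?S (param ?C i y) + b * (u (param ?C i y))\<^sup>2" "\<And>y. y \<notin> ?KU \<Longrightarrow> f y = 0"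
      and ab: "a \<ge> 0" "b \<ge> 0" for f a b
  proof -
    let ?F = "\<lambda>p. ennreal (a * ?S p + b * (u p)\<^sup>2)"
    have F: "?F \<in> borel_measurable borel" using mS mu by measurable
    have "integrable ?P (\<lambda>p. a * ?S p + b * (u p)\<^sup>2)" using L by (intro Bochner_Integration.integrable_add integrable_mult_right)
    then have "(\<integral>\<^sup>+p. ?F p \<partial>?P) < top"
      using Sp ab by (subst nn_integral_eq_integral) auto
    then have "ennreal c * (\<integral>\<^sup>+p. ?F p \<partial>?P) < top" by (simp add: ennreal_mult_less_top)
    moreover have "(\<integral>\<^sup>+y. ennreal (f y) \<partial>lborel) \<le> (\<integral>\<^sup>+y. ?F (param ?C i y) * indicator ?KU y \<partial>lborel)"
    proof (rule nn_integral_mono)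
      fix y show "ennreal (f y) \<le> ?F (param ?C i y) * indicator ?KU y"
        using f[of y] by (cases "y \<in> ?KU") (simp_all add: ennreal_leI)
    qed
    ultimately show ?thesis using bspec[OF c(2) F] by (meson le_less_trans)
  qed
  have in_V: "y \<in> ?V" if "y \<in> ?KU" for y using that K(2) by auto
  have ru: "0 \<le> r x" "r x \<le> 1" for x using \<rho>(2,3) by (simp_all add: r_def)
  have 1: "(\<integral>\<^sup>+y. ennreal ((h y)\<^sup>2) \<partial>lborel) < top"
  proof (rule bound[where a=0 and b=1])
    fix y assume y: "y \<in> ?KU"
    have "h y \<le> U y" using in_V[OF y] ru[of "fst y"] u(2) by (simp add: h_def U_def mult_left_le_one_le)
    then have "(h y)\<^sup>2 \<le> (U y)\<^sup>2" using hp by (rule power_mono)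
    then show "(h y)\<^sup>2 \<le> 0 * ?S (param ?C i y) + 1 * (u (param ?C i y))\<^sup>2" by (simp add: U_def)
  qed (use h0 in auto)
  have 2: "(\<integral>\<^sup>+y. ennreal ((pd b h y)\<^sup>2) \<partial>lborel) < top" for b
  proof -
    have dr: "((\<lambda>y. r (fst y)) has_derivative (\<lambda>v. pd (fst v) r x)) (at (x, t))" if "x \<in> chart_img Z i" for x and t :: real
      using has_derivative_of_fst[OF oV that, of r "\<lambda>y. r (fst y)"] smooth_on_differentiable[OF sr that] by simp
    have k1: "continuous_on K (pd (fst b) r)"
      by (rule continuous_on_subset[OF smooth_on_continuous[OF smooth_on_pd[OF sr]] K(2)])
    obtain c1 where c1: "\<And>x. x \<in> K \<Longrightarrow> \<bar>pd (fst b) r x\<bar> \<le> c1"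
      by (rule continuous_on_compact_bounded[OF k1 K(1)]) (rule that)
    have k2: "continuous_on K (\<lambda>x. metric Z i x (fst b) (fst b))"
      by (rule continuous_on_subset[OF smooth_on_continuous[OF smooth_metric[OF R i]] K(2)])
    obtain c2 where c2: "\<And>x. x \<in> K \<Longrightarrow> \<bar>metric Z i x (fst b) (fst b)\<bar> \<le> c2"
      by (rule continuous_on_compact_bounded[OF k2 K(1)]) (rule that)
    \<comment> \<open>A bound for the metric in direction \<open>b\<close> over the whole strip:
      \<open>c2\<close> for the slice component, \<open>(snd b)\<^sup>2\<close> for the axial
      one.\<close>
    let ?d = "max 0 c2 + (snd b)\<^sup>2"
    show ?thesis
    proof (rule bound[where a="2 * ?d" and b="2 * c1\<^sup>2"])
      fix y assume y: "y \<in> ?KU"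
      obtain x t where xt: "y = (x, t)" by (cases y)
      have xK: "x \<in> K" and x: "x \<in> chart_img Z i" using y K(2) xt by auto
      have "pd b h y = pd b (\<lambda>y. r (fst y) * U y) y"
        using frechet_derivative_cong_open[OF oV' in_V[OF y], of h "\<lambda>y. r (fst y) * U y"] by (simp add: h_def)
      also have "\<dots> = r (fst y) * pd b U y + pd b (\<lambda>y. r (fst y)) y * U y"
        using dr[OF x, of t] smooth_on_differentiable[OF sU in_V[OF y]] unfolding xt by (intro pd_mult) (auto simp: differentiable_def)
      also have "pd b (\<lambda>y. r (fst y)) y = pd (fst b) r x"
        unfolding xt by (simp add: frechet_derivative_eq[OF dr[OF x]])
      finally have e: "pd b h y = r x * pd b U y + pd (fst b) r x * U y" by (simp add: xt)
      have "(r x * pd b U y)\<^sup>2 \<le> 1 * (pd b U y)\<^sup>2"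
        unfolding power_mult_distrib using ru[of x] by (intro mult_right_mono) (auto simp: power_le_one)
      also have "\<dots> \<le> metric ?C i y b b * ?S (param ?C i y)"
        using pd_le_form_norm_sq[OF Z u(1) i x] by (simp add: U_def xt)
      also have "\<dots> \<le> ?d * ?S (param ?C i y)"
        using c2[OF xK] Sp by (intro mult_right_mono) (auto simp: cylinder_fst_snd xt power2_eq_square)
      finally have 1: "(r x * pd b U y)\<^sup>2 \<le> ?d * ?S (param ?C i y)" .
      have "\<bar>pd (fst b) r x\<bar>\<^sup>2 \<le> c1\<^sup>2" using c1[OF xK] by (intro power_mono) auto
      then have 2: "(pd (fst b) r x * U y)\<^sup>2 \<le> c1\<^sup>2 * (U y)\<^sup>2"
        unfolding power_mult_distrib by (intro mult_right_mono) auto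
      have "(a + b)\<^sup>2 \<le> 2 * a\<^sup>2 + 2 * b\<^sup>2" for a b :: real using sum_squares_bound[of a b] by (simp add: power2_sum)
      from order_trans[OF this add_mono[OF mult_left_mono[OF 1] mult_left_mono[OF 2]]]
      show "(pd b h y)\<^sup>2 \<le> 2 * ?d * ?S (param ?C i y) + 2 * c1\<^sup>2 * (u (param ?C i y))\<^sup>2"
        unfolding e by (simp add: U_def mult.assoc del: distrib_left_numeral)
    qed (use pd_outside_support[OF clK h0] in auto)
  qed
  let ?p = "2 * real n / (real n - 2)"
  have "DIM((real ^ 'm) \<times> real) = n" using n by simp
  from sobolev_embedding[OF this n(1) h1 hp 1 2]
  have fin: "(\<integral>\<^sup>+y. ennreal (h y powr ?p) \<partial>lborel) < top" .
  let ?F = "\<lambda>p. ennreal ((\<rho> (fst p) * u p) powr ?p)"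
  have F: "?F \<in> borel_measurable borel" using m\<rho> mu by measurable
  have "(\<integral>\<^sup>+p. ?F p \<partial>?P) \<le> ennreal c * (\<integral>\<^sup>+y. ?F (param ?C i y) * indicator ?KU y \<partial>lborel)"
    by (rule bspec[OF c(3) F, rule_format]) (use \<rho>(4) in auto)
  also have "(\<integral>\<^sup>+y. ?F (param ?C i y) * indicator ?KU y \<partial>lborel) \<le> (\<integral>\<^sup>+y. ennreal (h y powr ?p) \<partial>lborel)"
    by (intro nn_integral_mono)
      (use K(2) in \<open>auto simp: h_def r_def U_def param_cylinder[OF R i] subset_eq split: split_indicator\<close>)
  finally show ?thesis using fin
    by (meson ennreal_less_top ennreal_mult_less_top le_less_trans mult_left_mono zero_le)
qed

lemma sobolev_cylinder:
  assumes u: "smooth_function (cylinder Z) u" "\<And>p. u p \<ge> 0"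
    and L: "integrable (volume Z \<Otimes>\<^sub>M (lborel :: real measure)) (\<lambda>p. (u p)\<^sup>2)"
      "integrable (volume Z \<Otimes>\<^sub>M (lborel :: real measure)) (form_norm_sq (cylinder Z) (differential (cylinder Z) u))"
    and cS: "continuous_on UNIV (form_norm_sq (cylinder Z) (differential (cylinder Z) u))"
  shows "integrable (volume Z \<Otimes>\<^sub>M (lborel :: real measure)) (\<lambda>p. u p powr (2 * real n / (real n - 2)))"
proof -
  note R = closed_riemannian[OF Z]
  note Rc = riemannian_manifold_cylinder[OF R]
  let ?P = "volume Z \<Otimes>\<^sub>M (lborel :: real measure)" and ?p = "2 * real n / (real n - 2)"
  obtain T :: "('i \<times> (real ^ 'm) \<times> (real ^ 'm)) set" and \<rho>
    where T: "finite T" "\<And>\<tau>. \<tau> \<in> T \<Longrightarrow> fst \<tau> \<in> idx Z"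
    "\<And>\<tau>. \<tau> \<in> T \<Longrightarrow> cbox (fst (snd \<tau>)) (snd (snd \<tau>)) \<subseteq> chart_img Z (fst \<tau>)"
    "\<And>\<tau>. \<tau> \<in> T \<Longrightarrow> smooth_function Z (\<rho> \<tau>)"
    "\<And>\<tau> p. \<tau> \<in> T \<Longrightarrow> \<rho> \<tau> p \<ge> 0"
    "\<And>\<tau> p. \<tau> \<in> T \<Longrightarrow> \<rho> \<tau> p \<noteq> 0 \<Longrightarrow>
      p \<in> chart_dom Z (fst \<tau>) \<and> chart Z (fst \<tau>) p \<in> cbox (fst (snd \<tau>)) (snd (snd \<tau>))"
    "\<And>p. (\<Sum>\<tau>\<in>T. \<rho> \<tau> p) = 1"
    by (rule partition_of_unity[OF Z]) (rule that; assumption)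
  have \<rho>1: "\<rho> \<tau> z \<le> 1" if "\<tau> \<in> T" for \<tau> z
    using member_le_sum[OF that, of "\<lambda>\<tau>. \<rho> \<tau> z"] T(1,5,7) by simp
  have mu: "u \<in> borel_measurable borel"
    by (rule borel_measurable_continuous_onI[OF smooth_function_continuous[OF Rc u(1)]])
  have m\<rho>: "(\<lambda>p. \<rho> \<tau> (fst p)) \<in> borel_measurable (borel :: ('a \<times> real) measure)" if "\<tau> \<in> T" for \<tau>
    by (intro borel_measurable_continuous_onI continuous_on_compose2[OF smooth_function_continuous[OF R T(4)[OF that]]] continuous_on_fst continuous_on_id) auto
  let ?G = "\<lambda>\<tau> p. ennreal ((\<rho> \<tau> (fst p) * u p) powr ?p)"
  have mG: "?G \<tau> \<in> borel_measurable ?P" if "\<tau> \<in> T" for \<tau>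
    using m\<rho>[OF that] mu by (intro cyl_vol_measurable[OF Z]) measurable
  let ?N = "real (card T)"
  have N: "?N > 0" using T(1,7) by (auto simp: card_gt_0_iff intro!: Nat.gr0I)
  have p: "?p > 0" using n(1) by simp
  have "(\<integral>\<^sup>+p. ennreal (u p powr ?p) \<partial>?P) \<le> (\<integral>\<^sup>+p. ennreal (?N powr ?p) * (\<Sum>\<tau>\<in>T. ?G \<tau> p) \<partial>?P)"
  proof (rule nn_integral_mono)
    fix p :: "'a \<times> real"
    \<comment> \<open>Finitely many numbers with sum 1 are not all below their average. For such an
      index \<open>u\<close> is at most \<open>?N\<close> times its localized version, so its power
      is bounded by the sum over all indices.\<close>
    have "\<exists>\<tau>\<in>T. 1 / ?N \<le> \<rho> \<tau> (fst p)"
    proof (rule ccontr)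
      assume "\<not> ?thesis"
      then have "(\<Sum>\<tau>\<in>T. \<rho> \<tau> (fst p)) < (\<Sum>\<tau>\<in>T. 1 / ?N)" using N T(1) by (intro sum_strict_mono) auto
      then show False using T(7) N by simp
    qed
    then obtain \<tau> where \<tau>: "\<tau> \<in> T" "1 \<le> ?N * \<rho> \<tau> (fst p)" using N by (auto simp: field_simps)
    have "u p \<le> ?N * (\<rho> \<tau> (fst p) * u p)" using mult_right_mono[OF \<tau>(2) u(2)[of p]] by (simp add: mult.assoc)
    then have "u p powr ?p \<le> (?N * (\<rho> \<tau> (fst p) * u p)) powr ?p" using p u(2) by (intro powr_mono2) auto
    also have "\<dots> = ?N powr ?p * (\<rho> \<tau> (fst p) * u p) powr ?p" by (rule powr_mult)
    finally have "ennreal (u p powr ?p) \<le> ennreal (?N powr ?p) * ?G \<tau> p"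
      by (subst ennreal_mult[symmetric]) (auto intro: ennreal_leI)
    also have "\<dots> \<le> ennreal (?N powr ?p) * (\<Sum>\<tau>\<in>T. ?G \<tau> p)"
      by (intro mult_left_mono member_le_sum \<tau> T(1)) auto
    finally show "ennreal (u p powr ?p) \<le> ennreal (?N powr ?p) * (\<Sum>\<tau>\<in>T. ?G \<tau> p)" .
  qed
  also have "\<dots> = ennreal (?N powr ?p) * (\<Sum>\<tau>\<in>T. \<integral>\<^sup>+p. ?G \<tau> p \<partial>?P)"
    by (subst nn_integral_cmult, intro borel_measurable_sum mG, assumption, subst nn_integral_sum, rule mG, assumption, rule refl)
  also have "\<dots> < top"
  proof -
    have "(\<integral>\<^sup>+p. ?G \<tau> p \<partial>?P) < top" if \<tau>: "\<tau> \<in> T" for \<tau>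
      by (rule sobolev_local[OF u L cS T(2)[OF \<tau>] compact_cbox T(3,4,5)[OF \<tau>] \<rho>1[OF \<tau>] T(6)[OF \<tau>]])
    then show ?thesis using T(1) by (simp add: ennreal_mult_less_top)
  qed
  finally show ?thesis
    using cyl_vol_measurable[OF Z, of "\<lambda>p. u p powr ?p"] mu by (intro integrableI_nonneg) auto
qed

end

section \<open>Stretching along the axis\<close>

context
  fixes Z :: "('i, 'a::{t2_space,second_countable_topology}, real ^ 'm::finite) riem"
  assumes Z: "closed_riemannian_manifold Z"
begin

lemma cylinder_chart_cover:
  obtains I where "finite I" "I \<subseteq> idx (cylinder Z)" "(\<Union>i\<in>I. chart_dom (cylinder Z) i) = UNIV"
proof -
  obtain I where I: "finite I" "I \<subseteq> idx Z" "(\<Union>i\<in>I. chart_dom Z i) = UNIV" using finite_chart_cover[OF Z] by blast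
  from I(3) have "(\<Union>i\<in>I. chart_dom (cylinder Z) i) = UNIV" by (simp add: UN_Times_distrib[symmetric] Sigma_Union[symmetric] set_eq_iff)
  with I(1,2) show thesis by (intro that) auto
qed

lemma is_volume_volume_cylinder: "is_volume (cylinder Z) (volume (cylinder Z))"
  unfolding volume_cylinder[OF Z] by (rule is_volume_cylinder[OF Z])

lemma measurable_axial_scaling: "(\<lambda>p. (fst p, s * snd p)) \<in> (cyl_vol Z) \<rightarrow>\<^sub>M (cyl_vol Z)"
  by (intro measurable_Pair measurable_fst measurable_compose[OF measurable_snd, of "\<lambda>t. s * t" lborel lborel]) simp

lemma continuous_form_norm_sq_cylinder:
  assumes "smooth_function (cylinder Z) u"
  shows "continuous_on UNIV (form_norm_sq (cylinder Z) (differential (cylinder Z) u))"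
proof -
  note R = closed_riemannian[OF Z]
  obtain I where I: "finite I" "I \<subseteq> idx (cylinder Z)" "(\<Union>i\<in>I. chart_dom (cylinder Z) i) = UNIV"
    by (rule cylinder_chart_cover)
  show ?thesis
    by (rule continuous_form_norm_sq[OF riemannian_manifold_cylinder[OF R] I is_volume_volume_cylinder continuous_on_cometric_cylinder[OF R] assms])
qed

lemma sobolev12_cylinder_iff:
  assumes u: "smooth_function (cylinder Z) u"
  shows "u \<in> sobolev12 (cylinder Z) \<longleftrightarrow>
    integrable (cyl_vol Z) (\<lambda>p. (u p)\<^sup>2) \<and> integrable (cyl_vol Z) (form_norm_sq (cylinder Z) (differential (cylinder Z) u))"
proof -
  note R = closed_riemannian[OF Z]
  obtain I where I: "finite I" "I \<subseteq> idx (cylinder Z)" "(\<Union>i\<in>I. chart_dom (cylinder Z) i) = UNIV"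
    by (rule cylinder_chart_cover)
  have "u \<in> borel_measurable borel"
    by (rule borel_measurable_continuous_onI[OF smooth_function_continuous[OF riemannian_manifold_cylinder[OF R] u]])
  from sobolev12_smooth_iff[OF riemannian_manifold_cylinder[OF R] I is_volume_volume_cylinder continuous_on_cometric_cylinder[OF R] u this]
  show ?thesis by (simp only: volume_cylinder[OF Z])
qed

lemma yamabe_quotient_cylinder:
  assumes n: "n \<ge> 3" "CARD('m) = n - 1" and u: "smooth_function (cylinder Z) u"
  shows "yamabe_quotient (cylinder Z) u =
    (LINT p|cyl_vol Z. alpha n * form_norm_sq (cylinder Z) (differential (cylinder Z) u) p + scalar_curvature Z (fst p) * (u p)\<^sup>2)
    / (LINT p|cyl_vol Z. \<bar>u p\<bar> powr (2 * real n / (real n - 2))) powr ((real n - 2) / real n)"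
proof -
  note R = closed_riemannian[OF Z]
  obtain I where I: "finite I" "I \<subseteq> idx (cylinder Z)" "(\<Union>i\<in>I. chart_dom (cylinder Z) i) = UNIV"
    by (rule cylinder_chart_cover)
  have mu: "u \<in> borel_measurable borel"
    by (rule borel_measurable_continuous_onI[OF smooth_function_continuous[OF riemannian_manifold_cylinder[OF R] u]])
  have sc: "scalar_curvature (cylinder Z) = (\<lambda>p. scalar_curvature Z (fst p))" using scalar_curvature_cylinder[OF R] by auto
  have "continuous_on UNIV (\<lambda>p :: 'a \<times> real. scalar_curvature Z (fst p))"
    by (intro continuous_on_compose2[OF continuous_scalar_curvature[OF R]] continuous_on_fst continuous_on_id) auto
  then have mS: "scalar_curvature (cylinder Z) \<in> borel_measurable borel" unfolding sc by (rule borel_measurable_continuous_onI)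
  have "DIM((real ^ 'm) \<times> real) = n" using n by simp
  with yamabe_quotient_smooth[OF riemannian_manifold_cylinder[OF R] I is_volume_volume_cylinder continuous_on_cometric_cylinder[OF R] u mu mS]
  show ?thesis by (simp only: volume_cylinder[OF Z] sc)
qed

lemma nn_integral_axial_scaling:
  assumes h: "h \<in> borel_measurable borel" and s: "s > 0"
  shows "(\<integral>\<^sup>+p. h (fst p, s * snd p) \<partial>cyl_vol Z) = ennreal (1 / s) * (\<integral>\<^sup>+p. h p \<partial>cyl_vol Z)"
proof -
  interpret finite_measure "volume Z" by (rule finite_measure_volume[OF Z])
  interpret pair_sigma_finite "volume Z" "lborel :: real measure" ..
  have hP [measurable]: "h \<in> borel_measurable (cyl_vol Z)" using h by (rule cyl_vol_measurable[OF Z])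
  have hs [measurable]: "(\<lambda>p. h (fst p, s * snd p)) \<in> borel_measurable (cyl_vol Z)"
    by (rule measurable_compose[OF measurable_axial_scaling hP])
  have "(\<integral>\<^sup>+t. h (z, t) \<partial>lborel) = ennreal s * (\<integral>\<^sup>+t. h (z, s * t) \<partial>lborel)" for z
    using nn_integral_real_affine[of "\<lambda>t. h (z, t)" s 0] s measurable_Pair2[OF hP, of z] space_volume[OF Z] by simp
  then have "(\<integral>\<^sup>+p. h p \<partial>cyl_vol Z) = ennreal s * (\<integral>\<^sup>+p. h (fst p, s * snd p) \<partial>cyl_vol Z)"
    by (simp add: lborel.nn_integral_fst[symmetric] nn_integral_cmult)
  then show ?thesis using s by (simp add: mult.assoc[symmetric] ennreal_mult[symmetric])
qed

text \<open>The stretching pushes the product measure forward to \<open>1 / s\<close> times itself;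
  integrals and integrability follow at once.\<close>

lemma integral_axial_scaling:
  fixes h :: "'a \<times> real \<Rightarrow> real"
  assumes h: "h \<in> borel_measurable borel" and s: "s > 0"
  shows "(LINT p|cyl_vol Z. h (fst p, s * snd p)) = (LINT p|cyl_vol Z. h p) / s"
    and "integrable (cyl_vol Z) h \<Longrightarrow> integrable (cyl_vol Z) (\<lambda>p. h (fst p, s * snd p))"
proof -
  let ?T = "\<lambda>p. (fst p, s * snd p)"
  have hP [measurable]: "h \<in> borel_measurable (cyl_vol Z)" using h by (rule cyl_vol_measurable[OF Z])
  have T [measurable]: "?T \<in> (cyl_vol Z) \<rightarrow>\<^sub>M (cyl_vol Z)" by (rule measurable_axial_scaling)
  have d: "distr (cyl_vol Z) (cyl_vol Z) ?T = density (cyl_vol Z) (\<lambda>_. ennreal (1 / s))"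
  proof (rule measure_eqI)
    fix A assume "A \<in> sets (distr (cyl_vol Z) (cyl_vol Z) ?T)"
    then have A: "A \<in> sets (cyl_vol Z)" by simp
    have "emeasure (distr (cyl_vol Z) (cyl_vol Z) ?T) A = (\<integral>\<^sup>+p. indicator A p \<partial>distr (cyl_vol Z) (cyl_vol Z) ?T)" using A by simp
    also have "\<dots> = (\<integral>\<^sup>+p. indicator A (?T p) \<partial>cyl_vol Z)" by (rule nn_integral_distr[OF T]) (use borel_measurable_indicator[OF A] in \<open>simp only: measurable_distr_eq1\<close>)
    also have "\<dots> = ennreal (1 / s) * (\<integral>\<^sup>+p. indicator A p \<partial>cyl_vol Z)"
      by (rule nn_integral_axial_scaling[OF _ s]) (use A sets_cyl_vol[OF Z] in simp)
    also have "\<dots> = emeasure (density (cyl_vol Z) (\<lambda>_. ennreal (1 / s))) A" using A by (simp add: emeasure_density_const)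
    finally show "emeasure (distr (cyl_vol Z) (cyl_vol Z) ?T) A = emeasure (density (cyl_vol Z) (\<lambda>_. ennreal (1 / s))) A" .
  qed simp
  have "(LINT p|cyl_vol Z. h (?T p)) = (LINT p|distr (cyl_vol Z) (cyl_vol Z) ?T. h p)" by (rule integral_distr[OF T hP, symmetric])
  also have "\<dots> = (LINT p|cyl_vol Z. h p) / s" unfolding d using s by (subst integral_density) auto
  finally show "(LINT p|cyl_vol Z. h (?T p)) = (LINT p|cyl_vol Z. h p) / s" .
  assume "integrable (cyl_vol Z) h"
  then have "integrable (distr (cyl_vol Z) (cyl_vol Z) ?T) h" unfolding d using s by (subst integrable_density) auto
  then show "integrable (cyl_vol Z) (\<lambda>p. h (?T p))" by (simp add: integrable_distr_eq[OF T hP])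
qed

lemma continuous_cylinder_eq_0:
  fixes F :: "'a \<times> real \<Rightarrow> real"
  assumes "continuous_on UNIV F" "AE p in (cyl_vol Z). F p = 0" shows "F p = 0"
  by (rule continuous_AE_eq_0[OF riemannian_manifold_cylinder[OF closed_riemannian[OF Z]] is_volume_cylinder[OF Z]
        gram_det_cylinder_pos[OF Z] assms])

text \<open>By Tonelli the integral is that of the constant infinity over the slice, whose volume is
  positive.\<close>

lemma not_integrable_axially_constant:
  fixes g :: "'a \<Rightarrow> real"
  assumes "continuous_on UNIV g" "\<And>z. g z > 0"
  shows "\<not> integrable (cyl_vol Z) (\<lambda>p. g (fst p))"
proof
  assume int: "integrable (cyl_vol Z) (\<lambda>p. g (fst p))"
  have mg: "g \<in> borel_measurable (volume Z)"
    using borel_measurable_continuous_onI[OF assms(1)] by (simp only: measurable_cong_sets[OF sets_volume[OF Z] refl])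
  have "(\<lambda>p. ennreal (g (fst p))) \<in> borel_measurable (cyl_vol Z)" using int by measurable
  note tonelli = lborel.nn_integral_fst[OF this]
  have gz: "ennreal (g z) \<noteq> 0" for z using assms(2)[of z] by simp
  from tonelli
  have "(\<integral>\<^sup>+p. ennreal (g (fst p)) \<partial>cyl_vol Z) = (\<integral>\<^sup>+z. (\<integral>\<^sup>+t. ennreal (g z) \<partial>(lborel :: real measure)) \<partial>volume Z)" by simp
  also have "\<dots> = (\<integral>\<^sup>+z. top \<partial>volume Z)"
    by (intro nn_integral_cong) (simp add: emeasure_lborel_UNIV ennreal_mult_top gz)
  also have "\<dots> = top"
  proof -
    have "emeasure (volume Z) UNIV \<noteq> 0"
      by (rule emeasure_volume_open_pos[OF closed_riemannian[OF Z] is_volume_volume[OF Z] gram_det_pos[OF Z] open_UNIV UNIV_I])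
    then show ?thesis by (simp add: space_volume[OF Z] ennreal_top_mult)
  qed
  finally show False using int assms(2) by (simp add: integrable_iff_bounded less_imp_le)
qed

end

text \<open>The number A of the overview. The curvature term belongs to it because the curvature of
  the cylinder is that of the slice and so does not change under stretching.\<close>

definition horizontal_energy ::
  "nat \<Rightarrow> ('i, 'a::topological_space, 'e::euclidean_space) riem \<Rightarrow> ('a \<times> real \<Rightarrow> real) \<Rightarrow> real" where
  "horizontal_energy n Z u = (LINT p|cyl_vol Z.
    alpha n * form_norm_sq Z (differential Z (slice u (snd p))) (fst p) + scalar_curvature Z (fst p) * (u p)\<^sup>2)"

definition axial_energy ::
  "nat \<Rightarrow> ('i, 'a::topological_space, 'e::euclidean_space) riem \<Rightarrow> ('a \<times> real \<Rightarrow> real) \<Rightarrow> real" where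
  "axial_energy n Z u = alpha n * (LINT p|cyl_vol Z. (axial_deriv u p)\<^sup>2)"

definition critical_mass ::
  "nat \<Rightarrow> ('i, 'a::topological_space, 'e::euclidean_space) riem \<Rightarrow> ('a \<times> real \<Rightarrow> real) \<Rightarrow> real" where
  "critical_mass n Z u = (LINT p|cyl_vol Z. \<bar>u p\<bar> powr (2 * real n / (real n - 2)))"

context
  fixes Z :: "('i, 'a::{t2_space,second_countable_topology}, real ^ 'm::finite) riem" and n :: nat
  assumes Z: "closed_riemannian_manifold Z" and n: "n \<ge> 3" "CARD('m) = n - 1"
begin

lemma integrable_energies:
  assumes u: "smooth_function (cylinder Z) u" and L: "u \<in> sobolev12 (cylinder Z)"
  shows "integrable (cyl_vol Z) (\<lambda>p. (axial_deriv u p)\<^sup>2)"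
    and "integrable (cyl_vol Z) (\<lambda>p. alpha n * form_norm_sq Z (differential Z (slice u (snd p))) (fst p) + scalar_curvature Z (fst p) * (u p)\<^sup>2)"
    and "(\<lambda>p. form_norm_sq Z (differential Z (slice u (snd p))) (fst p)) \<in> borel_measurable borel"
proof -
  note R = closed_riemannian[OF Z]
  let ?E = "form_norm_sq (cylinder Z) (differential (cylinder Z) u)"
  let ?S = "\<lambda>p. form_norm_sq Z (differential Z (slice u (snd p))) (fst p)"
  have L': "integrable (cyl_vol Z) (\<lambda>p. (u p)\<^sup>2)" "integrable (cyl_vol Z) ?E" using L unfolding sobolev12_cylinder_iff[OF Z u] by blast+
  have E: "?E p = ?S p + (axial_deriv u p)\<^sup>2" for p
    using form_norm_sq_cylinder[OF R u, of "fst p" "snd p"] by simp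
  have mT: "axial_deriv u \<in> borel_measurable borel"
    by (rule borel_measurable_continuous_onI[OF continuous_axial_deriv[OF R u]])
  have mE: "?E \<in> borel_measurable borel"
    by (rule borel_measurable_continuous_onI[OF continuous_form_norm_sq_cylinder[OF Z u]])
  \<comment> \<open>Slice and chart vary with \<open>p\<close>, so measurability of this part is
    obtained by subtracting the axial part from the total energy density, both of which are
    continuous.\<close>
  have Se: "?S = (\<lambda>p. ?E p - (axial_deriv u p)\<^sup>2)" using E by auto
  show mS: "?S \<in> borel_measurable borel" unfolding Se using mT mE by measurable
  have Sp: "?S p \<ge> 0" for p by (rule form_norm_sq_nonneg[OF R one_form_differential[OF R smooth_slice[OF R u]]])
  show 1: "integrable (cyl_vol Z) (\<lambda>p. (axial_deriv u p)\<^sup>2)"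
  proof (rule Bochner_Integration.integrable_bound[OF L'(2)])
    show "(\<lambda>p. (axial_deriv u p)\<^sup>2) \<in> borel_measurable (cyl_vol Z)" using mT by (intro cyl_vol_measurable[OF Z]) measurable
    show "AE p in (cyl_vol Z). norm ((axial_deriv u p)\<^sup>2) \<le> norm (?E p)"
    proof (rule AE_I2)
      show "norm ((axial_deriv u p)\<^sup>2) \<le> norm (?E p)" for p using Sp[of p] unfolding E by simp
    qed
  qed
  have 2: "integrable (cyl_vol Z) ?S" unfolding Se by (rule Bochner_Integration.integrable_diff[OF L'(2) 1])
  obtain C where C: "\<And>z. \<bar>scalar_curvature Z z\<bar> \<le> C"
    by (rule continuous_on_compact_bounded[OF continuous_scalar_curvature[OF R] compact_UNIV[OF Z]]) (rule that, simp)
  have "integrable (cyl_vol Z) (\<lambda>p. scalar_curvature Z (fst p) * (u p)\<^sup>2)"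
  proof (rule Bochner_Integration.integrable_bound[OF integrable_mult_right[OF L'(1), of C]])
    have "continuous_on UNIV (\<lambda>p :: 'a \<times> real. scalar_curvature Z (fst p) * (u p)\<^sup>2)"
      by (intro continuous_on_mult continuous_on_power smooth_function_continuous[OF riemannian_manifold_cylinder[OF R] u]
          continuous_on_compose2[OF continuous_scalar_curvature[OF R]] continuous_on_fst continuous_on_id) auto
    then show "(\<lambda>p. scalar_curvature Z (fst p) * (u p)\<^sup>2) \<in> borel_measurable (cyl_vol Z)"
      by (intro cyl_vol_measurable[OF Z] borel_measurable_continuous_onI)
    show "AE p in (cyl_vol Z). norm (scalar_curvature Z (fst p) * (u p)\<^sup>2) \<le> norm (C * (u p)\<^sup>2)"
    proof (rule AE_I2)
      show "norm (scalar_curvature Z (fst p) * (u p)\<^sup>2) \<le> norm (C * (u p)\<^sup>2)" for p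
        using C[of "fst p"] by (auto simp: abs_mult intro!: mult_right_mono)
    qed
  qed
  with 2 show "integrable (cyl_vol Z) (\<lambda>p. alpha n * ?S p + scalar_curvature Z (fst p) * (u p)\<^sup>2)"
    by (intro Bochner_Integration.integrable_add integrable_mult_right)
qed

text \<open>Substitution in the axial variable divides every integral by \<open>s\<close>; only the
  axial derivative brings a further factor, which is squared in the energy.\<close>

lemma yamabe_quotient_axial_scaling:
  assumes u: "smooth_function (cylinder Z) u" and L: "u \<in> sobolev12 (cylinder Z)" and s: "s > 0"
  shows "(\<lambda>p. u (fst p, s * snd p)) \<in> sobolev12 (cylinder Z)"
    and "yamabe_quotient (cylinder Z) (\<lambda>p. u (fst p, s * snd p))
      = ((horizontal_energy n Z u + s\<^sup>2 * axial_energy n Z u) / s) / (critical_mass n Z u / s) powr ((real n - 2) / real n)"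
proof -
  note R = closed_riemannian[OF Z]
  let ?v = "\<lambda>p. u (fst p, s * snd p)"
  let ?S = "\<lambda>p. form_norm_sq Z (differential Z (slice u (snd p))) (fst p)"
  have v: "smooth_function (cylinder Z) ?v" by (rule smooth_axial_scaling[OF R u])
  note int = integrable_energies[OF u L]
  have L': "integrable (cyl_vol Z) (\<lambda>p. (u p)\<^sup>2)" using L unfolding sobolev12_cylinder_iff[OF Z u] by blast
  have mu: "u \<in> borel_measurable borel"
    by (rule borel_measurable_continuous_onI[OF smooth_function_continuous[OF riemannian_manifold_cylinder[OF R] u]])
  have mT: "axial_deriv u \<in> borel_measurable borel"
    by (rule borel_measurable_continuous_onI[OF continuous_axial_deriv[OF R u]])
  have mR: "(\<lambda>p :: 'a \<times> real. scalar_curvature Z (fst p)) \<in> borel_measurable borel"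
    by (intro borel_measurable_continuous_onI continuous_on_compose2[OF continuous_scalar_curvature[OF R]] continuous_on_fst continuous_on_id) auto
  define E where "E p = ?S p + s\<^sup>2 * (axial_deriv u p)\<^sup>2" for p
  have E: "form_norm_sq (cylinder Z) (differential (cylinder Z) ?v) p = E (fst p, s * snd p)" for p
    using form_norm_sq_cylinder[OF R v, of "fst p" "snd p", unfolded slice_axial_scaling[OF R u] axial_deriv_axial_scaling[OF R u]]
    by (simp add: E_def power_mult_distrib)
  then have E': "form_norm_sq (cylinder Z) (differential (cylinder Z) ?v) = (\<lambda>p. E (fst p, s * snd p))" by (rule ext)
  have mE: "E \<in> borel_measurable borel" unfolding E_def using int(3) mT by measurable
  have "integrable (cyl_vol Z) (form_norm_sq (cylinder Z) (differential (cylinder Z) u))"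
    using L unfolding sobolev12_cylinder_iff[OF Z u] by blast
  \<comment> \<open>\<open>E\<close> is the total energy density of \<open>u\<close> with its axial
    part reweighted, so it is integrable along with both.\<close>
  then have "integrable (cyl_vol Z) (\<lambda>p. form_norm_sq (cylinder Z) (differential (cylinder Z) u) p + (s\<^sup>2 - 1) * (axial_deriv u p)\<^sup>2)"
    using int(1) by (intro Bochner_Integration.integrable_add integrable_mult_right)
  moreover have "form_norm_sq (cylinder Z) (differential (cylinder Z) u) p + (s\<^sup>2 - 1) * (axial_deriv u p)\<^sup>2 = E p" for p
    using form_norm_sq_cylinder[OF R u, of "fst p" "snd p"] by (simp add: E_def algebra_simps)
  ultimately have "integrable (cyl_vol Z) E" by simp
  from integral_axial_scaling(2)[OF Z mE s this]
  have "integrable (cyl_vol Z) (form_norm_sq (cylinder Z) (differential (cylinder Z) ?v))" unfolding E' .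
  moreover have "integrable (cyl_vol Z) (\<lambda>p. (?v p)\<^sup>2)"
    by (rule integral_axial_scaling(2)[OF Z _ s L']) (use mu in measurable)
  ultimately show "?v \<in> sobolev12 (cylinder Z)" unfolding sobolev12_cylinder_iff[OF Z v] by blast
  let ?h = "\<lambda>p. alpha n * E p + scalar_curvature Z (fst p) * (u p)\<^sup>2"
  have mh: "?h \<in> borel_measurable borel" using mE mR mu by measurable
  have "(LINT p|cyl_vol Z. alpha n * form_norm_sq (cylinder Z) (differential (cylinder Z) ?v) p + scalar_curvature Z (fst p) * (?v p)\<^sup>2)
    = (LINT p|cyl_vol Z. ?h p) / s"
    using integral_axial_scaling(1)[OF Z mh s] by (simp add: E)
  also have "(LINT p|cyl_vol Z. ?h p) = (LINT p|cyl_vol Z. (alpha n * ?S p + scalar_curvature Z (fst p) * (u p)\<^sup>2)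
      + s\<^sup>2 * alpha n * (axial_deriv u p)\<^sup>2)"
    by (intro Bochner_Integration.integral_cong) (auto simp: E_def algebra_simps)
  also have "\<dots> = horizontal_energy n Z u + s\<^sup>2 * axial_energy n Z u"
    unfolding horizontal_energy_def axial_energy_def
    by (subst Bochner_Integration.integral_add[OF int(2) integrable_mult_right[OF int(1)]]) simp
  finally have N: "(LINT p|cyl_vol Z. alpha n * form_norm_sq (cylinder Z) (differential (cylinder Z) ?v) p + scalar_curvature Z (fst p) * (?v p)\<^sup>2)
    = (horizontal_energy n Z u + s\<^sup>2 * axial_energy n Z u) / s" .
  have "(\<lambda>p. \<bar>u p\<bar> powr (2 * real n / (real n - 2))) \<in> borel_measurable borel" using mu by measurable
  from integral_axial_scaling(1)[OF Z this s]
  have "(LINT p|cyl_vol Z. \<bar>?v p\<bar> powr (2 * real n / (real n - 2))) = critical_mass n Z u / s" by (simp add: critical_mass_def)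
  with N show "yamabe_quotient (cylinder Z) ?v
      = ((horizontal_energy n Z u + s\<^sup>2 * axial_energy n Z u) / s) / (critical_mass n Z u / s) powr ((real n - 2) / real n)"
    unfolding yamabe_quotient_cylinder[OF Z n v] by (simp only:)
qed

text \<open>The slice being compact, vanishing outside an interval of the axis already means compact
  support.\<close>

lemma integrable_axial_compact_support:
  fixes F :: "'a \<times> real \<Rightarrow> real"
  assumes F: "continuous_on UNIV F" "\<And>z t. t \<notin> {a..b} \<Longrightarrow> F (z, t) = 0"
  shows "integrable (cyl_vol Z) F"
proof -
  interpret finite_measure "volume Z" by (rule finite_measure_volume[OF Z])
  let ?A = "(UNIV :: 'a set) \<times> {a..b}"
  have K: "compact ?A" by (intro compact_Times compact_UNIV[OF Z]) simp
  obtain C where C: "\<And>p. p \<in> ?A \<Longrightarrow> \<bar>F p\<bar> \<le> C"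
    by (rule continuous_on_compact_bounded[OF continuous_on_subset[OF F(1) subset_UNIV] K]) (rule that)
  have U: "(UNIV :: 'a set) \<in> sets (volume Z)" by (simp add: sets_volume[OF Z])
  show ?thesis
  proof (rule integrableI_bounded_set[where A="?A" and B=C])
    show "?A \<in> sets (cyl_vol Z)" using U by (intro pair_measureI) auto
    show "F \<in> borel_measurable (cyl_vol Z)" by (intro cyl_vol_measurable[OF Z] borel_measurable_continuous_onI F(1))
    have "emeasure (cyl_vol Z) ?A = emeasure (volume Z) UNIV * emeasure lborel {a..b}"
      using U by (intro lborel.emeasure_pair_measure_Times) auto
    also have "\<dots> < top"
    proof -
      have "emeasure (volume Z) UNIV < top" using emeasure_finite[of UNIV] unfolding infinity_ennreal_def less_top .
      moreover have "emeasure lborel {a..b} < top" by (simp add: emeasure_lborel_Icc_eq)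
      ultimately show ?thesis unfolding ennreal_mult_less_top by blast
    qed
    finally show "emeasure (cyl_vol Z) ?A < \<infinity>" by simp
    show "AE p in (cyl_vol Z). p \<in> ?A \<longrightarrow> norm (F p) \<le> C" using C by (intro AE_I2) auto
    have "p \<notin> ?A \<longrightarrow> F p = 0" for p using F(2)[of "snd p" "fst p"] by (auto simp: mem_Times_iff)
    then show "AE p in (cyl_vol Z). p \<notin> ?A \<longrightarrow> F p = 0" by (intro AE_I2)
  qed
qed

text \<open>The function is \<open>f z * \<phi> t\<close> with a cutoff \<open>\<phi>\<close>.\<close>

lemma test_function_cylinder:
  assumes f: "smooth_function Z f" "f z0 \<noteq> 0" "\<And>z. conf_laplacian n Z f z = 0"
  obtains w where "smooth_function (cylinder Z) w" "w \<in> sobolev12 (cylinder Z)" "\<exists>p. w p \<noteq> 0" "horizontal_energy n Z w = 0"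
proof -
  note R = closed_riemannian[OF Z]
  define \<phi> where "\<phi> = box_bump 1 (- 1) (1 :: real)"
  have sm: "smooth_on UNIV \<phi>" unfolding \<phi>_def by (rule smooth_on_box_bump) simp
  have \<phi>0: "\<phi> t = 0" if "t \<notin> {-1..1}" for t
    unfolding \<phi>_def by (rule box_bump_eq_0) (use that in \<open>auto simp: box_real\<close>)
  define w where "w p = f (fst p) * \<phi> (snd p)" for p
  have w: "smooth_function (cylinder Z) w" unfolding w_def by (rule smooth_function_prod_cylinder[OF R f(1) sm])
  have cw: "continuous_on UNIV w" by (rule smooth_function_continuous[OF riemannian_manifold_cylinder[OF R] w])
  have S: "form_norm_sq Z (differential Z (slice w t)) z = form_norm_sq Z (differential Z f) z * (\<phi> t)\<^sup>2" for z t
  proof -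
    have "slice w t = (\<lambda>z. f z * \<phi> t)" by (auto simp: slice_def w_def)
    then show ?thesis using form_norm_sq_scale[OF R f(1)] by simp
  qed
  have T: "axial_deriv w (z, t) = 0" if t: "t \<notin> {-1..1}" for z t
  proof (rule DERIV_unique[OF has_axial_deriv[OF R w]])
    have "open (- {-1..1 :: real})" by (simp add: open_Compl)
    from has_field_derivative_transform_within_open[OF DERIV_const this, of t 0 "\<lambda>s. w (z, s)"] t
    show "((\<lambda>s. w (z, s)) has_real_derivative 0) (at t)" using \<phi>0 by (auto simp: w_def)
  qed
  have "integrable (cyl_vol Z) (\<lambda>p. (w p)\<^sup>2)"
    by (rule integrable_axial_compact_support[of _ "-1" 1]) (use cw \<phi>0 in \<open>auto intro!: continuous_on_power simp: w_def\<close>)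
  moreover have "integrable (cyl_vol Z) (form_norm_sq (cylinder Z) (differential (cylinder Z) w))"
  proof (rule integrable_axial_compact_support[of _ "-1" 1, OF continuous_form_norm_sq_cylinder[OF Z w]])
    show "form_norm_sq (cylinder Z) (differential (cylinder Z) w) (z, t) = 0" if "t \<notin> {-1..1}" for z t
      unfolding form_norm_sq_cylinder[OF R w] S T[OF that] \<phi>0[OF that] by simp
  qed
  ultimately have L: "w \<in> sobolev12 (cylinder Z)" unfolding sobolev12_cylinder_iff[OF Z w] by blast
  have "\<phi> 0 > 0" unfolding \<phi>_def by (subst box_bump_pos_iff) (auto simp: box_real)
  then have "w (z0, 0) \<noteq> 0" using f(2) by (simp add: w_def)
  then have ne: "\<exists>p. w p \<noteq> 0" by blast
  let ?e = "\<lambda>z. alpha n * form_norm_sq Z (differential Z f) z + scalar_curvature Z z * (f z)\<^sup>2"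
  \<comment> \<open>The energy density is a product. Integrated over the slice first it gives 0 for
    every axial coordinate, by \<open>energy_identity\<close>.\<close>
  have e: "alpha n * form_norm_sq Z (differential Z (slice w (snd p))) (fst p) + scalar_curvature Z (fst p) * (w p)\<^sup>2
      = (\<phi> (snd p))\<^sup>2 * ?e (fst p)" for p
    unfolding S by (simp add: w_def power_mult_distrib algebra_simps)
  have "alpha n \<noteq> 0" using n by (simp add: alpha_def)
  note en = energy_identity[OF Z f(1) f(3) this]
  interpret finite_measure "volume Z" by (rule finite_measure_volume[OF Z])
  interpret pair_sigma_finite "volume Z" "lborel :: real measure" ..
  have "integrable (cyl_vol Z) (\<lambda>(z, t). (\<phi> t)\<^sup>2 * ?e z)"
    using integrable_energies(2)[OF w L] by (simp add: e split_def)
  from integral_snd[OF this]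
  have "(LINT p|cyl_vol Z. (case p of (z, t) \<Rightarrow> (\<phi> t)\<^sup>2 * ?e z)) = 0" using en by simp
  then have "horizontal_energy n Z w = 0" unfolding horizontal_energy_def by (simp add: e split_def)
  with w L ne show thesis by (rule that)
qed

end

section \<open>Nonexistence of a minimizer\<close>

lemma le_0_if_le_small_multiples:
  fixes q c :: real
  assumes "c \<ge> 0" "\<And>s. 0 < s \<Longrightarrow> s \<le> 1 \<Longrightarrow> q \<le> s * c"
  shows "q \<le> 0"
proof (rule field_le_epsilon)
  fix e :: real assume e: "e > 0"
  \<comment> \<open>The minimum keeps \<open>s\<close> in the admissible range, and the added 1
    keeps the denominator positive when \<open>c = 0\<close>.\<close>
  define s where "s = min 1 (e / (c + 1))"
  have s: "0 < s" "s \<le> 1" "s \<le> e / (c + 1)" using e assms(1) by (auto simp: s_def)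
  have "s * c \<le> s * (c + 1)" using s by simp
  also have "\<dots> \<le> e" using s(3) assms(1) by (simp add: le_divide_eq)
  finally show "q \<le> 0 + e" using assms(2)[OF s(1,2)] by simp
qed

theorem proposition5p1:
  fixes Z :: "('i, 'a::{t2_space,second_countable_topology}, real ^ 'm::finite) riem"
    and n :: nat
  assumes "n \<ge> 3"
    and "CARD('m) = n - 1"
    and "closed_riemannian_manifold Z"
    and "connected (UNIV :: 'a set)"
    and "is_first_eigenvalue n Z 0"
  shows "\<not> (\<exists>u. yamabe_minimizer (cylinder Z) u)"
proof
  note n = assms(1,2) and Z = assms(3)
  note R = closed_riemannian[OF Z]
  let ?P = "volume Z \<Otimes>\<^sub>M (lborel :: real measure)" and ?C = "cylinder Z"
  define \<kappa> where "\<kappa> = (real n - 2) / real n"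
  have \<kappa>: "0 < \<kappa>" "\<kappa> < 1" using n(1) by (auto simp: \<kappa>_def)
  have \<alpha>: "alpha n > 0" using n(1) by (simp add: alpha_def)
  note scaling = yamabe_quotient_axial_scaling[OF Z n, folded \<kappa>_def]
  assume "\<exists>u. yamabe_minimizer ?C u"
  then obtain u where u: "smooth_function ?C u" "\<And>p. u p > 0" "u \<in> sobolev12 ?C"
    and min: "ereal (yamabe_quotient ?C u) = yamabe_cyl ?C"
    unfolding yamabe_minimizer_def by blast
  have cont: "continuous_on UNIV w" if "smooth_function ?C w" for w
    by (rule smooth_function_continuous[OF riemannian_manifold_cylinder[OF R] that])
  have le: "yamabe_quotient ?C u \<le> yamabe_quotient ?C w"
    if w: "smooth_function ?C w" "w \<in> sobolev12 ?C" "\<exists>p. w p \<noteq> 0" for w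
  proof -
    have "\<not> (AE p in ?P. w p = 0)" using continuous_cylinder_eq_0[OF Z cont[OF w(1)]] w(3) by blast
    then have "yamabe_cyl ?C \<le> ereal (yamabe_quotient ?C w)"
      unfolding yamabe_cyl_def volume_cylinder[OF Z] using w(2) by (intro INF_lower) auto
    then show ?thesis unfolding min[symmetric] by simp
  qed
  let ?A = "horizontal_energy n Z u" and ?B = "axial_energy n Z u" and ?D = "critical_mass n Z u"
  have Q: "yamabe_quotient ?C u = (?A + ?B) / ?D powr \<kappa>"
    using scaling(2)[OF u(1,3), of 1] by simp
  have D: "?D > 0"
  proof -
    let ?p = "2 * real n / (real n - 2)"
    have int: "integrable ?P (\<lambda>p. u p powr ?p)"
      using u(3) unfolding sobolev12_cylinder_iff[OF Z u(1)]
      by (intro sobolev_cylinder[OF Z n u(1)] continuous_form_norm_sq_cylinder[OF Z u(1)] less_imp_le[OF u(2)]) auto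
    have De: "?D = (LINT p|?P. u p powr ?p)"
      unfolding critical_mass_def using u(2) by (simp add: abs_of_pos)
    have "?D \<noteq> 0"
    proof
      assume "?D = 0"
      then have "AE p in ?P. u p powr ?p = 0"
        using integral_nonneg_eq_0_iff_AE[OF int] De by simp
      then have "AE p in ?P. u p = 0" by eventually_elim simp
      from continuous_cylinder_eq_0[OF Z cont[OF u(1)] this] u(2) show False by (metis less_irrefl)
    qed
    moreover have "?D \<ge> 0" unfolding De by simp
    ultimately show ?thesis by simp
  qed
  have "yamabe_quotient ?C u \<le> 0"
  proof -
    obtain f where f: "smooth_function Z f" "\<exists>z. f z \<noteq> 0" "\<And>z. conf_laplacian n Z f z = 0"
      using assms(5) unfolding is_first_eigenvalue_def is_eigenvalue_def by auto
    then obtain z0 where z0: "f z0 \<noteq> 0" by blast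
    obtain w where w: "smooth_function ?C w" "w \<in> sobolev12 ?C" "\<exists>p. w p \<noteq> 0" "horizontal_energy n Z w = 0"
      by (rule test_function_cylinder[OF Z n f(1) z0 f(3)])
    let ?b = "axial_energy n Z w" and ?d = "critical_mass n Z w"
    have b: "?b \<ge> 0" unfolding axial_energy_def using \<alpha> by simp
    have d: "?d \<ge> 0" unfolding critical_mass_def by simp
    show ?thesis
    proof (rule le_0_if_le_small_multiples[of "?b / ?d powr \<kappa>"])
      fix s :: real assume s: "0 < s" "s \<le> 1"
      let ?v = "\<lambda>p. w (fst p, s * snd p)"
      obtain z t where "w (z, t) \<noteq> 0" using w(3) by auto
      then have "?v (z, t / s) \<noteq> 0" using s by simp
      then have "\<exists>p. ?v p \<noteq> 0" by blast
      from le[OF smooth_axial_scaling[OF R w(1)] scaling(1)[OF w(1,2) s(1)] this]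
      have "yamabe_quotient ?C u \<le> s * ?b / (?d / s) powr \<kappa>"
        unfolding scaling(2)[OF w(1,2) s(1)] using s by (simp add: w(4) power2_eq_square)
      also have "\<dots> \<le> s * (?b / ?d powr \<kappa>)"
      \<comment> \<open>For \<open>?d = 0\<close> both sides are 0, since
        \<open>0 powr \<kappa>\<close> and division by 0 are 0.\<close>
      proof (cases "?d = 0")
        case False
        then have "?d > 0" using d by simp
        \<comment> \<open>As \<open>s\<close> is at most 1, replacing \<open>?d / s\<close> by
          \<open>?d\<close> can only enlarge the quotient and leaves a bound linear in
          \<open>s\<close>.\<close>
        moreover from this have "?d \<le> ?d / s" using s by (simp add: le_divide_eq)
        ultimately have "?d powr \<kappa> \<le> (?d / s) powr \<kappa>" "?d powr \<kappa> > 0" using \<kappa>(1) by (auto intro: powr_mono2)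
        then show ?thesis using s b by (auto intro!: divide_left_mono)
      qed simp
      finally show "yamabe_quotient ?C u \<le> s * (?b / ?d powr \<kappa>)" .
    qed (use b in simp)
  qed
  then have AB: "?A + ?B \<le> 0" unfolding Q using D by (simp add: divide_le_0_iff)
  have B: "?B \<le> 0"
  proof -
    have ne: "\<exists>p. u (fst p, 1 / 2 * snd p) \<noteq> 0" using u(2) by (metis less_irrefl)
    \<comment> \<open>The factor by which the stretching for \<open>s = 1/2\<close> enlarges the
      denominator; it is less than 2 because \<kappa> is less than 1.\<close>
    define q where "q = 2 powr \<kappa>"
    have q: "1 < q" "q < 2" unfolding q_def using \<kappa> powr_less_mono[of 0 \<kappa> 2] powr_less_mono[of \<kappa> 1 2] by auto
    have e: "(?A + (1/2)\<^sup>2 * ?B) / (1/2) = 2 * ?A + ?B / 2" by (simp add: power2_eq_square)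
    have "(?A + ?B) / ?D powr \<kappa> \<le> ((?A + (1/2)\<^sup>2 * ?B) / (1/2)) / (?D / (1/2)) powr \<kappa>"
      using le[OF smooth_axial_scaling[OF R u(1)] scaling(1)[OF u(1,3)] ne] scaling(2)[OF u(1,3), of "1/2"]
      unfolding Q by simp
    also have "(?D / (1/2)) powr \<kappa> = ?D powr \<kappa> * q" unfolding q_def using D by (simp add: powr_mult)
    also have "((?A + (1/2)\<^sup>2 * ?B) / (1/2)) / (?D powr \<kappa> * q) = (((2 * ?A + ?B / 2)) / q) / ?D powr \<kappa>"
      unfolding e by (simp only: divide_divide_eq_left mult.commute)
    finally have "?A + ?B \<le> (2 * ?A + ?B / 2) / q" unfolding divide_le_cancel using D by simp
    then have "q * (?A + ?B) \<le> 2 * ?A + ?B / 2" using q by (simp add: field_simps)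
    \<comment> \<open>Here the sign of \<open>?A + ?B\<close> enters: multiplying
      \<open>q < 2\<close> by a nonpositive number reverses the inequality. The terms in
      \<open>?A\<close> then cancel and leave \<open>3 / 2 * ?B \<le> 0\<close>.\<close>
    moreover have "2 * (?A + ?B) \<le> q * (?A + ?B)" using mult_right_mono_neg[OF less_imp_le[OF q(2)] AB] .
    ultimately show ?thesis by simp
  qed
  \<comment> \<open>The integral in \<open>?B\<close> is nonnegative too, so the continuous function
    \<open>axial_deriv u\<close> vanishes almost everywhere and hence everywhere.\<close>
  have "axial_deriv u p = 0" for p
  proof (rule continuous_cylinder_eq_0[OF Z continuous_axial_deriv[OF R u(1)]])
    note int = integrable_energies(1)[OF Z n u(1,3)]
    have "(LINT p|?P. (axial_deriv u p)\<^sup>2) \<ge> 0" by simp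
    moreover have "(LINT p|?P. (axial_deriv u p)\<^sup>2) \<le> 0"
      using B \<alpha> unfolding axial_energy_def by (simp add: mult_le_0_iff)
    ultimately have "(LINT p|?P. (axial_deriv u p)\<^sup>2) = 0" by (intro antisym)
    then have "AE p in ?P. (axial_deriv u p)\<^sup>2 = 0" using integral_nonneg_eq_0_iff_AE[OF int] by simp
    then show "AE p in ?P. axial_deriv u p = 0" by eventually_elim simp
  qed
  then have "((\<lambda>s. u (z, s)) has_real_derivative 0) (at t)" for z t
    using has_axial_deriv[OF R u(1), of z t] by simp
  then have "u (z, t) = u (z, 0)" for z t using DERIV_isconst_all[of "\<lambda>s. u (z, s)" t 0] by blast
  then have "(\<lambda>p. (u p)\<^sup>2) = (\<lambda>p. (u (fst p, 0))\<^sup>2)" by (metis prod.collapse)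
  moreover have "integrable ?P (\<lambda>p. (u p)\<^sup>2)" using u(3) unfolding sobolev12_cylinder_iff[OF Z u(1)] by blast
  moreover have "continuous_on UNIV (\<lambda>z. (u (z, 0))\<^sup>2)"
    by (intro continuous_on_power continuous_on_compose2[OF cont[OF u(1)]] continuous_on_Pair continuous_on_id continuous_on_const) auto
  moreover have "(u (z, 0))\<^sup>2 > 0" for z using u(2)[of "(z, 0)"] by simp
  ultimately show False using not_integrable_axially_constant[OF Z, of "\<lambda>z. (u (z, 0))\<^sup>2"] by simp
qed

end
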